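(* Let $\Gamma$ be a finitely generated word hyperbolic group and let $\{\rho_t\}_{t\in(-1,1)}$ be an analytic one parameter family of representations of $\Gamma$ in $\mathsf{G}=\mathsf{SO}_0(n,n)$ with $\rho_0(\Gamma)\subset\mathsf{G}_0$. Let $U$ be the tangent vector to $\{\rho_t\}$ at $\rho=\rho_0$ and $u=Ue_{2n}$. Suppose $(\rho,u):\Gamma\to\mathsf{G}_a=\mathsf{G}_0\ltimes\mathbb{R}^{2n-1}$ is affine Anosov with respect to $\mathsf{P}_a^\pm$. Then there exists $\epsilon>0$ such that for all $t$ with $|t|\in(0,\epsilon)$, $\rho_t$ is Anosov in $\mathsf{SL}(2n,\mathbb{R})$ with respect to the stabilizer of an $n$-dimensional subspace of $\mathbb{R}^{2n}$.
   Context: Linear setting. Let $n\ge2$. On $\mathbb{R}^{2n}$ with standard basis $e_1,\dots,e_{2n}$ put $\langle v\mid w\rangle=v^tI_{n,n}w$, $I_{n,n}=\mathrm{diag}(I_n,-I_n)$. $\mathsf{G}=\mathsf{SO}_0(n,n)$ is the identity component of $\mathsf{SO}(n,n)$; $\mathsf{G}_0=\{g\in\mathsf{G}:ge_{2n}=e_{2n}\}\cong\mathsf{SO}_0(n,n-1)$; $\mathbb{R}^{n,n-1}=\mathbb{R}^{2n-1}=\mathrm{span}(e_1,\dots,e_{2n-1})$; $\mathsf{G}_a=\mathsf{G}_0\ltimes\mathbb{R}^{2n-1}$ acts affinely on $\mathbb{R}^{2n-1}$ by $(g,u)x=gx+u$. Let $W_\pm=\mathrm{span}\{e_j\pm e_{n+j}:1\le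 j\le n-1\}$, $\mathsf{L}_0=\mathrm{Stab}_{\mathsf{G}_0}(W_+)\cap\mathrm{Stab}_{\mathsf{G}_0}(W_-)$ (it fixes $e_n$), and define $\nu:\mathsf{G}_0/\mathsf{L}_0\to\mathbb{R}^{2n-1}$, $\nu([g])=ge_n$. A null subspace of $\mathbb{R}^{n,n-1}$ is an $n$-dimensional subspace whose orthogonal in $\mathbb{R}^{2n-1}$ is maximal isotropic; affine null subspaces are affine subspaces parallel to null subspaces. Put $\mathsf{P}_a^\pm=\mathrm{Stab}_{\mathsf{G}_a}(W_\pm^\perp\cap\mathbb{R}^{2n-1})$ and $\mathsf{L}_a=\mathsf{P}_a^+\cap\mathsf{P}_a^-$. Then $\mathsf{G}_a/\mathsf{P}_a^\pm$ is identified with the space of affine null subspaces, and $\mathsf{G}_a/\mathsf{L}_a$ with the open set of transverse pairs in $\mathsf{G}_a/\mathsf{P}_a^+\times\mathsf{G}_a/\mathsf{P}_a^-$. Tangent vector: for $\gamma\in\Gamma$, $U(\gamma)=\left.\frac{d}{dt}\right|_{t=0}\rho_t(\gamma)\rho(\gamma)^{-1}$ and $u(\gamma)=U(\gamma)e_{2n}\in\mathbb{R}^{2n-1}$; $(\rho,u)(\gamma)=(\rho(\gamma),u(\gamma))$ is a homomorphism to $\mathsf{G}_a$. Analytic family: $t\mapsto\rho_t(\gamma)$ is analytic for each $\gamma$. Gromov flow. $\partial_\infty\Gamma$ is the Gromov boundary, $\partial_\infty\Gamma^{(2)}=\{(p_+,p_-): p_+\ne p_-\}$, and $\widetilde{\mathsf{U}\Gamma}=\partial_\infty\Gamma^{(2)}\times\mathbb{R}$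 with flow $\phi_t(p_+,p_-,p_0)=(p_+,p_-,p_0+t)$. It carries Gromov's proper cocompact $\Gamma$-action, commuting with $\phi$ and inducing the diagonal action on $\partial_\infty\Gamma^{(2)}$, together with a metric (well defined up to H\"older equivalence) for which $\Gamma$ acts by isometries, $\phi_t$ acts by Lipschitz homeomorphisms and flow orbits are quasi-isometric embeddings. For each infinite order $\gamma$ with attracting/repelling points $\gamma^\pm$ there is $l(\gamma)>0$ with $\gamma(\gamma^+,\gamma^-,t)=\phi_{l(\gamma)}(\gamma^+,\gamma^-,t)$. Affine Anosov. An injective homomorphism $(\rho,u):\Gamma\to\mathsf{G}_a$ is affine Anosov with respect to $\mathsf{P}_a^\pm$ if: (1a) there are continuous injective $(\rho,u)(\Gamma)$-equivariant maps $\xi^\pm:\partial_\infty\Gamma\to\mathsf{G}_a/\mathsf{P}_a^\pm$ with $\xi(p)=(\xi^+(p_+),\xi^-(p_-))\in\mathsf{G}_a/\mathsf{L}_a$ for all $p\in\widetilde{\mathsf{U}\Gamma}$; (1b) there are $C,c>0$ and a continuous $(\rho,u)(\Gamma)$-equivariant family of Euclidean norms $\|\cdot\|_p$ on $T_{\xi(p)}(\mathsf{G}_a/\mathsf{L}_a)$ with $\|v^\pm\|_{\phi_{\mp t}p}\le Ce^{-ct}\|v^\pm\|_p$ for $v^\pm\in T_{\xi^\pm(p_\pm)}(\mathsf{G}_a/\mathsf{P}_a^\pm)$, $t\ge0$; (2) there is a $(\rho,u)(\Gamma)$-equivariant map $s:\widetilde{\mathsf{U}\Gamma}\to\mathbb{R}^{2n-1}$,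 H\"older continuous and differentiable along flow lines, such that $\left\langle\left.\frac{\partial}{\partial t}\right|_{t=0}s(\phi_tp)\mid\nu_\rho(p)\right\rangle\ne0$ for all $p$, where $\nu_\rho(p)=\nu(\xi_\rho(p))$ and $\xi_\rho(p)\in\mathsf{G}_0/\mathsf{L}_0$ is the linear part of $\xi(p)$. Anosov in $\mathsf{SL}(2n,\mathbb{R})$ with respect to the stabilizer of an $n$-dimensional subspace: let $\mathsf{Q}_\pm$ be the stabilizers in $\mathsf{H}=\mathsf{SL}(2n,\mathbb{R})$ of two complementary $n$-dimensional subspaces and $\mathcal{X}=\mathsf{H}/(\mathsf{Q}_+\cap\mathsf{Q}_-)\subset\mathsf{H}/\mathsf{Q}_+\times\mathsf{H}/\mathsf{Q}_-$. A homomorphism $\varrho:\Gamma\to\mathsf{H}$ is Anosov if there are continuous injective equivariant maps $\xi^\pm:\partial_\infty\Gamma\to\mathsf{H}/\mathsf{Q}_\pm$ with $\xi(p)=(\xi^+(p_+),\xi^-(p_-))\in\mathcal{X}$ for all $p$, and $C,c>0$ and a continuous equivariant family of Euclidean norms on $T_{\xi(p)}\mathcal{X}$ with $\|v^\pm\|_{\phi_{\mp t}p}\le Ce^{-ct}\|v^\pm\|_p$ for $v^\pm\in T_{\xi^\pm(p_\pm)}\mathsf{H}/\mathsf{Q}_\pm$, $t\ge0$. *)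

theory Defs
  imports "HOL-Analysis.Analysis" "HOL-Algebra.Left_Coset" "HOL-Algebra.Generated_Groups"
begin

section \<open>Word hyperbolic groups and the Gromov boundary\<close>

text \<open>Everything is relative to a finite generating set \<open>S\<close>; hyperbolicity, the boundary and its
  topology do not depend on the choice.\<close>

definition word_length :: "'g monoid \<Rightarrow> 'g set \<Rightarrow> 'g \<Rightarrow> nat" where
  "word_length \<Gamma> S g = (LEAST m. \<exists>ws. length ws = m \<and> set ws \<subseteq> S \<union> m_inv \<Gamma> ` S \<and>
      foldr (\<otimes>\<^bsub>\<Gamma>\<^esub>) ws \<one>\<^bsub>\<Gamma>\<^esub> = g)"

definition word_dist :: "'g monoid \<Rightarrow> 'g set \<Rightarrow> 'g \<Rightarrow> 'g \<Rightarrow> real" where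
  "word_dist \<Gamma> S g h = real (word_length \<Gamma> S (inv\<^bsub>\<Gamma>\<^esub> g \<otimes>\<^bsub>\<Gamma>\<^esub> h))"

definition gromov_product :: "'g monoid \<Rightarrow> 'g set \<Rightarrow> 'g \<Rightarrow> 'g \<Rightarrow> 'g \<Rightarrow> real" where
  "gromov_product \<Gamma> S w x y =
     (word_dist \<Gamma> S x w + word_dist \<Gamma> S y w - word_dist \<Gamma> S x y) / 2"

definition finite_generating_set :: "'g monoid \<Rightarrow> 'g set \<Rightarrow> bool" where
  "finite_generating_set \<Gamma> S \<longleftrightarrow> finite S \<and> S \<subseteq> carrier \<Gamma> \<and> generate \<Gamma> S = carrier \<Gamma>"

definition word_hyperbolic :: "'g monoid \<Rightarrow> 'g set \<Rightarrow> bool" where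
  "word_hyperbolic \<Gamma> S \<longleftrightarrow> (\<exists>\<delta>. \<forall>w\<in>carrier \<Gamma>. \<forall>x\<in>carrier \<Gamma>. \<forall>y\<in>carrier \<Gamma>. \<forall>z\<in>carrier \<Gamma>.
     gromov_product \<Gamma> S w x z \<ge>
       min (gromov_product \<Gamma> S w x y) (gromov_product \<Gamma> S w y z) - \<delta>)"

text \<open>Boundary points are classes of sequences converging to infinity. The relation below is an
  equivalence relation on the sequences \<open>x\<close> that are related to themselves, and these are
  exactly the sequences converging to infinity.\<close>

type_synonym 'g bpoint = "(nat \<Rightarrow> 'g) set"

definition same_end :: "'g monoid \<Rightarrow> 'g set \<Rightarrow> ((nat \<Rightarrow> 'g) \<times> (nat \<Rightarrow> 'g)) set" where
  "same_end \<Gamma> S = {(x, y). range x \<subseteq> carrier \<Gamma> \<and> range y \<subseteq> carrier \<Gamma> \<and>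
     (\<forall>r. \<exists>N. \<forall>i\<ge>N. \<forall>j\<ge>N. gromov_product \<Gamma> S \<one>\<^bsub>\<Gamma>\<^esub> (x i) (y j) \<ge> r)}"

definition gromov_boundary :: "'g monoid \<Rightarrow> 'g set \<Rightarrow> 'g bpoint set" where
  "gromov_boundary \<Gamma> S = {x. (x, x) \<in> same_end \<Gamma> S} // same_end \<Gamma> S"

text \<open>The basic neighbourhoods of \<open>p\<close>: those \<open>q\<close> for which \<open>liminf (x\<^sub>i | y\<^sub>j) \<ge> r\<close> for some
  sequences representing \<open>p\<close> and \<open>q\<close>. As Gromov products take values in half integers, the lower
  limit is at least \<open>r\<close> iff the terms eventually are.\<close>

definition boundary_nbhd :: "'g monoid \<Rightarrow> 'g set \<Rightarrow> 'g bpoint \<Rightarrow> real \<Rightarrow> 'g bpoint set" where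
  "boundary_nbhd \<Gamma> S p r = {q \<in> gromov_boundary \<Gamma> S.
     \<exists>x\<in>p. \<exists>y\<in>q. \<exists>N. \<forall>i\<ge>N. \<forall>j\<ge>N. gromov_product \<Gamma> S \<one>\<^bsub>\<Gamma>\<^esub> (x i) (y j) \<ge> r}"

definition boundary_topology :: "'g monoid \<Rightarrow> 'g set \<Rightarrow> 'g bpoint topology" where
  "boundary_topology \<Gamma> S = topology (\<lambda>V. V \<subseteq> gromov_boundary \<Gamma> S \<and>
     (\<forall>p\<in>V. \<exists>r. boundary_nbhd \<Gamma> S p r \<subseteq> V))"

definition boundary_act :: "'g monoid \<Rightarrow> 'g \<Rightarrow> 'g bpoint \<Rightarrow> 'g bpoint" where
  "boundary_act \<Gamma> \<gamma> p = (\<lambda>x i. \<gamma> \<otimes>\<^bsub>\<Gamma>\<^esub> x i) ` p"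

definition attracting_point :: "'g monoid \<Rightarrow> 'g set \<Rightarrow> 'g \<Rightarrow> 'g bpoint" where
  "attracting_point \<Gamma> S \<gamma> = same_end \<Gamma> S `` {\<lambda>i::nat. \<gamma> [^]\<^bsub>\<Gamma>\<^esub> i}"

definition repelling_point :: "'g monoid \<Rightarrow> 'g set \<Rightarrow> 'g \<Rightarrow> 'g bpoint" where
  "repelling_point \<Gamma> S \<gamma> = attracting_point \<Gamma> S (inv\<^bsub>\<Gamma>\<^esub> \<gamma>)"

lemma istopology_boundary:
  "istopology (\<lambda>V. V \<subseteq> gromov_boundary \<Gamma> S \<and> (\<forall>p\<in>V. \<exists>r. boundary_nbhd \<Gamma> S p r \<subseteq> V))"
proof -
  have mono: "boundary_nbhd \<Gamma> S p r' \<subseteq> boundary_nbhd \<Gamma> S p r" if "r \<le> r'" for p r r'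
    using that unfolding boundary_nbhd_def by (blast intro: order_trans)
  show ?thesis
    unfolding istopology_def
  proof (intro conjI allI impI)
    fix V W
    assume V: "V \<subseteq> gromov_boundary \<Gamma> S \<and> (\<forall>p\<in>V. \<exists>r. boundary_nbhd \<Gamma> S p r \<subseteq> V)"
      and W: "W \<subseteq> gromov_boundary \<Gamma> S \<and> (\<forall>p\<in>W. \<exists>r. boundary_nbhd \<Gamma> S p r \<subseteq> W)"
    show "V \<inter> W \<subseteq> gromov_boundary \<Gamma> S" using V by blast
    show "\<forall>p\<in>V \<inter> W. \<exists>r. boundary_nbhd \<Gamma> S p r \<subseteq> V \<inter> W"
    proof
      fix p assume "p \<in> V \<inter> W"
      then obtain r r' where "boundary_nbhd \<Gamma> S p r \<subseteq> V" "boundary_nbhd \<Gamma> S p r' \<subseteq> W"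
        using V W by blast
      then have "boundary_nbhd \<Gamma> S p (max r r') \<subseteq> V \<inter> W"
        using mono[of r "max r r'" p] mono[of r' "max r r'" p] by auto
      then show "\<exists>r. boundary_nbhd \<Gamma> S p r \<subseteq> V \<inter> W" ..
    qed
  next
    fix \<K>
    assume K: "\<forall>V\<in>\<K>. V \<subseteq> gromov_boundary \<Gamma> S \<and>
      (\<forall>p\<in>V. \<exists>r. boundary_nbhd \<Gamma> S p r \<subseteq> V)"
    show "\<Union>\<K> \<subseteq> gromov_boundary \<Gamma> S" using K by blast
    show "\<forall>p\<in>\<Union>\<K>. \<exists>r. boundary_nbhd \<Gamma> S p r \<subseteq> \<Union>\<K>"
    proof
      fix p assume "p \<in> \<Union>\<K>"
      then obtain V where V: "V \<in> \<K>" "p \<in> V" by blast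
      then obtain r where "boundary_nbhd \<Gamma> S p r \<subseteq> V" using K by meson
      then show "\<exists>r. boundary_nbhd \<Gamma> S p r \<subseteq> \<Union>\<K>" using V(1) by (meson Union_upper subset_trans)
    qed
  qed
qed

section \<open>The Gromov flow\<close>

type_synonym 'g fpoint = "('g bpoint \<times> 'g bpoint) \<times> real"

definition flow_topology :: "'g monoid \<Rightarrow> 'g set \<Rightarrow> 'g fpoint topology" where
  "flow_topology \<Gamma> S = prod_topology
     (subtopology (prod_topology (boundary_topology \<Gamma> S) (boundary_topology \<Gamma> S))
        {(p, q). p \<noteq> q})
     euclideanreal"

abbreviation flow_space :: "'g monoid \<Rightarrow> 'g set \<Rightarrow> 'g fpoint set" where
  "flow_space \<Gamma> S \<equiv> topspace (flow_topology \<Gamma> S)"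

definition flow :: "real \<Rightarrow> 'g fpoint \<Rightarrow> 'g fpoint" where
  "flow t p = (fst p, snd p + t)"

abbreviation end_plus :: "'g fpoint \<Rightarrow> 'g bpoint" where
  "end_plus p \<equiv> fst (fst p)"

abbreviation end_minus :: "'g fpoint \<Rightarrow> 'g bpoint" where
  "end_minus p \<equiv> snd (fst p)"

text \<open>The action \<open>act\<close> and the metric \<open>D\<close> are Gromov's data on the flow space. They are
  not canonical and are therefore kept as parameters, characterised by the following properties.\<close>

definition gromov_flow ::
  "'g monoid \<Rightarrow> 'g set \<Rightarrow> ('g \<Rightarrow> 'g fpoint \<Rightarrow> 'g fpoint) \<Rightarrow> ('g fpoint \<Rightarrow> 'g fpoint \<Rightarrow> real) \<Rightarrow> bool"
where
  "gromov_flow \<Gamma> S act D \<longleftrightarrow>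
     \<comment> \<open>a continuous action commuting with the flow and inducing the diagonal action\<close>
     (\<forall>\<gamma>\<in>carrier \<Gamma>. continuous_map (flow_topology \<Gamma> S) (flow_topology \<Gamma> S) (act \<gamma>)) \<and>
     (\<forall>p\<in>flow_space \<Gamma> S. act \<one>\<^bsub>\<Gamma>\<^esub> p = p) \<and>
     (\<forall>\<gamma>\<in>carrier \<Gamma>. \<forall>\<eta>\<in>carrier \<Gamma>. \<forall>p\<in>flow_space \<Gamma> S.
        act (\<gamma> \<otimes>\<^bsub>\<Gamma>\<^esub> \<eta>) p = act \<gamma> (act \<eta> p)) \<and>
     (\<forall>\<gamma>\<in>carrier \<Gamma>. \<forall>p\<in>flow_space \<Gamma> S. \<forall>t. act \<gamma> (flow t p) = flow t (act \<gamma> p)) \<and>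
     (\<forall>\<gamma>\<in>carrier \<Gamma>. \<forall>p\<in>flow_space \<Gamma> S.
        fst (act \<gamma> p) = (boundary_act \<Gamma> \<gamma> (end_plus p), boundary_act \<Gamma> \<gamma> (end_minus p))) \<and>
     \<comment> \<open>proper and cocompact\<close>
     (\<forall>K. compactin (flow_topology \<Gamma> S) K \<longrightarrow>
        finite {\<gamma>\<in>carrier \<Gamma>. act \<gamma> ` K \<inter> K \<noteq> {}}) \<and>
     (\<exists>K. compactin (flow_topology \<Gamma> S) K \<and>
        (\<Union>\<gamma>\<in>carrier \<Gamma>. act \<gamma> ` K) = flow_space \<Gamma> S) \<and>
     \<comment> \<open>a compatible metric, invariant under the group, for which each time of the flow is
        Lipschitz and each flow orbit is a quasi-isometric embedding\<close>
     Metric_space (flow_space \<Gamma> S) D \<and>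
     Metric_space.mtopology (flow_space \<Gamma> S) D = flow_topology \<Gamma> S \<and>
     (\<forall>\<gamma>\<in>carrier \<Gamma>. \<forall>p\<in>flow_space \<Gamma> S. \<forall>q\<in>flow_space \<Gamma> S.
        D (act \<gamma> p) (act \<gamma> q) = D p q) \<and>
     (\<forall>t. \<exists>L. \<forall>p\<in>flow_space \<Gamma> S. \<forall>q\<in>flow_space \<Gamma> S.
        D (flow t p) (flow t q) \<le> L * D p q) \<and>
     (\<forall>p\<in>flow_space \<Gamma> S. \<exists>K\<ge>1. \<exists>M\<ge>0. \<forall>t t'.
        \<bar>t - t'\<bar> / K - M \<le> D (flow t p) (flow t' p) \<and>
        D (flow t p) (flow t' p) \<le> K * \<bar>t - t'\<bar> + M) \<and>
     \<comment> \<open>elements of infinite order translate their axis towards the attracting point\<close>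
     (\<forall>\<gamma>\<in>carrier \<Gamma>. (\<forall>m::nat. m > 0 \<longrightarrow> \<gamma> [^]\<^bsub>\<Gamma>\<^esub> m \<noteq> \<one>\<^bsub>\<Gamma>\<^esub>) \<longrightarrow>
        (\<exists>l>0. \<forall>t.
           act \<gamma> ((attracting_point \<Gamma> S \<gamma>, repelling_point \<Gamma> S \<gamma>), t) =
           flow l ((attracting_point \<Gamma> S \<gamma>, repelling_point \<Gamma> S \<gamma>), t)))"

text \<open>Hoelder continuity is local: an equivariant map to a space on which the group acts by
  non-isometric affine maps cannot satisfy a uniform Hoelder estimate in general.\<close>

definition hoelder_on_flow ::
  "'g monoid \<Rightarrow> 'g set \<Rightarrow> ('g fpoint \<Rightarrow> 'g fpoint \<Rightarrow> real) \<Rightarrow> ('g fpoint \<Rightarrow> 'v::metric_space) \<Rightarrow> bool"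
where
  "hoelder_on_flow \<Gamma> S D s \<longleftrightarrow> (\<forall>p\<in>flow_space \<Gamma> S. \<exists>r>0. \<exists>C. \<exists>\<alpha>. 0 < \<alpha> \<and> \<alpha> \<le> 1 \<and>
     (\<forall>q\<in>flow_space \<Gamma> S. \<forall>q'\<in>flow_space \<Gamma> S. D p q < r \<longrightarrow> D p q' < r \<longrightarrow>
        dist (s q) (s q') \<le> C * D q q' powr \<alpha>))"

section \<open>Homogeneous spaces and the Anosov property\<close>

text \<open>Lie groups are groups \<open>G\<close> whose carrier is a subset of a Euclidean space (of matrices, or
  of pairs of a matrix and a vector) and whose operations are restrictions of smooth maps.
  For a closed subgroup \<open>H\<close>, the velocities at the identity of curves in \<open>H\<close> form its
  Lie algebra.\<close>

definition lie_algebra :: "'a::real_normed_vector monoid \<Rightarrow> 'a set \<Rightarrow> 'a set" where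
  "lie_algebra G H = {X. \<exists>c :: real \<Rightarrow> 'a. c 0 = \<one>\<^bsub>G\<^esub> \<and> (\<forall>t. c t \<in> H) \<and>
     (c has_vector_derivative X) (at 0)}"

definition Ad :: "'a::real_normed_vector monoid \<Rightarrow> 'a \<Rightarrow> 'a \<Rightarrow> 'a" where
  "Ad G g = frechet_derivative (\<lambda>x. g \<otimes>\<^bsub>G\<^esub> x \<otimes>\<^bsub>G\<^esub> inv\<^bsub>G\<^esub> g) (at \<one>\<^bsub>G\<^esub>)"

definition coset_stabilizer :: "'a monoid \<Rightarrow> 'a set \<Rightarrow> 'a set" where
  "coset_stabilizer G x = {g\<in>carrier G. g <#\<^bsub>G\<^esub> x = x}"

text \<open>The quotient topology on \<open>G/P\<close>.\<close>

definition coset_topology :: "'a::topological_space monoid \<Rightarrow> 'a set \<Rightarrow> 'a set topology" where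
  "coset_topology G P = topology (\<lambda>V. V \<subseteq> lcosets\<^bsub>G\<^esub> P \<and>
     openin (top_of_set (carrier G)) {g\<in>carrier G. g <#\<^bsub>G\<^esub> P \<in> V})"

lemma istopology_coset:
  "istopology (\<lambda>V. V \<subseteq> lcosets\<^bsub>G\<^esub> P \<and>
     openin (top_of_set (carrier G)) {g\<in>carrier G. g <#\<^bsub>G\<^esub> P \<in> V})"
  unfolding istopology_def
proof (intro conjI allI impI)
  fix V W
  assume V: "V \<subseteq> lcosets\<^bsub>G\<^esub> P \<and> openin (top_of_set (carrier G)) {g\<in>carrier G. g <#\<^bsub>G\<^esub> P \<in> V}"
    and W: "W \<subseteq> lcosets\<^bsub>G\<^esub> P \<and> openin (top_of_set (carrier G)) {g\<in>carrier G. g <#\<^bsub>G\<^esub> P \<in> W}"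
  show "V \<inter> W \<subseteq> lcosets\<^bsub>G\<^esub> P" using V by blast
  have "{g\<in>carrier G. g <#\<^bsub>G\<^esub> P \<in> V \<inter> W} =
      {g\<in>carrier G. g <#\<^bsub>G\<^esub> P \<in> V} \<inter> {g\<in>carrier G. g <#\<^bsub>G\<^esub> P \<in> W}" by blast
  then show "openin (top_of_set (carrier G)) {g\<in>carrier G. g <#\<^bsub>G\<^esub> P \<in> V \<inter> W}"
    using V W by (simp add: openin_Int)
next
  fix \<K>
  assume K: "\<forall>V\<in>\<K>. V \<subseteq> lcosets\<^bsub>G\<^esub> P \<and>
    openin (top_of_set (carrier G)) {g\<in>carrier G. g <#\<^bsub>G\<^esub> P \<in> V}"
  show "\<Union>\<K> \<subseteq> lcosets\<^bsub>G\<^esub> P" using K by blast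
  have "{g\<in>carrier G. g <#\<^bsub>G\<^esub> P \<in> \<Union>\<K>} = (\<Union>V\<in>\<K>. {g\<in>carrier G. g <#\<^bsub>G\<^esub> P \<in> V})"
    by blast
  then show "openin (top_of_set (carrier G)) {g\<in>carrier G. g <#\<^bsub>G\<^esub> P \<in> \<Union>\<K>}"
    using K by auto
qed

text \<open>The tangent space of a homogeneous space of \<open>G\<close> at a coset \<open>x\<close> is the quotient
  \<open>\<gg>/\<gg>\<^sub>x\<close> of the Lie algebra of \<open>G\<close> by that of the stabilizer of \<open>x\<close>, the class of \<open>X\<close> being the
  velocity at \<open>0\<close> of \<open>c t <# x\<close> for a curve \<open>c\<close> with velocity \<open>X\<close>. A Euclidean norm on
  \<open>\<gg>/\<hh>\<close> is represented by its pullback \<open>N\<close> to \<open>\<gg>\<close>, i.e. by the square root of a positive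
  semidefinite form on \<open>\<gg>\<close> with null space exactly \<open>\<hh>\<close>.\<close>

definition euclidean_norm_mod :: "'a::real_vector set \<Rightarrow> 'a set \<Rightarrow> ('a \<Rightarrow> real) \<Rightarrow> bool" where
  "euclidean_norm_mod \<gg> \<hh> N \<longleftrightarrow> (\<exists>B. bilinear B \<and> (\<forall>X Y. B X Y = B Y X) \<and>
     (\<forall>X\<in>\<gg>. 0 \<le> B X X \<and> (B X X = 0 \<longleftrightarrow> X \<in> \<hh>) \<and> N X = sqrt (B X X)))"

text \<open>With \<open>L = P\<^sub>+ \<inter> P\<^sub>-\<close>, the space \<open>G/L\<close> embeds in \<open>G/P\<^sub>+ \<times> G/P\<^sub>-\<close> by \<open>hL \<mapsto> (hP\<^sub>+, hP\<^sub>-)\<close>; as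
  \<open>hL = hP\<^sub>+ \<inter> hP\<^sub>-\<close>, a pair of cosets lies in the image iff its intersection is a coset of \<open>L\<close>,
  and that intersection is then the corresponding point of \<open>G/L\<close>.\<close>

definition limit_maps ::
  "'g monoid \<Rightarrow> 'g set \<Rightarrow> 'a::topological_space monoid \<Rightarrow> 'a set \<Rightarrow> 'a set \<Rightarrow> ('g \<Rightarrow> 'a) \<Rightarrow>
   ('g bpoint \<Rightarrow> 'a set) \<Rightarrow> ('g bpoint \<Rightarrow> 'a set) \<Rightarrow> bool"
where
  "limit_maps \<Gamma> S G Pp Pm \<rho> \<xi>p \<xi>m \<longleftrightarrow>
     continuous_map (boundary_topology \<Gamma> S) (coset_topology G Pp) \<xi>p \<and>
     continuous_map (boundary_topology \<Gamma> S) (coset_topology G Pm) \<xi>m \<and>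
     inj_on \<xi>p (gromov_boundary \<Gamma> S) \<and> inj_on \<xi>m (gromov_boundary \<Gamma> S) \<and>
     (\<forall>\<gamma>\<in>carrier \<Gamma>. \<forall>x\<in>gromov_boundary \<Gamma> S.
        \<xi>p (boundary_act \<Gamma> \<gamma> x) = \<rho> \<gamma> <#\<^bsub>G\<^esub> \<xi>p x \<and>
        \<xi>m (boundary_act \<Gamma> \<gamma> x) = \<rho> \<gamma> <#\<^bsub>G\<^esub> \<xi>m x) \<and>
     (\<forall>p\<in>flow_space \<Gamma> S. \<xi>p (end_plus p) \<inter> \<xi>m (end_minus p) \<in> lcosets\<^bsub>G\<^esub> (Pp \<inter> Pm))"

text \<open>In the splitting of the tangent space of \<open>G/L\<close> at \<open>\<xi>(p)\<close> coming from the product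
  \<open>G/P\<^sub>+ \<times> G/P\<^sub>-\<close>, the vectors tangent to the factor \<open>G/P\<^sub>+\<close> are those with vanishing component in
  \<open>G/P\<^sub>-\<close>, i.e. the classes of the elements of the Lie algebra of the stabilizer of the
  \<open>G/P\<^sub>-\<close>-component \<open>\<xi>\<^sup>-(p\<^sub>-)\<close>; similarly for the other factor.\<close>

definition contracting ::
  "'g monoid \<Rightarrow> 'g set \<Rightarrow> ('g \<Rightarrow> 'g fpoint \<Rightarrow> 'g fpoint) \<Rightarrow> 'a::real_normed_vector monoid \<Rightarrow>
   ('g \<Rightarrow> 'a) \<Rightarrow> ('g bpoint \<Rightarrow> 'a set) \<Rightarrow> ('g bpoint \<Rightarrow> 'a set) \<Rightarrow> bool"
where
  "contracting \<Gamma> S act G \<rho> \<xi>p \<xi>m \<longleftrightarrow>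
     (\<exists>C>0. \<exists>c>0. \<exists>N :: 'g fpoint \<Rightarrow> 'a \<Rightarrow> real.
       (\<forall>p\<in>flow_space \<Gamma> S. euclidean_norm_mod (lie_algebra G (carrier G))
          (lie_algebra G (coset_stabilizer G (\<xi>p (end_plus p) \<inter> \<xi>m (end_minus p)))) (N p)) \<and>
       continuous_map
         (prod_topology (flow_topology \<Gamma> S) (top_of_set (lie_algebra G (carrier G))))
         euclideanreal (\<lambda>(p, X). N p X) \<and>
       (\<forall>\<gamma>\<in>carrier \<Gamma>. \<forall>p\<in>flow_space \<Gamma> S. \<forall>X\<in>lie_algebra G (carrier G).
          N (act \<gamma> p) (Ad G (\<rho> \<gamma>) X) = N p X) \<and>
       (\<forall>p\<in>flow_space \<Gamma> S. \<forall>t\<ge>0.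
          (\<forall>X\<in>lie_algebra G (coset_stabilizer G (\<xi>m (end_minus p))).
             N (flow (- t) p) X \<le> C * exp (- c * t) * N p X) \<and>
          (\<forall>X\<in>lie_algebra G (coset_stabilizer G (\<xi>p (end_plus p))).
             N (flow t p) X \<le> C * exp (- c * t) * N p X)))"

definition anosov ::
  "'g monoid \<Rightarrow> 'g set \<Rightarrow> ('g \<Rightarrow> 'g fpoint \<Rightarrow> 'g fpoint) \<Rightarrow> 'a::real_normed_vector monoid \<Rightarrow>
   'a set \<Rightarrow> 'a set \<Rightarrow> ('g \<Rightarrow> 'a) \<Rightarrow> bool"
where
  "anosov \<Gamma> S act G Pp Pm \<rho> \<longleftrightarrow> \<rho> \<in> hom \<Gamma> G \<and>
     (\<exists>\<xi>p \<xi>m. limit_maps \<Gamma> S G Pp Pm \<rho> \<xi>p \<xi>m \<and> contracting \<Gamma> S act G \<rho> \<xi>p \<xi>m)"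

section \<open>The linear setting\<close>

text \<open>The index type \<open>'n + 'n\<close> stands for \<open>{1, \<dots>, 2n}\<close>, where \<open>n = CARD('n)\<close>: \<open>Inl j\<close> and
  \<open>Inr j\<close> are the indices \<open>j\<close> and \<open>n + j\<close>. The parameter \<open>k\<close> below is the element of \<open>'n\<close>
  that plays the role of the last index \<open>n\<close>, so \<open>e\<^sub>n\<close> and \<open>e\<^sub>2\<^sub>n\<close> are \<open>axis (Inl k) 1\<close> and
  \<open>axis (Inr k) 1\<close>, and \<open>\<real>\<^sup>2\<^sup>n\<^sup>-\<^sup>1\<close> is the hyperplane of vectors with vanishing \<open>Inr k\<close>
  coordinate.\<close>

type_synonym 'n vec2 = "real ^ ('n + 'n)"
type_synonym 'n mat2 = "real ^ ('n + 'n) ^ ('n + 'n)"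

definition Inn :: "'n::finite mat2" where
  "Inn = (\<chi> i j. if i = j then (case i of Inl _ \<Rightarrow> 1 | Inr _ \<Rightarrow> - 1) else 0)"

definition form :: "'n::finite vec2 \<Rightarrow> 'n vec2 \<Rightarrow> real" where
  "form v w = v \<bullet> (Inn *v w)"

definition SOnn :: "'n::finite mat2 set" where
  "SOnn = {A. det A = 1 \<and> transpose A ** Inn ** A = Inn}"

definition mat_group :: "(real ^ 'm ^ 'm) set \<Rightarrow> (real ^ 'm::finite ^ 'm) monoid" where
  "mat_group M = \<lparr>carrier = M, mult = (**), one = mat 1\<rparr>"

definition G_group :: "'n::finite mat2 monoid" where
  "G_group = mat_group (connected_component_set SOnn (mat 1))"

definition G0 :: "'n::finite \<Rightarrow> 'n mat2 set" where
  "G0 k = {g \<in> carrier G_group. g *v axis (Inr k) 1 = axis (Inr k) 1}"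

definition hyp :: "'n::finite \<Rightarrow> 'n vec2 set" where
  "hyp k = {v. v $ Inr k = 0}"

definition Ga_group :: "'n::finite \<Rightarrow> ('n mat2 \<times> 'n vec2) monoid" where
  "Ga_group k = \<lparr>carrier = G0 k \<times> hyp k,
     mult = (\<lambda>(g, u) (h, v). (g ** h, u + g *v v)), one = (mat 1, 0)\<rparr>"

definition affine_act :: "'n::finite mat2 \<times> 'n vec2 \<Rightarrow> 'n vec2 \<Rightarrow> 'n vec2" where
  "affine_act a x = fst a *v x + snd a"

definition Wp :: "'n::finite \<Rightarrow> 'n vec2 set" where
  "Wp k = span {axis (Inl j) 1 + axis (Inr j) 1 | j. j \<noteq> k}"

definition Wm :: "'n::finite \<Rightarrow> 'n vec2 set" where
  "Wm k = span {axis (Inl j) 1 - axis (Inr j) 1 | j. j \<noteq> k}"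

definition form_orth :: "'n::finite vec2 set \<Rightarrow> 'n vec2 set" where
  "form_orth W = {v. \<forall>w\<in>W. form v w = 0}"

definition Pa_plus :: "'n::finite \<Rightarrow> ('n mat2 \<times> 'n vec2) set" where
  "Pa_plus k = {a \<in> carrier (Ga_group k).
     affine_act a ` (form_orth (Wp k) \<inter> hyp k) = form_orth (Wp k) \<inter> hyp k}"

definition Pa_minus :: "'n::finite \<Rightarrow> ('n mat2 \<times> 'n vec2) set" where
  "Pa_minus k = {a \<in> carrier (Ga_group k).
     affine_act a ` (form_orth (Wm k) \<inter> hyp k) = form_orth (Wm k) \<inter> hyp k}"

text \<open>The map \<open>\<nu>\<close> on \<open>G\<^sub>0/L\<^sub>0\<close>; the vector \<open>g e\<^sub>n\<close> is the same for all \<open>g\<close> in a coset of \<open>L\<^sub>0\<close>, as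
  \<open>L\<^sub>0\<close> fixes \<open>e\<^sub>n\<close>. The linear part of a coset of \<open>L\<^sub>a\<close> is its image under \<open>fst\<close>, which is a
  coset of \<open>L\<^sub>0\<close>.\<close>

definition nu :: "'n::finite \<Rightarrow> 'n mat2 set \<Rightarrow> 'n vec2" where
  "nu k x = the_elem ((\<lambda>g. g *v axis (Inl k) 1) ` x)"

definition affine_anosov ::
  "'n::finite \<Rightarrow> 'g monoid \<Rightarrow> 'g set \<Rightarrow> ('g \<Rightarrow> 'g fpoint \<Rightarrow> 'g fpoint) \<Rightarrow>
   ('g fpoint \<Rightarrow> 'g fpoint \<Rightarrow> real) \<Rightarrow> ('g \<Rightarrow> 'n mat2 \<times> 'n vec2) \<Rightarrow> bool"
where
  "affine_anosov k \<Gamma> S act D \<rho> \<longleftrightarrow>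
     \<rho> \<in> hom \<Gamma> (Ga_group k) \<and> inj_on \<rho> (carrier \<Gamma>) \<and>
     (\<exists>\<xi>p \<xi>m. limit_maps \<Gamma> S (Ga_group k) (Pa_plus k) (Pa_minus k) \<rho> \<xi>p \<xi>m \<and>
        contracting \<Gamma> S act (Ga_group k) \<rho> \<xi>p \<xi>m \<and>
        (\<exists>s :: 'g fpoint \<Rightarrow> 'n vec2.
           (\<forall>p\<in>flow_space \<Gamma> S. s p \<in> hyp k) \<and>
           (\<forall>\<gamma>\<in>carrier \<Gamma>. \<forall>p\<in>flow_space \<Gamma> S. s (act \<gamma> p) = affine_act (\<rho> \<gamma>) (s p)) \<and>
           hoelder_on_flow \<Gamma> S D s \<and>
           (\<forall>p\<in>flow_space \<Gamma> S. \<forall>t. (\<lambda>\<tau>. s (flow \<tau> p)) differentiable at t) \<and>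
           (\<forall>p\<in>flow_space \<Gamma> S.
              form (vector_derivative (\<lambda>t. s (flow t p)) (at 0))
                (nu k (fst ` (\<xi>p (end_plus p) \<inter> \<xi>m (end_minus p)))) \<noteq> 0)))"

definition SL_group :: "(real ^ 'm ^ 'm) monoid" where
  "SL_group = mat_group {A :: real ^ 'm::finite ^ 'm. det A = 1}"

definition SL_stabilizer :: "(real ^ 'm) set \<Rightarrow> (real ^ 'm::finite ^ 'm) set" where
  "SL_stabilizer V = {A \<in> carrier SL_group. (*v) A ` V = V}"

text \<open>The choice of the complementary subspaces is immaterial, since \<open>SL(2n, \<real>)\<close> acts
  transitively on such pairs.\<close>

definition anosov_SL_half ::
  "'g monoid \<Rightarrow> 'g set \<Rightarrow> ('g \<Rightarrow> 'g fpoint \<Rightarrow> 'g fpoint) \<Rightarrow> ('g \<Rightarrow> 'n::finite mat2) \<Rightarrow> bool"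
where
  "anosov_SL_half \<Gamma> S act \<rho> \<longleftrightarrow>
     (\<forall>Vp Vm :: 'n vec2 set. subspace Vp \<and> subspace Vm \<and> dim Vp = CARD('n) \<and> dim Vm = CARD('n) \<and>
        Vp \<inter> Vm = {0} \<longrightarrow>
        anosov \<Gamma> S act SL_group (SL_stabilizer Vp) (SL_stabilizer Vm) \<rho>)"

section \<open>Analytic families\<close>

text \<open>Real analyticity on an open set.\<close>

definition real_analytic_on :: "(real \<Rightarrow> 'v::real_normed_vector) \<Rightarrow> real set \<Rightarrow> bool" where
  "real_analytic_on f I \<longleftrightarrow> (\<forall>t\<^sub>0\<in>I. \<exists>r>0. \<exists>a :: nat \<Rightarrow> 'v. \<forall>t. \<bar>t - t\<^sub>0\<bar> < r \<longrightarrow>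
     (\<lambda>i. (t - t\<^sub>0) ^ i *\<^sub>R a i) sums f t)"

definition tangent_vector :: "(real \<Rightarrow> 'g \<Rightarrow> real ^ 'm ^ 'm) \<Rightarrow> 'g \<Rightarrow> real ^ 'm::finite ^ 'm" where
  "tangent_vector \<rho> \<gamma> = vector_derivative (\<lambda>t. \<rho> t \<gamma> ** matrix_inv (\<rho> 0 \<gamma>)) (at 0)"

end

theory Submission
  imports Defs "HOL-Library.Diagonal_Subsequence" "HOL-Real_Asymp.Real_Asymp"
begin

text \<open>
  Over the flow space the affine Anosov structure splits \<open>\<real>\<^sup>2\<^sup>n\<close> equivariantly for \<open>\<rho>\<^sub>0\<close> into
  \<open>W\<^sub>+ \<oplus> W\<^sub>- \<oplus> span(\<nu>, e\<^sub>2\<^sub>n)\<close>, where the flow contracts \<open>W\<^sub>+\<close>, expands \<open>W\<^sub>-\<close> and is neutral on the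
  last plane. With coordinates \<open>a = \<langle>v | \<nu>\<rangle>\<close> and \<open>b = v\<^sub>2\<^sub>n\<close> on the plane, the first order term of
  \<open>\<rho>\<^sub>t\<close> changes \<open>ab\<close> by \<open>t \<langle>u | \<nu>\<rangle> (a\<^sup>2 + b\<^sup>2)\<close>, and \<open>\<langle>u(\<gamma>) | \<nu>\<rangle>\<close> is the coboundary of
  \<open>h = \<langle>s | \<nu>\<rangle>\<close> under \<open>\<gamma>\<close>. By transversality of \<open>s\<close> the function \<open>h\<close> is strictly monotone along flow lines. Hence for
  small \<open>t \<noteq> 0\<close> the quadratic form
  \<open>\<parallel>v\<^sub>-\<parallel>\<^sup>2 - \<parallel>v\<^sub>+\<parallel>\<^sup>2 - sgn(t) ab + \<bar>t\<bar> h (a\<^sup>2 + b\<^sup>2)\<close> strictly increases along the flow twisted by \<open>\<rho>\<^sub>t\<close>.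

  A strictly increasing form of signature \<open>(n, n)\<close> gives a dominated splitting into the vectors
  that stay bounded forwards resp. backwards. That the two subbundles depend only on one endpoint of
  the flow line, and injectively so, uses that asymptotic rays stay close modulo the group
  while opposite rays do not. Both facts are read off from the growth of the linearised affine
  action of \<open>\<Gamma>\<close> on \<open>\<real>\<^sup>2\<^sup>n\<close>, where a limit flag is the set of vectors of slow growth.\<close>

section \<open>Hyperbolic groups and their boundary\<close>

text \<open>On the neutral plane \<open>\<rho> 0\<close> has no growth at all, so the conclusion is
  not a stability statement at \<open>t = 0\<close>: the gap opens only at a rate of order
  \<bar>t\<bar>, and the estimates must be exact to first order. By skewness for the form, the
  infinitesimal deformation acts on the plane as a boost
  \<open>(a, b) \<mapsto> (a + t\<kappa>b, b + t\<kappa>a)\<close>, whose eigenlines are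
  \<open>a = b\<close> and \<open>a = -b\<close>; this is where \<open>ab\<close> comes from. The
  number \<kappa> depends on the group element and has no definite sign, so nothing is monotone
  before the coboundary is removed. No bound on \<open>t\<close> can be expected to serve all group
  elements at once. The form is therefore compared only between points of a compact set
  \<open>K\<close> whose translates cover the flow space, and only for the finitely many elements
  that bring points of \<open>K\<close> back to \<open>K\<close> after a fixed time; whole orbits
  are handled by composing such returns. The axioms in \<open>gromov_flow\<close> say nothing direct
  about asymptotic or opposite rays. They can be replaced by growth because the linearised affine
  action grows at most linearly on a limit flag (\<open>h\<close> has bounded increments in unit
  time) and exponentially on a complement.\<close>

locale hyperbolic_group = group \<Gamma> for \<Gamma> :: "'g monoid" (structure) +
  fixes S :: "'g set"
  assumes generating: "finite_generating_set \<Gamma> S"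
    and hyperbolic: "word_hyperbolic \<Gamma> S"
begin

section \<open>Word length and Gromov products based at the identity\<close>

abbreviation "wl \<equiv> word_length \<Gamma> S"
abbreviation "gp \<equiv> gromov_product \<Gamma> S \<one>"
abbreviation "letters \<equiv> S \<union> m_inv \<Gamma> ` S"
abbreviation "eval_word ws \<equiv> foldr (\<otimes>) ws \<one>"

lemma letters_carrier: "letters \<subseteq> carrier \<Gamma>"
  using generating unfolding finite_generating_set_def by auto

lemma finite_letters: "finite letters"
  using generating unfolding finite_generating_set_def by auto

lemma eval_word_closed: "set ws \<subseteq> carrier \<Gamma> \<Longrightarrow> eval_word ws \<in> carrier \<Gamma>"
  by (induction ws) auto

lemma eval_word_append:
  "set ws \<subseteq> carrier \<Gamma> \<Longrightarrow> set vs \<subseteq> carrier \<Gamma> \<Longrightarrow>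
    eval_word (ws @ vs) = eval_word ws \<otimes> eval_word vs"
  by (induction ws) (auto simp: eval_word_closed m_assoc)

lemma eval_word_inv:
  "set ws \<subseteq> carrier \<Gamma> \<Longrightarrow> eval_word (rev (map (m_inv \<Gamma>) ws)) = inv (eval_word ws)"
proof (induction ws)
  case (Cons a ws)
  then have "eval_word (rev (map (m_inv \<Gamma>) ws) @ [inv a]) = inv (eval_word ws) \<otimes> inv a"
    by (subst eval_word_append) auto
  then show ?case using Cons by (simp add: inv_mult_group eval_word_closed)
qed auto

lemma word_exists: "g \<in> carrier \<Gamma> \<Longrightarrow> \<exists>ws. set ws \<subseteq> letters \<and> eval_word ws = g"
proof -
  assume "g \<in> carrier \<Gamma>"
  then have "g \<in> generate \<Gamma> S" using generating unfolding finite_generating_set_def by simp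
  then show ?thesis
  proof induction
    case one
    show ?case by (rule exI[of _ "[]"]) simp
  next
    case (incl h)
    then show ?case using letters_carrier by (intro exI[of _ "[h]"]) auto
  next
    case (inv h)
    then show ?case using letters_carrier by (intro exI[of _ "[inv h]"]) auto
  next
    case (eng g h)
    then obtain ws vs where "set ws \<subseteq> letters" "eval_word ws = g" "set vs \<subseteq> letters" "eval_word vs = h"
      by blast
    moreover from this have "set ws \<subseteq> carrier \<Gamma>" "set vs \<subseteq> carrier \<Gamma>" using letters_carrier by blast+
    ultimately have "set (ws @ vs) \<subseteq> letters" "eval_word (ws @ vs) = g \<otimes> h"
      using eval_word_append[of ws vs] by auto
    then show ?case by blast
  qed
qed

lemma word_length_attained:
  assumes "g \<in> carrier \<Gamma>"
  obtains ws where "length ws = wl g" "set ws \<subseteq> letters" "eval_word ws = g"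
proof -
  have "\<exists>m. \<exists>ws. length ws = m \<and> set ws \<subseteq> letters \<and> eval_word ws = g"
    using word_exists[OF assms] by metis
  then have "\<exists>ws. length ws = wl g \<and> set ws \<subseteq> letters \<and> eval_word ws = g"
    unfolding word_length_def by (rule LeastI_ex)
  then show ?thesis using that by blast
qed

lemma word_length_le: "set ws \<subseteq> letters \<Longrightarrow> wl (eval_word ws) \<le> length ws"
  unfolding word_length_def by (rule Least_le) blast

lemma wl_one [simp]: "wl \<one> = 0"
  using word_length_le[of "[]"] by simp

lemma wl_mult:
  assumes "g \<in> carrier \<Gamma>" "h \<in> carrier \<Gamma>"
  shows "wl (g \<otimes> h) \<le> wl g + wl h"
proof -
  obtain ws where ws: "length ws = wl g" "set ws \<subseteq> letters" "eval_word ws = g"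
    by (rule word_length_attained[OF assms(1)])
  obtain vs where vs: "length vs = wl h" "set vs \<subseteq> letters" "eval_word vs = h"
    by (rule word_length_attained[OF assms(2)])
  have "eval_word (ws @ vs) = g \<otimes> h"
    using ws vs letters_carrier eval_word_append[of ws vs] by blast
  then show ?thesis using word_length_le[of "ws @ vs"] ws vs by auto
qed

lemma wl_inv_le: assumes "g \<in> carrier \<Gamma>" shows "wl (inv g) \<le> wl g"
proof -
  obtain ws where ws: "length ws = wl g" "set ws \<subseteq> letters" "eval_word ws = g"
    by (rule word_length_attained[OF assms])
  have "eval_word (rev (map (m_inv \<Gamma>) ws)) = inv g"
    using ws letters_carrier by (subst eval_word_inv) auto
  moreover have "set (rev (map (m_inv \<Gamma>) ws)) \<subseteq> letters"
    using ws generating unfolding finite_generating_set_def by (auto simp: subset_iff)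
  ultimately show ?thesis using word_length_le[of "rev (map (m_inv \<Gamma>) ws)"] ws by auto
qed

lemma wl_inv: assumes "g \<in> carrier \<Gamma>" shows "wl (inv g) = wl g"
  using wl_inv_le[of g] wl_inv_le[of "inv g"] assms by simp

text \<open>A shortest word for \<open>g\<close> is cut after \<open>r\<close> letters;
  subadditivity of the length forces both pieces to be shortest as well. Such prefixes replace
  points on geodesics.\<close>

lemma wl_prefix:
  assumes "g \<in> carrier \<Gamma>" "r \<le> wl g"
  obtains a b where "a \<in> carrier \<Gamma>" "b \<in> carrier \<Gamma>" "g = a \<otimes> b" "wl a = r" "wl b = wl g - r"
proof -
  obtain ws where ws: "length ws = wl g" "set ws \<subseteq> letters" "eval_word ws = g"
    by (rule word_length_attained[OF assms(1)])
  define a where "a = eval_word (take r ws)"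
  define b where "b = eval_word (drop r ws)"
  have sets: "set (take r ws) \<subseteq> letters" "set (drop r ws) \<subseteq> letters"
    using ws(2) set_take_subset[of r ws] set_drop_subset[of r ws] by (simp_all add: subset_trans)
  then have c: "set (take r ws) \<subseteq> carrier \<Gamma>" "set (drop r ws) \<subseteq> carrier \<Gamma>"
    using letters_carrier by blast+
  have ab: "a \<in> carrier \<Gamma>" "b \<in> carrier \<Gamma>" unfolding a_def b_def by (intro eval_word_closed c)+
  have g: "g = a \<otimes> b" unfolding a_def b_def
    using eval_word_append[OF c] ws(3) by (simp only: append_take_drop_id)
  have "wl a \<le> r" "wl b \<le> wl g - r"
    using word_length_le[OF sets(1)] word_length_le[OF sets(2)] ws(1) assms(2)
    unfolding a_def b_def length_take length_drop by linarith+
  moreover have "wl g \<le> wl a + wl b" using wl_mult[OF ab] g by simp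
  ultimately have "wl a = r" "wl b = wl g - r" using assms(2) by linarith+
  then show ?thesis using that[OF ab g] by blast
qed

lemma finite_wl_ball: "finite {g \<in> carrier \<Gamma>. wl g \<le> r}"
proof (rule finite_subset)
  show "{g \<in> carrier \<Gamma>. wl g \<le> r} \<subseteq> eval_word ` {ws. set ws \<subseteq> letters \<and> length ws \<le> r}"
  proof
    fix g assume g: "g \<in> {g \<in> carrier \<Gamma>. wl g \<le> r}"
    then have "g \<in> carrier \<Gamma>" by simp
    from word_length_attained[OF this] obtain ws
      where "length ws = wl g" "set ws \<subseteq> letters" "eval_word ws = g" by metis
    then show "g \<in> eval_word ` {ws. set ws \<subseteq> letters \<and> length ws \<le> r}" using g by force
  qed
  show "finite (eval_word ` {ws. set ws \<subseteq> letters \<and> length ws \<le> r})"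
    using finite_lists_length_le[OF finite_letters] by simp
qed

lemma gp_eq:
  assumes "x \<in> carrier \<Gamma>" "y \<in> carrier \<Gamma>"
  shows "gp x y = (real (wl x) + real (wl y) - real (wl (inv x \<otimes> y))) / 2"
  using assms by (simp add: gromov_product_def word_dist_def wl_inv)

lemma gp_commute:
  assumes "x \<in> carrier \<Gamma>" "y \<in> carrier \<Gamma>"
  shows "gp x y = gp y x"
proof -
  have "wl (inv x \<otimes> y) = wl (inv y \<otimes> x)"
    using wl_inv[of "inv x \<otimes> y"] assms by (simp add: inv_mult_group)
  then show ?thesis using assms by (simp add: gp_eq)
qed

lemma gp_self: "x \<in> carrier \<Gamma> \<Longrightarrow> gp x x = wl x"
  by (simp add: gp_eq)

text \<open>A prefix of a shortest word lies on a geodesic from the identity, so the triangle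
  inequality behind the Gromov product is an equality.\<close>

lemma gp_prefix:
  assumes "a \<in> carrier \<Gamma>" "b \<in> carrier \<Gamma>" "wl a + wl b = wl (a \<otimes> b)"
  shows "gp a (a \<otimes> b) = wl a"
proof -
  have "inv a \<otimes> (a \<otimes> b) = b" using assms by (simp add: m_assoc[symmetric])
  then show ?thesis using assms by (simp add: gp_eq flip: assms(3))
qed

lemma hyperbolicity:
  obtains \<delta> where "\<And>x y z. x \<in> carrier \<Gamma> \<Longrightarrow> y \<in> carrier \<Gamma> \<Longrightarrow> z \<in> carrier \<Gamma> \<Longrightarrow>
    gp x z \<ge> min (gp x y) (gp y z) - \<delta>" "\<delta> \<ge> 0"
proof -
  obtain \<delta> where *: "\<And>x y z. x \<in> carrier \<Gamma> \<Longrightarrow> y \<in> carrier \<Gamma> \<Longrightarrow> z \<in> carrier \<Gamma> \<Longrightarrow>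
    gp x z \<ge> min (gp x y) (gp y z) - \<delta>"
    using hyperbolic unfolding word_hyperbolic_def by blast
  show ?thesis
  proof (rule that[of "max \<delta> 0"])
    fix x y z assume "x \<in> carrier \<Gamma>" "y \<in> carrier \<Gamma>" "z \<in> carrier \<Gamma>"
    from *[OF this] show "gp x z \<ge> min (gp x y) (gp y z) - max \<delta> 0" by linarith
  qed simp
qed

section \<open>The boundary as a set of ends, its topology and its compactness\<close>

abbreviation "ends \<equiv> same_end \<Gamma> S"
abbreviation "bdry \<equiv> gromov_boundary \<Gamma> S"

lemma ends_iff: "(x, y) \<in> ends \<longleftrightarrow> range x \<subseteq> carrier \<Gamma> \<and> range y \<subseteq> carrier \<Gamma> \<and>
     (\<forall>r. \<exists>N. \<forall>i\<ge>N. \<forall>j\<ge>N. gp (x i) (y j) \<ge> r)"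
  unfolding same_end_def by blast

lemma endsD: "(x, y) \<in> ends \<Longrightarrow> \<exists>N. \<forall>i\<ge>N. \<forall>j\<ge>N. gp (x i) (y j) \<ge> r"
  unfolding ends_iff by (elim conjE) (erule spec)

lemma ends_carrier: "(x, y) \<in> ends \<Longrightarrow> x i \<in> carrier \<Gamma> \<and> y j \<in> carrier \<Gamma>"
  unfolding ends_iff by auto

text \<open>Only transitivity needs hyperbolicity: the four-point inequality through one far term of
  the middle sequence costs a single \<delta>, which is absorbed because \<open>r\<close> is
  arbitrary.\<close>

lemma equiv_ends: "equiv {x. (x, x) \<in> ends} ends"
proof -
  have sym: "sym ends"
  proof (rule symI)
    fix x y assume "(x, y) \<in> ends"
    then show "(y, x) \<in> ends" unfolding ends_iff
      by (metis gp_commute range_subsetD)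
  qed
  have trans: "trans ends"
  proof (rule transI)
    fix x y z assume xy: "(x, y) \<in> ends" and yz: "(y, z) \<in> ends"
    obtain \<delta> where d: "\<And>x y z. x \<in> carrier \<Gamma> \<Longrightarrow> y \<in> carrier \<Gamma> \<Longrightarrow> z \<in> carrier \<Gamma> \<Longrightarrow>
      gp x z \<ge> min (gp x y) (gp y z) - \<delta>" "\<delta> \<ge> 0" by (rule hyperbolicity) blast
    have "\<exists>N. \<forall>i\<ge>N. \<forall>j\<ge>N. gp (x i) (z j) \<ge> r" for r
    proof -
      obtain N1 where N1: "\<And>i j. i \<ge> N1 \<Longrightarrow> j \<ge> N1 \<Longrightarrow> gp (x i) (y j) \<ge> r + \<delta>"
        using endsD[OF xy, of "r + \<delta>"] by metis
      obtain N2 where N2: "\<And>i j. i \<ge> N2 \<Longrightarrow> j \<ge> N2 \<Longrightarrow> gp (y i) (z j) \<ge> r + \<delta>"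
        using endsD[OF yz, of "r + \<delta>"] by metis
      have "gp (x i) (z j) \<ge> r" if "i \<ge> max N1 N2" "j \<ge> max N1 N2" for i j
      proof -
        have "x i \<in> carrier \<Gamma>" "y (max N1 N2) \<in> carrier \<Gamma>" "z j \<in> carrier \<Gamma>"
          using ends_carrier[OF xy] ends_carrier[OF yz] by auto
        from d(1)[OF this] N1[of i "max N1 N2"] N2[of "max N1 N2" j] that show ?thesis by auto
      qed
      then show ?thesis by blast
    qed
    moreover have "range x \<subseteq> carrier \<Gamma>" "range z \<subseteq> carrier \<Gamma>"
      using ends_carrier[OF xy] ends_carrier[OF yz] by auto
    ultimately show "(x, z) \<in> ends" unfolding ends_iff by simp
  qed
  show ?thesis
  proof (rule equivI)
    show "ends \<subseteq> {x. (x, x) \<in> ends} \<times> {x. (x, x) \<in> ends}"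
    proof (rule subrelI)
      fix x y assume xy: "(x, y) \<in> ends"
      have yx: "(y, x) \<in> ends" by (rule symD[OF sym xy])
      show "(x, y) \<in> {x. (x, x) \<in> ends} \<times> {x. (x, x) \<in> ends}"
        using transD[OF trans xy yx] transD[OF trans yx xy] by blast
    qed
    show "refl_on {x. (x, x) \<in> ends} ends"
      by (simp add: refl_on_def)
  qed (fact sym trans)+
qed

lemma bdry_rel: "p \<in> bdry \<Longrightarrow> x \<in> p \<Longrightarrow> y \<in> p \<Longrightarrow> (x, y) \<in> ends"
  unfolding gromov_boundary_def using equiv_ends by (rule quotient_eq_iff[THEN iffD1]) auto

lemma bdry_nonempty: "p \<in> bdry \<Longrightarrow> \<exists>x. x \<in> p"
  unfolding gromov_boundary_def using in_quotient_imp_non_empty[OF equiv_ends] by blast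

lemma bdry_eqI: "p \<in> bdry \<Longrightarrow> q \<in> bdry \<Longrightarrow> x \<in> p \<Longrightarrow> y \<in> q \<Longrightarrow> (x, y) \<in> ends \<Longrightarrow> p = q"
  unfolding gromov_boundary_def using quotient_eqI[OF equiv_ends] by blast

lemma bdry_class: "(x, x) \<in> ends \<Longrightarrow> ends `` {x} \<in> bdry \<and> x \<in> ends `` {x}"
  unfolding gromov_boundary_def by (auto intro: quotientI)

lemma openin_boundary:
  "openin (boundary_topology \<Gamma> S) V \<longleftrightarrow> V \<subseteq> bdry \<and> (\<forall>p\<in>V. \<exists>r. boundary_nbhd \<Gamma> S p r \<subseteq> V)"
  unfolding boundary_topology_def
  using topology_inverse'[OF istopology_boundary[of \<Gamma> S]] by simp

lemma topspace_boundary [simp]: "topspace (boundary_topology \<Gamma> S) = bdry"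
proof
  show "topspace (boundary_topology \<Gamma> S) \<subseteq> bdry"
    using openin_boundary openin_topspace by blast
  have "openin (boundary_topology \<Gamma> S) bdry"
    unfolding openin_boundary by (auto simp: boundary_nbhd_def)
  then show "bdry \<subseteq> topspace (boundary_topology \<Gamma> S)" by (rule openin_subset)
qed

text \<open>Points of the boundary are closed. This makes the complement of a point an open set over
  which flow lines with that point as a fixed end can be used as local coordinates. A point
  \<open>y\<close> in all basic neighbourhoods of \<open>p\<close> must equal \<open>p\<close>,
  although the representing sequences may change with the radius.\<close>

lemma boundary_T1: "openin (boundary_topology \<Gamma> S) (bdry - {y})"
proof (cases "y \<in> bdry")
  case False
  then have "bdry - {y} = topspace (boundary_topology \<Gamma> S)" by simp
  then show ?thesis by (metis openin_topspace)
next
  case y: True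
  obtain \<delta> where d: "\<And>x y z. x \<in> carrier \<Gamma> \<Longrightarrow> y \<in> carrier \<Gamma> \<Longrightarrow> z \<in> carrier \<Gamma> \<Longrightarrow>
      gp x z \<ge> min (gp x y) (gp y z) - \<delta>" "\<delta> \<ge> 0" by (rule hyperbolicity) blast
  show ?thesis unfolding openin_boundary
  proof (intro conjI ballI)
    fix p assume p: "p \<in> bdry - {y}"
    show "\<exists>r. boundary_nbhd \<Gamma> S p r \<subseteq> bdry - {y}"
    proof (rule ccontr)
      assume "\<nexists>r. boundary_nbhd \<Gamma> S p r \<subseteq> bdry - {y}"
      then have close: "y \<in> boundary_nbhd \<Gamma> S p r" for r unfolding boundary_nbhd_def by blast
      obtain x0 where x0: "x0 \<in> p" using bdry_nonempty p by blast
      obtain y0 where y0: "y0 \<in> y" using bdry_nonempty y by blast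
      have car: "range x0 \<subseteq> carrier \<Gamma>" "range y0 \<subseteq> carrier \<Gamma>"
        using bdry_rel[OF _ x0 x0] bdry_rel[OF y y0 y0] p unfolding ends_iff by auto
      have "\<exists>N. \<forall>i\<ge>N. \<forall>j\<ge>N. gp (x0 i) (y0 j) \<ge> r" for r
      proof -
        \<comment> \<open>The chain \<open>x0\<close>, \<open>x1\<close>, \<open>y1\<close>,
          \<open>y0\<close> uses the four-point inequality twice, hence the margin
          \<open>2 * \<delta>\<close>.\<close>
        obtain x1 y1 N where 1: "x1 \<in> p" "y1 \<in> y" "\<And>i j. i \<ge> N \<Longrightarrow> j \<ge> N \<Longrightarrow> gp (x1 i) (y1 j) \<ge> r + 2 * \<delta>"
          using close[of "r + 2 * \<delta>"] unfolding boundary_nbhd_def by blast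
        obtain N1 where N1: "\<And>i j. i \<ge> N1 \<Longrightarrow> j \<ge> N1 \<Longrightarrow> gp (x0 i) (x1 j) \<ge> r + 2 * \<delta>"
          using endsD[OF bdry_rel[OF _ x0 1(1)], of "r + 2 * \<delta>"] p by (metis DiffD1)
        obtain N2 where N2: "\<And>i j. i \<ge> N2 \<Longrightarrow> j \<ge> N2 \<Longrightarrow> gp (y1 i) (y0 j) \<ge> r + 2 * \<delta>"
          using endsD[OF bdry_rel[OF y 1(2) y0], of "r + 2 * \<delta>"] by metis
        define M where "M = max N (max N1 N2)"
        have "gp (x0 i) (y0 j) \<ge> r" if "i \<ge> M" "j \<ge> M" for i j
        proof -
          have c: "x0 i \<in> carrier \<Gamma>" "x1 M \<in> carrier \<Gamma>" "y1 M \<in> carrier \<Gamma>" "y0 j \<in> carrier \<Gamma>"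
            using ends_carrier[OF bdry_rel[OF _ x0 1(1)]] ends_carrier[OF bdry_rel[OF y y0 1(2)]] p by auto
          have M: "M \<ge> N" "M \<ge> N1" "M \<ge> N2" unfolding M_def by auto
          have "gp (x0 i) (x1 M) \<ge> r + 2 * \<delta>" by (rule N1) (use that M in auto)
          moreover have "gp (x1 M) (y1 M) \<ge> r + 2 * \<delta>" by (rule 1(3)) (use M in auto)
          ultimately have "gp (x0 i) (y1 M) \<ge> r + \<delta>" using d(1)[OF c(1,2,3)] by linarith
          moreover have "gp (y1 M) (y0 j) \<ge> r + 2 * \<delta>" by (rule N2) (use that M in auto)
          ultimately show ?thesis using d(1)[OF c(1,3,4)] d(2) by linarith
        qed
        then show ?thesis by blast
      qed
      then have "(x0, y0) \<in> ends" unfolding ends_iff using car by simp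
      then have "p = y" using bdry_eqI[OF _ y x0 y0] p by blast
      then show False using p by blast
    qed
  qed blast
qed

text \<open>That coordinate \<open>r\<close> is constant along a subsequence is inherited by further
  subsequences and can be reached by the pigeonhole principle; the diagonal sequence then has this
  property for every \<open>r\<close> from index \<open>Suc r\<close> on.\<close>

lemma diagonal_finite:
  fixes a :: "nat \<Rightarrow> nat \<Rightarrow> 'g"
  assumes fin: "\<And>r. finite (range (\<lambda>n. a n r))"
  shows "\<exists>k c. strict_mono (k :: nat \<Rightarrow> nat) \<and> (\<forall>r. \<forall>\<^sub>F n in sequentially. a (k n) r = c r)"
proof -
  define P where "P r s \<longleftrightarrow> (\<exists>c. \<forall>m. a (s m) r = c)" for r and s :: "nat \<Rightarrow> nat"
  interpret subseqs P
  proof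
    fix n :: nat and s :: "nat \<Rightarrow> nat" assume "strict_mono s"
    have "finite (range (\<lambda>m. a (s m) n))"
      by (rule finite_subset[OF _ fin[of n]]) auto
    then obtain c where "infinite {m. a (s m) n = c}"
      using pigeonhole_infinite[of UNIV "\<lambda>m. a (s m) n"] by auto
    then obtain r where r: "strict_mono (r :: nat \<Rightarrow> nat)" "\<And>i. r i \<in> {m. a (s m) n = c}"
      using infinite_enumerate by blast
    then show "\<exists>r'. strict_mono r' \<and> P n (s \<circ> r')" unfolding P_def by auto
  qed
  have "P r (diagseq \<circ> ((+) (Suc r)))" for r
    by (rule diagseq_holds) (auto simp: P_def)
  then obtain c where c: "\<And>r m. a (diagseq (Suc r + m)) r = c r"
    unfolding P_def o_def by metis
  have "\<forall>\<^sub>F n in sequentially. a (diagseq n) r = c r" for r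
    unfolding eventually_sequentially
  proof (intro exI[of _ "Suc r"] allI impI)
    fix n assume "Suc r \<le> n"
    then show "a (diagseq n) r = c r" using c[of r "n - Suc r"] by simp
  qed
  then show ?thesis using subseq_diagseq by blast
qed

text \<open>Each boundary point is followed by prefixes of every length \<open>r\<close> of words
  that represent it. Balls in the group are finite, so along a subsequence the prefixes of each
  length become constant; the stable prefixes \<open>c r\<close> form a sequence whose end is the
  limit.\<close>

lemma boundary_seq_compact:
  assumes x: "\<And>n::nat. x n \<in> bdry"
  obtains k p where "strict_mono (k :: nat \<Rightarrow> nat)" "limitin (boundary_topology \<Gamma> S) (x \<circ> k) p sequentially"
proof -
  obtain \<delta> where d: "\<And>x y z. x \<in> carrier \<Gamma> \<Longrightarrow> y \<in> carrier \<Gamma> \<Longrightarrow> z \<in> carrier \<Gamma> \<Longrightarrow>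
      gp x z \<ge> min (gp x y) (gp y z) - \<delta>" "\<delta> \<ge> 0" by (rule hyperbolicity) blast
  have "\<exists>g. \<forall>n. g n \<in> x n" by (intro choice allI bdry_nonempty x)
  then obtain g where g: "\<And>n. g n \<in> x n" by blast
  have gc: "g n i \<in> carrier \<Gamma>" for n i
    using ends_carrier[OF bdry_rel[OF x g g]] by blast
  \<comment> \<open>The prefix is taken from one far term \<open>g n N\<close> of the representing
    sequence; the loss of \<delta> pays for comparing it with all later terms.\<close>
  have "\<exists>a. a \<in> carrier \<Gamma> \<and> wl a = r \<and> (\<exists>N. \<forall>i\<ge>N. gp a (g n i) \<ge> real r - \<delta>)" for n r
  proof -
    obtain N where N: "\<And>i j. i \<ge> N \<Longrightarrow> j \<ge> N \<Longrightarrow> gp (g n i) (g n j) \<ge> real r"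
      using endsD[OF bdry_rel[OF x g g], of "real r"] by metis
    have "r \<le> wl (g n N)" using N[of N N] gp_self gc by simp
    then obtain a b where ab: "a \<in> carrier \<Gamma>" "b \<in> carrier \<Gamma>" "g n N = a \<otimes> b" "wl a = r" "wl b = wl (g n N) - r"
      using wl_prefix[OF gc, of r n N] by metis
    have "gp a (g n N) = r" using gp_prefix[of a b] ab \<open>r \<le> wl (g n N)\<close> by simp
    then have "gp a (g n i) \<ge> real r - \<delta>" if "i \<ge> N" for i
      using d(1)[OF ab(1) gc[of n N] gc[of n i]] N[OF order_refl that] by linarith
    then show ?thesis using ab by blast
  qed
  then have "\<exists>a. \<forall>n r. a n r \<in> carrier \<Gamma> \<and> wl (a n r) = r \<and> (\<exists>N. \<forall>i\<ge>N. gp (a n r) (g n i) \<ge> real r - \<delta>)"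
    by (intro choice allI) blast
  then obtain a where a: "\<And>n r. a n r \<in> carrier \<Gamma>" "\<And>n r. wl (a n r) = r"
    "\<And>n r. \<exists>N. \<forall>i\<ge>N. gp (a n r) (g n i) \<ge> real r - \<delta>" by blast
  have "finite (range (\<lambda>n. a n r))" for r
    by (rule finite_subset[OF _ finite_wl_ball[of r]]) (use a in auto)
  then obtain k c where k: "strict_mono k" and c: "\<And>r. \<forall>\<^sub>F n in sequentially. a (k n) r = c r"
    using diagonal_finite[of a] by blast
  have cc: "c r \<in> carrier \<Gamma>" for r
    using eventually_happens[OF c[of r]] a(1)[of _ r] by (metis sequentially_bot)
  have gpc: "gp (c r) (c s) \<ge> min (real r) (real s) - 2 * \<delta>" for r s
  proof -
    obtain n where n: "a (k n) r = c r" "a (k n) s = c s"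
      using eventually_happens[OF eventually_conj[OF c[of r] c[of s]]] by auto
    obtain N1 N2 where "\<And>i. i \<ge> N1 \<Longrightarrow> gp (c r) (g (k n) i) \<ge> real r - \<delta>"
       "\<And>i. i \<ge> N2 \<Longrightarrow> gp (c s) (g (k n) i) \<ge> real s - \<delta>" 
      using a(3)[where n = "k n" and r = r] a(3)[where n = "k n" and r = s] n by metis
    from this(1)[of "max N1 N2"] this(2)[of "max N1 N2"]
    have "gp (c r) (g (k n) (max N1 N2)) \<ge> real r - \<delta>" "gp (g (k n) (max N1 N2)) (c s) \<ge> real s - \<delta>"
      using gp_commute[OF cc[of s] gc[of "k n" "max N1 N2"]] by simp_all
    then show ?thesis using d(1)[OF cc[of r] gc[of "k n" "max N1 N2"] cc[of s]] by linarith
  qed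
  have "\<exists>N. \<forall>i\<ge>N. \<forall>j\<ge>N. gp (c i) (c j) \<ge> r" for r
  proof (intro exI[of _ "nat \<lceil>r + 2 * \<delta>\<rceil>"] allI impI)
    fix i j assume "nat \<lceil>r + 2 * \<delta>\<rceil> \<le> i" "nat \<lceil>r + 2 * \<delta>\<rceil> \<le> j"
    then have "r + 2 * \<delta> \<le> i" "r + 2 * \<delta> \<le> j" by linarith+
    then show "gp (c i) (c j) \<ge> r" using gpc[of i j] by linarith
  qed
  then have cE: "(c, c) \<in> ends" unfolding ends_iff using cc by auto
  define p where "p = ends `` {c}"
  have p: "p \<in> bdry" "c \<in> p" using bdry_class[OF cE] unfolding p_def by auto
  have near: "\<forall>\<^sub>F n in sequentially. x (k n) \<in> boundary_nbhd \<Gamma> S p r" for r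
  proof -
    \<comment> \<open>Two \<delta> are lost between stable prefixes, and one more in the last
      four-point inequality.\<close>
    define m where "m = nat \<lceil>r + 3 * \<delta>\<rceil>"
    have m: "r + 3 * \<delta> \<le> m" unfolding m_def by linarith
    show ?thesis using c[of m]
    proof eventually_elim
      case (elim n)
      obtain N where N: "\<And>i. i \<ge> N \<Longrightarrow> gp (c m) (g (k n) i) \<ge> real m - \<delta>" 
        using a(3)[where n = "k n" and r = m] elim by metis
      have "gp (c j) (g (k n) i) \<ge> r" if "i \<ge> max N m" "j \<ge> max N m" for i j
      proof -
        have "gp (c m) (g (k n) i) \<ge> real m - \<delta>" using N[of i] that by simp
        moreover have "gp (c j) (c m) \<ge> real m - 2 * \<delta>" using gpc[of j m] that by simp
        ultimately show ?thesis using d(1)[OF cc[of j] cc[of m] gc[of "k n" i]] m d(2) by linarith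
      qed
      then have "\<forall>i\<ge>max N m. \<forall>j\<ge>max N m. gp (c i) (g (k n) j) \<ge> r" by blast
      then show ?case unfolding boundary_nbhd_def using x g p(2) by blast
    qed
  qed
  have "limitin (boundary_topology \<Gamma> S) (x \<circ> k) p sequentially"
    unfolding limitin_def
  proof (intro conjI allI impI)
    fix V assume "openin (boundary_topology \<Gamma> S) V \<and> p \<in> V"
    then obtain r where "boundary_nbhd \<Gamma> S p r \<subseteq> V" unfolding openin_boundary by blast
    then show "\<forall>\<^sub>F n in sequentially. (x \<circ> k) n \<in> V"
      using near[of r] by (auto elim: eventually_mono)
  qed (use p in simp)
  then show ?thesis using that k by blast
qed

text \<open>Midpoints of geodesic words of length \<open>2m\<close> are translated to the identity; the two halves
  then converge to two different boundary points.\<close>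

lemma boundary_two_points:
  assumes x: "x \<in> bdry"
  obtains y where "y \<in> bdry" "y \<noteq> x"
proof -
  obtain \<delta> where d: "\<And>x y z. x \<in> carrier \<Gamma> \<Longrightarrow> y \<in> carrier \<Gamma> \<Longrightarrow> z \<in> carrier \<Gamma> \<Longrightarrow>
      gp x z \<ge> min (gp x y) (gp y z) - \<delta>" "\<delta> \<ge> 0" by (rule hyperbolicity) blast
  have "\<exists>a b. a \<in> carrier \<Gamma> \<and> b \<in> carrier \<Gamma> \<and> wl a = m \<and> wl b = m \<and> gp a b = 0" for m
  proof -
    obtain g where g: "g \<in> x" using bdry_nonempty x by blast
    obtain N where N: "gp (g N) (g N) \<ge> real (2 * m)" and gN: "g N \<in> carrier \<Gamma>"
      using endsD[OF bdry_rel[OF x g g], of "real (2 * m)"] ends_carrier[OF bdry_rel[OF x g g]] by blast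
    then have "2 * m \<le> wl (g N)" using gp_self[OF gN] by simp
    then obtain h h' where h: "h \<in> carrier \<Gamma>" "wl h = 2 * m" using wl_prefix[OF gN] by metis
    then obtain a b where ab: "a \<in> carrier \<Gamma>" "b \<in> carrier \<Gamma>" "h = a \<otimes> b" "wl a = m" "wl b = m"
      using wl_prefix[OF h(1), of m] by (metis add_diff_cancel_left' le_add1 mult_2)
    have "gp (inv a) b = 0" using ab h by (simp add: gp_eq wl_inv)
    then show ?thesis using ab wl_inv by (intro exI[of _ "inv a"] exI[of _ b]) auto
  qed
  then obtain a b where ab: "\<And>m. a m \<in> carrier \<Gamma>" "\<And>m. b m \<in> carrier \<Gamma>"
    "\<And>m. wl (a m) = m" "\<And>m. wl (b m) = m" "\<And>m. gp (a m) (b m) = 0" by metis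
  have pre: "\<exists>c. c \<in> carrier \<Gamma> \<and> wl c \<le> r \<and> (r \<le> wl g \<longrightarrow> gp c g = r)" if gc: "g \<in> carrier \<Gamma>" for g r
  proof (cases "r \<le> wl g")
    case True
    then obtain u v where "u \<in> carrier \<Gamma>" "v \<in> carrier \<Gamma>" "g = u \<otimes> v" "wl u = r" "wl v = wl g - r"
      using wl_prefix[OF gc True] by metis
    then show ?thesis using gp_prefix[of u v] True by (intro exI[of _ u]) auto
  next
    case False
    then show ?thesis by (intro exI[of _ \<one>]) auto
  qed
  have prefixes: "\<exists>w. \<forall>n r. w n r \<in> carrier \<Gamma> \<and> wl (w n r) \<le> r \<and> (r \<le> n \<longrightarrow> gp (w n r) (f n) = r)"
    if f: "\<And>m. f m \<in> carrier \<Gamma>" "\<And>m. wl (f m) = m" for f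
    using pre[OF f(1)] unfolding f(2) by (intro choice allI) blast
  obtain u where u: "\<And>n r. u n r \<in> carrier \<Gamma>" "\<And>n r. wl (u n r) \<le> r"
    "\<And>n r. r \<le> n \<Longrightarrow> gp (u n r) (a n) = r" using prefixes[OF ab(1,3)] by blast
  obtain v where v: "\<And>n r. v n r \<in> carrier \<Gamma>" "\<And>n r. wl (v n r) \<le> r"
    "\<And>n r. r \<le> n \<Longrightarrow> gp (v n r) (b n) = r" using prefixes[OF ab(2,4)] by blast
  have "finite (range (\<lambda>n. u n r))" for r
    by (rule finite_subset[OF _ finite_wl_ball[of r]]) (use u in auto)
  then obtain k c where k: "strict_mono k" and c: "\<And>r. \<forall>\<^sub>F n in sequentially. u (k n) r = c r"
    using diagonal_finite[of u] by blast
  have "finite (range (\<lambda>n. v (k n) r))" for r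
    by (rule finite_subset[OF _ finite_wl_ball[of r]]) (use v in auto)
  then obtain l e where l: "strict_mono l" and e: "\<And>r. \<forall>\<^sub>F n in sequentially. v (k (l n)) r = e r"
    using diagonal_finite[of "\<lambda>n. v (k n)"] by blast
  have c: "\<forall>\<^sub>F n in sequentially. u (k (l n)) r = c r" for r
    using eventually_subseq[OF l c[of r]] .
  have kl: "strict_mono (k \<circ> l)" using k l by (rule strict_mono_o)
  then have big: "\<forall>\<^sub>F n in sequentially. r \<le> k (l n)" for r
    unfolding eventually_sequentially
  proof (intro exI[of _ r] allI impI)
    fix n assume "r \<le> n"
    then show "r \<le> k (l n)" using seq_suble[OF kl, of n] by simp
  qed
  have ec: "\<exists>n. u n r = c r \<and> u n s = c s \<and> v n r = e r \<and> v n s = e s \<and> r \<le> n \<and> s \<le> n" for r s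
  proof -
    have "\<forall>\<^sub>F n in sequentially. u (k (l n)) r = c r \<and> u (k (l n)) s = c s \<and> v (k (l n)) r = e r \<and>
       v (k (l n)) s = e s \<and> r \<le> k (l n) \<and> s \<le> k (l n)"
      using c[of r] c[of s] e[of r] e[of s] big[of r] big[of s] by eventually_elim auto
    then show ?thesis using eventually_happens by fastforce
  qed
  have cc: "c r \<in> carrier \<Gamma>" "e r \<in> carrier \<Gamma>" for r using ec[of r r] u v by metis+
  have gpc: "gp (c r) (c s) \<ge> min (real r) (real s) - \<delta>" "gp (e r) (e s) \<ge> min (real r) (real s) - \<delta>" for r s
  proof -
    obtain n where n: "u n r = c r" "u n s = c s" "v n r = e r" "v n s = e s" "r \<le> n" "s \<le> n"
      using ec by blast
    have "gp (c r) (a n) = r" "gp (a n) (c s) = s" "gp (e r) (b n) = r" "gp (b n) (e s) = s"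
      using u v n gp_commute ab by metis+
    then show "gp (c r) (c s) \<ge> min (real r) (real s) - \<delta>" "gp (e r) (e s) \<ge> min (real r) (real s) - \<delta>"
      using d(1)[OF cc(1)[of r] ab(1)[of n] cc(1)[of s]] d(1)[OF cc(2)[of r] ab(2)[of n] cc(2)[of s]] by auto
  qed
  have conv: "\<exists>N. \<forall>i\<ge>N. \<forall>j\<ge>N. gp (f i) (f j) \<ge> r"
    if "\<And>r s. gp (f r) (f s) \<ge> min (real r) (real s) - \<delta>" for f r
  proof (intro exI[of _ "nat \<lceil>r + \<delta>\<rceil>"] allI impI)
    fix i j assume "nat \<lceil>r + \<delta>\<rceil> \<le> i" "nat \<lceil>r + \<delta>\<rceil> \<le> j"
    then have "r + \<delta> \<le> i" "r + \<delta> \<le> j" by linarith+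
    then show "gp (f i) (f j) \<ge> r" using that[of i j] by auto
  qed
  have E: "(c, c) \<in> ends" "(e, e) \<in> ends" unfolding ends_iff using cc conv gpc by auto
  have "(c, e) \<notin> ends"
  proof
    assume "(c, e) \<in> ends"
    \<comment> \<open>The path \<open>a n\<close>, \<open>c r\<close>, \<open>e r\<close>,
      \<open>b n\<close> costs \<open>2 * \<delta>\<close>, so this threshold leaves a product of at
      least 1, whereas the two halves have product 0 at their common midpoint.\<close>
    then obtain N where N: "\<And>i j. i \<ge> N \<Longrightarrow> j \<ge> N \<Longrightarrow> gp (c i) (e j) \<ge> 2 * \<delta> + 1"
      using endsD[of c e "2 * \<delta> + 1"] by metis
    define r where "r = max N (nat \<lceil>2 * \<delta> + 1\<rceil>)"
    have r: "2 * \<delta> + 1 \<le> r" unfolding r_def by linarith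
    obtain n where n: "u n r = c r" "v n r = e r" "r \<le> n" using ec by blast
    have 1: "gp (a n) (c r) = r" "gp (e r) (b n) = r" using u v n gp_commute ab by metis+
    have "gp (a n) (e r) \<ge> \<delta> + 1"
    proof -
      have "gp (c r) (e r) \<ge> 2 * \<delta> + 1" by (rule N) (auto simp: r_def)
      then show ?thesis using d(1)[OF ab(1)[of n] cc(1)[of r] cc(2)[of r]] 1(1) r d(2) by linarith
    qed
    then have "gp (a n) (b n) \<ge> 1"
      using d(1)[OF ab(1)[of n] cc(2)[of r] ab(2)[of n]] 1(2) r d(2) by linarith
    then show False using ab(5)[of n] by simp
  qed
  then have "ends `` {c} \<noteq> ends `` {e}" using bdry_class[OF E(2)] by auto
  then show ?thesis using that bdry_class[OF E(1)] bdry_class[OF E(2)] by metis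
qed

end

section \<open>The Gromov flow\<close>

text \<open>A flow point is a nested pair; quantifiers over flow points are to stay quantifiers over
  points instead of being split into coordinates.\<close>

declare split_paired_All [simp del] split_paired_Ex [simp del]

text \<open>A Boolean \<epsilon> names an end of a flow line and at the same time, through
  \<open>sg \<epsilon>\<close>, the time direction attached to it. Every statement about the two
  ends is then proved once.\<close>

definition sg :: "bool \<Rightarrow> real" where "sg \<epsilon> = (if \<epsilon> then 1 else -1)"

definition ep :: "bool \<Rightarrow> 'g fpoint \<Rightarrow> 'g bpoint" where
  "ep \<epsilon> p = (if \<epsilon> then end_plus p else end_minus p)"

definition mk :: "bool \<Rightarrow> 'g bpoint \<Rightarrow> 'g bpoint \<Rightarrow> real \<Rightarrow> 'g fpoint" where
  "mk \<epsilon> x y r = (if \<epsilon> then ((x, y), r) else ((y, x), r))"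

lemma ep_flow [simp]: "ep \<epsilon> (flow t p) = ep \<epsilon> p"
  by (simp add: ep_def flow_def)

lemma ep_mk [simp]: "ep \<epsilon> (mk \<epsilon> x y r) = x" "ep (\<not> \<epsilon>) (mk \<epsilon> x y r) = y" "snd (mk \<epsilon> x y r) = r"
  "ep True (mk False x y r) = y" "ep False (mk True x y r) = y"
  by (auto simp: ep_def mk_def)

lemma mk_ep: "mk \<epsilon> (ep \<epsilon> p) (ep (\<not> \<epsilon>) p) (snd p) = p"
  by (auto simp: ep_def mk_def)

lemma flow_mk [simp]: "flow t (mk \<epsilon> x y r) = mk \<epsilon> x y (r + t)"
  by (auto simp: flow_def mk_def)

lemma flow_flow [simp]: "flow s (flow t p) = flow (s + t) p" "flow 0 p = p"
  by (auto simp: flow_def add_ac)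

text \<open>The flow space is metrizable, so all continuity arguments can be run with convergent
  sequences and abstract topologies enter only through this lemma.\<close>

lemma continuous_map_sequential:
  fixes f :: "'a \<Rightarrow> 'b::topological_space"
  assumes Z: "metrizable_space Z"
    and f: "\<And>\<sigma> l. range \<sigma> \<subseteq> topspace Z \<Longrightarrow> limitin Z \<sigma> l sequentially \<Longrightarrow> (\<lambda>n. f (\<sigma> n)) \<longlonglongrightarrow> f l"
  shows "continuous_map Z euclidean f"
proof -
  obtain M d where M: "Metric_space M d" "Z = Metric_space.mtopology M d"
    using Z unfolding metrizable_space_def by blast
  interpret Metric_space M d by (rule M)
  show ?thesis unfolding continuous_map_closedin
  proof (intro conjI allI impI)
    fix C :: "'b set" assume C: "closedin euclidean C"
    show "closedin Z {x \<in> topspace Z. f x \<in> C}"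
      unfolding M(2) metric_closedin_iff_sequentially_closed
    proof (intro conjI allI impI)
      fix \<sigma> l assume *: "range \<sigma> \<subseteq> {x \<in> topspace mtopology. f x \<in> C} \<and> limitin mtopology \<sigma> l sequentially"
      then have "(\<lambda>n. f (\<sigma> n)) \<longlonglongrightarrow> f l" by (intro f) (auto simp: M(2))
      moreover have "\<forall>n. f (\<sigma> n) \<in> C" using * by auto
      ultimately have "f l \<in> C" 
        using closed_sequentially[of C "\<lambda>n. f (\<sigma> n)" "f l"] C by simp
      then show "l \<in> {x \<in> topspace mtopology. f x \<in> C}" using * limitin_topspace[of mtopology \<sigma> l sequentially] by simp
    qed auto
  qed auto
qed

section \<open>The Gromov flow: action, convergence and compact sets\<close>

locale flow_system = hyperbolic_group \<Gamma> S for \<Gamma> :: "'g monoid" (structure) and S :: "'g set" +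
  fixes act :: "'g \<Rightarrow> 'g fpoint \<Rightarrow> 'g fpoint" and D :: "'g fpoint \<Rightarrow> 'g fpoint \<Rightarrow> real"
  assumes gromov: "gromov_flow \<Gamma> S act D"
begin

abbreviation "T \<equiv> flow_topology \<Gamma> S"
abbreviation "X \<equiv> topspace T"
abbreviation "B \<equiv> boundary_topology \<Gamma> S"
abbreviation "\<beta> \<equiv> boundary_act \<Gamma>"
abbreviation conv :: "(nat \<Rightarrow> 'g fpoint) \<Rightarrow> 'g fpoint \<Rightarrow> bool" where
  "conv P p \<equiv> limitin T P p sequentially"

lemma act_continuous: "\<gamma> \<in> carrier \<Gamma> \<Longrightarrow> continuous_map T T (act \<gamma>)"
  using gromov[unfolded gromov_flow_def, THEN conjunct1] by simp

lemma act_one [simp]: "p \<in> X \<Longrightarrow> act \<one> p = p"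
  using gromov[unfolded gromov_flow_def, THEN conjunct2, THEN conjunct1] by simp

lemma act_mult: "\<gamma> \<in> carrier \<Gamma> \<Longrightarrow> \<eta> \<in> carrier \<Gamma> \<Longrightarrow> p \<in> X \<Longrightarrow> act (\<gamma> \<otimes> \<eta>) p = act \<gamma> (act \<eta> p)"
  using gromov[unfolded gromov_flow_def, THEN conjunct2, THEN conjunct2, THEN conjunct1] by simp

lemma act_flow: "\<gamma> \<in> carrier \<Gamma> \<Longrightarrow> p \<in> X \<Longrightarrow> act \<gamma> (flow t p) = flow t (act \<gamma> p)"
  using gromov[unfolded gromov_flow_def, THEN conjunct2, THEN conjunct2, THEN conjunct2, THEN conjunct1] by simp

lemma act_ends: "\<gamma> \<in> carrier \<Gamma> \<Longrightarrow> p \<in> X \<Longrightarrow> fst (act \<gamma> p) = (\<beta> \<gamma> (end_plus p), \<beta> \<gamma> (end_minus p))"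
  using gromov[unfolded gromov_flow_def, THEN conjunct2, THEN conjunct2, THEN conjunct2, THEN conjunct2, THEN conjunct1] by simp

lemma act_proper: "compactin T C \<Longrightarrow> finite {\<gamma> \<in> carrier \<Gamma>. act \<gamma> ` C \<inter> C \<noteq> {}}"
  using gromov[unfolded gromov_flow_def, THEN conjunct2, THEN conjunct2, THEN conjunct2, THEN conjunct2, THEN conjunct2, THEN conjunct1] by simp

lemma cocompact: "\<exists>K. compactin T K \<and> (\<Union>\<gamma>\<in>carrier \<Gamma>. act \<gamma> ` K) = X"
  using gromov[unfolded gromov_flow_def, THEN conjunct2, THEN conjunct2, THEN conjunct2, THEN conjunct2, THEN conjunct2, THEN conjunct2, THEN conjunct1] by simp

lemma metric_flow: "Metric_space X D"
  using gromov[unfolded gromov_flow_def, THEN conjunct2, THEN conjunct2, THEN conjunct2, THEN conjunct2, THEN conjunct2, THEN conjunct2, THEN conjunct2, THEN conjunct1] by simp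

lemma mtopology_flow: "Metric_space.mtopology X D = T"
  using gromov[unfolded gromov_flow_def, THEN conjunct2, THEN conjunct2, THEN conjunct2, THEN conjunct2, THEN conjunct2, THEN conjunct2, THEN conjunct2, THEN conjunct2, THEN conjunct1] by simp

sublocale M: Metric_space "topspace (flow_topology \<Gamma> S)" D
  by (rule metric_flow)

lemma mtopology_T: "M.mtopology = T"
  by (rule mtopology_flow)

lemma metrizable_T: "metrizable_space T"
  using M.metrizable_space_mtopology by (simp add: mtopology_T)

lemma act_closed [simp]: "\<gamma> \<in> carrier \<Gamma> \<Longrightarrow> p \<in> X \<Longrightarrow> act \<gamma> p \<in> X"
  using act_continuous continuous_map_image_subset_topspace by blast

lemma act_inv: "\<gamma> \<in> carrier \<Gamma> \<Longrightarrow> p \<in> X \<Longrightarrow> act (inv \<gamma>) (act \<gamma> p) = p"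
  "\<gamma> \<in> carrier \<Gamma> \<Longrightarrow> p \<in> X \<Longrightarrow> act \<gamma> (act (inv \<gamma>) p) = p"
  by (simp_all flip: act_mult)

lemma ep_act: "\<gamma> \<in> carrier \<Gamma> \<Longrightarrow> p \<in> X \<Longrightarrow> ep \<epsilon> (act \<gamma> p) = \<beta> \<gamma> (ep \<epsilon> p)"
  by (simp add: ep_def act_ends)

lemma in_X: "p \<in> X \<longleftrightarrow> end_plus p \<in> bdry \<and> end_minus p \<in> bdry \<and> end_plus p \<noteq> end_minus p"
  unfolding flow_topology_def by (cases p) auto

lemma mk_in_X: "mk \<epsilon> x y r \<in> X \<longleftrightarrow> x \<in> bdry \<and> y \<in> bdry \<and> x \<noteq> y"
  by (auto simp: in_X mk_def)

lemma ep_bdry: "p \<in> X \<Longrightarrow> ep \<epsilon> p \<in> bdry"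
  by (simp add: in_X ep_def)

lemma ep_distinct: "p \<in> X \<Longrightarrow> ep \<epsilon> p \<noteq> ep (\<not> \<epsilon>) p"
  by (auto simp: in_X ep_def)

lemma flow_closed [simp]: "flow t p \<in> X \<longleftrightarrow> p \<in> X"
  by (simp add: in_X flow_def)

lemma point_exists:
  assumes "x \<in> bdry" obtains p where "p \<in> X" "ep \<epsilon> p = x"
proof -
  obtain y where "y \<in> bdry" "y \<noteq> x" using boundary_two_points[OF assms] .
  then show ?thesis using that[of "mk \<epsilon> x y 0"] assms by (auto simp: mk_in_X)
qed

text \<open>Read off from the action on a flow line ending at \<open>x\<close>, which avoids any
  computation of how translation changes Gromov products based at the identity.\<close>

lemma bdry_act:
  assumes "\<gamma> \<in> carrier \<Gamma>" "x \<in> bdry" shows "\<beta> \<gamma> x \<in> bdry"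
proof -
  obtain p where "p \<in> X" "ep True p = x" using point_exists[OF assms(2)] .
  then show ?thesis using ep_bdry[of "act \<gamma> p" True] assms by (simp add: ep_act)
qed

text \<open>The action commutes with the flow, so it carries a flow line to a flow line by a
  translation of the time parameter.\<close>

lemma act_mk:
  assumes "\<gamma> \<in> carrier \<Gamma>" "mk \<epsilon> x y r \<in> X"
  obtains \<tau> where "\<And>t. act \<gamma> (mk \<epsilon> x y (r + t)) = mk \<epsilon> (\<beta> \<gamma> x) (\<beta> \<gamma> y) (\<tau> + t)"
proof -
  have "act \<gamma> (mk \<epsilon> x y (r + t)) = mk \<epsilon> (\<beta> \<gamma> x) (\<beta> \<gamma> y) (snd (act \<gamma> (mk \<epsilon> x y r)) + t)" for t
  proof -
    have "act \<gamma> (mk \<epsilon> x y (r + t)) = flow t (act \<gamma> (mk \<epsilon> x y r))"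
      using act_flow[OF assms, of t] by simp
    also have "act \<gamma> (mk \<epsilon> x y r) = mk \<epsilon> (\<beta> \<gamma> x) (\<beta> \<gamma> y) (snd (act \<gamma> (mk \<epsilon> x y r)))"
      using mk_ep[of \<epsilon> "act \<gamma> (mk \<epsilon> x y r)"] assms by (simp add: ep_act)
    finally show ?thesis by simp
  qed
  then show ?thesis using that by blast
qed

lemma conv_X: "conv P p \<Longrightarrow> p \<in> X"
  by (rule limitin_topspace)

lemma conv_ep: assumes "conv P p" shows "limitin B (\<lambda>j. ep \<epsilon> (P j)) (ep \<epsilon> p) sequentially"
  using assms unfolding flow_topology_def limitin_pairwise limitin_subtopology ep_def
  by (simp add: o_def)

lemma conv_snd: assumes "conv P p" shows "(\<lambda>j. snd (P j)) \<longlonglongrightarrow> snd p"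
  using assms unfolding flow_topology_def limitin_pairwise by (simp add: o_def)

lemma convI:
  assumes "\<And>j. P j \<in> X" "p \<in> X" "\<And>\<epsilon>. limitin B (\<lambda>j. ep \<epsilon> (P j)) (ep \<epsilon> p) sequentially"
    and "(\<lambda>j. snd (P j)) \<longlonglongrightarrow> snd p"
  shows "conv P p"
proof -
  have "end_plus (P j) \<noteq> end_minus (P j)" for j using assms(1)[of j] by (simp add: in_X)
  moreover have "end_plus p \<noteq> end_minus p" using assms(2) by (simp add: in_X)
  ultimately show ?thesis
    using assms(3)[of True] assms(3)[of False] assms(4)
    unfolding flow_topology_def limitin_pairwise limitin_subtopology ep_def
    by (simp add: o_def split_beta)
qed

lemma conv_subseq: "conv P p \<Longrightarrow> strict_mono r \<Longrightarrow> conv (P \<circ> r) p"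
  by (rule limitin_subsequence)

lemma conv_act: "\<gamma> \<in> carrier \<Gamma> \<Longrightarrow> conv P p \<Longrightarrow> conv (\<lambda>j. act \<gamma> (P j)) (act \<gamma> p)"
  using continuous_map_limit[OF act_continuous] by (simp add: o_def)

lemma conv_flow:
  assumes "\<And>j. P j \<in> X" "conv P p" "t \<longlonglongrightarrow> s"
  shows "conv (\<lambda>j. flow (t j) (P j)) (flow s p)"
proof (rule convI)
  show "(\<lambda>j. snd (flow (t j) (P j))) \<longlonglongrightarrow> snd (flow s p)"
    unfolding flow_def using tendsto_add[OF conv_snd[OF assms(2)] assms(3)] by simp
qed (use assms conv_X conv_ep in auto)

lemma conv_metric: "conv P p \<longleftrightarrow> p \<in> X \<and> (\<forall>e>0. \<forall>\<^sub>F j in sequentially. P j \<in> X \<and> D (P j) p < e)"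
  using M.limitin_metric[of P p sequentially] by (simp add: mtopology_T)

lemma compact_seq:
  fixes P :: "nat \<Rightarrow> 'g fpoint"
  assumes "compactin T C" "\<And>j. P j \<in> C"
  obtains r :: "nat \<Rightarrow> nat" and p where "strict_mono r" "p \<in> C" "conv (P \<circ> r) p"
proof -
  have "range P \<subseteq> C" using assms(2) by blast
  moreover have "\<forall>P::nat \<Rightarrow> 'g fpoint. range P \<subseteq> C \<longrightarrow>
      (\<exists>l r. l \<in> C \<and> strict_mono (r :: nat \<Rightarrow> nat) \<and> conv (P \<circ> r) l)"
    using M.compactin_sequentially[of C, unfolded mtopology_T] assms(1) by simp
  ultimately obtain l and r :: "nat \<Rightarrow> nat" where "l \<in> C" "strict_mono r" "conv (P \<circ> r) l" by metis
  then show ?thesis by (intro that)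
qed

lemma compactI:
  assumes "C \<subseteq> X" "\<And>P. (\<And>j::nat. P j \<in> C) \<Longrightarrow> \<exists>p r. p \<in> C \<and> strict_mono (r :: nat \<Rightarrow> nat) \<and> conv (P \<circ> r) p"
  shows "compactin T C"
proof -
  have "\<forall>P :: nat \<Rightarrow> 'g fpoint. range P \<subseteq> C \<longrightarrow> (\<exists>p r. p \<in> C \<and> strict_mono (r :: nat \<Rightarrow> nat) \<and> conv (P \<circ> r) p)"
  proof (intro allI impI)
    fix P :: "nat \<Rightarrow> 'g fpoint" assume "range P \<subseteq> C"
    then show "\<exists>p r. p \<in> C \<and> strict_mono (r :: nat \<Rightarrow> nat) \<and> conv (P \<circ> r) p" using assms(2)[of P] by blast
  qed
  then show ?thesis
    by (rule M.compactin_sequentially[of C, unfolded mtopology_T, THEN iffD2, OF conjI, OF assms(1)])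
qed

lemma compact_convergent:
  assumes "\<And>j. P j \<in> X" "conv P p" shows "compactin T (insert p (range P))"
  by (rule compactin_sequence_with_limit[OF assms(2)]) (use assms in auto)

section \<open>A compact set with covering translates, and uniform bounds over compact sets\<close>

definition K :: "'g fpoint set" where
  "K = (SOME K. compactin T K \<and> (\<Union>\<gamma>\<in>carrier \<Gamma>. act \<gamma> ` K) = X)"

lemma K: "compactin T K" "(\<Union>\<gamma>\<in>carrier \<Gamma>. act \<gamma> ` K) = X"
proof -
  from someI_ex[OF cocompact] show "compactin T K" "(\<Union>\<gamma>\<in>carrier \<Gamma>. act \<gamma> ` K) = X"
    unfolding K_def by blast+
qed

lemma K_X: "p \<in> K \<Longrightarrow> p \<in> X"
  using compactin_subset_topspace[OF K(1)] by blast

lemma K_cover: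
  assumes "p \<in> X" obtains \<gamma> where "\<gamma> \<in> carrier \<Gamma>" "act \<gamma> p \<in> K"
proof -
  obtain \<gamma> k where "\<gamma> \<in> carrier \<Gamma>" "k \<in> K" "p = act \<gamma> k" using K(2) assms by blast
  then show ?thesis using that[of "inv \<gamma>"] by (simp add: act_inv K_X)
qed

lemma compact_flow_K: "compactin T {flow t p | t p. \<bar>t\<bar> \<le> L \<and> p \<in> K}"
proof (rule compactI)
  fix P assume "\<And>j::nat. P j \<in> {flow t p | t p. \<bar>t\<bar> \<le> L \<and> p \<in> K}"
  then have "\<forall>j. \<exists>t p. P j = flow t p \<and> \<bar>t\<bar> \<le> L \<and> p \<in> K" by blast
  then obtain t q where q: "\<And>j. P j = flow (t j) (q j)" "\<And>j. \<bar>t j\<bar> \<le> L" "\<And>j. q j \<in> K" by metis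
  obtain r p where r: "strict_mono r" "p \<in> K" "conv (q \<circ> r) p" using compact_seq[OF K(1) q(3)] .
  have "\<forall>j. (t \<circ> r) j \<in> {-L..L}" using q(2) by (auto simp: abs_le_iff minus_le_iff)
  then obtain s k where k: "s \<in> {-L..L}" "strict_mono k" "(t \<circ> r \<circ> k) \<longlonglongrightarrow> s"
    using seq_compactE[OF compact_Icc[of "-L" L, unfolded compact_eq_seq_compact_metric], of "t \<circ> r"] by blast
  have "conv (\<lambda>j. flow ((t \<circ> r \<circ> k) j) ((q \<circ> r \<circ> k) j)) (flow s p)"
    by (rule conv_flow[OF _ conv_subseq[OF r(3) k(2)] k(3)]) (use q K_X in auto)
  moreover have "(\<lambda>j. flow ((t \<circ> r \<circ> k) j) ((q \<circ> r \<circ> k) j)) = P \<circ> (r \<circ> k)" using q by auto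
  moreover have "\<bar>s\<bar> \<le> L" using k(1) by auto
  ultimately have "flow s p \<in> {flow t p | t p. \<bar>t\<bar> \<le> L \<and> p \<in> K}" "conv (P \<circ> (r \<circ> k)) (flow s p)"
    using r(2) by auto
  then show "\<exists>p r. p \<in> {flow t p | t p. \<bar>t\<bar> \<le> L \<and> p \<in> K} \<and> strict_mono r \<and> conv (P \<circ> r) p"
    using strict_mono_o[OF r(1) k(2)] by blast
qed (use K_X in auto)

text \<open>The extreme value theorem on the unit sphere bundle over \<open>C\<close>, in sequential
  form. The predicate \<open>Q\<close> is closed under limits and stands for membership in a
  subbundle, whose total space need not be described as a topological space.\<close>

lemma compact_pos_bound:
  fixes f :: "'g fpoint \<Rightarrow> 'v::euclidean_space \<Rightarrow> real"
  assumes C: "compactin T C"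
    and f: "\<And>P p v w. (\<And>j. P j \<in> C) \<Longrightarrow> (\<And>j. Q (P j) (v j)) \<Longrightarrow> conv P p \<Longrightarrow> v \<longlonglongrightarrow> w \<Longrightarrow>
       (\<lambda>j. f (P j) (v j)) \<longlonglongrightarrow> f p w \<and> Q p w"
    and pos: "\<And>p v. p \<in> C \<Longrightarrow> norm v = 1 \<Longrightarrow> Q p v \<Longrightarrow> 0 < f p v"
  shows "\<exists>c>0. \<forall>p\<in>C. \<forall>v. norm v = 1 \<longrightarrow> Q p v \<longrightarrow> c \<le> f p v"
proof (rule ccontr)
  assume neg: "\<not> ?thesis"
  have "\<exists>p v. p \<in> C \<and> norm v = 1 \<and> Q p v \<and> f p v < 1 / real (Suc j)" for j
  proof -
    have "(1 / real (Suc j)) > 0" by simp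
    with neg show ?thesis by (meson not_le)
  qed
  then obtain P v where P: "\<And>j. P j \<in> C" "\<And>j. norm (v j) = 1" "\<And>j. Q (P j) (v j)"
    "\<And>j. f (P j) (v j) < 1 / real (Suc j)" by metis
  obtain r p where r: "strict_mono r" "p \<in> C" "conv (P \<circ> r) p" using compact_seq[OF C P(1)] .
  have "\<forall>j. (v \<circ> r) j \<in> sphere 0 1" using P(2) by simp
  then obtain w k where k: "w \<in> sphere 0 1" "strict_mono k" "(v \<circ> r \<circ> k) \<longlonglongrightarrow> w"
    using seq_compactE[OF compact_sphere[of 0 1, unfolded compact_eq_seq_compact_metric], of "v \<circ> r"] by blast
  have lim: "(\<lambda>j. f ((P \<circ> r \<circ> k) j) ((v \<circ> r \<circ> k) j)) \<longlonglongrightarrow> f p w \<and> Q p w"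
    by (rule f[OF _ _ conv_subseq[OF r(3) k(2)] k(3)]) (use P in auto)
  then have "0 < f p w" using pos r(2) k(1) by auto
  moreover have "f p w \<le> 0"
  proof (rule LIMSEQ_le[OF conjunct1[OF lim]])
    show "(\<lambda>j. 1 / real (Suc j)) \<longlonglongrightarrow> 0" by (rule LIMSEQ_Suc[OF lim_1_over_n])
    have "f ((P \<circ> r \<circ> k) j) ((v \<circ> r \<circ> k) j) \<le> 1 / real (Suc j)" for j
    proof -
      have "j \<le> r (k j)" using seq_suble[OF strict_mono_o[OF r(1) k(2)], of j] by simp
      then have "1 / real (Suc (r (k j))) \<le> 1 / real (Suc j)" by (simp add: frac_le)
      then show ?thesis using P(4)[of "r (k j)"] by simp
    qed
    then show "\<exists>N. \<forall>j\<ge>N. f ((P \<circ> r \<circ> k) j) ((v \<circ> r \<circ> k) j) \<le> 1 / real (Suc j)" by blast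
  qed
  ultimately show False by simp
qed

text \<open>An upper bound for \<open>f\<close> is a positive lower bound for
  \<open>1 / (1 + \<bar>f\<bar>)\<close>, whose positivity is automatic.\<close>

lemma compact_upper_bound:
  fixes f :: "'g fpoint \<Rightarrow> 'v::euclidean_space \<Rightarrow> real"
  assumes C: "compactin T C"
    and f: "\<And>P p v w. (\<And>j. P j \<in> C) \<Longrightarrow> conv P p \<Longrightarrow> v \<longlonglongrightarrow> w \<Longrightarrow> (\<lambda>j. f (P j) (v j)) \<longlonglongrightarrow> f p w"
  shows "\<exists>c>0. \<forall>p\<in>C. \<forall>v. norm v = 1 \<longrightarrow> f p v \<le> c"
proof -
  have lim: "(\<lambda>j. 1 / (1 + \<bar>f (P j) (v j)\<bar>)) \<longlonglongrightarrow> 1 / (1 + \<bar>f p w\<bar>)"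
    if "\<And>j. P j \<in> C" "conv P p" "v \<longlonglongrightarrow> w" for P p v w
    by (intro tendsto_intros f that) auto
  have "\<exists>c>0. \<forall>p\<in>C. \<forall>v. norm v = 1 \<longrightarrow> True \<longrightarrow> c \<le> 1 / (1 + \<bar>f p v\<bar>)"
    by (rule compact_pos_bound[OF C]) (use lim in auto)
  then obtain c where c: "c > 0" "\<And>p v. p \<in> C \<Longrightarrow> norm v = 1 \<Longrightarrow> c \<le> 1 / (1 + \<bar>f p v\<bar>)" by blast
  have "f p v \<le> 1 / c" if "p \<in> C" "norm v = 1" for p v
  proof -
    have "c * (1 + \<bar>f p v\<bar>) \<le> 1" using c(2)[OF that] by (simp add: field_simps)
    then have "1 + \<bar>f p v\<bar> \<le> 1 / c" using c(1) by (simp add: field_simps)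
    then show ?thesis by linarith
  qed
  then show ?thesis using c(1) by (intro exI[of _ "1 / c"]) auto
qed

text \<open>Properness speaks of compact sets, while a bump function needs a metric neighbourhood of
  \<open>K\<close> covered by finitely many translates. If no radius worked, points
  \<open>p n\<close> of translates by ever longer \<open>g n\<close> would approach
  \<open>K\<close>; a limit point together with the subsequence and \<open>K\<close> is compact and
  is met by infinitely many of these translates.\<close>

lemma bump_radius:
  obtains r F where "r > 0" "finite F" "F \<subseteq> carrier \<Gamma>"
    "\<And>p k. p \<in> X \<Longrightarrow> k \<in> K \<Longrightarrow> D p k < r \<Longrightarrow> \<exists>g\<in>F. p \<in> act g ` K"
proof -
  define G where "G n = {g \<in> carrier \<Gamma>. \<exists>p k. p \<in> act g ` K \<and> k \<in> K \<and> D p k < 1 / real (Suc n)}" for n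
  have "\<exists>n. finite (G n)"
  proof (rule ccontr)
    assume inf: "\<nexists>n. finite (G n)"
    have "\<exists>g p k. g \<in> carrier \<Gamma> \<and> n \<le> wl g \<and> p \<in> act g ` K \<and> k \<in> K \<and> D p k < 1 / real (Suc n)" for n
    proof -
      have "\<not> G n \<subseteq> {g \<in> carrier \<Gamma>. wl g \<le> n}" using inf finite_subset[OF _ finite_wl_ball[of n], of "G n"] by blast
      then obtain g where g: "g \<in> carrier \<Gamma>" "g \<in> G n" "\<not> wl g \<le> n" unfolding G_def by blast
      then have "n \<le> wl g" by simp
      moreover obtain p k where "p \<in> act g ` K" "k \<in> K" "D p k < 1 / real (Suc n)"
        using g(2) unfolding G_def by blast
      ultimately show ?thesis using g(1) by blast
    qed
    then obtain g p k where g: "\<And>n. g n \<in> carrier \<Gamma>" "\<And>n. n \<le> wl (g n)" "\<And>n. p n \<in> act (g n) ` K"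
      "\<And>n. k n \<in> K" "\<And>n. D (p n) (k n) < 1 / real (Suc n)" by metis
    obtain r k0 where r: "strict_mono r" "k0 \<in> K" "conv (k \<circ> r) k0" using compact_seq[OF K(1) g(4)] .
    have pX: "p n \<in> X" for n using g(3)[of n] g(1)[of n] by (auto simp: K_X)
    have kX: "k n \<in> X" "k0 \<in> X" for n using g(4)[of n] r(2) by (simp_all add: K_X)
    have "conv (p \<circ> r) k0" unfolding conv_metric
    proof (intro conjI allI impI)
      fix e :: real assume e: "e > 0"
      have 1: "\<forall>\<^sub>F j in sequentially. D (k (r j)) k0 < e / 2"
      proof -
        have "\<forall>\<^sub>F j in sequentially. (k \<circ> r) j \<in> X \<and> D ((k \<circ> r) j) k0 < e / 2"
          using r(3) half_gt_zero[OF e] unfolding conv_metric by blast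
        then show ?thesis by (rule eventually_mono) (auto simp: o_def)
      qed
      have "(\<lambda>j. 1 / real (Suc j)) \<longlonglongrightarrow> 0" by (rule LIMSEQ_Suc[OF lim_1_over_n])
      then have 2: "\<forall>\<^sub>F j in sequentially. 1 / real (Suc j) < e / 2" using e by (intro order_tendstoD(2)) auto
      show "\<forall>\<^sub>F j in sequentially. (p \<circ> r) j \<in> X \<and> D ((p \<circ> r) j) k0 < e"
        using 1 2
      proof eventually_elim
        case (elim j)
        have "1 / real (Suc (r j)) \<le> 1 / real (Suc j)" using seq_suble[OF r(1), of j] by (simp add: frac_le)
        then show ?case using M.triangle[of "p (r j)" "k (r j)" k0] elim g(5)[of "r j"] pX kX by auto
      qed
    qed (fact kX)
    then have "compactin T (insert k0 (range (p \<circ> r)))" by (rule compact_convergent[rotated]) (simp add: pX)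
    then have C: "compactin T (insert k0 (range (p \<circ> r)) \<union> K)" using K(1) by (rule compactin_Un)
    define C where "C = insert k0 (range (p \<circ> r)) \<union> K"
    have "g (r j) \<in> {\<gamma> \<in> carrier \<Gamma>. act \<gamma> ` C \<inter> C \<noteq> {}}" for j
      using g(1,3)[of "r j"] unfolding C_def by fastforce
    then have "finite (range (\<lambda>j. g (r j)))"
      by (intro finite_subset[OF image_subsetI act_proper[OF C[folded C_def]]])
    then have "finite (wl ` range (\<lambda>j. g (r j)))" by simp
    then obtain m where "\<And>x. x \<in> wl ` range (\<lambda>j. g (r j)) \<Longrightarrow> x \<le> m"
      unfolding finite_nat_set_iff_bounded_le by auto
    then have m: "wl (g (r j)) \<le> m" for j by blast
    have "Suc m \<le> r (Suc m)" by (rule seq_suble[OF r(1)])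
    then show False using g(2)[of "r (Suc m)"] m[of "Suc m"] by linarith
  qed
  then obtain n where n: "finite (G n)" by blast
  show ?thesis
  proof (rule that[of "1 / real (Suc n)" "G n"])
    fix p k assume pk: "p \<in> X" "k \<in> K" "D p k < 1 / real (Suc n)"
    then obtain g where "g \<in> carrier \<Gamma>" "p \<in> act g ` K" using K(2) by blast
    then show "\<exists>g\<in>G n. p \<in> act g ` K" using pk unfolding G_def by blast
  qed (use n in \<open>auto simp: G_def\<close>)
qed

text \<open>The function is the positive part of \<open>r - dist(p, K)\<close>. The last clause is
  local finiteness in the form needed later: one finite set of group elements serves a convergent
  sequence and its limit together.\<close>

lemma bump_function:
  "\<exists>\<phi>. (\<forall>p. \<phi> p \<ge> 0) \<and> (\<forall>p\<in>K. \<phi> p > (0::real)) \<and>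
    (\<forall>P p. (\<forall>j. P j \<in> X) \<longrightarrow> conv P p \<longrightarrow> (\<lambda>j. \<phi> (P j)) \<longlonglongrightarrow> \<phi> p) \<and>
    (\<forall>P p. (\<forall>j. P j \<in> X) \<longrightarrow> conv P p \<longrightarrow> (\<exists>A. finite A \<and> A \<subseteq> carrier \<Gamma> \<and>
       (\<forall>\<gamma>\<in>carrier \<Gamma>. \<forall>q\<in>insert p (range P). \<phi> (act (inv \<gamma>) q) \<noteq> 0 \<longrightarrow> \<gamma> \<in> A)))"
proof (cases "K = {}")
  case True
  then have "X = {}" using K(2) by simp
  then show ?thesis using True by (intro exI[of _ "\<lambda>_. 0"]) auto
next
  case False
  obtain r F where rF: "r > 0" "finite F" "F \<subseteq> carrier \<Gamma>"
    "\<And>p k. p \<in> X \<Longrightarrow> k \<in> K \<Longrightarrow> D p k < r \<Longrightarrow> \<exists>g\<in>F. p \<in> act g ` K" using bump_radius by metis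
  define dK where "dK p = (INF k\<in>K. D p k)" for p
  have bdd: "bdd_below (D p ` K)" for p by (rule bdd_belowI[of _ 0]) auto
  have lip: "dK p - D p q \<le> dK q" if "p \<in> X" "q \<in> X" for p q
    unfolding dK_def
  proof (rule cINF_greatest[OF False])
    fix k assume k: "k \<in> K"
    have "(INF k\<in>K. D p k) \<le> D p k" by (rule cINF_lower[OF bdd k])
    then show "(INF k\<in>K. D p k) - D p q \<le> D q k" using M.triangle[of p q k] that K_X[OF k] by simp
  qed
  define \<phi> where "\<phi> p = max 0 (r - dK p)" for p
  show ?thesis
  proof (intro exI[of _ \<phi>] conjI allI ballI impI)
    fix p assume p: "p \<in> K"
    have "dK p \<le> D p p" unfolding dK_def by (rule cINF_lower[OF bdd p])
    then show "\<phi> p > 0" using K_X[OF p] rF(1) unfolding \<phi>_def by simp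
  next
    fix P p assume P': "\<forall>j. P j \<in> X" and conv: "conv P p"
    then have P: "\<And>j. P j \<in> X" "conv P p" by blast+
    show "(\<lambda>j. \<phi> (P j)) \<longlonglongrightarrow> \<phi> p"
    proof -
    have "(\<lambda>j. dK (P j)) \<longlonglongrightarrow> dK p"
    proof (rule LIMSEQ_I)
      fix e :: real assume "e > 0"
      then obtain N where "\<And>j. j \<ge> N \<Longrightarrow> D (P j) p < e"
        using P(2) unfolding conv_metric eventually_sequentially by metis
      moreover have "\<bar>dK (P j) - dK p\<bar> \<le> D (P j) p" for j
        using lip[OF P(1)[of j] conv_X[OF P(2)]] lip[OF conv_X[OF P(2)] P(1)[of j]] M.commute[of p "P j"] by linarith
      ultimately show "\<exists>N. \<forall>j\<ge>N. norm (dK (P j) - dK p) < e"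
        unfolding real_norm_def by (meson le_less_trans)
    qed
    then show ?thesis unfolding \<phi>_def by (intro tendsto_intros)
    qed
    define C where "C = insert p (range P) \<union> (\<Union>g\<in>F. act g ` K)"
    have "compactin T C" unfolding C_def
    proof (intro compactin_Un compact_convergent P)
      show "compactin T (\<Union>g\<in>F. act g ` K)"
        using rF(2,3) image_compactin[OF K(1) act_continuous] by (intro compactin_Union) auto
    qed
    from act_proper[OF this] have fin: "finite {\<gamma> \<in> carrier \<Gamma>. act \<gamma> ` C \<inter> C \<noteq> {}}" .
    define A where "A = m_inv \<Gamma> ` {\<gamma> \<in> carrier \<Gamma>. act \<gamma> ` C \<inter> C \<noteq> {}}"
    have "\<gamma> \<in> A" if g: "\<gamma> \<in> carrier \<Gamma>" "q \<in> insert p (range P)" "\<phi> (act (inv \<gamma>) q) \<noteq> 0" for \<gamma> q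
    proof -
      have qX: "q \<in> X" using g(2) P(1) conv_X[OF P(2)] by blast
      have "dK (act (inv \<gamma>) q) < r" using g(3) unfolding \<phi>_def by (auto simp: max_def split: if_splits)
      then obtain k where "k \<in> K" "D (act (inv \<gamma>) q) k < r"
        unfolding dK_def using cINF_less_iff[OF False bdd] by blast
      then have "act (inv \<gamma>) q \<in> C" using rF(4)[of "act (inv \<gamma>) q" k] g(1) qX unfolding C_def by auto
      moreover have "q \<in> C" using g(2) unfolding C_def by blast
      ultimately have "inv \<gamma> \<in> {\<gamma> \<in> carrier \<Gamma>. act \<gamma> ` C \<inter> C \<noteq> {}}" using g(1) by blast
      then show ?thesis unfolding A_def using g(1) by (metis (no_types, lifting) imageI inv_inv)
    qed
    moreover have "finite A" "A \<subseteq> carrier \<Gamma>" unfolding A_def using fin by auto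
    ultimately show "\<exists>A. finite A \<and> A \<subseteq> carrier \<Gamma> \<and>
       (\<forall>\<gamma>\<in>carrier \<Gamma>. \<forall>q\<in>insert p (range P). \<phi> (act (inv \<gamma>) q) \<noteq> 0 \<longrightarrow> \<gamma> \<in> A)" by blast
  qed (simp add: \<phi>_def)
qed

definition bump :: "'g fpoint \<Rightarrow> real" where
  "bump = (SOME \<phi>. (\<forall>p. \<phi> p \<ge> 0) \<and> (\<forall>p\<in>K. \<phi> p > 0) \<and>
    (\<forall>P p. (\<forall>j. P j \<in> X) \<longrightarrow> conv P p \<longrightarrow> (\<lambda>j. \<phi> (P j)) \<longlonglongrightarrow> \<phi> p) \<and>
    (\<forall>P p. (\<forall>j. P j \<in> X) \<longrightarrow> conv P p \<longrightarrow> (\<exists>A. finite A \<and> A \<subseteq> carrier \<Gamma> \<and>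
       (\<forall>\<gamma>\<in>carrier \<Gamma>. \<forall>q\<in>insert p (range P). \<phi> (act (inv \<gamma>) q) \<noteq> 0 \<longrightarrow> \<gamma> \<in> A))))"

lemma bump:
  shows "bump p \<ge> 0" and "p \<in> K \<Longrightarrow> bump p > 0"
    and "(\<And>j. P j \<in> X) \<Longrightarrow> conv P p \<Longrightarrow> (\<lambda>j. bump (P j)) \<longlonglongrightarrow> bump p"
    and "(\<And>j. P j \<in> X) \<Longrightarrow> conv P p \<Longrightarrow> \<exists>A. finite A \<and> A \<subseteq> carrier \<Gamma> \<and>
       (\<forall>\<gamma>\<in>carrier \<Gamma>. \<forall>q\<in>insert p (range P). bump (act (inv \<gamma>) q) \<noteq> 0 \<longrightarrow> \<gamma> \<in> A)"
proof -
  note * = someI_ex[OF bump_function, folded bump_def]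
  show "bump p \<ge> 0" and "p \<in> K \<Longrightarrow> bump p > 0"
    and "(\<And>j. P j \<in> X) \<Longrightarrow> conv P p \<Longrightarrow> (\<lambda>j. bump (P j)) \<longlonglongrightarrow> bump p"
    and "(\<And>j. P j \<in> X) \<Longrightarrow> conv P p \<Longrightarrow> \<exists>A. finite A \<and> A \<subseteq> carrier \<Gamma> \<and>
       (\<forall>\<gamma>\<in>carrier \<Gamma>. \<forall>q\<in>insert p (range P). bump (act (inv \<gamma>) q) \<noteq> 0 \<longrightarrow> \<gamma> \<in> A)"
    using * by blast+
qed

end

section \<open>Cone fields and averaged inner products\<close>

text \<open>Since \<open>Q \<le> C * n\<close>, a positive value of \<open>Q\<close> is multiplied
  at each step by at least \<open>1 + d / C\<close>, which is impossible when \<open>n\<close> is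
  bounded. If \<open>Q\<close> is never positive, then \<open>- Q\<close> shrinks at each step by
  the factor \<open>1 - d / C\<close>, and \<open>d * n i \<le> - Q i\<close> transfers the decay to
  \<open>n\<close>. The condition \<open>2 * d \<le> C\<close> keeps this factor at least
  \<open>1 / 2\<close>, so that it has a logarithm.\<close>

lemma growth_alternative:
  fixes n Q :: "nat \<Rightarrow> real"
  assumes "0 < d" "2 * d \<le> C" "\<And>i. 0 \<le> n i" "\<And>i. \<bar>Q i\<bar> \<le> C * n i" "\<And>i. Q (Suc i) \<ge> Q i + d * n i"
  shows "(\<And>i. n i \<le> b) \<Longrightarrow> Q i \<le> 0"
    and "(\<And>i. Q i \<le> 0) \<Longrightarrow> n i \<le> C / d * (1 - d / C) ^ i * n 0"
proof -
  have C: "C > 0" using assms(1,2) by linarith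
  {
    assume b: "\<And>i. n i \<le> b"
    show "Q i \<le> 0"
    proof (rule ccontr)
      assume "\<not> Q i \<le> 0"
      then have Qi: "Q i > 0" by simp
      have grow: "Q (i + m) \<ge> (1 + d / C) ^ m * Q i" for m
      proof (induction m)
        case (Suc m)
        have "Q (i + m) / C \<le> n (i + m)" using assms(4)[of "i + m"] C by (simp add: field_simps)
        then have "Q (Suc (i + m)) \<ge> Q (i + m) + d * (Q (i + m) / C)"
          using assms(5)[of "i + m"] mult_left_mono[of "Q (i + m) / C" "n (i + m)" d] assms(1) by linarith
        then have "Q (i + Suc m) \<ge> (1 + d / C) * Q (i + m)" by (simp add: algebra_simps)
        moreover have "(1 + d / C) * Q (i + m) \<ge> (1 + d / C) * ((1 + d / C) ^ m * Q i)"
          using Suc assms(1) C by (intro mult_left_mono) auto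
        ultimately show ?case by (simp add: mult.assoc)
      qed simp
      have "1 < 1 + d / C" using assms(1) C by simp
      then obtain m where "(1 + d / C) ^ m > C * b / Q i" using real_arch_pow by blast
      then have "(1 + d / C) ^ m * Q i > C * b" using Qi by (simp add: field_simps)
      moreover have "Q (i + m) \<le> C * b"
        using assms(4)[of "i + m"] mult_left_mono[OF b[of "i + m"], of C] C by linarith
      ultimately show False using grow[of m] by linarith
    qed
  next
    assume Q: "\<And>i. Q i \<le> 0"
    have decay: "- Q i \<le> (1 - d / C) ^ i * (- Q 0)" for i
    proof (induction i)
      case (Suc i)
      have "- Q i / C \<le> n i" using assms(4)[of i] C by (simp add: field_simps)
      then have "- Q (Suc i) \<le> - Q i - d * (- Q i / C)"
        using assms(5)[of i] mult_left_mono[of "- Q i / C" "n i" d] assms(1) by linarith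
      then have "- Q (Suc i) \<le> (1 - d / C) * (- Q i)" by (simp add: algebra_simps)
      moreover have "(1 - d / C) * (- Q i) \<le> (1 - d / C) * ((1 - d / C) ^ i * (- Q 0))"
        using Suc assms(1,2) C by (intro mult_left_mono) (auto simp: field_simps)
      ultimately show ?case by (simp add: mult.assoc)
    qed simp
    have "d * n i \<le> - Q i" using assms(5)[of i] Q[of "Suc i"] by linarith
    also have "\<dots> \<le> (1 - d / C) ^ i * (- Q 0)" by (rule decay)
    also have "\<dots> \<le> (1 - d / C) ^ i * (C * n 0)"
      using assms(1,2) assms(4)[of 0] C by (intro mult_left_mono zero_le_power) (auto simp: field_simps)
    finally show "n i \<le> C / d * (1 - d / C) ^ i * n 0" using assms(1) by (simp add: field_simps)
  }
qed

text \<open>A frame indexed by the finite type is a single vector of a Euclidean space, so sequences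
  of subspaces become accessible to the Bolzano-Weierstrass theorem.\<close>

lemma orthonormal_frame:
  fixes V :: "'v::euclidean_space set"
  assumes "subspace V" "dim V = CARD('n)"
  obtains F :: "'v ^ 'n::finite" where "\<And>i. F $ i \<in> V" "\<And>i j. F $ i \<bullet> F $ j = (if i = j then 1 else 0)"
proof -
  obtain B where B: "B \<subseteq> V" "pairwise orthogonal B" "\<And>x. x \<in> B \<Longrightarrow> norm x = 1" "independent B"
    "card B = dim V" "span B = V" using orthonormal_basis_subspace[OF assms(1)] by metis
  have "finite B" using B(4) by (rule independent_imp_finite)
  then obtain f :: "'n \<Rightarrow> 'v" where f: "bij_betw f UNIV B"
    using finite_same_card_bij[of "UNIV :: 'n set" B] B(5) assms(2) by auto
  have "f i \<bullet> f j = (if i = j then 1 else 0)" for i j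
  proof (cases "i = j")
    case True
    have "f i \<in> B" using f by (auto simp: bij_betw_def)
    then show ?thesis using B(3) True by (simp add: dot_square_norm)
  next
    case False
    then have "f i \<in> B" "f j \<in> B" "f i \<noteq> f j" using f by (auto simp: bij_betw_def inj_def)
    then show ?thesis using B(2) False unfolding pairwise_def orthogonal_def by auto
  qed
  moreover have "f i \<in> V" for i using f B(1) by (auto simp: bij_betw_def)
  ultimately show ?thesis using that[of "\<chi> i. f i"] by simp
qed

lemma frame_norm:
  fixes F :: "'v::euclidean_space ^ 'n::finite" and c :: "real ^ 'n"
  assumes "\<And>i j. F $ i \<bullet> F $ j = (if i = j then 1 else 0)"
  shows "norm (\<Sum>i\<in>UNIV. c $ i *\<^sub>R F $ i) = norm c"
proof -
  have "(\<Sum>i\<in>UNIV. c $ i *\<^sub>R F $ i) \<bullet> (\<Sum>i\<in>UNIV. c $ i *\<^sub>R F $ i) = c \<bullet> c"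
    by (simp add: inner_sum_left inner_sum_right assms if_distrib[of "\<lambda>x. _ * x"] inner_vec_def cong: if_cong)
  then show ?thesis by (simp add: norm_eq)
qed

text \<open>The cones \<open>Q i \<le> 0\<close> decrease. Orthonormal frames of subspaces in them
  subconverge, the limit frame is again orthonormal, and for fixed \<open>k\<close> all late frames
  span subspaces of the cone of index \<open>k\<close>, which is closed.\<close>

lemma nested_cones:
  fixes Q :: "nat \<Rightarrow> 'v::euclidean_space \<Rightarrow> real"
  assumes cont: "\<And>i. continuous_on UNIV (Q i)" and mono: "\<And>i v. Q i v \<le> Q (Suc i) v"
    and sub: "\<And>i. \<exists>V. subspace V \<and> dim V = CARD('n::finite) \<and> (\<forall>v\<in>V. Q i v \<le> 0)"
  shows "\<exists>V. subspace V \<and> dim V = CARD('n) \<and> (\<forall>v\<in>V. \<forall>i. Q i v \<le> 0)"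
proof -
  have "\<exists>F :: 'v ^ 'n. (\<forall>j k. F $ j \<bullet> F $ k = (if j = k then 1 else 0)) \<and>
     (\<forall>c :: real ^ 'n. Q i (\<Sum>j\<in>UNIV. c $ j *\<^sub>R F $ j) \<le> 0)" for i
  proof -
    obtain V where V: "subspace V" "dim V = CARD('n)" "\<forall>v\<in>V. Q i v \<le> 0" using sub by metis
    obtain F :: "'v ^ 'n" where F: "\<And>i. F $ i \<in> V" "\<And>i j. F $ i \<bullet> F $ j = (if i = j then 1 else 0)"
      using orthonormal_frame[OF V(1,2)] by metis
    have "(\<Sum>j\<in>UNIV. c $ j *\<^sub>R F $ j) \<in> V" for c :: "real ^ 'n"
      by (intro subspace_sum subspace_scale V F)
    then show ?thesis using V(3) F(2) by blast
  qed
  then obtain F :: "nat \<Rightarrow> 'v ^ 'n" where F: "\<And>i j k. F i $ j \<bullet> F i $ k = (if j = k then 1 else 0)"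
    "\<And>i c. Q i (\<Sum>j\<in>UNIV. c $ j *\<^sub>R F i $ j) \<le> 0" by metis
  have "bounded (range F)"
  proof (rule boundedI)
    fix x assume "x \<in> range F"
    then obtain i where x: "x = F i" by blast
    have "norm (F i $ j) = 1" for j using F(1)[of i j j] by (simp add: norm_eq_1)
    then show "norm x \<le> real CARD('n)"
      using L2_set_le_sum[of UNIV "\<lambda>j. norm (F i $ j)"] unfolding x norm_vec_def by simp
  qed
  then obtain F0 and r :: "nat \<Rightarrow> nat" where r: "strict_mono r" "(F \<circ> r) \<longlonglongrightarrow> F0"
    using bounded_imp_convergent_subsequence by blast
  have comp: "(\<lambda>i. F (r i) $ j) \<longlonglongrightarrow> F0 $ j" for j
    using tendsto_vec_nth[OF r(2), of j] by (simp add: o_def)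
  have on: "F0 $ j \<bullet> F0 $ k = (if j = k then 1 else 0)" for j k
    using LIMSEQ_unique[OF tendsto_inner[OF comp[of j] comp[of k]]] F(1) by (simp add: LIMSEQ_const_iff)
  define f where "f c = (\<Sum>j\<in>UNIV. c $ j *\<^sub>R F0 $ j)" for c :: "real ^ 'n"
  have lin: "linear f" unfolding f_def
    by (intro linearI) (simp_all add: scaleR_add_left sum.distrib scaleR_sum_right)
  have "inj f"
    using frame_norm[of F0] on unfolding linear_injective_0[OF lin] f_def by (metis norm_eq_zero)
  then have d: "dim (range f) = CARD('n)" using dim_image_eq[OF lin, of UNIV] by simp
  have "Q k (f c) \<le> 0" for k c
  proof (rule LIMSEQ_le_const2)
    have "(\<lambda>i. \<Sum>j\<in>UNIV. c $ j *\<^sub>R F (r i) $ j) \<longlonglongrightarrow> f c"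
      unfolding f_def by (intro tendsto_intros comp)
    then show "(\<lambda>i. Q k (\<Sum>j\<in>UNIV. c $ j *\<^sub>R F (r i) $ j)) \<longlonglongrightarrow> Q k (f c)"
      using continuous_on_tendsto_compose[OF cont] by simp
    have "Q k (\<Sum>j\<in>UNIV. c $ j *\<^sub>R F (r i) $ j) \<le> 0" if "k \<le> i" for i
    proof -
      have "k \<le> r i" using seq_suble[OF r(1), of i] that by simp
      then have "Q k v \<le> Q (r i) v" for v using lift_Suc_mono_le[of "\<lambda>i. Q i v"] mono by blast
      then show ?thesis using F(2) order_trans by blast
    qed
    then show "\<exists>N. \<forall>i\<ge>N. Q k (\<Sum>j\<in>UNIV. c $ j *\<^sub>R F (r i) $ j) \<le> 0" by blast
  qed
  then show ?thesis using d linear_subspace_image[OF lin subspace_UNIV] by (intro exI[of _ "range f"]) auto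
qed

text \<open>Continuity of the components of a vector in a varying direct sum. Closedness of the
  summands under limits suffices, since the trivial intersection in the limit prevents the
  components from escaping to infinity.\<close>

lemma decomposition_limit:
  fixes A B :: "nat \<Rightarrow> 'v::euclidean_space set"
  assumes sub: "\<And>j. subspace (A j)" "\<And>j. subspace (B j)" "subspace A0" "subspace B0"
    and A: "\<And>r v w. strict_mono (r :: nat \<Rightarrow> nat) \<Longrightarrow> (\<And>j. v j \<in> A (r j)) \<Longrightarrow> v \<longlonglongrightarrow> w \<Longrightarrow> w \<in> A0"
    and B: "\<And>r v w. strict_mono (r :: nat \<Rightarrow> nat) \<Longrightarrow> (\<And>j. v j \<in> B (r j)) \<Longrightarrow> v \<longlonglongrightarrow> w \<Longrightarrow> w \<in> B0"
    and int: "A0 \<inter> B0 \<subseteq> {0}"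
    and a: "\<And>j. a j \<in> A j" "\<And>j. v j - a j \<in> B j" "v \<longlonglongrightarrow> v0"
  shows "\<exists>a0\<in>A0. v0 - a0 \<in> B0 \<and> a \<longlonglongrightarrow> a0"
proof -
  have key: "\<exists>a0 k. a0 \<in> A0 \<and> v0 - a0 \<in> B0 \<and> strict_mono (k :: nat \<Rightarrow> nat) \<and> (a \<circ> r \<circ> k) \<longlonglongrightarrow> a0"
    if r: "strict_mono r" for r :: "nat \<Rightarrow> nat"
  proof -
    \<comment> \<open>Homogenisation: \<open>(t j, t j *\<^sub>R a (r j))\<close> is bounded without
      any bound on \<open>a\<close>, and \<open>t j\<close> plus the norm of the second entry is 1.
      A limit with \<open>t0 = 0\<close> would be a unit vector in both limit summands.\<close>
    define t where "t j = 1 / (1 + norm (a (r j)))" for j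
    define \<alpha> where "\<alpha> j = t j *\<^sub>R a (r j)" for j
    have pos: "1 + norm (a (r j)) > 0" for j by (simp add: add_pos_nonneg)
    have t01: "0 \<le> t j" "t j \<le> 1" for j unfolding t_def using pos[of j] by auto
    have nrm: "norm (\<alpha> j) = 1 - t j" for j
      unfolding \<alpha>_def t_def using pos[of j] by (simp add: field_simps)
    have "norm (t j, \<alpha> j) \<le> 2" for j
      using norm_Pair_le[of "t j" "\<alpha> j"] nrm[of j] t01[of j] by simp
    then have "bounded (range (\<lambda>j. (t j, \<alpha> j)))" by (intro boundedI) auto
    then obtain l k where k: "strict_mono (k :: nat \<Rightarrow> nat)" "((\<lambda>j. (t j, \<alpha> j)) \<circ> k) \<longlonglongrightarrow> l"
      using bounded_imp_convergent_subsequence by blast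
    obtain t0 \<alpha>0 where l: "l = (t0, \<alpha>0)" by force
    have lim: "(\<lambda>j. t (k j)) \<longlonglongrightarrow> t0" "(\<lambda>j. \<alpha> (k j)) \<longlonglongrightarrow> \<alpha>0"
      using tendsto_fst[OF k(2)] tendsto_snd[OF k(2)] unfolding l by (simp_all add: o_def)
    have rk: "strict_mono (r \<circ> k)" by (rule strict_mono_o[OF r k(1)])
    have 1: "\<alpha>0 \<in> A0"
      by (rule A[OF rk _ lim(2)]) (simp add: \<alpha>_def a sub subspace_scale)
    have vlim: "(\<lambda>j. v (r (k j))) \<longlonglongrightarrow> v0" using LIMSEQ_subseq_LIMSEQ[OF a(3) rk] by (simp add: o_def)
    have 2: "t0 *\<^sub>R v0 - \<alpha>0 \<in> B0"
    proof (rule B[OF rk])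
      fix j
      have "t (k j) *\<^sub>R (v (r (k j)) - a (r (k j))) \<in> B (r (k j))" by (intro subspace_scale sub a)
      then show "t (k j) *\<^sub>R v (r (k j)) - \<alpha> (k j) \<in> B ((r \<circ> k) j)"
        by (simp add: \<alpha>_def scaleR_diff_right)
    next
      show "(\<lambda>j. t (k j) *\<^sub>R v (r (k j)) - \<alpha> (k j)) \<longlonglongrightarrow> t0 *\<^sub>R v0 - \<alpha>0"
        by (intro tendsto_intros lim vlim)
    qed
    have n0: "norm \<alpha>0 = 1 - t0"
    proof (rule LIMSEQ_unique[OF tendsto_norm[OF lim(2)]])
      show "(\<lambda>j. norm (\<alpha> (k j))) \<longlonglongrightarrow> 1 - t0" unfolding nrm by (intro tendsto_intros lim)
    qed
    have t0: "t0 \<noteq> 0"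
    proof
      assume "t0 = 0"
      then have "- \<alpha>0 \<in> B0" "norm \<alpha>0 = 1" using 2 n0 by auto
      then have "\<alpha>0 \<in> B0" using subspace_neg[OF sub(4), of "- \<alpha>0"] by simp
      then show False using 1 int \<open>norm \<alpha>0 = 1\<close> by auto
    qed
    define a0 where "a0 = inverse t0 *\<^sub>R \<alpha>0"
    have "a0 \<in> A0" unfolding a0_def by (intro subspace_scale sub 1)
    moreover have "v0 - a0 \<in> B0"
      using subspace_scale[OF sub(4) 2, of "inverse t0"] t0 unfolding a0_def by (simp add: scaleR_diff_right)
    moreover have "(a \<circ> r \<circ> k) \<longlonglongrightarrow> a0"
    proof -
      have "a (r (k j)) = inverse (t (k j)) *\<^sub>R \<alpha> (k j)" for j
        unfolding \<alpha>_def t_def using pos[of "k j"] by simp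
      then show ?thesis unfolding a0_def o_def by (simp add: tendsto_intros lim t0)
    qed
    ultimately show ?thesis using k(1) by blast
  qed
  obtain a0 where a0: "a0 \<in> A0" "v0 - a0 \<in> B0" using key[OF strict_mono_id] by blast
  have uniq: "b = a0" if "b \<in> A0" "v0 - b \<in> B0" for b
  proof -
    have "b - a0 \<in> A0" using that(1) a0(1) by (rule subspace_diff[OF sub(3)])
    moreover have "b - a0 \<in> B0" using subspace_diff[OF sub(4) a0(2) that(2)] by simp
    ultimately show ?thesis using int by auto
  qed
  have "a \<longlonglongrightarrow> a0"
  proof (rule ccontr)
    assume "\<not> a \<longlonglongrightarrow> a0"
    then obtain e where e: "e > 0" "\<And>N. \<exists>n\<ge>N. \<not> dist (a n) a0 < e" unfolding lim_sequentially by blast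
    have "infinite {n. \<not> dist (a n) a0 < e}"
      unfolding infinite_nat_iff_unbounded_le using e(2) by blast
    then obtain r where r: "strict_mono (r :: nat \<Rightarrow> nat)" "\<And>n. r n \<in> {n. \<not> dist (a n) a0 < e}"
      using infinite_enumerate by blast
    obtain b k where k: "b \<in> A0" "v0 - b \<in> B0" "(a \<circ> r \<circ> k) \<longlonglongrightarrow> b" using key[OF r(1)] by blast
    have "(a \<circ> r \<circ> k) \<longlonglongrightarrow> a0" using k uniq by blast
    then obtain N where "dist ((a \<circ> r \<circ> k) N) a0 < e" using e(1) unfolding lim_sequentially by blast
    then show False using r(2)[of "k N"] by simp
  qed
  then show ?thesis using a0 by blast
qed

section \<open>Equivariant inner products obtained by averaging over the group\<close>

context flow_system
begin

text \<open>The bump-weighted sum of pulled back inner products. The weights are not normalised, as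
  positivity and equivariance are all that is asked. Restricting the index set to nonzero weights
  makes it finite over points of the flow space, so that \<open>sum\<close> has its intended value
  there.\<close>

definition avg :: "('g \<Rightarrow> 'v \<Rightarrow> 'v) \<Rightarrow> 'g fpoint \<Rightarrow> 'v::euclidean_space \<Rightarrow> 'v \<Rightarrow> real" where
  "avg R p v w = (\<Sum>\<gamma> | \<gamma> \<in> carrier \<Gamma> \<and> bump (act (inv \<gamma>) p) \<noteq> 0.
     bump (act (inv \<gamma>) p) * (R (inv \<gamma>) v \<bullet> R (inv \<gamma>) w))"

lemma avg_on:
  assumes "finite A" "A \<subseteq> carrier \<Gamma>"
    and "\<And>\<gamma>. \<gamma> \<in> carrier \<Gamma> \<Longrightarrow> bump (act (inv \<gamma>) p) \<noteq> 0 \<Longrightarrow> \<gamma> \<in> A"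
  shows "avg R p v w = (\<Sum>\<gamma>\<in>A. bump (act (inv \<gamma>) p) * (R (inv \<gamma>) v \<bullet> R (inv \<gamma>) w))"
  unfolding avg_def by (rule sum.mono_neutral_left) (use assms in auto)

lemma avg_support:
  assumes "p \<in> X"
  shows "\<exists>A. finite A \<and> A \<subseteq> carrier \<Gamma> \<and>
    (\<forall>\<gamma>\<in>carrier \<Gamma>. bump (act (inv \<gamma>) p) \<noteq> 0 \<longrightarrow> \<gamma> \<in> A)"
  using bump(4)[of "\<lambda>_. p" p] assms by simp

lemma avg_commute: "avg R p v w = avg R p w v"
  unfolding avg_def by (simp add: inner_commute)

lemma avg_nonneg: "avg R p v v \<ge> 0"
  unfolding avg_def by (intro sum_nonneg mult_nonneg_nonneg bump) auto

end

locale flow_rep = flow_system \<Gamma> S act D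
  for \<Gamma> :: "'g monoid" (structure) and S :: "'g set"
    and act :: "'g \<Rightarrow> 'g fpoint \<Rightarrow> 'g fpoint" and D :: "'g fpoint \<Rightarrow> 'g fpoint \<Rightarrow> real" +
  fixes R :: "'g \<Rightarrow> 'v::euclidean_space \<Rightarrow> 'v"
  assumes lin: "\<gamma> \<in> carrier \<Gamma> \<Longrightarrow> linear (R \<gamma>)"
    and R_mult: "\<gamma> \<in> carrier \<Gamma> \<Longrightarrow> \<eta> \<in> carrier \<Gamma> \<Longrightarrow> R (\<gamma> \<otimes> \<eta>) v = R \<gamma> (R \<eta> v)"
    and R_one: "R \<one> v = v"
begin

abbreviation "ip \<equiv> avg R"

lemma R_inv: "\<gamma> \<in> carrier \<Gamma> \<Longrightarrow> R (inv \<gamma>) (R \<gamma> v) = v" "\<gamma> \<in> carrier \<Gamma> \<Longrightarrow> R \<gamma> (R (inv \<gamma>) v) = v"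
  by (simp_all add: R_one flip: R_mult)

lemma bilinear_ip: "bilinear (ip p)"
proof -
  have l: "linear (\<lambda>v. ip p v w)" for w
    unfolding avg_def
  proof (intro linear_compose_sum ballI)
    fix \<gamma> assume "\<gamma> \<in> {\<gamma> \<in> carrier \<Gamma>. bump (act (inv \<gamma>) p) \<noteq> 0}"
    then have "linear (R (inv \<gamma>))" using lin by simp
    then show "linear (\<lambda>v. bump (act (inv \<gamma>) p) * (R (inv \<gamma>) v \<bullet> R (inv \<gamma>) w))"
      by (intro linearI) (simp_all add: linear_add linear_scale inner_add_left algebra_simps)
  qed
  then have "linear (\<lambda>w. ip p v w)" for v by (subst avg_commute)
  then show ?thesis unfolding bilinear_def using l by blast
qed

lemma ip_pos:
  assumes "p \<in> X" "v \<noteq> 0" shows "ip p v v > 0"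
proof -
  obtain A where A: "finite A" "A \<subseteq> carrier \<Gamma>"
    "\<forall>\<gamma>\<in>carrier \<Gamma>. bump (act (inv \<gamma>) p) \<noteq> 0 \<longrightarrow> \<gamma> \<in> A" using avg_support[OF assms(1)] by metis
  obtain \<gamma> where g: "\<gamma> \<in> carrier \<Gamma>" "act \<gamma> p \<in> K" using K_cover[OF assms(1)] by metis
  then have b: "bump (act (inv (inv \<gamma>)) p) > 0" using bump(2) by simp
  have "inv \<gamma> \<in> A" using A(3)[rule_format, of "inv \<gamma>"] g(1) b by simp
  have "R \<gamma> v \<noteq> 0" using R_inv(1)[OF g(1), of v] assms(2) linear_0[OF lin[of "inv \<gamma>"]] g(1) by force
  then have "0 < bump (act (inv (inv \<gamma>)) p) * (R (inv (inv \<gamma>)) v \<bullet> R (inv (inv \<gamma>)) v)"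
    using b g(1) by simp
  moreover have "ip p v v = (\<Sum>\<gamma>\<in>A. bump (act (inv \<gamma>) p) * (R (inv \<gamma>) v \<bullet> R (inv \<gamma>) v))"
    by (rule avg_on) (use A in auto)
  ultimately show ?thesis
    using sum_pos2[OF A(1) \<open>inv \<gamma> \<in> A\<close>, of "\<lambda>\<gamma>. bump (act (inv \<gamma>) p) * (R (inv \<gamma>) v \<bullet> R (inv \<gamma>) v)"]
    by (simp add: bump(1))
qed

lemma ip_equivariant:
  assumes "\<eta> \<in> carrier \<Gamma>" "p \<in> X"
  shows "ip (act \<eta> p) (R \<eta> v) (R \<eta> w) = ip p v w"
proof -
  have *: "bump (act (inv (\<eta> \<otimes> \<gamma>)) (act \<eta> p)) = bump (act (inv \<gamma>) p)"
    "R (inv (\<eta> \<otimes> \<gamma>)) (R \<eta> v) = R (inv \<gamma>) v" if "\<gamma> \<in> carrier \<Gamma>" for \<gamma> v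
  proof -
    have i: "inv (\<eta> \<otimes> \<gamma>) = inv \<gamma> \<otimes> inv \<eta>" using that assms(1) by (simp add: inv_mult_group)
    show "bump (act (inv (\<eta> \<otimes> \<gamma>)) (act \<eta> p)) = bump (act (inv \<gamma>) p)"
      unfolding i using act_mult[of "inv \<gamma>" "inv \<eta>" "act \<eta> p"] that assms act_inv by simp
    show "R (inv (\<eta> \<otimes> \<gamma>)) (R \<eta> v) = R (inv \<gamma>) v"
      unfolding i using R_mult[of "inv \<gamma>" "inv \<eta>" "R \<eta> v"] that assms R_inv by simp
  qed
  show ?thesis unfolding avg_def
  proof (rule sum.reindex_bij_witness[of _ "\<lambda>\<gamma>. \<eta> \<otimes> \<gamma>" "\<lambda>\<gamma>. inv \<eta> \<otimes> \<gamma>"])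
    fix \<gamma> assume "\<gamma> \<in> {\<gamma> \<in> carrier \<Gamma>. bump (act (inv \<gamma>) (act \<eta> p)) \<noteq> 0}"
    then have g: "\<gamma> \<in> carrier \<Gamma>" "bump (act (inv \<gamma>) (act \<eta> p)) \<noteq> 0" by auto
    have e: "\<eta> \<otimes> (inv \<eta> \<otimes> \<gamma>) = \<gamma>" using g(1) assms(1) by (simp flip: m_assoc)
    show "\<eta> \<otimes> (inv \<eta> \<otimes> \<gamma>) = \<gamma>" by fact
    have c: "inv \<eta> \<otimes> \<gamma> \<in> carrier \<Gamma>" using g assms by simp
    show "inv \<eta> \<otimes> \<gamma> \<in> {\<gamma> \<in> carrier \<Gamma>. bump (act (inv \<gamma>) p) \<noteq> 0}"
      using *(1)[OF c] g c e by simp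
    show "bump (act (inv (inv \<eta> \<otimes> \<gamma>)) p) * (R (inv (inv \<eta> \<otimes> \<gamma>)) v \<bullet> R (inv (inv \<eta> \<otimes> \<gamma>)) w) =
        bump (act (inv \<gamma>) (act \<eta> p)) * (R (inv \<gamma>) (R \<eta> v) \<bullet> R (inv \<gamma>) (R \<eta> w))"
      using *[OF c] unfolding e by simp
  next
    fix \<gamma> assume "\<gamma> \<in> {\<gamma> \<in> carrier \<Gamma>. bump (act (inv \<gamma>) p) \<noteq> 0}"
    then have g: "\<gamma> \<in> carrier \<Gamma>" "bump (act (inv \<gamma>) p) \<noteq> 0" by auto
    show "inv \<eta> \<otimes> (\<eta> \<otimes> \<gamma>) = \<gamma>" using g(1) assms(1) by (simp flip: m_assoc)
    show "\<eta> \<otimes> \<gamma> \<in> {\<gamma> \<in> carrier \<Gamma>. bump (act (inv \<gamma>) (act \<eta> p)) \<noteq> 0}"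
      using *(1)[OF g(1)] g assms by simp
  qed
qed

lemma R_tendsto: "\<gamma> \<in> carrier \<Gamma> \<Longrightarrow> v \<longlonglongrightarrow> w \<Longrightarrow> (\<lambda>j. R \<gamma> (v j)) \<longlonglongrightarrow> R \<gamma> w"
  using isCont_tendsto_compose[of w "R \<gamma>" v sequentially] linear_continuous_at[OF lin[of \<gamma>, unfolded linear_conv_bounded_linear]]
  by auto

lemma ip_tendsto:
  assumes "\<And>j. P j \<in> X" "conv P p" "v \<longlonglongrightarrow> v0" "w \<longlonglongrightarrow> w0"
  shows "(\<lambda>j. ip (P j) (v j) (w j)) \<longlonglongrightarrow> ip p v0 w0"
proof -
  obtain A where A: "finite A" "A \<subseteq> carrier \<Gamma>"
    "\<forall>\<gamma>\<in>carrier \<Gamma>. \<forall>q\<in>insert p (range P). bump (act (inv \<gamma>) q) \<noteq> 0 \<longrightarrow> \<gamma> \<in> A"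
    using bump(4)[OF assms(1,2)] by metis
  have eq: "ip q v w = (\<Sum>\<gamma>\<in>A. bump (act (inv \<gamma>) q) * (R (inv \<gamma>) v \<bullet> R (inv \<gamma>) w))"
    if "q \<in> insert p (range P)" for q v w
    by (rule avg_on) (use A that in auto)
  have "(\<lambda>j. \<Sum>\<gamma>\<in>A. bump (act (inv \<gamma>) (P j)) * (R (inv \<gamma>) (v j) \<bullet> R (inv \<gamma>) (w j)))
     \<longlonglongrightarrow> (\<Sum>\<gamma>\<in>A. bump (act (inv \<gamma>) p) * (R (inv \<gamma>) v0 \<bullet> R (inv \<gamma>) w0))"
  proof (intro tendsto_sum tendsto_mult tendsto_inner)
    fix \<gamma> assume "\<gamma> \<in> A"
    then have g: "inv \<gamma> \<in> carrier \<Gamma>" using A(2) by auto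
    show "(\<lambda>j. bump (act (inv \<gamma>) (P j))) \<longlonglongrightarrow> bump (act (inv \<gamma>) p)"
      using assms(1) g by (intro bump(3) conv_act assms(2)) auto
    show "(\<lambda>j. R (inv \<gamma>) (v j)) \<longlonglongrightarrow> R (inv \<gamma>) v0" "(\<lambda>j. R (inv \<gamma>) (w j)) \<longlonglongrightarrow> R (inv \<gamma>) w0"
      by (intro R_tendsto g assms(3,4))+
  qed
  then show ?thesis using eq by simp
qed

lemma ip_scale: "ip p (c *\<^sub>R v) (c *\<^sub>R v) = c\<^sup>2 * ip p v v"
  using bilinear_ip[of p] by (simp add: bilinear_lmul bilinear_rmul power2_eq_square)

lemma ip_zero [simp]: "ip p 0 0 = 0"
  using ip_scale[of p 0 0] by simp

lemma norm_homogeneous: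
  fixes v :: 'v
  assumes "\<And>v. norm v = 1 \<Longrightarrow> c \<le> f v" "\<And>c v. f (c *\<^sub>R v) = c\<^sup>2 * f v"
  shows "c * (norm v)\<^sup>2 \<le> f v"
proof (cases "v = 0")
  case True
  then show ?thesis using assms(2)[of 0 0] by simp
next
  case False
  have "f v = (norm v)\<^sup>2 * f (v /\<^sub>R norm v)" using assms(2)[of "norm v" "v /\<^sub>R norm v"] False by simp
  moreover have "c \<le> f (v /\<^sub>R norm v)" using False by (intro assms(1)) simp
  ultimately show ?thesis using mult_left_mono[of c "f (v /\<^sub>R norm v)" "(norm v)\<^sup>2"] by (simp add: mult.commute)
qed

lemma ip_bounds:
  assumes C: "compactin T C"
  shows "\<exists>c>0. \<exists>d>0. \<forall>p\<in>C. \<forall>v. c * (norm v)\<^sup>2 \<le> ip p v v \<and> ip p v v \<le> d * (norm v)\<^sup>2"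
proof -
  have CX: "p \<in> X" if "p \<in> C" for p using compactin_subset_topspace[OF C] that by blast
  have "\<exists>c>0. \<forall>p\<in>C. \<forall>v. norm v = 1 \<longrightarrow> True \<longrightarrow> c \<le> ip p v v"
  proof (rule compact_pos_bound[OF C])
    fix p v assume "p \<in> C" "norm (v :: 'v) = 1"
    then show "0 < ip p v v" by (intro ip_pos CX) auto
  qed (use CX ip_tendsto in auto)
  then obtain c where c: "c > 0" "\<And>p v. p \<in> C \<Longrightarrow> norm v = 1 \<Longrightarrow> c \<le> ip p v v" by auto
  have "\<exists>d>0. \<forall>p\<in>C. \<forall>v. norm v = 1 \<longrightarrow> ip p v v \<le> d"
    by (rule compact_upper_bound[OF C]) (use CX ip_tendsto in auto)
  then obtain d where d: "d > 0" "\<And>p v. p \<in> C \<Longrightarrow> norm v = 1 \<Longrightarrow> ip p v v \<le> d" by auto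
  have "c * (norm v)\<^sup>2 \<le> ip p v v \<and> ip p v v \<le> d * (norm v)\<^sup>2" if "p \<in> C" for p v
  proof
    show "c * (norm v)\<^sup>2 \<le> ip p v v" by (rule norm_homogeneous) (use c that ip_scale in auto)
    have "(-d) * (norm v)\<^sup>2 \<le> - ip p v v"
      by (rule norm_homogeneous) (use d that ip_scale in auto)
    then show "ip p v v \<le> d * (norm v)\<^sup>2" by simp
  qed
  then show ?thesis using c(1) d(1) by blast
qed

text \<open>By equivariance the base point can be moved into \<open>K\<close>; what remains is a
  comparison over the compact set swept out by \<open>K\<close> in bounded time.\<close>

lemma ip_flow_comparable:
  "\<exists>L>0. \<forall>p\<in>X. \<forall>t. \<bar>t\<bar> \<le> s \<longrightarrow> (\<forall>v. ip (flow t p) v v \<le> L * ip p v v)"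
proof -
  define C where "C = {flow t p | t p. \<bar>t\<bar> \<le> \<bar>s\<bar> \<and> p \<in> K}"
  have "compactin T C" unfolding C_def by (rule compact_flow_K)
  from ip_bounds[OF this] obtain c d where cd: "c > 0" "d > 0"
    "\<And>p v. p \<in> C \<Longrightarrow> c * (norm v)\<^sup>2 \<le> ip p v v \<and> ip p v v \<le> d * (norm v)\<^sup>2" by blast
  have "ip (flow t p) v v \<le> d / c * ip p v v" if p: "p \<in> X" "\<bar>t\<bar> \<le> s" for p t v
  proof -
    obtain \<gamma> where g: "\<gamma> \<in> carrier \<Gamma>" "act \<gamma> p \<in> K" using K_cover[OF p(1)] by metis
    have 1: "flow t (act \<gamma> p) \<in> C" unfolding C_def using g(2) p(2) by auto
    have 2: "act \<gamma> p \<in> C"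
      unfolding C_def using g(2) p(2) by (intro CollectI exI[of _ 0] exI[of _ "act \<gamma> p"]) auto
    have "ip (flow t p) v v = ip (flow t (act \<gamma> p)) (R \<gamma> v) (R \<gamma> v)"
      using ip_equivariant[OF g(1), of "flow t p" v v] p act_flow[OF g(1) p(1)] by simp
    also have "\<dots> \<le> d * (norm (R \<gamma> v))\<^sup>2" using cd(3)[OF 1] by blast
    also have "\<dots> \<le> d / c * ip (act \<gamma> p) (R \<gamma> v) (R \<gamma> v)"
      using conjunct1[OF cd(3)[OF 2, of "R \<gamma> v"]] cd(1,2) by (simp add: field_simps)
    also have "\<dots> = d / c * ip p v v" using ip_equivariant[OF g(1) p(1), of v v] by simp
    finally show ?thesis .
  qed
  then show ?thesis using cd(1,2) by (intro exI[of _ "d / c"]) auto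
qed

end

section \<open>Lyapunov functions for equivariant bundle maps\<close>

text \<open>The function \<open>q\<close> is neither equivariant nor defined usefully outside
  \<open>K\<close>: \<open>q_step\<close> only compares two points of \<open>K\<close> related by
  flowing for time \<tau> and returning with a group element. The subspaces in \<open>q_neg\<close>
  and \<open>q_pos\<close> play the role of signature \<open>(n, n)\<close>.\<close>

locale lyapunov_rep = flow_rep \<Gamma> S act D R
  for \<Gamma> :: "'g monoid" (structure) and S :: "'g set"
    and act :: "'g \<Rightarrow> 'g fpoint \<Rightarrow> 'g fpoint" and D :: "'g fpoint \<Rightarrow> 'g fpoint \<Rightarrow> real"
    and R :: "'g \<Rightarrow> 'n::finite vec2 \<Rightarrow> 'n vec2" +
  fixes \<tau> :: real and q :: "'g fpoint \<Rightarrow> 'n vec2 \<Rightarrow> real" and Cq dq :: real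
  assumes \<tau>: "\<tau> > 0" and dq: "dq > 0"
    and q_cont: "p \<in> K \<Longrightarrow> continuous_on UNIV (q p)"
    and q_bound: "p \<in> K \<Longrightarrow> \<bar>q p v\<bar> \<le> Cq * (norm v)\<^sup>2"
    and q_step: "\<gamma> \<in> carrier \<Gamma> \<Longrightarrow> p \<in> K \<Longrightarrow> act \<gamma> (flow \<tau> p) \<in> K \<Longrightarrow>
        q (act \<gamma> (flow \<tau> p)) (R \<gamma> v) \<ge> q p v + dq * (norm v)\<^sup>2"
    and q_neg: "p \<in> K \<Longrightarrow> \<exists>V. subspace V \<and> dim V = CARD('n) \<and> (\<forall>v\<in>V. q p v \<le> 0)"
    and q_pos: "p \<in> K \<Longrightarrow> \<exists>V. subspace V \<and> dim V = CARD('n) \<and> (\<forall>v\<in>V. q p v \<ge> 0)"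
begin

declare avg_nonneg [simp]

text \<open>The lifted flow leaves the vector itself fixed on the trivial bundle; growth is growth
  of its norm as the base point moves. Boundedness is a weaker demand than decay, which makes
  equivariance and flow invariance immediate, and exponential decay is recovered afterwards.\<close>

definition E :: "bool \<Rightarrow> 'g fpoint \<Rightarrow> 'n vec2 set" where
  "E \<epsilon> p = {v. \<exists>b. \<forall>s\<ge>0. ip (flow (sg \<epsilon> * s) p) v v \<le> b}"

text \<open>The points of an orbit at multiples of \<tau> are moved into \<open>K\<close> by chosen
  elements, and \<open>q\<close> is pulled back along them. Reversing time turns an increasing form
  into a decreasing one, which the factor \<open>sg \<epsilon>\<close> compensates, so both
  directions give the same kind of sequence.\<close>

lemma lyapunov_sequence:
  obtains C d where "0 < d" "2 * d \<le> C"
    "\<And>p \<epsilon>. p \<in> X \<Longrightarrow> \<exists>Q :: nat \<Rightarrow> 'n vec2 \<Rightarrow> real.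
       (\<forall>i v. \<bar>Q i v\<bar> \<le> C * ip (flow (sg \<epsilon> * (real i * \<tau>)) p) v v) \<and>
       (\<forall>i v. Q (Suc i) v \<ge> Q i v + d * ip (flow (sg \<epsilon> * (real i * \<tau>)) p) v v) \<and>
       (\<forall>i. continuous_on UNIV (Q i)) \<and>
       (\<forall>i. \<exists>V. subspace V \<and> dim V = CARD('n) \<and> (\<forall>v\<in>V. Q i v \<le> 0))"
proof -
  obtain c0 d0 where cd: "c0 > 0" "d0 > 0"
    "\<And>p v. p \<in> K \<Longrightarrow> c0 * (norm v)\<^sup>2 \<le> ip p v v \<and> ip p v v \<le> d0 * (norm v)\<^sup>2"
    using ip_bounds[OF K(1)] by blast
  obtain L where L: "L > 0" "\<And>p t v. p \<in> X \<Longrightarrow> \<bar>t\<bar> \<le> \<tau> \<Longrightarrow> ip (flow t p) v v \<le> L * ip p v v"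
    using ip_flow_comparable[of \<tau>] by blast
  define C1 where "C1 = \<bar>Cq\<bar> / c0"
  \<comment> \<open>\<open>q_step\<close> measures the gain at the earlier flow time. In the
    backward direction that is the point with index \<open>Suc i\<close>, and changing to index
    \<open>i\<close> costs the factor \<open>L\<close>.\<close>
  define d1 where "d1 = min (dq / d0) (dq / d0 / L)"
  have d1: "d1 > 0" unfolding d1_def using dq cd L by simp
  define C2 where "C2 = max C1 (2 * d1)"
  have C2: "C2 \<ge> C1" "2 * d1 \<le> C2" unfolding C2_def by auto
  show ?thesis
  proof (rule that[OF d1 C2(2)])
    fix p \<epsilon> assume p: "p \<in> X"
    define P where "P i = flow (sg \<epsilon> * (real i * \<tau>)) p" for i :: nat
    have PX: "P i \<in> X" for i unfolding P_def using p by simp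
    have "\<exists>\<gamma>. \<forall>i. \<gamma> i \<in> carrier \<Gamma> \<and> act (\<gamma> i) (P i) \<in> K"
      by (intro choice allI) (use K_cover PX in metis)
    then obtain \<gamma> where g: "\<And>i. \<gamma> i \<in> carrier \<Gamma>" "\<And>i. act (\<gamma> i) (P i) \<in> K" by blast
    define k where "k i = act (\<gamma> i) (P i)" for i
    have kK: "k i \<in> K" for i unfolding k_def by (rule g)
    define Q where "Q i v = sg \<epsilon> * q (k i) (R (\<gamma> i) v)" for i v
    have ipk: "ip (k i) (R (\<gamma> i) v) (R (\<gamma> i) v) = ip (P i) v v" for i v
      unfolding k_def by (rule ip_equivariant[OF g(1) PX])
    have step: "q (k j) (R (\<gamma> j) v) \<ge> q (k i) (R (\<gamma> i) v) + dq * (norm (R (\<gamma> i) v))\<^sup>2"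
      if "P j = flow \<tau> (P i)" for i j v
    proof -
      \<comment> \<open>The transition between the two choices of elements is the return element to
        which \<open>q_step\<close> applies; hence the choices at different times need no
        coordination.\<close>
      define \<eta> where "\<eta> = \<gamma> j \<otimes> inv (\<gamma> i)"
      have eta: "\<eta> \<in> carrier \<Gamma>" unfolding \<eta>_def using g by simp
      have "flow \<tau> (k i) = act (\<gamma> i) (P j)" unfolding k_def that using act_flow[OF g(1) PX] by simp
      then have 1: "act \<eta> (flow \<tau> (k i)) = k j"
        unfolding \<eta>_def k_def using act_mult[OF g(1) inv_closed[OF g(1)]] g(1) PX act_inv by simp
      have 2: "R \<eta> (R (\<gamma> i) v) = R (\<gamma> j) v"
        unfolding \<eta>_def using R_mult[OF g(1) inv_closed[OF g(1)]] g(1) R_inv by simp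
      show ?thesis using q_step[OF eta kK[of i], of "R (\<gamma> i) v"] kK[of j] unfolding 1 2 by simp
    qed
    have cdk: "c0 * (norm w)\<^sup>2 \<le> ip (k i) w w" "ip (k i) w w \<le> d0 * (norm w)\<^sup>2" for i w
      using cd(3)[OF kK] by blast+
    have nrm: "dq * (norm (R (\<gamma> i) v))\<^sup>2 \<ge> dq / d0 * ip (P i) v v" for i v
      using cdk(2)[of i "R (\<gamma> i) v"] dq cd(2) unfolding ipk by (simp add: field_simps)
    have ip0: "ip (P i) v v \<ge> 0" for i v by (rule avg_nonneg)
    have "\<bar>Q i v\<bar> \<le> C2 * ip (P i) v v" for i v
    proof -
      have "\<bar>Q i v\<bar> = \<bar>q (k i) (R (\<gamma> i) v)\<bar>" unfolding Q_def sg_def by simp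
      also have "\<dots> \<le> Cq * (norm (R (\<gamma> i) v))\<^sup>2" by (rule q_bound[OF kK])
      also have "\<dots> \<le> \<bar>Cq\<bar> * (norm (R (\<gamma> i) v))\<^sup>2" by (intro mult_right_mono) auto
      also have "\<dots> \<le> C1 * ip (P i) v v"
        unfolding C1_def using mult_left_mono[OF cdk(1)[of "R (\<gamma> i) v" i], of "\<bar>Cq\<bar> / c0"] cd(1) unfolding ipk
        by simp
      also have "\<dots> \<le> C2 * ip (P i) v v" using C2(1) ip0 by (intro mult_right_mono) auto
      finally show ?thesis .
    qed
    moreover have "Q (Suc i) v \<ge> Q i v + d1 * ip (P i) v v" for i v
    proof (cases \<epsilon>)
      case True
      have "P (Suc i) = flow \<tau> (P i)" unfolding P_def sg_def using True by (simp add: algebra_simps)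
      from step[OF this, of v] nrm[of i v] have "Q (Suc i) v \<ge> Q i v + dq / d0 * ip (P i) v v"
        unfolding Q_def sg_def using True by simp
      moreover have "d1 * ip (P i) v v \<le> dq / d0 * ip (P i) v v"
        unfolding d1_def by (intro mult_right_mono ip0) auto
      ultimately show ?thesis by linarith
    next
      case False
      have e: "P i = flow \<tau> (P (Suc i))" unfolding P_def sg_def using False by (simp add: algebra_simps)
      from step[OF this, of v] nrm[of "Suc i" v]
      have 1: "Q (Suc i) v \<ge> Q i v + dq / d0 * ip (P (Suc i)) v v"
        unfolding Q_def sg_def using False by simp
      have "ip (P i) v v \<le> L * ip (P (Suc i)) v v" unfolding e using L(2)[OF PX] \<tau> by simp
      then have "dq / d0 * (ip (P i) v v / L) \<le> dq / d0 * ip (P (Suc i)) v v"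
        using L(1) dq cd(2) by (intro mult_left_mono) (auto simp: field_simps)
      moreover have "d1 * ip (P i) v v \<le> dq / d0 / L * ip (P i) v v"
        unfolding d1_def by (intro mult_right_mono ip0) auto
      ultimately show ?thesis using 1 by simp
    qed
    moreover have "continuous_on UNIV (Q i)" for i
      unfolding Q_def using linear_continuous_on[OF lin[OF g(1), unfolded linear_conv_bounded_linear], of UNIV]
      by (intro continuous_on_mult continuous_on_const continuous_on_compose2[OF q_cont[OF kK]]) auto
    moreover have "\<exists>V. subspace V \<and> dim V = CARD('n) \<and> (\<forall>v\<in>V. Q i v \<le> 0)" for i
    proof -
      obtain V where V: "subspace V" "dim V = CARD('n)" "\<forall>v\<in>V. sg \<epsilon> * q (k i) v \<le> 0"
        using q_neg[OF kK, of i] q_pos[OF kK, of i] unfolding sg_def by (cases \<epsilon>) auto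
      have l: "linear (R (inv (\<gamma> i)))" using lin g(1) by simp
      have "inj (R (inv (\<gamma> i)))" using R_inv(2)[OF g(1)] by (metis injI)
      then have "dim (R (inv (\<gamma> i)) ` V) = CARD('n)"
        using dim_image_eq[OF l] V(2) inj_on_subset by (metis subset_UNIV)
      moreover have "Q i v \<le> 0" if "v \<in> R (inv (\<gamma> i)) ` V" for v
        using that V(3) R_inv(2)[OF g(1)] unfolding Q_def by auto
      ultimately show ?thesis using linear_subspace_image[OF l V(1)] by blast
    qed
    ultimately show "\<exists>Q :: nat \<Rightarrow> 'n vec2 \<Rightarrow> real.
       (\<forall>i v. \<bar>Q i v\<bar> \<le> C2 * ip (flow (sg \<epsilon> * (real i * \<tau>)) p) v v) \<and>
       (\<forall>i v. Q (Suc i) v \<ge> Q i v + d1 * ip (flow (sg \<epsilon> * (real i * \<tau>)) p) v v) \<and>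
       (\<forall>i. continuous_on UNIV (Q i)) \<and>
       (\<forall>i. \<exists>V. subspace V \<and> dim V = CARD('n) \<and> (\<forall>v\<in>V. Q i v \<le> 0))"
      unfolding P_def by (intro exI[of _ Q]) blast
  qed
qed

text \<open>By the growth alternative, being bounded along the ray is equivalent to lying in all
  cones \<open>Q i \<le> 0\<close>, and it forces exponential decay at multiples of \<tau>; times in
  between cost a fixed factor. Intersecting the cones gives the lower bound on the
  dimension.\<close>

lemma E_summary:
  obtains C c where "C > 0" "c > 0"
    "\<And>p \<epsilon> v s. p \<in> X \<Longrightarrow> v \<in> E \<epsilon> p \<Longrightarrow> s \<ge> 0 \<Longrightarrow>
        ip (flow (sg \<epsilon> * s) p) v v \<le> C * exp (- c * s) * ip p v v"
    "\<And>p \<epsilon>. p \<in> X \<Longrightarrow> \<exists>V. subspace V \<and> dim V = CARD('n) \<and> V \<subseteq> E \<epsilon> p"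
proof -
  obtain C d where Cd: "0 < d" "2 * d \<le> C"
    "\<And>p \<epsilon>. p \<in> X \<Longrightarrow> \<exists>Q :: nat \<Rightarrow> 'n vec2 \<Rightarrow> real.
       (\<forall>i v. \<bar>Q i v\<bar> \<le> C * ip (flow (sg \<epsilon> * (real i * \<tau>)) p) v v) \<and>
       (\<forall>i v. Q (Suc i) v \<ge> Q i v + d * ip (flow (sg \<epsilon> * (real i * \<tau>)) p) v v) \<and>
       (\<forall>i. continuous_on UNIV (Q i)) \<and>
       (\<forall>i. \<exists>V. subspace V \<and> dim V = CARD('n) \<and> (\<forall>v\<in>V. Q i v \<le> 0))"
    using lyapunov_sequence by metis
  obtain L where L: "L > 0" "\<And>p t v. p \<in> X \<Longrightarrow> \<bar>t\<bar> \<le> \<tau> \<Longrightarrow> ip (flow t p) v v \<le> L * ip p v v"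
    using ip_flow_comparable[of \<tau>] by blast
  define \<theta> where "\<theta> = 1 - d / C"
  have C0: "C > 0" using Cd by linarith
  have th: "1/2 \<le> \<theta>" "\<theta> < 1" unfolding \<theta>_def using Cd C0 by (auto simp: field_simps)
  \<comment> \<open>Chosen so that \<open>\<theta> ^ i\<close> equals \<open>exp\<close> of
    \<open>- c\<close> times the time \<open>i * \<tau>\<close>.\<close>
  define c where "c = - ln \<theta> / \<tau>"
  have c: "c > 0" unfolding c_def using ln_less_zero[of \<theta>] th \<tau> by (simp add: divide_neg_pos)
  define C1 where "C1 = L * (C / d) * exp (c * \<tau>)"
  have C1: "C1 > 0" unfolding C1_def using L C0 Cd by simp
  have decay: "ip (flow (sg \<epsilon> * s) p) v v \<le> C1 * exp (- c * s) * ip p v v"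
    if p: "p \<in> X" and s: "s \<ge> 0"
      and m: "\<And>i. ip (flow (sg \<epsilon> * (real i * \<tau>)) p) v v \<le> C / d * \<theta> ^ i * ip p v v" for p \<epsilon> v s
  proof -
    define i where "i = nat \<lfloor>s / \<tau>\<rfloor>"
    have i: "real i \<le> s / \<tau>" "s / \<tau> < real i + 1"
      unfolding i_def using s \<tau> by (simp_all add: of_nat_nat)
    then have i': "real i * \<tau> \<le> s" "s \<le> real i * \<tau> + \<tau>" using \<tau> by (simp_all add: field_simps)
    have "\<theta> ^ i = exp (ln \<theta> * real i)" using th by (simp add: exp_of_nat2_mult)
    also have "ln \<theta> * real i = - c * (real i * \<tau>)" unfolding c_def using \<tau> by simp
    also have "exp \<dots> \<le> exp (c * \<tau> + - c * s)" unfolding exp_le_cancel_iff using i'(2) c mult_left_mono[of s "real i * \<tau> + \<tau>" c] by (simp add: algebra_simps)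
    finally have th_i: "\<theta> ^ i \<le> exp (c * \<tau>) * exp (- c * s)" unfolding exp_add by simp
    have "flow (sg \<epsilon> * s) p = flow (sg \<epsilon> * (s - real i * \<tau>)) (flow (sg \<epsilon> * (real i * \<tau>)) p)"
      by (simp add: algebra_simps)
    moreover have "\<bar>sg \<epsilon> * (s - real i * \<tau>)\<bar> \<le> \<tau>" using i' \<tau> unfolding sg_def by (auto simp: abs_if)
    ultimately have "ip (flow (sg \<epsilon> * s) p) v v \<le> L * ip (flow (sg \<epsilon> * (real i * \<tau>)) p) v v"
      using L(2)[of "flow (sg \<epsilon> * (real i * \<tau>)) p"] p by simp
    also have "\<dots> \<le> L * (C / d * \<theta> ^ i * ip p v v)" using m[of i] L(1) by (intro mult_left_mono) auto
    also have "\<dots> \<le> L * (C / d * (exp (c * \<tau>) * exp (- c * s)) * ip p v v)"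
      using th_i L(1) C0 Cd(1) by (intro mult_left_mono mult_right_mono) auto
    finally show ?thesis unfolding C1_def by (simp add: mult_ac)
  qed
  have E_iff: "(\<exists>Q :: nat \<Rightarrow> 'n vec2 \<Rightarrow> real. (\<forall>i v. Q i v \<le> Q (Suc i) v) \<and> (\<forall>i. continuous_on UNIV (Q i)) \<and>
       (\<forall>i. \<exists>V. subspace V \<and> dim V = CARD('n) \<and> (\<forall>v\<in>V. Q i v \<le> 0)) \<and>
       (\<forall>v. v \<in> E \<epsilon> p \<longleftrightarrow> (\<forall>i. Q i v \<le> 0))) \<and>
     (\<forall>v i. v \<in> E \<epsilon> p \<longrightarrow> ip (flow (sg \<epsilon> * (real i * \<tau>)) p) v v \<le> C / d * \<theta> ^ i * ip p v v)"
    if p: "p \<in> X" for p \<epsilon>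
  proof -
    obtain Q :: "nat \<Rightarrow> 'n vec2 \<Rightarrow> real" where
      Q: "\<And>i v. \<bar>Q i v\<bar> \<le> C * ip (flow (sg \<epsilon> * (real i * \<tau>)) p) v v"
       "\<And>i v. Q (Suc i) v \<ge> Q i v + d * ip (flow (sg \<epsilon> * (real i * \<tau>)) p) v v"
       "\<And>i. continuous_on UNIV (Q i)"
       "\<And>i. \<exists>V. subspace V \<and> dim V = CARD('n) \<and> (\<forall>v\<in>V. Q i v \<le> 0)" using Cd(3)[OF p, of \<epsilon>] by blast
    define nn where "nn v i = ip (flow (sg \<epsilon> * (real i * \<tau>)) p) v v" for v i
    have nn: "0 \<le> nn v i" "\<bar>Q i v\<bar> \<le> C * nn v i" "Q (Suc i) v \<ge> Q i v + d * nn v i" for v i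
      unfolding nn_def by (rule avg_nonneg, rule Q(1), rule Q(2))
    have 1: "Q i v \<le> 0" if "v \<in> E \<epsilon> p" for v i
    proof -
      obtain b where "\<And>s. s \<ge> 0 \<Longrightarrow> ip (flow (sg \<epsilon> * s) p) v v \<le> b" using \<open>v \<in> E \<epsilon> p\<close> unfolding E_def by blast
      then have b: "nn v i \<le> b" for i unfolding nn_def using \<tau> by simp
      show ?thesis by (rule growth_alternative(1)[where n = "nn v" and Q = "\<lambda>i. Q i v", OF Cd(1,2) nn b])
    qed
    have 2: "nn v i \<le> C / d * \<theta> ^ i * ip p v v" if "\<And>i. Q i v \<le> 0" for v i
      using growth_alternative(2)[where n = "nn v" and Q = "\<lambda>i. Q i v", OF Cd(1,2) nn that, of i] unfolding \<theta>_def nn_def by simp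
    have 3: "v \<in> E \<epsilon> p" if "\<And>i. Q i v \<le> 0" for v
    proof -
      have "ip (flow (sg \<epsilon> * s) p) v v \<le> C1 * ip p v v" if s: "s \<ge> 0" for s
      proof -
        have "ip (flow (sg \<epsilon> * s) p) v v \<le> C1 * exp (- c * s) * ip p v v"
          by (rule decay[OF p s 2[OF \<open>\<And>i. Q i v \<le> 0\<close>, unfolded nn_def]])
        also have "\<dots> \<le> C1 * 1 * ip p v v" using C1 c s by (intro mult_left_mono mult_right_mono) auto
        finally show ?thesis by simp
      qed
      then show ?thesis unfolding E_def by blast
    qed
    have "Q i v \<le> Q (Suc i) v" for i v using nn(1)[of v i] nn(3)[of i v] Cd(1) by (smt (verit) mult_nonneg_nonneg)
    moreover have "v \<in> E \<epsilon> p \<longleftrightarrow> (\<forall>i. Q i v \<le> 0)" for v using 1 3 by blast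
    ultimately show ?thesis using Q(3,4) 2[unfolded nn_def] 1 by blast
  qed
  show ?thesis
  proof (rule that[OF C1 c])
    fix p \<epsilon> v s assume "p \<in> X" "v \<in> E \<epsilon> p" "s \<ge> (0::real)"
    then show "ip (flow (sg \<epsilon> * s) p) v v \<le> C1 * exp (- c * s) * ip p v v"
      using E_iff by (intro decay) auto
  next
    fix p \<epsilon> assume p: "p \<in> X"
    from E_iff[OF this, of \<epsilon>] obtain Q :: "nat \<Rightarrow> 'n vec2 \<Rightarrow> real" where
      Q: "\<And>i v. Q i v \<le> Q (Suc i) v" "\<And>i. continuous_on UNIV (Q i)"
       "\<And>i. \<exists>V. subspace V \<and> dim V = CARD('n) \<and> (\<forall>v\<in>V. Q i v \<le> 0)"
       "\<And>v. v \<in> E \<epsilon> p \<longleftrightarrow> (\<forall>i. Q i v \<le> 0)" by blast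
    show "\<exists>V. subspace V \<and> dim V = CARD('n) \<and> V \<subseteq> E \<epsilon> p"
      using nested_cones[where Q = Q, OF Q(2,1,3)] Q(4) by blast
  qed
qed

lemma E_subspace: "subspace (E \<epsilon> p)"
proof (rule subspaceI)
  show "0 \<in> E \<epsilon> p" unfolding E_def by auto
next
  fix v w assume "v \<in> E \<epsilon> p" "w \<in> E \<epsilon> p"
  then obtain b c where b: "\<And>s. s \<ge> 0 \<Longrightarrow> ip (flow (sg \<epsilon> * s) p) v v \<le> b"
    and c: "\<And>s. s \<ge> 0 \<Longrightarrow> ip (flow (sg \<epsilon> * s) p) w w \<le> c" unfolding E_def by blast
  have "ip (flow (sg \<epsilon> * s) p) (v + w) (v + w) \<le> 2 * b + 2 * c" if "s \<ge> 0" for s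
  proof -
    let ?p = "flow (sg \<epsilon> * s) p"
    have "ip ?p (v + w) (v + w) + ip ?p (v - w) (v - w) = 2 * ip ?p v v + 2 * ip ?p w w"
      using bilinear_ip[of ?p] by (simp add: bilinear_ladd bilinear_radd bilinear_lsub bilinear_rsub)
    then show ?thesis using b[OF that] c[OF that] avg_nonneg[of R ?p "v - w"] by linarith
  qed
  then show "v + w \<in> E \<epsilon> p" unfolding E_def by blast
next
  fix a :: real and v assume "v \<in> E \<epsilon> p"
  then obtain b where "\<And>s. s \<ge> 0 \<Longrightarrow> ip (flow (sg \<epsilon> * s) p) v v \<le> b" unfolding E_def by blast
  then have "ip (flow (sg \<epsilon> * s) p) (a *\<^sub>R v) (a *\<^sub>R v) \<le> a\<^sup>2 * b" if "s \<ge> 0" for s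
    unfolding ip_scale using that by (intro mult_left_mono) auto
  then show "a *\<^sub>R v \<in> E \<epsilon> p" unfolding E_def by blast
qed

lemma E_flow: assumes p: "p \<in> X" shows "E \<epsilon> (flow t p) = E \<epsilon> p"
proof -
  have sub: "E \<epsilon> (flow t p) \<subseteq> E \<epsilon> p" if p: "p \<in> X" for t p
  proof
    fix v assume "v \<in> E \<epsilon> (flow t p)"
    then obtain b where b: "\<And>s. s \<ge> 0 \<Longrightarrow> ip (flow (sg \<epsilon> * s) (flow t p)) v v \<le> b" unfolding E_def by blast
    obtain L where L: "L > 0" "\<And>p s v. p \<in> X \<Longrightarrow> \<bar>s\<bar> \<le> \<bar>t\<bar> \<Longrightarrow> ip (flow s p) v v \<le> L * ip p v v"
      using ip_flow_comparable[of "\<bar>t\<bar>"] by blast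
    have "ip (flow (sg \<epsilon> * s) p) v v \<le> L * b" if "s \<ge> 0" for s
    proof -
      have "flow (sg \<epsilon> * s) p = flow (- t) (flow (sg \<epsilon> * s) (flow t p))" by simp
      then have "ip (flow (sg \<epsilon> * s) p) v v \<le> L * ip (flow (sg \<epsilon> * s) (flow t p)) v v"
        using L(2)[of "flow (sg \<epsilon> * s) (flow t p)" "-t" v] p by simp
      also have "\<dots> \<le> L * b" using b[OF that] L(1) by (intro mult_left_mono) auto
      finally show ?thesis .
    qed
    then show "v \<in> E \<epsilon> p" unfolding E_def by blast
  qed
  show ?thesis using sub[OF p, of t] sub[of "flow t p" "-t"] p by auto
qed

lemma E_act: assumes "\<gamma> \<in> carrier \<Gamma>" "p \<in> X" shows "R \<gamma> v \<in> E \<epsilon> (act \<gamma> p) \<longleftrightarrow> v \<in> E \<epsilon> p"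
  unfolding E_def using ip_equivariant[OF assms(1)] assms(2) act_flow[OF assms, symmetric] by simp

lemma E_decay:
  obtains C c where "C > 0" "c > 0"
    "\<And>p \<epsilon> v s. p \<in> X \<Longrightarrow> v \<in> E \<epsilon> p \<Longrightarrow> s \<ge> 0 \<Longrightarrow>
        ip (flow (sg \<epsilon> * s) p) v v \<le> C * exp (- c * s) * ip p v v"
  using E_summary by metis

text \<open>Going out for time \<open>s\<close> along one direction and coming back along the other
  bounds the norm of a common vector by \<open>C * C * exp (- 2 * c * s)\<close> times itself, which
  is absurd for large \<open>s\<close>.\<close>

lemma E_int: assumes p: "p \<in> X" shows "E \<epsilon> p \<inter> E (\<not> \<epsilon>) p = {0}"
proof -
  have "v = 0" if v: "v \<in> E \<epsilon> p" "v \<in> E (\<not> \<epsilon>) p" for v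
  proof (rule ccontr)
    assume "v \<noteq> 0"
    then have pos: "ip p v v > 0" using ip_pos p by blast
    obtain C c where C: "C > 0" "c > 0"
      "\<And>p \<epsilon> v s. p \<in> X \<Longrightarrow> v \<in> E \<epsilon> p \<Longrightarrow> s \<ge> 0 \<Longrightarrow>
        ip (flow (sg \<epsilon> * s) p) v v \<le> C * exp (- c * s) * ip p v v" using E_decay by metis
    have ineq: "1 \<le> C * C * exp (- (2 * c) * s)" if s: "s \<ge> 0" for s
    proof -
      have 1: "ip (flow (sg \<epsilon> * s) p) v v \<le> C * exp (- c * s) * ip p v v" by (rule C(3)[OF p v(1) s])
      have "p = flow (sg (\<not> \<epsilon>) * s) (flow (sg \<epsilon> * s) p)" by (simp add: sg_def)
      then have "ip p v v \<le> C * exp (- c * s) * ip (flow (sg \<epsilon> * s) p) v v"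
        using C(3)[of "flow (sg \<epsilon> * s) p" v "\<not> \<epsilon>" s] E_flow[OF p] v(2) p s by simp
      also have "\<dots> \<le> C * exp (- c * s) * (C * exp (- c * s) * ip p v v)"
        using 1 C(1) by (intro mult_left_mono) auto
      also have "\<dots> = C * C * (exp (- c * s) * exp (- c * s)) * ip p v v" by simp
      also have "exp (- c * s) * exp (- c * s) = exp (- (2 * c) * s)"
        unfolding exp_add[symmetric] by (simp add: algebra_simps)
      finally have "1 * ip p v v \<le> C * C * exp (- (2 * c) * s) * ip p v v" by simp
      then show ?thesis using pos mult_le_cancel_right_pos by blast
    qed
    have "((\<lambda>s. C * C * exp (- (2 * c) * s)) \<longlongrightarrow> 0) at_top" using C(1,2) by real_asymp
    then have "\<forall>\<^sub>F s in at_top. C * C * exp (- (2 * c) * s) < 1" by (rule order_tendstoD) simp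
    then obtain s0 where "\<And>s. s \<ge> s0 \<Longrightarrow> C * C * exp (- (2 * c) * s) < 1" unfolding eventually_at_top_linorder by blast
    from this[of "max s0 0"] ineq[of "max s0 0"] show False by simp
  qed
  then show ?thesis using subspace_0[OF E_subspace] by blast
qed

text \<open>Both spaces have dimension at least \<open>n\<close> and meet trivially in dimension
  \<open>2n\<close>; this leaves no room.\<close>

lemma E_dim: assumes p: "p \<in> X" shows "dim (E \<epsilon> p) = CARD('n)"
proof -
  have ge: "CARD('n) \<le> dim (E \<epsilon> p)" for \<epsilon>
    using E_summary p by (metis dim_subset)
  have "dim {x + y |x y. x \<in> E \<epsilon> p \<and> y \<in> E (\<not> \<epsilon>) p} + dim (E \<epsilon> p \<inter> E (\<not> \<epsilon>) p) = dim (E \<epsilon> p) + dim (E (\<not> \<epsilon>) p)"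
    by (rule dim_sums_Int[OF E_subspace E_subspace])
  moreover have "dim {x + y |x y. x \<in> E \<epsilon> p \<and> y \<in> E (\<not> \<epsilon>) p} \<le> 2 * CARD('n)"
    using dim_subset_UNIV[of "{x + y |x y. x \<in> E \<epsilon> p \<and> y \<in> E (\<not> \<epsilon>) p}"] by simp
  ultimately show ?thesis using ge[of \<epsilon>] ge[of "\<not> \<epsilon>"] E_int[OF p, of \<epsilon>] by simp
qed

lemma E_sum: assumes p: "p \<in> X" shows "\<exists>a\<in>E True p. v - a \<in> E False p"
proof -
  let ?S = "{x + y |x y. x \<in> E True p \<and> y \<in> E False p}"
  have "dim ?S + dim (E True p \<inter> E False p) = dim (E True p) + dim (E False p)"
    by (rule dim_sums_Int[OF E_subspace E_subspace])
  then have "dim ?S = DIM('n vec2)" using E_int[OF p, of True] E_dim[OF p] by simp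
  moreover have "subspace ?S" by (intro subspace_sums E_subspace)
  ultimately have "?S = UNIV" using subspace_dim_equal[OF _ subspace_UNIV subset_UNIV, of ?S] by simp
  then obtain x y where "v = x + y" "x \<in> E True p" "y \<in> E False p" by blast
  then show ?thesis by (intro bexI[of _ x]) auto
qed

text \<open>The bound in the definition of \<open>E\<close> depends on the vector and would not
  survive a limit; the uniform constant of \<open>E_decay\<close> does.\<close>

lemma E_limit:
  assumes "\<And>j. P j \<in> X" "conv P p" "\<And>j. v j \<in> E \<epsilon> (P j)" "v \<longlonglongrightarrow> w"
  shows "w \<in> E \<epsilon> p"
proof -
  obtain C c where C: "C > 0" "c > 0"
    "\<And>p \<epsilon> v s. p \<in> X \<Longrightarrow> v \<in> E \<epsilon> p \<Longrightarrow> s \<ge> 0 \<Longrightarrow>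
        ip (flow (sg \<epsilon> * s) p) v v \<le> C * exp (- c * s) * ip p v v" using E_decay by metis
  have "ip (flow (sg \<epsilon> * s) p) w w \<le> C * ip p w w" if s: "s \<ge> 0" for s
  proof (rule LIMSEQ_le)
    have "conv (\<lambda>j. flow (sg \<epsilon> * s) (P j)) (flow (sg \<epsilon> * s) p)"
      by (rule conv_flow[OF assms(1,2) tendsto_const])
    then show "(\<lambda>j. ip (flow (sg \<epsilon> * s) (P j)) (v j) (v j)) \<longlonglongrightarrow> ip (flow (sg \<epsilon> * s) p) w w"
      using assms by (intro ip_tendsto) auto
    show "(\<lambda>j. C * ip (P j) (v j) (v j)) \<longlonglongrightarrow> C * ip p w w"
      using assms by (intro tendsto_intros ip_tendsto) auto
    have "ip (flow (sg \<epsilon> * s) (P j)) (v j) (v j) \<le> C * ip (P j) (v j) (v j)" for j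
    proof -
      have "ip (flow (sg \<epsilon> * s) (P j)) (v j) (v j) \<le> C * exp (- c * s) * ip (P j) (v j) (v j)"
        by (rule C(3)[OF assms(1,3) s])
      also have "\<dots> \<le> C * 1 * ip (P j) (v j) (v j)"
        using C(1,2) s by (intro mult_right_mono mult_left_mono) auto
      finally show ?thesis by simp
    qed
    then show "\<exists>N. \<forall>j\<ge>N. ip (flow (sg \<epsilon> * s) (P j)) (v j) (v j) \<le> C * ip (P j) (v j) (v j)" by blast
  qed
  then show ?thesis unfolding E_def by blast
qed

section \<open>The projection belonging to the splitting, and its continuity\<close>

definition proj :: "'g fpoint \<Rightarrow> 'n vec2 \<Rightarrow> 'n vec2" where
  "proj p v = (THE a. a \<in> E True p \<and> v - a \<in> E False p)"

lemma proj_eqI: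
  assumes "p \<in> X" "a \<in> E True p" "v - a \<in> E False p" shows "proj p v = a"
  unfolding proj_def
proof (rule the_equality)
  fix b assume b: "b \<in> E True p \<and> v - b \<in> E False p"
  have "b - a \<in> E True p" using b assms(2) by (intro subspace_diff[OF E_subspace]) auto
  moreover have "b - a \<in> E False p" using subspace_diff[OF E_subspace assms(3), of "v - b"] b by simp
  ultimately have "b - a \<in> E True p \<inter> E (\<not> True) p" by simp
  then show "b = a" unfolding E_int[OF assms(1)] by simp
qed (use assms in auto)

lemma proj_mem: assumes "p \<in> X" shows "proj p v \<in> E True p" "v - proj p v \<in> E False p"
  using E_sum[OF assms, of v] proj_eqI[OF assms] by auto

lemma proj_linear: assumes p: "p \<in> X" shows "linear (proj p)"
proof (rule linearI)
  fix v w and c :: real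
  show "proj p (v + w) = proj p v + proj p w"
  proof (rule proj_eqI[OF p])
    show "v + w - (proj p v + proj p w) \<in> E False p"
      using subspace_add[OF E_subspace proj_mem(2)[OF p, of v] proj_mem(2)[OF p, of w]] by (simp add: algebra_simps)
  qed (intro subspace_add[OF E_subspace] proj_mem p)
  show "proj p (c *\<^sub>R v) = c *\<^sub>R proj p v"
  proof (rule proj_eqI[OF p])
    show "c *\<^sub>R v - c *\<^sub>R proj p v \<in> E False p"
      using subspace_scale[OF E_subspace proj_mem(2)[OF p, of v], of c] by (simp add: algebra_simps)
  qed (intro subspace_scale[OF E_subspace] proj_mem p)
qed

lemma proj_tendsto:
  assumes P: "\<And>j. P j \<in> X" "conv P p" and v: "v \<longlonglongrightarrow> w"
  shows "(\<lambda>j. proj (P j) (v j)) \<longlonglongrightarrow> proj p w"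
proof -
  have p: "p \<in> X" by (rule conv_X[OF P(2)])
  have "\<exists>a0\<in>E True p. w - a0 \<in> E False p \<and> (\<lambda>j. proj (P j) (v j)) \<longlonglongrightarrow> a0"
  proof (rule decomposition_limit[of "\<lambda>j. E True (P j)" "\<lambda>j. E False (P j)" _ _ _ v])
    fix r :: "nat \<Rightarrow> nat" and v and w :: "'n vec2" assume r: "strict_mono r" "v \<longlonglongrightarrow> w"
    have c: "conv (\<lambda>j. P (r j)) p" using conv_subseq[OF P(2) r(1)] by (simp add: o_def)
    show "w \<in> E True p" if "\<And>j. v j \<in> E True (P (r j))"
      by (rule E_limit[OF _ c that r(2)]) (rule P)
    show "w \<in> E False p" if "\<And>j. v j \<in> E False (P (r j))"
      by (rule E_limit[OF _ c that r(2)]) (rule P)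
  qed (use E_subspace proj_mem P v E_int[OF p, of True] in auto)
  then show ?thesis using proj_eqI[OF p] by auto
qed

end

section \<open>Matrices and the special linear group\<close>

lemma bilinear_matrix_mult: "bilinear ((**) :: real ^ 'b::finite ^ 'a::finite \<Rightarrow> real ^ 'c::finite ^ 'b \<Rightarrow> _)"
  unfolding bilinear_def
  by (intro conjI allI linearI)
    (simp_all add: vec_eq_iff matrix_matrix_mult_def sum.distrib sum_distrib_left algebra_simps)

lemmas tendsto_matrix_mult [tendsto_intros] =
  bounded_bilinear.tendsto[OF bilinear_matrix_mult[unfolded bilinear_conv_bounded_bilinear]]

lemma bilinear_matrix_vector: "bilinear ((*v) :: real ^ 'b::finite ^ 'a::finite \<Rightarrow> real ^ 'b \<Rightarrow> _)"
  unfolding bilinear_def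
  by (intro conjI allI linearI)
    (simp_all add: vec_eq_iff matrix_vector_mult_def sum.distrib sum_distrib_left algebra_simps)

lemmas tendsto_matrix_vector [tendsto_intros] =
  bounded_bilinear.tendsto[OF bilinear_matrix_vector[unfolded bilinear_conv_bounded_bilinear]]

lemma norm_vec_power2: "(norm x)\<^sup>2 = (\<Sum>i\<in>UNIV. (norm (x $ i))\<^sup>2)"
  for x :: "'a::real_normed_vector ^ 'n::finite"
  unfolding norm_vec_def L2_set_def by (simp add: sum_nonneg)

lemma norm_matrix_vector_le:
  fixes A :: "real ^ 'b::finite ^ 'a::finite"
  shows "norm (A *v x) \<le> norm A * norm x"
proof -
  have "(norm (A *v x))\<^sup>2 = (\<Sum>i\<in>UNIV. (A $ i \<bullet> x)\<^sup>2)"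
    by (simp add: norm_vec_power2[of "A *v x"] matrix_vector_mul_component)
  also have "\<dots> \<le> (\<Sum>i\<in>UNIV. (norm (A $ i))\<^sup>2 * (norm x)\<^sup>2)"
    using Cauchy_Schwarz_ineq by (intro sum_mono) (simp add: power2_norm_eq_inner)
  also have "\<dots> = (norm A)\<^sup>2 * (norm x)\<^sup>2"
    by (simp add: norm_vec_power2[of A] sum_distrib_right)
  finally have "(norm (A *v x))\<^sup>2 \<le> (norm A * norm x)\<^sup>2" by (simp add: power_mult_distrib)
  then show ?thesis by (rule power2_le_imp_le) simp
qed

lemma norm_matrix_columns:
  fixes A :: "real ^ 'b::finite ^ 'a::finite"
  shows "(norm A)\<^sup>2 = (\<Sum>j\<in>UNIV. (norm (A *v axis j 1))\<^sup>2)"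
proof -
  have "(norm A)\<^sup>2 = (\<Sum>i\<in>UNIV. \<Sum>j\<in>UNIV. (A $ i $ j)\<^sup>2)"
    by (simp add: norm_vec_power2)
  also have "\<dots> = (\<Sum>j\<in>UNIV. \<Sum>i\<in>UNIV. (A $ i $ j)\<^sup>2)" by (rule sum.swap)
  also have "\<dots> = (\<Sum>j\<in>UNIV. (norm (A *v axis j 1))\<^sup>2)"
    by (simp add: norm_vec_power2[of "A *v _"] matrix_vector_mul_component inner_axis)
  finally show ?thesis .
qed

lemma det_scaleR: "det (c *\<^sub>R A) = c ^ CARD('n) * det (A :: real ^ 'n::finite ^ 'n)"
proof -
  have "c *\<^sub>R A = matrix ((*\<^sub>R) c) ** A"
    unfolding matrix_scaleR by (simp add: vec_eq_iff matrix_matrix_mult_def mat_def if_distrib[of "\<lambda>x. x * _"] cong: if_cong)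
  then show ?thesis by (simp add: det_mul)
qed

text \<open>Existence is enough: two curves in the matrices with the same velocity at the identity
  will be compared, so the derivative never has to be identified as the trace.\<close>

lemma det_has_derivative: "\<exists>D. (det has_derivative D) (at (A :: real ^ 'n::finite ^ 'n))"
proof -
  have "\<exists>D. ((\<lambda>A :: real ^ 'n ^ 'n. of_int (sign p) * (\<Prod>i\<in>UNIV. A $ i $ p i)) has_derivative D) (at A)" for p
  proof -
    have "((\<lambda>A :: real ^ 'n ^ 'n. A $ i $ j) has_derivative (\<lambda>A. A $ i $ j)) (at A)" for i j
      by (intro bounded_linear_imp_has_derivative linear_conv_bounded_linear[THEN iffD1] linearI) auto
    then show ?thesis by (intro exI) (rule has_derivative_mult_right has_derivative_prod | assumption)+
  qed
  then have "\<forall>p. \<exists>D. ((\<lambda>A :: real ^ 'n ^ 'n. of_int (sign p) * (\<Prod>i\<in>UNIV. A $ i $ p i)) has_derivative D) (at A)"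
    by (rule allI)
  from choice[OF this] obtain D where "\<And>p. ((\<lambda>A :: real ^ 'n ^ 'n. of_int (sign p) * (\<Prod>i\<in>UNIV. A $ i $ p i)) has_derivative D p) (at A)"
    by blast
  then have "((\<lambda>A. \<Sum>p | p permutes (UNIV :: 'n set). of_int (sign p) * (\<Prod>i\<in>UNIV. A $ i $ p i)) has_derivative
      (\<lambda>h. \<Sum>p | p permutes (UNIV :: 'n set). D p h)) (at A)"
    by (intro has_derivative_sum) auto
  then show ?thesis unfolding det_def[abs_def] by blast
qed

lemma has_vector_derivative_in_subspace:
  fixes c :: "real \<Rightarrow> 'a::euclidean_space"
  assumes "(c has_vector_derivative X) (at 0)" "subspace S" "\<And>t. c t \<in> S"
  shows "X \<in> S"
proof (rule Lim_in_closed_set[OF closed_subspace[OF assms(2)]])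
  have "((\<lambda>h. (c (0 + h) - c 0) /\<^sub>R h) \<longlongrightarrow> X) (at 0)"
  proof (subst Lim_null, subst tendsto_norm_zero_iff[symmetric])
    have "((\<lambda>h. norm (c (0 + h) - c 0 - h *\<^sub>R X) / norm h) \<longlongrightarrow> 0) (at 0)"
      using assms(1) unfolding has_vector_derivative_def has_derivative_at by blast
    moreover have "\<forall>\<^sub>F h in at 0. norm (c (0 + h) - c 0 - h *\<^sub>R X) / norm h = norm ((c (0 + h) - c 0) /\<^sub>R h - X)"
      unfolding eventually_at_filter
    proof (intro always_eventually allI impI)
      fix h :: real assume "h \<noteq> 0"
      then have "(c (0 + h) - c 0) /\<^sub>R h - X = (c (0 + h) - c 0 - h *\<^sub>R X) /\<^sub>R h"
        by (simp add: algebra_simps)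
      then show "norm (c (0 + h) - c 0 - h *\<^sub>R X) / norm h = norm ((c (0 + h) - c 0) /\<^sub>R h - X)"
        by (simp add: divide_inverse mult.commute)
    qed
    ultimately show "((\<lambda>h. norm ((c (0 + h) - c 0) /\<^sub>R h - X)) \<longlongrightarrow> 0) (at 0)"
      by (rule Lim_transform_eventually)
  qed
  then show "((\<lambda>h. (c (0 + h) - c 0) /\<^sub>R h) \<longlongrightarrow> X) (at 0)" .
  show "\<forall>\<^sub>F h in at 0. (c (0 + h) - c 0) /\<^sub>R h \<in> S"
    using assms(2,3) by (intro always_eventually allI subspace_scale subspace_diff)
qed simp

lemma openin_coset_topology:
  "openin (coset_topology G P) V \<longleftrightarrow> V \<subseteq> lcosets\<^bsub>G\<^esub> P \<and>
     openin (top_of_set (carrier G)) {g\<in>carrier G. g <#\<^bsub>G\<^esub> P \<in> V}"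
  unfolding coset_topology_def using topology_inverse'[OF istopology_coset[of G P]] by simp

lemma topspace_coset [simp]: "topspace (coset_topology G P) = lcosets\<^bsub>G\<^esub> P"
proof
  show "topspace (coset_topology G P) \<subseteq> lcosets\<^bsub>G\<^esub> P"
    using openin_coset_topology openin_topspace by blast
  have "{g\<in>carrier G. g <#\<^bsub>G\<^esub> P \<in> lcosets\<^bsub>G\<^esub> P} = carrier G" unfolding LCOSETS_def by auto
  then have "openin (coset_topology G P) (lcosets\<^bsub>G\<^esub> P)" unfolding openin_coset_topology by simp
  then show "lcosets\<^bsub>G\<^esub> P \<subseteq> topspace (coset_topology G P)" by (rule openin_subset)
qed

section \<open>Cosets of the special linear group as configurations of subspaces\<close>

lemma SL_simps [simp]:
  "A \<in> carrier SL_group \<longleftrightarrow> det A = 1" "A \<otimes>\<^bsub>SL_group\<^esub> B = A ** B" "\<one>\<^bsub>SL_group\<^esub> = mat 1"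
  by (simp_all add: SL_group_def mat_group_def)

lemma group_SL: "group (SL_group :: (real ^ 'm::finite ^ 'm) monoid)"
proof (rule groupI)
  fix A :: "real ^ 'm ^ 'm" assume A: "A \<in> carrier SL_group"
  then obtain B where "A ** B = mat 1" "B ** A = mat 1"
    using invertible_det_nz[of A] unfolding invertible_def by auto
  moreover from this have "det A * det B = 1" by (metis det_mul det_I)
  ultimately show "\<exists>B\<in>carrier SL_group. B \<otimes>\<^bsub>SL_group\<^esub> A = \<one>\<^bsub>SL_group\<^esub>" using A by auto
qed (simp_all add: det_mul matrix_mul_assoc)

lemma SL_inv:
  assumes "det (A :: real ^ 'm::finite ^ 'm) = 1"
  shows "A ** inv\<^bsub>SL_group\<^esub> A = mat 1" "inv\<^bsub>SL_group\<^esub> A ** A = mat 1" "det (inv\<^bsub>SL_group\<^esub> A) = 1"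
  using group.r_inv[OF group_SL, of A] group.l_inv[OF group_SL, of A] group.inv_closed[OF group_SL, of A] assms by auto

lemma matrix_image_comp: "(*v) (A ** B) ` V = (*v) A ` ((*v) B ` V)"
  by (auto simp: image_iff matrix_vector_mul_assoc)

lemma image_mat_1 [simp]: "(*v) (mat 1 :: real ^ 'm::finite ^ 'm) ` V = V"
  by (auto simp: image_iff)

lemma SL_image_inv:
  assumes "det (A :: real ^ 'm::finite ^ 'm) = 1" "(*v) A ` V = W"
  shows "(*v) (inv\<^bsub>SL_group\<^esub> A) ` W = V"
proof -
  have "(*v) (inv\<^bsub>SL_group\<^esub> A) ` ((*v) A ` V) = (*v) (inv\<^bsub>SL_group\<^esub> A ** A) ` V"
    unfolding matrix_image_comp ..
  then show ?thesis using assms(2) SL_inv(2)[OF assms(1)] by simp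
qed

text \<open>Identifies the coset space with an orbit of subspaces: a coset is the set of all
  matrices that carry \<open>V\<close> to the given subspace.\<close>

lemma l_coset_SL:
  assumes g: "det (g :: real ^ 'm::finite ^ 'm) = 1" "(*v) g ` V = A"
  shows "g <#\<^bsub>SL_group\<^esub> SL_stabilizer V = {h. det h = 1 \<and> (*v) h ` V = A}"
proof
  show "g <#\<^bsub>SL_group\<^esub> SL_stabilizer V \<subseteq> {h. det h = 1 \<and> (*v) h ` V = A}"
  proof
    fix x assume "x \<in> g <#\<^bsub>SL_group\<^esub> SL_stabilizer V"
    then obtain h where "det h = 1" "(*v) h ` V = V" "x = g ** h"
      unfolding l_coset_def SL_stabilizer_def by auto
    then show "x \<in> {h. det h = 1 \<and> (*v) h ` V = A}" using g by (simp add: det_mul matrix_image_comp)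
  qed
  show "{h. det h = 1 \<and> (*v) h ` V = A} \<subseteq> g <#\<^bsub>SL_group\<^esub> SL_stabilizer V"
  proof
    fix h assume h: "h \<in> {h. det h = 1 \<and> (*v) h ` V = A}"
    have "inv\<^bsub>SL_group\<^esub> g ** h \<in> SL_stabilizer V"
      using h SL_image_inv[OF g] SL_inv[OF g(1)] unfolding SL_stabilizer_def by (simp add: det_mul matrix_image_comp)
    moreover have "h = g ** (inv\<^bsub>SL_group\<^esub> g ** h)" using SL_inv[OF g(1)] by (simp add: matrix_mul_assoc)
    ultimately show "h \<in> g <#\<^bsub>SL_group\<^esub> SL_stabilizer V" unfolding l_coset_def by auto
  qed
qed

lemma l_coset_SL_pair:
  assumes g: "det (g :: real ^ 'm::finite ^ 'm) = 1" "(*v) g ` V = A" "(*v) g ` W = B"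
  shows "g <#\<^bsub>SL_group\<^esub> (SL_stabilizer V \<inter> SL_stabilizer W) = {h. det h = 1 \<and> (*v) h ` V = A \<and> (*v) h ` W = B}"
proof
  show "g <#\<^bsub>SL_group\<^esub> (SL_stabilizer V \<inter> SL_stabilizer W) \<subseteq> {h. det h = 1 \<and> (*v) h ` V = A \<and> (*v) h ` W = B}"
  proof
    fix x assume "x \<in> g <#\<^bsub>SL_group\<^esub> (SL_stabilizer V \<inter> SL_stabilizer W)"
    then obtain h where "det h = 1" "(*v) h ` V = V" "(*v) h ` W = W" "x = g ** h"
      unfolding l_coset_def SL_stabilizer_def by auto
    then show "x \<in> {h. det h = 1 \<and> (*v) h ` V = A \<and> (*v) h ` W = B}"
      using g by (simp add: det_mul matrix_image_comp)
  qed
  show "{h. det h = 1 \<and> (*v) h ` V = A \<and> (*v) h ` W = B} \<subseteq> g <#\<^bsub>SL_group\<^esub> (SL_stabilizer V \<inter> SL_stabilizer W)"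
  proof
    fix h assume h: "h \<in> {h. det h = 1 \<and> (*v) h ` V = A \<and> (*v) h ` W = B}"
    have "inv\<^bsub>SL_group\<^esub> g ** h \<in> SL_stabilizer V \<inter> SL_stabilizer W"
      using h SL_image_inv[OF g(1,2)] SL_image_inv[OF g(1,3)] SL_inv[OF g(1)]
      unfolding SL_stabilizer_def by (simp add: det_mul matrix_image_comp)
    moreover have "h = g ** (inv\<^bsub>SL_group\<^esub> g ** h)" using SL_inv[OF g(1)] by (simp add: matrix_mul_assoc)
    ultimately show "h \<in> g <#\<^bsub>SL_group\<^esub> (SL_stabilizer V \<inter> SL_stabilizer W)" unfolding l_coset_def by auto
  qed
qed

lemma sum_UNIV_Plus: "(\<Sum>x\<in>UNIV. f x) = (\<Sum>i\<in>UNIV. f (Inl i)) + (\<Sum>i\<in>UNIV. f (Inr i))"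
  for f :: "'a::finite + 'b::finite \<Rightarrow> 'c::comm_monoid_add"
  using sum.Plus[of "UNIV :: 'a set" "UNIV :: 'b set" f] by (simp add: UNIV_Plus_UNIV)

lemma adapted_matrix:
  fixes V W :: "'n::finite vec2 set"
  assumes V: "subspace V" "dim V = CARD('n)" and W: "subspace W" "dim W = CARD('n)" and VW: "V \<inter> W = {0}"
  shows "\<exists>M :: 'n mat2. det M \<noteq> 0 \<and> (*v) M ` {x. \<forall>i. x $ Inr i = 0} = V \<and> (*v) M ` {x. \<forall>i. x $ Inl i = 0} = W"
proof -
  obtain F :: "'n vec2 ^ 'n" where F: "\<And>i. F $ i \<in> V" "\<And>i j. F $ i \<bullet> F $ j = (if i = j then 1 else 0)"
    using orthonormal_frame[OF V] by metis
  obtain G :: "'n vec2 ^ 'n" where G: "\<And>i. G $ i \<in> W" "\<And>i j. G $ i \<bullet> G $ j = (if i = j then 1 else 0)"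
    using orthonormal_frame[OF W] by metis
  define M :: "'n mat2" where "M = (\<chi> r c. case c of Inl i \<Rightarrow> F $ i $ r | Inr i \<Rightarrow> G $ i $ r)"
  define f where "f F c = (\<Sum>i\<in>UNIV. c $ i *\<^sub>R F $ i)" for F :: "'n vec2 ^ 'n" and c :: "real ^ 'n"
  have lin: "linear (f F)" for F unfolding f_def
    by (intro linearI) (simp_all add: scaleR_add_left sum.distrib scaleR_sum_right)
  have range: "range (f F) = V"
    if "subspace V" "dim V = CARD('n)" "\<And>i. F $ i \<in> V" "\<And>i j. F $ i \<bullet> F $ j = (if i = j then 1 else 0)" for F V
  proof (rule subspace_dim_equal)
    have "norm (f F c) = norm c" for c unfolding f_def by (rule frame_norm[OF that(4)])
    then have "inj (f F)" unfolding linear_injective_0[OF lin] by (metis norm_eq_zero)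
    then show "dim V \<le> dim (range (f F))" using dim_image_eq[OF lin, of F UNIV] that(2) by simp
    show "range (f F) \<subseteq> V" unfolding f_def using that(1,3) by (auto intro!: subspace_sum subspace_scale)
  qed (use that linear_subspace_image[OF lin subspace_UNIV] in auto)
  have M: "M *v x = f F (\<chi> i. x $ Inl i) + f G (\<chi> i. x $ Inr i)" for x
    unfolding f_def M_def by (simp add: vec_eq_iff matrix_vector_mult_def sum_UNIV_Plus mult.commute)
  have f0: "f F 0 = 0" for F by (rule linear_0[OF lin])
  have "(*v) M ` {x. \<forall>i. x $ Inr i = 0} = V"
  proof -
    have "(*v) M ` {x. \<forall>i. x $ Inr i = 0} = range (f F)"
    proof safe
      fix x :: "'n vec2" assume "\<forall>i. x $ Inr i = 0"
      then have "(\<chi> i. x $ Inr i) = (0 :: real ^ 'n)" by (simp add: vec_eq_iff)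
      then show "M *v x \<in> range (f F)" unfolding M by (simp add: f0)
    next
      fix c :: "real ^ 'n"
      define x :: "'n vec2" where "x = (\<chi> j. case j of Inl i \<Rightarrow> c $ i | Inr i \<Rightarrow> 0)"
      have "(\<chi> i. x $ Inl i) = c" "(\<chi> i. x $ Inr i) = (0 :: real ^ 'n)" unfolding x_def by (simp_all add: vec_eq_iff)
      then have "f F c = M *v x" unfolding M by (simp add: f0)
      then show "f F c \<in> (*v) M ` {x. \<forall>i. x $ Inr i = 0}" unfolding x_def by auto
    qed
    then show ?thesis using range[OF V F] by simp
  qed
  moreover have "(*v) M ` {x. \<forall>i. x $ Inl i = 0} = W"
  proof -
    have "(*v) M ` {x. \<forall>i. x $ Inl i = 0} = range (f G)"
    proof safe
      fix x :: "'n vec2" assume "\<forall>i. x $ Inl i = 0"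
      then have "(\<chi> i. x $ Inl i) = (0 :: real ^ 'n)" by (simp add: vec_eq_iff)
      then show "M *v x \<in> range (f G)" unfolding M by (simp add: f0)
    next
      fix c :: "real ^ 'n"
      define x :: "'n vec2" where "x = (\<chi> j. case j of Inr i \<Rightarrow> c $ i | Inl i \<Rightarrow> 0)"
      have "(\<chi> i. x $ Inr i) = c" "(\<chi> i. x $ Inl i) = (0 :: real ^ 'n)" unfolding x_def by (simp_all add: vec_eq_iff)
      then have "f G c = M *v x" unfolding M by (simp add: f0)
      then show "f G c \<in> (*v) M ` {x. \<forall>i. x $ Inl i = 0}" unfolding x_def by auto
    qed
    then show ?thesis using range[OF W G] by simp
  qed
  moreover have "det M \<noteq> 0"
  proof -
    have "x = 0" if "M *v x = 0" for x
    proof -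
      let ?a = "\<chi> i. x $ Inl i" and ?b = "\<chi> i. x $ Inr i"
      have "f F ?a = - f G ?b" using that unfolding M by (simp add: add_eq_0_iff)
      moreover have "f F ?a \<in> V" "- f G ?b \<in> W"
        using range[OF V F] range[OF W G] subspace_neg[OF W(1)] by blast+
      ultimately have "f F ?a \<in> V \<inter> W" by simp
      then have "f F ?a = 0" "f G ?b = 0" using VW \<open>f F ?a = - f G ?b\<close> by simp_all
      then have "?a = 0" "?b = 0" using frame_norm[OF F(2), of ?a] frame_norm[OF G(2), of ?b] unfolding f_def by auto
      then have "x $ j = 0" for j by (cases j) (auto simp: vec_eq_iff)
      then show ?thesis by (simp add: vec_eq_iff)
    qed
    then have "\<exists>N. N ** M = mat 1" unfolding matrix_left_invertible_ker by blast
    then have "invertible M" unfolding invertible_left_inverse .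
    then show ?thesis by (simp add: invertible_det_nz)
  qed
  ultimately show ?thesis by blast
qed

text \<open>Matrices adapted to the two splittings are composed; their determinants need not agree,
  which is repaired on a single coordinate axis.\<close>

lemma SL_transitive_pairs:
  fixes Vp Vm A B :: "'n::finite vec2 set"
  assumes V: "subspace Vp" "dim Vp = CARD('n)" "subspace Vm" "dim Vm = CARD('n)" "Vp \<inter> Vm = {0}"
    and A: "subspace A" "dim A = CARD('n)" "subspace B" "dim B = CARD('n)" "A \<inter> B = {0}"
  obtains g :: "'n mat2" where "det g = 1" "(*v) g ` Vp = A" "(*v) g ` Vm = B"
proof -
  let ?l = "{x :: 'n vec2. \<forall>i. x $ Inr i = 0}" and ?r = "{x :: 'n vec2. \<forall>i. x $ Inl i = 0}"
  obtain M where M: "det M \<noteq> 0" "(*v) M ` ?l = Vp" "(*v) M ` ?r = Vm" using adapted_matrix[OF V] by blast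
  obtain N where N: "det N \<noteq> 0" "(*v) N ` ?l = A" "(*v) N ` ?r = B" using adapted_matrix[OF A] by blast
  obtain M' where M': "M ** M' = mat 1" "M' ** M = mat 1" using M(1) invertible_det_nz[of M] unfolding invertible_def by blast
  have dM: "det M * det M' = 1" using M'(1) by (metis det_mul det_I)
  \<comment> \<open>Rescaling one basis vector of the first coordinate subspace by this factor
    preserves both coordinate subspaces and brings the total determinant to 1.\<close>
  define a where "a = det M / det N"
  have a: "a \<noteq> 0" using M(1) N(1) unfolding a_def by simp
  fix k :: 'n
  define d :: "real \<Rightarrow> 'n mat2" where "d b = (\<chi> i j. if i = j then (if i = Inl k then b else 1) else 0)" for b
  have dv: "(d b *v x) $ i = (if i = Inl k then b else 1) * x $ i" for b x i
    unfolding d_def matrix_vector_mult_def by (simp add: if_distrib[of "\<lambda>x. x * _"] cong: if_cong)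
  have inv: "d a *v (d (1 / a) *v x) = x" for x by (simp add: vec_eq_iff dv a)
  have "d b *v x \<in> ?l" if "x \<in> ?l" for b x using that by (simp add: dv)
  then have dl: "(*v) (d a) ` ?l = ?l" using inv by (auto simp: image_iff) metis
  have "d b *v x \<in> ?r" if "x \<in> ?r" for b x using that by (simp add: dv)
  then have dr: "(*v) (d a) ` ?r = ?r" using inv by (auto simp: image_iff) metis
  have "det (d a) = (\<Prod>i\<in>UNIV. d a $ i $ i)" by (rule det_diagonal) (simp add: d_def)
  also have "\<dots> = a" unfolding d_def by simp
  finally have dd: "det (d a) = a" .
  have inM: "(*v) M' ` Vp = ?l" "(*v) M' ` Vm = ?r"
    using matrix_image_comp[of M' M ?l] matrix_image_comp[of M' M ?r] unfolding M'(2) M(2,3) by simp_all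
  show ?thesis
  proof (rule that[of "N ** d a ** M'"])
    have "det N * a = det M" unfolding a_def using N(1) by simp
    moreover have "det (N ** d a ** M') = (det N * a) * det M'" by (simp add: det_mul dd)
    ultimately show "det (N ** d a ** M') = 1" using dM by simp
    show "(*v) (N ** d a ** M') ` Vp = A" "(*v) (N ** d a ** M') ` Vm = B"
      using inM dl dr N by (simp_all add: matrix_image_comp)
  qed
qed

lemma linear_matrix_conj: "linear (\<lambda>X :: real ^ 'b::finite ^ 'a::finite. A ** X ** B)"
proof -
  have "linear ((\<lambda>Y. Y ** B) \<circ> (\<lambda>X :: real ^ 'b ^ 'a. A ** X))"
    by (rule linear_compose[OF spec[OF conjunct1[OF bilinear_matrix_mult[unfolded bilinear_def]]]
        spec[OF conjunct2[OF bilinear_matrix_mult[unfolded bilinear_def]]]])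
  then show ?thesis by (simp add: o_def)
qed

lemma Ad_SL:
  assumes "det (g :: real ^ 'm::finite ^ 'm) = 1"
  shows "Ad SL_group g X = g ** X ** inv\<^bsub>SL_group\<^esub> g"
proof -
  have "((\<lambda>X. g ** X ** inv\<^bsub>SL_group\<^esub> g) has_derivative (\<lambda>X. g ** X ** inv\<^bsub>SL_group\<^esub> g)) (at \<one>\<^bsub>SL_group\<^esub>)"
    by (intro bounded_linear_imp_has_derivative linear_conv_bounded_linear[THEN iffD1] linear_matrix_conj)
  from fun_cong[OF frechet_derivative_at[OF this], of X, symmetric] show ?thesis
    unfolding Ad_def SL_simps .
qed

lemma has_vector_derivative_matrix_mult:
  fixes c :: "real \<Rightarrow> real ^ 'b::finite ^ 'a::finite"
  assumes "(c has_vector_derivative X) F"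
  shows "((\<lambda>t. A ** c t ** B) has_vector_derivative A ** X ** B) F"
proof -
  show ?thesis
    by (rule bounded_linear.has_vector_derivative[OF linear_matrix_conj[unfolded linear_conv_bounded_linear] assms])
qed

lemma has_vector_derivative_matrix_vector:
  fixes c :: "real \<Rightarrow> real ^ 'b::finite ^ 'a::finite"
  assumes "(c has_vector_derivative X) F"
  shows "((\<lambda>t. c t *v v) has_vector_derivative X *v v) F"
proof -
  have "linear (\<lambda>X :: real ^ 'b ^ 'a. X *v v)" using bilinear_matrix_vector unfolding bilinear_def by blast
  then show ?thesis using assms
    by (intro bounded_linear.has_vector_derivative[of "\<lambda>X. X *v v"]) (simp_all add: linear_conv_bounded_linear)
qed

text \<open>The stabilizer algebra is defined by curves, so a block-diagonal \<open>X\<close> has to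
  be realised as the velocity of a curve inside the stabilizer. A given curve in the group with
  velocity \<open>X\<close> is made block-diagonal and then normalised to determinant 1, with no
  exponential map involved.\<close>

lemma lie_stabilizer_SL:
  fixes A B V W :: "(real ^ 'm::finite) set"
  assumes A: "subspace A" "subspace B" "A \<inter> B = {0}"
    and P: "\<And>v. P *v v \<in> A" "\<And>v. v - P *v v \<in> B"
    and Z: "Z = {h. det h = 1 \<and> (*v) h ` V = A \<and> (*v) h ` W = B}" "Z \<noteq> {}"
    and X: "X \<in> lie_algebra SL_group (carrier SL_group)"
  shows "X \<in> lie_algebra SL_group (coset_stabilizer SL_group Z) \<longleftrightarrow>
     (\<forall>v\<in>A. X *v v \<in> A) \<and> (\<forall>v\<in>B. X *v v \<in> B)"
proof
  assume "X \<in> lie_algebra SL_group (coset_stabilizer SL_group Z)"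
  then obtain c where c: "\<And>t. c t \<in> coset_stabilizer SL_group Z" "(c has_vector_derivative X) (at 0)"
    unfolding lie_algebra_def by blast
  obtain g where g: "g \<in> Z" using Z(2) by blast
  have "c t ** g \<in> Z" for t
  proof -
    have "c t <#\<^bsub>SL_group\<^esub> Z = Z" using c(1) unfolding coset_stabilizer_def by blast
    then show ?thesis using g unfolding l_coset_def by auto
  qed
  then have "(*v) (c t) ` A = A" "(*v) (c t) ` B = B" for t
    using g unfolding Z(1) by (auto simp: matrix_image_comp)
  then have "c t *v v \<in> A" if "v \<in> A" for t v using that by blast
  moreover have "c t *v v \<in> B" if "v \<in> B" for t v using that \<open>\<And>t. (*v) (c t) ` B = B\<close> by blast
  ultimately show "(\<forall>v\<in>A. X *v v \<in> A) \<and> (\<forall>v\<in>B. X *v v \<in> B)"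
    using has_vector_derivative_in_subspace[OF has_vector_derivative_matrix_vector[OF c(2)]] A(1,2) by blast
next
  assume XAB: "(\<forall>v\<in>A. X *v v \<in> A) \<and> (\<forall>v\<in>B. X *v v \<in> B)"
  obtain c where c: "c 0 = mat 1" "\<And>t. det (c t) = 1" "(c has_vector_derivative X) (at 0)"
    using X unfolding lie_algebra_def by auto
  define Q where "Q = mat 1 - P"
  have Qv: "Q *v v = v - P *v v" for v unfolding Q_def by (simp add: matrix_vector_mult_diff_rdistrib)
  have PA: "P *v v = v" if "v \<in> A" for v
  proof -
    have "v - P *v v \<in> A \<inter> B" using subspace_diff[OF A(1) that P(1)] P(2) by blast
    then show ?thesis using A(3) by simp
  qed
  have PB: "P *v v = 0" if "v \<in> B" for v
  proof -
    have "P *v v \<in> A \<inter> B" using subspace_diff[OF A(2) that P(2)[of v]] P(1)[of v] by simp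
    then show ?thesis using A(3) by simp
  qed
  \<comment> \<open>The diagonal blocks of \<open>c t\<close> for the splitting into
    \<open>A\<close> and \<open>B\<close>. The velocity becomes the diagonal part of
    \<open>X\<close>, which is \<open>X\<close>, but the determinant is no longer
    controlled.\<close>
  define E where "E t = P ** c t ** P + Q ** c t ** Q" for t
  have Ev: "E t *v v = P *v (c t *v (P *v v)) + Q *v (c t *v (Q *v v))" for t v
    unfolding E_def by (simp add: matrix_vector_mult_add_rdistrib matrix_vector_mul_assoc matrix_mul_assoc)
  have EA: "E t *v v \<in> A" if "v \<in> A" for t v using that PA P(1) unfolding Ev Qv by simp
  have EB: "E t *v v \<in> B" if "v \<in> B" for t v using that PB P(2) unfolding Ev Qv by simp
  have "P *v (X *v (P *v v)) + Q *v (X *v (Q *v v)) = X *v v" for v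
  proof -
    have 1: "P *v (X *v (P *v v)) = X *v (P *v v)" using PA XAB P(1) by blast
    have "P *v (X *v (Q *v v)) = 0" using PB XAB P(2) unfolding Qv by blast
    then have 2: "Q *v (X *v (Q *v v)) = X *v (Q *v v)" unfolding Qv[of "X *v _"] by simp
    show ?thesis unfolding 1 2 unfolding Qv by (simp add: matrix_vector_mult_diff_distrib)
  qed
  then have X': "P ** X ** P + Q ** X ** Q = X"
    by (simp add: matrix_eq matrix_vector_mult_add_rdistrib matrix_vector_mul_assoc[symmetric])
  have E': "(E has_vector_derivative X) (at 0)"
    using has_vector_derivative_add[OF has_vector_derivative_matrix_mult[OF c(3), of P P] has_vector_derivative_matrix_mult[OF c(3), of Q Q]]
    unfolding E_def[abs_def] X' .
  have "P *v (P *v v) + Q *v (Q *v v) = v" for v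
    using PA[OF P(1)[of v]] PB[OF P(2)[of v]] unfolding Qv by simp
  then have E0: "E 0 = mat 1" unfolding E_def c(1)
    by (simp add: matrix_eq matrix_vector_mult_add_rdistrib matrix_vector_mul_assoc[symmetric])
  obtain d where d: "(det has_derivative d) (at (mat 1 :: real ^ 'm ^ 'm))" using det_has_derivative by blast
  have det_c: "((\<lambda>t. det (f t)) has_vector_derivative d Y) (at 0)"
    if "f 0 = mat 1" "(f has_vector_derivative Y) (at 0)" for f Y
    using vector_derivative_diff_chain_within[of f Y 0 UNIV det d] has_derivative_at_withinI[OF d] that
    by (simp add: o_def)
  have "((\<lambda>t. det (c t)) has_vector_derivative d X) (at 0)" by (rule det_c[OF c(1,3)])
  then have "((\<lambda>t :: real. 1) has_vector_derivative d X) (at 0)" unfolding c(2) .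
  from vector_derivative_unique_at[OF this has_vector_derivative_const] have "d X = 0" .
  with det_c[OF E0 E'] have dE: "((\<lambda>t. det (E t)) has_real_derivative 0) (at 0)"
    by (simp add: has_real_derivative_iff_has_vector_derivative)
  \<comment> \<open>Scaling an \<open>m\<close> by \<open>m\<close> matrix by \<open>r\<close>
    multiplies its determinant by the \<open>m\<close>-th power of \<open>r\<close>. As
    \<open>det (E t)\<close> has derivative 0 at 0, the normalising factor does not change the
    velocity.\<close>
  define a where "a = - 1 / real CARD('m)"
  define h where "h t = det (E t) powr a" for t
  have "(h has_real_derivative 0) (at 0)"
    unfolding h_def using DERIV_fun_powr[OF dE, of a] by (simp add: E0)
  then have hE: "((\<lambda>t. h t *\<^sub>R E t) has_vector_derivative X) (at 0)"
    using has_vector_derivative_scaleR[OF _ E', of h 0] by (simp add: h_def E0)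
  \<comment> \<open>The curve must lie in the stabilizer at all times; where
    \<open>det (E t)\<close> is not positive the identity is substituted, which does not affect the
    germ at 0.\<close>
  define k where "k t = (if det (E t) > 0 then h t *\<^sub>R E t else mat 1)" for t
  have "\<forall>\<^sub>F t in nhds 0. det (E t) > 0"
  proof -
    have "isCont (\<lambda>t. det (E t)) 0" by (rule DERIV_isCont[OF dE])
    then have "((\<lambda>t. det (E t)) \<longlongrightarrow> det (E 0)) (at 0)" unfolding isCont_def .
    then have "\<forall>\<^sub>F t in at 0. det (E t) > 0" by (rule order_tendstoD) (simp add: E0)
    then show ?thesis by (simp add: eventually_nhds_conv_at E0)
  qed
  then have "\<forall>\<^sub>F t in nhds 0. h t *\<^sub>R E t = k t" by eventually_elim (simp add: k_def)
  then have k': "(k has_vector_derivative X) (at 0)"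
    using hE has_vector_derivative_cong_ev[of UNIV "\<lambda>t. h t *\<^sub>R E t" k 0 X]
    by (simp add: k_def h_def E0)
  have "k t \<in> coset_stabilizer SL_group Z" for t
  proof -
    have "det (k t) = 1 \<and> (\<forall>v\<in>A. k t *v v \<in> A) \<and> (\<forall>v\<in>B. k t *v v \<in> B)"
    proof (cases "det (E t) > 0")
      case True
      have "h t ^ CARD('m) = det (E t) powr (-1)"
        unfolding h_def a_def using True by (simp add: powr_powr flip: powr_realpow)
      then have "det (k t) = 1" unfolding k_def using True by (simp add: det_scaleR powr_minus)
      moreover have "k t *v v = h t *\<^sub>R (E t *v v)" for v unfolding k_def using True by (simp add: scaleR_matrix_vector_assoc)
      ultimately show ?thesis using EA EB A(1,2) subspace_scale by metis
    qed (simp add: k_def)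
    then have k: "det (k t) = 1" "\<And>v. v \<in> A \<Longrightarrow> k t *v v \<in> A" "\<And>v. v \<in> B \<Longrightarrow> k t *v v \<in> B" by blast+
    have inj: "inj ((*v) (k t))" using SL_inv(2)[OF k(1)]
      by (metis injI matrix_vector_mul_assoc matrix_vector_mul_lid)
    have surj: "(*v) (k t) ` V = V" if "subspace V" "\<And>v. v \<in> V \<Longrightarrow> k t *v v \<in> V" for V
    proof (rule subspace_dim_equal)
      show "dim V \<le> dim ((*v) (k t) ` V)" using dim_image_eq[of "(*v) (k t)" V] inj_on_subset[OF inj] by simp
    qed (use that linear_subspace_image[of "(*v) (k t)" V] in auto)
    have kA: "(*v) (k t) ` A = A" "(*v) (k t) ` B = B" using surj A(1,2) k(2,3) by blast+
    have "k t <#\<^bsub>SL_group\<^esub> Z = Z"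
    proof
      show "k t <#\<^bsub>SL_group\<^esub> Z \<subseteq> Z" 
      proof
        fix x assume "x \<in> k t <#\<^bsub>SL_group\<^esub> Z"
        then obtain g where "g \<in> Z" "x = k t ** g" unfolding l_coset_def by auto
        then show "x \<in> Z" unfolding Z(1) using k(1) kA by (simp add: det_mul matrix_image_comp)
      qed
      show "Z \<subseteq> k t <#\<^bsub>SL_group\<^esub> Z"
      proof
        fix g assume g: "g \<in> Z"
        have "inv\<^bsub>SL_group\<^esub> (k t) ** g \<in> Z"
          using g SL_image_inv[OF k(1) kA(1)] SL_image_inv[OF k(1) kA(2)] SL_inv[OF k(1)]
          unfolding Z(1) by (simp add: det_mul matrix_image_comp)
        moreover have "g = k t ** (inv\<^bsub>SL_group\<^esub> (k t) ** g)" using SL_inv[OF k(1)] by (simp add: matrix_mul_assoc)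
        ultimately show "g \<in> k t <#\<^bsub>SL_group\<^esub> Z" unfolding l_coset_def by auto
      qed
    qed
    then show ?thesis using k(1) unfolding coset_stabilizer_def by simp
  qed
  moreover have "k 0 = mat 1" unfolding k_def h_def by (simp add: E0)
  ultimately show "X \<in> lie_algebra SL_group (coset_stabilizer SL_group Z)"
    unfolding lie_algebra_def using k' by auto
qed

section \<open>From a Lyapunov function to the Anosov property\<close>

context flow_system
begin

text \<open>Two rays with a common end stay close modulo the group: along a subsequence, the same
  elements that bring points of one ray to a limit also bring points at nonnegative times of the
  other ray to a limit.\<close>

definition asymptotic_rays :: "bool \<Rightarrow> bool" where
  "asymptotic_rays \<epsilon> \<longleftrightarrow> (\<forall>p\<in>X. \<forall>q\<in>X. \<forall>s :: nat \<Rightarrow> real. ep \<epsilon> p = ep \<epsilon> q \<longrightarrow> filterlim s at_top sequentially \<longrightarrow>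
     (\<exists>r \<gamma> t P Q. strict_mono (r :: nat \<Rightarrow> nat) \<and> (\<forall>j. \<gamma> j \<in> carrier \<Gamma>) \<and> (\<forall>j. 0 \<le> t j) \<and>
        conv (\<lambda>j. act (\<gamma> j) (flow (sg \<epsilon> * s (r j)) q)) P \<and> conv (\<lambda>j. act (\<gamma> j) (flow (sg \<epsilon> * t j) p)) Q))"

text \<open>The flow space comes without a flip map, so a ray towards the other end is taken on the
  oppositely oriented line \<open>mk \<epsilon> y x\<close>. No elements may bring distant points of
  both rays to convergent positions simultaneously.\<close>

definition opposite_rays_diverge :: "bool \<Rightarrow> bool" where
  "opposite_rays_diverge \<epsilon> \<longleftrightarrow> (\<forall>x y \<gamma> P Q. \<forall>s t :: nat \<Rightarrow> real. x \<in> bdry \<longrightarrow> y \<in> bdry \<longrightarrow> x \<noteq> y \<longrightarrow>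
     (\<forall>j. \<gamma> j \<in> carrier \<Gamma>) \<longrightarrow> filterlim s at_top sequentially \<longrightarrow> filterlim t at_top sequentially \<longrightarrow>
     conv (\<lambda>j. act (\<gamma> j) (mk \<epsilon> x y (sg \<epsilon> * s j))) P \<longrightarrow>
     conv (\<lambda>j. act (\<gamma> j) (mk \<epsilon> y x (sg \<epsilon> * t j))) Q \<longrightarrow> False)"

lemma asymptotic_raysD:
  assumes "asymptotic_rays \<epsilon>" "p \<in> X" "q \<in> X" "ep \<epsilon> p = ep \<epsilon> q" "filterlim s at_top sequentially"
  shows "\<exists>r \<gamma> t P Q. strict_mono (r :: nat \<Rightarrow> nat) \<and> (\<forall>j. \<gamma> j \<in> carrier \<Gamma>) \<and> (\<forall>j. 0 \<le> t j) \<and>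
        conv (\<lambda>j. act (\<gamma> j) (flow (sg \<epsilon> * s (r j)) q)) P \<and> conv (\<lambda>j. act (\<gamma> j) (flow (sg \<epsilon> * t j) p)) Q"
  using assms(1)[unfolded asymptotic_rays_def, rule_format, OF assms(2-5)] .

lemma opposite_rays_divergeD:
  assumes "opposite_rays_diverge \<epsilon>" "x \<in> bdry" "y \<in> bdry" "x \<noteq> y" "\<And>j. \<gamma> j \<in> carrier \<Gamma>"
    "filterlim s at_top sequentially" "filterlim t at_top sequentially"
    "conv (\<lambda>j. act (\<gamma> j) (mk \<epsilon> x y (sg \<epsilon> * s j))) P" "conv (\<lambda>j. act (\<gamma> j) (mk \<epsilon> y x (sg \<epsilon> * t j))) Q"
  shows False
  using assms(1)[unfolded opposite_rays_diverge_def, rule_format, OF assms(2-9)] .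

end

section \<open>Descent of the invariant bundles to the boundary\<close>

locale lyapunov_SL = lyapunov_rep \<Gamma> S act D "\<lambda>\<gamma>. (*v) (\<rho> \<gamma>)" step qf Cq dq
  for \<Gamma> :: "'g monoid" (structure) and S :: "'g set"
    and act :: "'g \<Rightarrow> 'g fpoint \<Rightarrow> 'g fpoint" and D :: "'g fpoint \<Rightarrow> 'g fpoint \<Rightarrow> real"
    and \<rho> :: "'g \<Rightarrow> 'n::finite mat2"
    and step :: real and qf :: "'g fpoint \<Rightarrow> 'n vec2 \<Rightarrow> real" and Cq dq :: real +
  assumes hom: "\<rho> \<in> hom \<Gamma> SL_group"
    and asym: "asymptotic_rays \<epsilon>"
    and diverge: "opposite_rays_diverge \<epsilon>"
begin

lemma det_\<rho>: "\<gamma> \<in> carrier \<Gamma> \<Longrightarrow> det (\<rho> \<gamma>) = 1"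
  using hom unfolding hom_def by auto

text \<open>A vector bounded along the ray of \<open>p\<close> but not along that of
  \<open>q\<close> would be large at points of the second ray. The elements supplied by
  \<open>asymptotic_rays\<close> place both rays in compact sets, where the averaged norms are
  comparable to the norm of the same vector \<rho>(\<gamma>)v, a contradiction.\<close>

lemma E_end:
  assumes p: "p \<in> X" and q: "q \<in> X" and e: "ep \<epsilon> p = ep \<epsilon> q"
  shows "E \<epsilon> p \<subseteq> E \<epsilon> q"
proof (rule ccontr)
  assume "\<not> E \<epsilon> p \<subseteq> E \<epsilon> q"
  then obtain v where v: "v \<in> E \<epsilon> p" "v \<notin> E \<epsilon> q" by blast
  obtain b where b: "\<And>s. s \<ge> 0 \<Longrightarrow> ip (flow (sg \<epsilon> * s) p) v v \<le> b" using v(1) unfolding E_def by blast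
  have "\<exists>s\<ge>0. real j < ip (flow (sg \<epsilon> * s) q) v v" for j :: nat
    using v(2) unfolding E_def by (auto simp: not_le)
  then obtain s where s: "\<And>j. s j \<ge> 0" "\<And>j::nat. real j < ip (flow (sg \<epsilon> * s j) q) v v" by metis
  \<comment> \<open>Over bounded times the averaged norm changes by a bounded factor, so the times
    at which it exceeds every bound are themselves unbounded.\<close>
  have "filterlim s at_top sequentially"
    unfolding filterlim_at_top
  proof
    fix M :: real
    obtain L where L: "L > 0" "\<And>p s v. p \<in> X \<Longrightarrow> \<bar>s\<bar> \<le> \<bar>M\<bar> \<Longrightarrow> ip (flow s p) v v \<le> L * ip p v v"
      using ip_flow_comparable[of "\<bar>M\<bar>"] by blast
    show "\<forall>\<^sub>F j in sequentially. M \<le> s j"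
      unfolding eventually_sequentially
    proof (intro exI[of _ "nat \<lceil>L * ip q v v\<rceil>"] allI impI)
      fix j assume "nat \<lceil>L * ip q v v\<rceil> \<le> j"
      then have "L * ip q v v \<le> real j" by linarith
      moreover have "ip (flow (sg \<epsilon> * s j) q) v v \<le> L * ip q v v" if "s j \<le> M"
        by (rule L(2)[OF q]) (use that s(1)[of j] in \<open>auto simp: sg_def\<close>)
      ultimately show "M \<le> s j" using s(2)[of j] by linarith
    qed
  qed
  from asymptotic_raysD[OF asym p q e this]
  obtain r \<gamma> t P Q where r: "strict_mono (r :: nat \<Rightarrow> nat)" and g: "\<And>j. \<gamma> j \<in> carrier \<Gamma>" and t: "\<And>j. 0 \<le> t j"
    and P: "conv (\<lambda>j. act (\<gamma> j) (flow (sg \<epsilon> * s (r j)) q)) P" and Q: "conv (\<lambda>j. act (\<gamma> j) (flow (sg \<epsilon> * t j) p)) Q"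
    by blast
  define P' where "P' j = act (\<gamma> j) (flow (sg \<epsilon> * s (r j)) q)" for j
  define Q' where "Q' j = act (\<gamma> j) (flow (sg \<epsilon> * t j) p)" for j
  have X: "P' j \<in> X" "Q' j \<in> X" for j unfolding P'_def Q'_def using g p q by auto
  obtain c1 d1 where 1: "c1 > 0" "d1 > 0" "\<And>x v. x \<in> insert P (range P') \<Longrightarrow> c1 * (norm v)\<^sup>2 \<le> ip x v v \<and> ip x v v \<le> d1 * (norm v)\<^sup>2"
    using ip_bounds[OF compact_convergent[OF X(1) P[folded P'_def]]] by blast
  obtain c2 d2 where 2: "c2 > 0" "d2 > 0" "\<And>x v. x \<in> insert Q (range Q') \<Longrightarrow> c2 * (norm v)\<^sup>2 \<le> ip x v v \<and> ip x v v \<le> d2 * (norm v)\<^sup>2"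
    using ip_bounds[OF compact_convergent[OF X(2) Q[folded Q'_def]]] by blast
  have bound: "real j \<le> d1 * (b / c2)" for j
  proof -
    let ?w = "\<rho> (\<gamma> j) *v v"
    have "real j \<le> real (r j)" using seq_suble[OF r] by simp
    also have "\<dots> < ip (flow (sg \<epsilon> * s (r j)) q) v v" by (rule s(2))
    also have "\<dots> = ip (P' j) ?w ?w" unfolding P'_def using ip_equivariant[OF g] q by simp
    also have "\<dots> \<le> d1 * (norm ?w)\<^sup>2" using 1(3)[of "P' j" ?w] by blast
    also have "\<dots> \<le> d1 * (b / c2)"
    proof (intro mult_left_mono)
      have "c2 * (norm ?w)\<^sup>2 \<le> ip (Q' j) ?w ?w" using 2(3)[of "Q' j" ?w] by blast
      also have "\<dots> = ip (flow (sg \<epsilon> * t j) p) v v" unfolding Q'_def using ip_equivariant[OF g] p by simp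
      also have "\<dots> \<le> b" by (rule b[OF t])
      finally show "(norm ?w)\<^sup>2 \<le> b / c2" using 2(1) by (simp add: field_simps)
    qed (use 1 in simp)
    finally show ?thesis by simp
  qed
  show False using bound[of "nat \<lceil>d1 * (b / c2)\<rceil> + 1"] by linarith
qed

definition Eb :: "bool \<Rightarrow> 'g bpoint \<Rightarrow> 'n vec2 set" where
  "Eb \<epsilon> x = E \<epsilon> (SOME p. p \<in> X \<and> ep \<epsilon> p = x)"

lemma Eb: assumes p: "p \<in> X" shows "Eb \<epsilon> (ep \<epsilon> p) = E \<epsilon> p"
proof -
  have "(SOME q. q \<in> X \<and> ep \<epsilon> q = ep \<epsilon> p) \<in> X \<and> ep \<epsilon> (SOME q. q \<in> X \<and> ep \<epsilon> q = ep \<epsilon> p) = ep \<epsilon> p"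
    by (rule someI[of _ p]) (use p in simp)
  then show ?thesis unfolding Eb_def using E_end[OF p, of _ \<epsilon>] E_end[OF _ p, of _ \<epsilon>] by (intro subset_antisym) auto
qed

text \<open>A common vector would decay along the line towards \<open>x\<close> and along the
  reversed line towards \<open>y\<close>. Elements following the first line make it small, and they
  are shown to follow the second line to infinity as well, against the divergence of opposite
  rays.\<close>

lemma Eb_inj: assumes x: "x \<in> bdry" "y \<in> bdry" "x \<noteq> y" shows "Eb \<epsilon> x \<noteq> Eb \<epsilon> y"
proof
  assume eq: "Eb \<epsilon> x = Eb \<epsilon> y"
  define p where "p = mk \<epsilon> x y 0"
  define q where "q = mk \<epsilon> y x 0"
  have pq: "p \<in> X" "q \<in> X" unfolding p_def q_def using x by (auto simp: mk_in_X)
  have E: "E \<epsilon> p = E \<epsilon> q" using eq Eb[OF pq(1), of \<epsilon>] Eb[OF pq(2), of \<epsilon>] unfolding p_def q_def by simp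
  have "E \<epsilon> p \<noteq> {0}" using E_dim[OF pq(1), of \<epsilon>] dim_eq_0[of "E \<epsilon> p"] by auto
  then obtain v where v: "v \<in> E \<epsilon> p" "v \<noteq> 0" using subspace_0[OF E_subspace] by blast
  have "\<forall>j::nat. \<exists>\<gamma>. \<gamma> \<in> carrier \<Gamma> \<and> act \<gamma> (flow (sg \<epsilon> * real j) p) \<in> K"
    using K_cover pq(1) flow_closed by blast
  then obtain \<gamma> where g: "\<And>j. \<gamma> j \<in> carrier \<Gamma>" "\<And>j. act (\<gamma> j) (flow (sg \<epsilon> * real j) p) \<in> K" by metis
  obtain r P where r: "strict_mono r" "P \<in> K" "conv ((\<lambda>j. act (\<gamma> j) (flow (sg \<epsilon> * real j) p)) \<circ> r) P"
    using compact_seq[OF K(1) g(2)] .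
  define P' where "P' j = act (\<gamma> (r j)) (mk \<epsilon> x y (sg \<epsilon> * real (r j)))" for j
  have P': "conv P' P" using r(3) unfolding P'_def p_def o_def by simp
  have P'X: "P' j \<in> X" for j unfolding P'_def using g(1) x by (simp add: mk_in_X)
  \<comment> \<open>The parameter is chosen so that the moved point of the reversed line has time
    coordinate 0; convergence then reduces to that of the endpoints, which are those of
    \<open>P' j\<close> interchanged.\<close>
  have "\<exists>u. act (\<gamma> (r j)) (mk \<epsilon> y x u) = mk \<epsilon> (\<beta> (\<gamma> (r j)) y) (\<beta> (\<gamma> (r j)) x) 0" for j
  proof -
    obtain \<tau> where "\<And>t. act (\<gamma> (r j)) (mk \<epsilon> y x (0 + t)) = mk \<epsilon> (\<beta> (\<gamma> (r j)) y) (\<beta> (\<gamma> (r j)) x) (\<tau> + t)"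
      using act_mk[OF g(1)[of "r j"], of \<epsilon> y x 0] x unfolding mk_in_X by blast
    from this[of "- \<tau>"] show ?thesis by (intro exI[of _ "-\<tau>"]) simp
  qed
  then obtain u where u: "\<And>j. act (\<gamma> (r j)) (mk \<epsilon> y x (u j)) = mk \<epsilon> (\<beta> (\<gamma> (r j)) y) (\<beta> (\<gamma> (r j)) x) 0" by metis
  define t where "t j = sg \<epsilon> * u j" for j
  have ut: "u j = sg \<epsilon> * t j" for j unfolding t_def sg_def by simp
  define Q' where "Q' j = act (\<gamma> (r j)) (mk \<epsilon> y x (sg \<epsilon> * t j))" for j
  have Q'_eq: "Q' j = mk \<epsilon> (\<beta> (\<gamma> (r j)) y) (\<beta> (\<gamma> (r j)) x) 0" for j unfolding Q'_def ut[symmetric] by (rule u)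
  have Q'X: "Q' j \<in> X" for j unfolding Q'_def using g(1) x by (simp add: mk_in_X)
  define Q where "Q = mk \<epsilon> (ep (\<not> \<epsilon>) P) (ep \<epsilon> P) 0"
  have PX: "P \<in> X" by (rule K_X[OF r(2)])
  have epP: "ep \<epsilon>' (P' j) = \<beta> (\<gamma> (r j)) (ep \<epsilon>' (mk \<epsilon> x y 0))" for j \<epsilon>'
  proof -
    have "mk \<epsilon> x y (sg \<epsilon> * real (r j)) \<in> X" using x by (simp add: mk_in_X)
    from ep_act[OF g(1) this] show ?thesis unfolding P'_def by (simp add: ep_def mk_def)
  qed
  have Q': "conv Q' Q"
  proof (rule convI[OF Q'X])
    show "Q \<in> X" unfolding Q_def using ep_bdry[OF PX] ep_distinct[OF PX, of \<epsilon>] by (auto simp: mk_in_X)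
    show "(\<lambda>j. snd (Q' j)) \<longlonglongrightarrow> snd Q" unfolding Q'_eq Q_def by simp
    fix \<epsilon>'
    have "ep \<epsilon>' (Q' j) = ep (\<not> \<epsilon>') (P' j)" for j
      unfolding epP Q'_eq by (cases \<epsilon>; cases \<epsilon>') (simp_all add: ep_def mk_def)
    moreover have "ep \<epsilon>' Q = ep (\<not> \<epsilon>') P" unfolding Q_def by (cases \<epsilon>; cases \<epsilon>') (simp_all add: ep_def mk_def)
    ultimately show "limitin B (\<lambda>j. ep \<epsilon>' (Q' j)) (ep \<epsilon>' Q) sequentially" using conv_ep[OF P'] by simp
  qed
  obtain C c where C: "C > 0" "c > 0"
    "\<And>p \<epsilon> v s. p \<in> X \<Longrightarrow> v \<in> E \<epsilon> p \<Longrightarrow> s \<ge> 0 \<Longrightarrow>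
        ip (flow (sg \<epsilon> * s) p) v v \<le> C * exp (- c * s) * ip p v v" using E_decay by metis
  obtain c1 d1 where 1: "c1 > 0" "d1 > 0" "\<And>x v. x \<in> insert P (range P') \<Longrightarrow> c1 * (norm v)\<^sup>2 \<le> ip x v v \<and> ip x v v \<le> d1 * (norm v)\<^sup>2"
    using ip_bounds[OF compact_convergent[OF P'X P']] by blast
  obtain c2 d2 where 2: "c2 > 0" "d2 > 0" "\<And>x v. x \<in> insert Q (range Q') \<Longrightarrow> c2 * (norm v)\<^sup>2 \<le> ip x v v \<and> ip x v v \<le> d2 * (norm v)\<^sup>2"
    using ip_bounds[OF compact_convergent[OF Q'X Q']] by blast
  have small: "ip (flow (sg \<epsilon> * t j) q) v v \<le> d2 * (C * exp (- c * real j) * ip p v v / c1)" for j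
  proof -
    let ?w = "\<rho> (\<gamma> (r j)) *v v"
    have "ip (flow (sg \<epsilon> * t j) q) v v = ip (Q' j) ?w ?w"
      unfolding Q'_def using ip_equivariant[OF g(1)[of "r j"], of "mk \<epsilon> y x (sg \<epsilon> * t j)" v v] x by (simp add: mk_in_X q_def)
    also have "\<dots> \<le> d2 * (norm ?w)\<^sup>2" using 2(3)[of "Q' j" ?w] by blast
    also have "\<dots> \<le> d2 * (C * exp (- c * real j) * ip p v v / c1)"
    proof (intro mult_left_mono)
      have "c1 * (norm ?w)\<^sup>2 \<le> ip (P' j) ?w ?w" using 1(3)[of "P' j" ?w] by blast
      also have "\<dots> = ip (flow (sg \<epsilon> * real (r j)) p) v v"
        unfolding P'_def using ip_equivariant[OF g(1)[of "r j"], of "mk \<epsilon> x y (sg \<epsilon> * real (r j))" v v] x by (simp add: mk_in_X p_def)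
      also have "\<dots> \<le> C * exp (- c * real (r j)) * ip p v v" by (rule C(3)[OF pq(1) v(1)]) simp
      also have "\<dots> \<le> C * exp (- c * real j) * ip p v v"
        using seq_suble[OF r(1), of j] C(1,2) by (intro mult_left_mono mult_right_mono) auto
      finally show "(norm ?w)\<^sup>2 \<le> C * exp (- c * real j) * ip p v v / c1" using 1(1) by (simp add: field_simps)
    qed (use 2 in simp)
    finally show ?thesis .
  qed
  \<comment> \<open>Otherwise \<open>t j\<close> stays below some \<open>M\<close> while the norm of
    \<open>v\<close> at time \<open>t j\<close> tends to 0; the decay from \<open>t j\<close> to
    \<open>M\<close> would make the fixed positive norm at time \<open>M\<close> arbitrarily
    small.\<close>
  have "filterlim t at_top sequentially"
    unfolding filterlim_at_top
  proof
    fix M :: real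
    have pos: "ip (flow (sg \<epsilon> * M) q) v v > 0" using ip_pos pq(2) v(2) by simp
    have "(\<lambda>j. C * (d2 * (C * exp (- c * real j) * ip p v v / c1))) \<longlonglongrightarrow> 0"
    proof -
      have "(\<lambda>j. exp (- c * real j)) \<longlonglongrightarrow> 0" using C(2) by real_asymp
      from tendsto_mult_left[OF this, of "C * d2 * C * ip p v v / c1"] show ?thesis by (simp add: mult_ac)
    qed
    then have "\<forall>\<^sub>F j in sequentially. C * (d2 * (C * exp (- c * real j) * ip p v v / c1)) < ip (flow (sg \<epsilon> * M) q) v v"
      by (rule order_tendstoD) (rule pos)
    then show "\<forall>\<^sub>F j in sequentially. M \<le> t j"
    proof eventually_elim
      case (elim j)
      show ?case
      proof (rule ccontr)
        assume "\<not> M \<le> t j"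
        then have M: "M - t j \<ge> 0" by simp
        have "flow (sg \<epsilon> * M) q = flow (sg \<epsilon> * (M - t j)) (flow (sg \<epsilon> * t j) q)" by (simp add: algebra_simps)
        then have "ip (flow (sg \<epsilon> * M) q) v v \<le> C * exp (- c * (M - t j)) * ip (flow (sg \<epsilon> * t j) q) v v"
          using C(3)[of "flow (sg \<epsilon> * t j) q" v \<epsilon> "M - t j"] E_flow[OF pq(2)] E v(1) M pq(2) by simp
        also have "\<dots> \<le> C * 1 * ip (flow (sg \<epsilon> * t j) q) v v"
          using C(1,2) M by (intro mult_left_mono mult_right_mono) auto
        also have "\<dots> \<le> C * (d2 * (C * exp (- c * real j) * ip p v v / c1))"
          using mult_left_mono[OF small[of j], of C] C(1) by simp
        finally show False using elim by simp
      qed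
    qed
  qed
  moreover have "filterlim (\<lambda>j. real (r j)) at_top sequentially"
    using filterlim_compose[OF filterlim_real_sequentially filterlim_subseq[OF r(1)]] .
  ultimately show False
    using opposite_rays_divergeD[where \<gamma> = "\<lambda>j. \<gamma> (r j)", OF diverge x g(1) _ _ P'[unfolded P'_def] Q'[unfolded Q'_def]]
    by simp
qed

lemma Eb_act: assumes "\<gamma> \<in> carrier \<Gamma>" "x \<in> bdry" shows "Eb \<epsilon> (\<beta> \<gamma> x) = (*v) (\<rho> \<gamma>) ` Eb \<epsilon> x"
proof -
  obtain p where p: "p \<in> X" "ep \<epsilon> p = x" using point_exists[OF assms(2)] .
  have "Eb \<epsilon> (\<beta> \<gamma> x) = E \<epsilon> (act \<gamma> p)" using Eb[of "act \<gamma> p" \<epsilon>] ep_act[OF assms(1) p(1), of \<epsilon>] assms(1) p by simp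
  also have "\<dots> = (*v) (\<rho> \<gamma>) ` E \<epsilon> p"
  proof
    show "E \<epsilon> (act \<gamma> p) \<subseteq> (*v) (\<rho> \<gamma>) ` E \<epsilon> p"
    proof
      fix v assume v: "v \<in> E \<epsilon> (act \<gamma> p)"
      have "v = \<rho> \<gamma> *v (\<rho> (inv \<gamma>) *v v)" using R_inv(2)[OF assms(1)] by simp
      then show "v \<in> (*v) (\<rho> \<gamma>) ` E \<epsilon> p" using E_act[OF assms(1) p(1)] v by (metis imageI)
    qed
  qed (use E_act[OF assms(1) p(1)] in auto)
  finally show ?thesis using Eb[OF p(1), of \<epsilon>] p(2) by simp
qed

end

lemma SL_inj: "det (A :: real ^ 'm::finite ^ 'm) = 1 \<Longrightarrow> inj ((*v) A)"
  by (rule inj_on_inverseI[where g = "(*v) (inv\<^bsub>SL_group\<^esub> A)"]) (simp add: matrix_vector_mul_assoc SL_inv)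

context flow_system
begin

lemma continuous_map_T:
  fixes f :: "'g fpoint \<Rightarrow> 'b::topological_space"
  assumes "\<And>P p. (\<And>j. P j \<in> X) \<Longrightarrow> conv P p \<Longrightarrow> (\<lambda>j. f (P j)) \<longlonglongrightarrow> f p"
  shows "continuous_map T euclidean f"
proof (rule continuous_map_sequential[OF metrizable_T])
  fix P p assume "range P \<subseteq> X" and P: "conv P p"
  then have "P j \<in> X" for j by blast
  then show "(\<lambda>j. f (P j)) \<longlonglongrightarrow> f p" by (rule assms[OF _ P])
qed

lemma continuous_map_mk:
  assumes "y \<in> bdry"
  shows "continuous_map (subtopology B (bdry - {y})) T (\<lambda>x. mk \<epsilon> x y 0)"
proof -
  have id: "continuous_map (subtopology B (bdry - {y})) B (\<lambda>x. x)"
    by (rule continuous_map_from_subtopology) (simp flip: id_def)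
  have c: "continuous_map (subtopology B (bdry - {y})) B (\<lambda>x. y)"
    using assms by simp
  show ?thesis
    unfolding flow_topology_def mk_def
    by (cases \<epsilon>) (use assms in \<open>auto simp: continuous_map_in_subtopology
        intro!: continuous_map_pairedI id c\<close>)
qed

end

section \<open>The splitting in terms of projection matrices\<close>

context lyapunov_SL
begin

definition prj :: "bool \<Rightarrow> 'g fpoint \<Rightarrow> 'n mat2" where
  "prj \<epsilon> p = (if \<epsilon> then matrix (proj p) else mat 1 - matrix (proj p))"

lemma prj_vector: assumes "p \<in> X" shows "prj \<epsilon> p *v v = (if \<epsilon> then proj p v else v - proj p v)"
  using fun_cong[OF matrix_vector_mul(2)[OF proj_linear[OF assms]], of v]
  by (simp add: prj_def matrix_vector_mult_diff_rdistrib)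

lemma prj_mem: assumes "p \<in> X" shows "prj \<epsilon> p *v v \<in> E \<epsilon> p" "v - prj \<epsilon> p *v v \<in> E (\<not> \<epsilon>) p"
  using proj_mem[OF assms, of v] by (cases \<epsilon>; simp add: prj_vector[OF assms])+

lemma prj_unique:
  assumes p: "p \<in> X" and v: "a \<in> E \<epsilon> p" "v - a \<in> E (\<not> \<epsilon>) p" shows "prj \<epsilon> p *v v = a"
proof -
  have "prj \<epsilon> p *v v - a \<in> E \<epsilon> p" by (rule subspace_diff[OF E_subspace prj_mem(1)[OF p] v(1)])
  moreover have "prj \<epsilon> p *v v - a \<in> E (\<not> \<epsilon>) p"
    using subspace_diff[OF E_subspace v(2) prj_mem(2)[OF p, of v \<epsilon>]] by simp
  ultimately have "prj \<epsilon> p *v v - a \<in> E \<epsilon> p \<inter> E (\<not> \<epsilon>) p" by blast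
  then show ?thesis unfolding E_int[OF p] by simp
qed

lemma prj_id: "p \<in> X \<Longrightarrow> v \<in> E \<epsilon> p \<Longrightarrow> prj \<epsilon> p *v v = v"
  by (rule prj_unique) (auto simp: subspace_0 E_subspace)

lemma prj_zero: "p \<in> X \<Longrightarrow> v \<in> E (\<not> \<epsilon>) p \<Longrightarrow> prj \<epsilon> p *v v = 0"
  by (rule prj_unique) (auto simp: subspace_0 E_subspace)

lemma prj_tendsto:
  assumes P: "\<And>j. P j \<in> X" "conv P p"
  shows "(\<lambda>j. prj \<epsilon> (P j)) \<longlonglongrightarrow> prj \<epsilon> p"
proof -
  have "(\<lambda>j. matrix (proj (P j)) $ a $ b) \<longlonglongrightarrow> matrix (proj p) $ a $ b" for a b
    unfolding matrix_def using tendsto_vec_nth[OF proj_tendsto[OF P tendsto_const]] by simp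
  then have "(\<lambda>j. matrix (proj (P j))) \<longlonglongrightarrow> matrix (proj p)" by (intro vec_tendstoI)
  then show ?thesis unfolding prj_def by (cases \<epsilon>) (auto intro: tendsto_intros)
qed

lemma prj_flow: "p \<in> X \<Longrightarrow> prj \<epsilon> (flow t p) = prj \<epsilon> p"
  unfolding matrix_eq using prj_unique[of "flow t p"] prj_mem E_flow by auto

lemma inv_\<rho>:
  assumes "\<gamma> \<in> carrier \<Gamma>" shows "\<rho> \<gamma> ** \<rho> (inv \<gamma>) = mat 1" "\<rho> (inv \<gamma>) ** \<rho> \<gamma> = mat 1"
  using R_inv[OF assms] by (simp_all add: matrix_eq matrix_vector_mul_assoc[symmetric])

lemma SL_inv_\<rho>: assumes "\<gamma> \<in> carrier \<Gamma>" shows "inv\<^bsub>SL_group\<^esub> (\<rho> \<gamma>) = \<rho> (inv \<gamma>)"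
proof -
  have "inv\<^bsub>SL_group\<^esub> (\<rho> \<gamma>) = inv\<^bsub>SL_group\<^esub> (\<rho> \<gamma>) ** (\<rho> \<gamma> ** \<rho> (inv \<gamma>))"
    by (simp add: inv_\<rho>[OF assms])
  also have "\<dots> = \<rho> (inv \<gamma>)" using SL_inv(2)[OF det_\<rho>[OF assms]] by (simp add: matrix_mul_assoc)
  finally show ?thesis .
qed

lemma prj_act:
  assumes "\<gamma> \<in> carrier \<Gamma>" "p \<in> X" shows "prj \<epsilon> (act \<gamma> p) = \<rho> \<gamma> ** prj \<epsilon> p ** \<rho> (inv \<gamma>)"
  unfolding matrix_eq
proof
  fix v
  let ?w = "\<rho> (inv \<gamma>) *v v"
  have v: "v = \<rho> \<gamma> *v ?w" using R_inv(2)[OF assms(1)] by simp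
  have "prj \<epsilon> (act \<gamma> p) *v v = \<rho> \<gamma> *v (prj \<epsilon> p *v ?w)"
  proof (rule prj_unique)
    show "\<rho> \<gamma> *v (prj \<epsilon> p *v ?w) \<in> E \<epsilon> (act \<gamma> p)" using prj_mem(1) E_act assms by simp
    have "v - \<rho> \<gamma> *v (prj \<epsilon> p *v ?w) = \<rho> \<gamma> *v (?w - prj \<epsilon> p *v ?w)"
      by (subst v) (simp only: matrix_vector_mult_diff_distrib)
    then show "v - \<rho> \<gamma> *v (prj \<epsilon> p *v ?w) \<in> E (\<not> \<epsilon>) (act \<gamma> p)" using prj_mem(2) E_act assms by simp
  qed (use assms in simp)
  then show "prj \<epsilon> (act \<gamma> p) *v v = (\<rho> \<gamma> ** prj \<epsilon> p ** \<rho> (inv \<gamma>)) *v v"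
    by (simp add: matrix_vector_mul_assoc matrix_mul_assoc)
qed

text \<open>Two projections along the same complement differ by a nilpotent matrix \<open>N\<close>
  of square zero, and \<open>1 + N\<close> carries one image to the other. This is an explicit local
  section of the projection from the group to the orbit of subspaces, continuous in the base
  point.\<close>

lemma unipotent_prj:
  assumes p: "p \<in> X" "p0 \<in> X" and e: "ep (\<not> \<epsilon>) p = ep (\<not> \<epsilon>) p0"
  shows "det (mat 1 + (prj \<epsilon> p - prj \<epsilon> p0)) = 1"
    and "(*v) (mat 1 + (prj \<epsilon> p - prj \<epsilon> p0)) ` E \<epsilon> p0 = E \<epsilon> p"
proof -
  have same: "E (\<not> \<epsilon>) p = E (\<not> \<epsilon>) p0" using Eb[OF p(1), of "\<not> \<epsilon>"] Eb[OF p(2), of "\<not> \<epsilon>"] e by simp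
  let ?N = "prj \<epsilon> p - prj \<epsilon> p0"
  have Nv: "?N *v v = prj \<epsilon> p *v v - prj \<epsilon> p0 *v v" for v by (rule matrix_vector_mult_diff_rdistrib)
  have N_mem: "?N *v v \<in> E (\<not> \<epsilon>) p" for v
    using subspace_diff[OF E_subspace prj_mem(2)[OF p(2), of v \<epsilon>, folded same] prj_mem(2)[OF p(1), of v \<epsilon>]]
    unfolding Nv by simp
  have N_ker: "?N *v v = 0" if "v \<in> E (\<not> \<epsilon>) p" for v
    unfolding Nv using prj_zero[OF p(1) that] prj_zero[OF p(2) that[unfolded same]] by simp
  have NN: "?N ** ?N = 0" unfolding matrix_eq using N_mem N_ker by (simp add: matrix_vector_mul_assoc[symmetric])
  \<comment> \<open>conjugating \<open>1 + N\<close> by the matrix acting as \<open>1\<close> on \<open>E \<epsilon>\<close> and as \<open>2\<close> on the complement gives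
     \<open>1 + 2N = (1 + N)\<^sup>2\<close>, whence \<open>det (1 + N) = det (1 + N)\<^sup>2\<close>\<close>
  define d where "d a = prj \<epsilon> p0 + a *\<^sub>R (mat 1 - prj \<epsilon> p0)" for a :: real
  have dv: "d a *v v = prj \<epsilon> p0 *v v + a *\<^sub>R (v - prj \<epsilon> p0 *v v)" for a v
    unfolding d_def by (simp add: matrix_vector_mult_add_rdistrib matrix_vector_mult_diff_rdistrib scaleR_matrix_vector_assoc[symmetric])
  have pp: "prj \<epsilon> p0 *v (prj \<epsilon> p0 *v v) = prj \<epsilon> p0 *v v" for v by (rule prj_id[OF p(2) prj_mem(1)[OF p(2)]])
  have "d 2 ** d (1 / 2) = mat 1"
    unfolding matrix_eq by (simp add: matrix_vector_mul_assoc[symmetric] dv pp matrix_vector_right_distrib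
      matrix_vector_mult_diff_distrib matrix_vector_mult_scaleR)
  then have "det (d 2) * det (d (1 / 2)) = 1" by (metis det_mul det_I)
  then have d2: "det (d 2) \<noteq> 0" by auto
  have "d 2 ** (mat 1 + ?N) = (mat 1 + ?N) ** (mat 1 + ?N) ** d 2"
    unfolding matrix_eq
  proof
    fix v
    have n0: "prj \<epsilon> p0 *v (?N *v w) = 0" for w by (rule prj_zero[OF p(2) N_mem[unfolded same]])
    have n1: "?N *v (d 2 *v v) = ?N *v v"
    proof -
      have "v - prj \<epsilon> p0 *v v \<in> E (\<not> \<epsilon>) p" unfolding same by (rule prj_mem(2)[OF p(2)])
      from N_ker[OF this] have "?N *v (prj \<epsilon> p0 *v v) = ?N *v v" by (simp add: matrix_vector_mult_diff_distrib)
      then show ?thesis unfolding dv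
        using N_ker[OF \<open>v - prj \<epsilon> p0 *v v \<in> E (\<not> \<epsilon>) p\<close>] by (simp only: matrix_vector_right_distrib matrix_vector_mult_scaleR) simp
    qed
    have NNv: "?N *v (?N *v w) = 0" for w by (rule N_ker[OF N_mem])
    have "d 2 *v (v + ?N *v v) = d 2 *v v + 2 *\<^sub>R (?N *v v)"
      unfolding matrix_vector_right_distrib[of "d 2"] dv[of 2 "?N *v v"] n0 by simp
    moreover have "((mat 1 + ?N) ** (mat 1 + ?N) ** d 2) *v v = d 2 *v v + 2 *\<^sub>R (?N *v v)"
      by (simp add: matrix_vector_mul_assoc[symmetric] matrix_vector_mult_add_rdistrib[of _ ?N] matrix_vector_right_distrib
          n1 NNv scaleR_2 del: matrix_vector_mult_diff_rdistrib)
    ultimately show "(d 2 ** (mat 1 + ?N)) *v v = ((mat 1 + ?N) ** (mat 1 + ?N) ** d 2) *v v"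
      by (simp add: matrix_vector_mul_assoc[symmetric] matrix_vector_mult_add_rdistrib[of _ ?N])
  qed
  then have "det (d 2) * det (mat 1 + ?N) = det (mat 1 + ?N) * det (mat 1 + ?N) * det (d 2)"
    by (simp flip: det_mul)
  then have dd: "det (mat 1 + ?N) = det (mat 1 + ?N) * det (mat 1 + ?N)" using d2 by simp
  have "(mat 1 + ?N) ** (mat 1 - ?N) = mat 1"
    unfolding matrix_eq using N_ker[OF N_mem]
    by (simp add: matrix_vector_mul_assoc[symmetric] matrix_vector_mult_add_rdistrib[of _ ?N]
      matrix_vector_mult_diff_rdistrib[of _ ?N] matrix_vector_mult_diff_distrib[of ?N])
  then have "det (mat 1 + ?N) * det (mat 1 - ?N) = 1" by (simp flip: det_mul)
  then show det: "det (mat 1 + ?N) = 1" using dd by auto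
  show "(*v) (mat 1 + ?N) ` E \<epsilon> p0 = E \<epsilon> p"
  proof (rule subspace_dim_equal)
    have inj: "inj ((*v) (mat 1 + ?N))" by (rule SL_inj[OF det])
    show "dim (E \<epsilon> p) \<le> dim ((*v) (mat 1 + ?N) ` E \<epsilon> p0)"
      using dim_image_eq[of "(*v) (mat 1 + ?N)" "E \<epsilon> p0"] inj_on_subset[OF inj] E_dim[OF p(1)] E_dim[OF p(2)] by simp
    show "(*v) (mat 1 + ?N) ` E \<epsilon> p0 \<subseteq> E \<epsilon> p"
    proof
      fix w assume "w \<in> (*v) (mat 1 + ?N) ` E \<epsilon> p0"
      then obtain v where v: "v \<in> E \<epsilon> p0" "w = (mat 1 + ?N) *v v" by blast
      have "w = prj \<epsilon> p *v v" unfolding v(2) using prj_id[OF p(2) v(1)]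
        by (simp add: matrix_vector_mult_add_rdistrib Nv)
      then show "w \<in> E \<epsilon> p" using prj_mem(1)[OF p(1)] by simp
    qed
  qed (auto simp: E_subspace linear_subspace_image)
qed

end

section \<open>The limit maps for a given pair of complementary subspaces\<close>

locale half_pair = lyapunov_SL \<Gamma> S act D \<rho> step qf Cq dq
  for \<Gamma> :: "'g monoid" (structure) and S :: "'g set"
    and act :: "'g \<Rightarrow> 'g fpoint \<Rightarrow> 'g fpoint" and D :: "'g fpoint \<Rightarrow> 'g fpoint \<Rightarrow> real"
    and \<rho> :: "'g \<Rightarrow> 'n::finite mat2"
    and step :: real and qf :: "'g fpoint \<Rightarrow> 'n vec2 \<Rightarrow> real" and Cq dq :: real +
  fixes V :: "bool \<Rightarrow> 'n vec2 set"
  assumes V: "subspace (V \<epsilon>)" "dim (V \<epsilon>) = CARD('n)" "V True \<inter> V False = {0}"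
begin

definition \<xi> :: "bool \<Rightarrow> 'g bpoint \<Rightarrow> 'n mat2 set" where
  "\<xi> \<epsilon> x = {h. det h = 1 \<and> (*v) h ` V \<epsilon> = Eb \<epsilon> x}"

lemma frame_exists:
  assumes "p \<in> X"
  obtains g where "det g = 1" "(*v) g ` V True = E True p" "(*v) g ` V False = E False p"
  using SL_transitive_pairs[OF V(1,2) V(1,2,3) E_subspace E_dim[OF assms] E_subspace E_dim[OF assms], of True False]
    E_int[OF assms, of True] by auto

lemma frame_exists1:
  assumes "p \<in> X" obtains g where "det g = 1" "(*v) g ` V \<epsilon> = E \<epsilon> p"
proof -
  obtain g where g: "det g = 1" "(*v) g ` V True = E True p" "(*v) g ` V False = E False p"
    using frame_exists[OF assms] .
  show ?thesis by (rule that[OF g(1)]) (cases \<epsilon>; simp add: g)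
qed

lemma \<xi>_coset: "p \<in> X \<Longrightarrow> det g = 1 \<Longrightarrow> (*v) g ` V \<epsilon> = E \<epsilon> p \<Longrightarrow>
    g <#\<^bsub>SL_group\<^esub> SL_stabilizer (V \<epsilon>) = \<xi> \<epsilon> (ep \<epsilon> p)"
  unfolding \<xi>_def by (simp add: l_coset_SL Eb)

text \<open>Openness in the coset topology is tested on the group, so a continuous lift to matrices
  is wanted; it is found locally, on the complement of a point.\<close>

lemma \<xi>_continuous: "continuous_map B (coset_topology SL_group (SL_stabilizer (V \<epsilon>))) (\<xi> \<epsilon>)"
  unfolding continuous_map_def
proof (intro conjI allI impI)
  show "\<xi> \<epsilon> \<in> topspace B \<rightarrow> topspace (coset_topology SL_group (SL_stabilizer (V \<epsilon>)))"
  proof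
    fix x assume "x \<in> topspace B"
    then have "x \<in> bdry" by simp
    then obtain p where p: "p \<in> X" "ep \<epsilon> p = x" using point_exists[of x \<epsilon>] by blast
    obtain g where g: "det g = 1" "(*v) g ` V \<epsilon> = E \<epsilon> p" using frame_exists1[OF p(1)] .
    then show "\<xi> \<epsilon> x \<in> topspace (coset_topology SL_group (SL_stabilizer (V \<epsilon>)))"
      using \<xi>_coset[OF p(1) g] p(2) unfolding topspace_coset LCOSETS_def by force
  qed
  fix U assume U: "openin (coset_topology SL_group (SL_stabilizer (V \<epsilon>))) U"
  show "openin B {x \<in> topspace B. \<xi> \<epsilon> x \<in> U}"
  proof (subst openin_subopen, intro ballI)
    fix x0 assume x0: "x0 \<in> {x \<in> topspace B. \<xi> \<epsilon> x \<in> U}"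
    \<comment> \<open>Holding the opposite end fixed at \<open>y\<close> keeps the complementary
      bundle constant, which is what \<open>unipotent_prj\<close> requires.\<close>
    then obtain y where y: "y \<in> bdry" "y \<noteq> x0" using boundary_two_points[of x0] by auto
    define U0 where "U0 = bdry - {y}"
    have X: "mk \<epsilon> x y 0 \<in> X" if "x \<in> U0" for x using that y unfolding U0_def by (simp add: mk_in_X)
    have x0U: "x0 \<in> U0" using x0 y unfolding U0_def by simp
    define p0 where "p0 = mk \<epsilon> x0 y 0"
    obtain g where g: "det g = 1" "(*v) g ` V \<epsilon> = E \<epsilon> p0" using frame_exists1[OF X[OF x0U]] p0_def by metis
    define h where "h x = (mat 1 + (prj \<epsilon> (mk \<epsilon> x y 0) - prj \<epsilon> p0)) ** g" for x
    have h: "det (h x) = 1" "h x <#\<^bsub>SL_group\<^esub> SL_stabilizer (V \<epsilon>) = \<xi> \<epsilon> x" if "x \<in> U0" for x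
    proof -
      have e: "ep (\<not> \<epsilon>) (mk \<epsilon> x y 0) = ep (\<not> \<epsilon>) p0" unfolding p0_def by simp
      note u = unipotent_prj[OF X[OF that] X[OF x0U, folded p0_def] e]
      show d: "det (h x) = 1" unfolding h_def det_mul u(1) g(1) by simp
      have "(*v) (h x) ` V \<epsilon> = E \<epsilon> (mk \<epsilon> x y 0)" unfolding h_def matrix_image_comp g(2) u(2) ..
      then show "h x <#\<^bsub>SL_group\<^esub> SL_stabilizer (V \<epsilon>) = \<xi> \<epsilon> x" using \<xi>_coset[OF X[OF that] d] by simp
    qed
    have c1: "continuous_map T euclidean (\<lambda>p. (mat 1 + (prj \<epsilon> p - prj \<epsilon> p0)) ** g)"
      by (rule continuous_map_T) (intro tendsto_intros prj_tendsto)
    have "continuous_map (subtopology B U0) euclidean h"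
      using continuous_map_compose[OF continuous_map_mk[OF y(1), of \<epsilon>, folded U0_def] c1] unfolding h_def o_def .
    then have c: "continuous_map (subtopology B U0) (top_of_set (carrier SL_group)) h"
      using h(1) by (auto simp: continuous_map_in_subtopology)
    have "openin (top_of_set (carrier SL_group)) {k \<in> carrier SL_group. k <#\<^bsub>SL_group\<^esub> SL_stabilizer (V \<epsilon>) \<in> U}"
      using U unfolding openin_coset_topology by blast
    from openin_continuous_map_preimage[OF c this]
    have "openin (subtopology B U0) {x \<in> topspace (subtopology B U0). h x \<in> {k \<in> carrier SL_group. k <#\<^bsub>SL_group\<^esub> SL_stabilizer (V \<epsilon>) \<in> U}}" .
    also have "{x \<in> topspace (subtopology B U0). h x \<in> {k \<in> carrier SL_group. k <#\<^bsub>SL_group\<^esub> SL_stabilizer (V \<epsilon>) \<in> U}}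
        = {x \<in> U0. \<xi> \<epsilon> x \<in> U}"
    proof -
      have "topspace (subtopology B U0) = U0" unfolding U0_def by auto
      then show ?thesis using h by auto
    qed
    finally have "openin (subtopology B U0) {x \<in> U0. \<xi> \<epsilon> x \<in> U}" .
    then have "openin B {x \<in> U0. \<xi> \<epsilon> x \<in> U}"
      by (rule openin_trans_full) (simp add: U0_def boundary_T1)
    then show "\<exists>W. openin B W \<and> x0 \<in> W \<and> W \<subseteq> {x \<in> topspace B. \<xi> \<epsilon> x \<in> U}"
      using x0 x0U unfolding U0_def by (intro exI[of _ "{x \<in> U0. \<xi> \<epsilon> x \<in> U}"]) (auto simp: U0_def)
  qed
qed

lemma \<xi>_inter: "p \<in> X \<Longrightarrow> \<xi> True (end_plus p) \<inter> \<xi> False (end_minus p) =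
    {h. det h = 1 \<and> (*v) h ` V True = E True p \<and> (*v) h ` V False = E False p}"
  using Eb[of p True] Eb[of p False] unfolding \<xi>_def ep_def by auto

lemma \<xi>_limit_maps:
  "limit_maps \<Gamma> S SL_group (SL_stabilizer (V True)) (SL_stabilizer (V False)) \<rho> (\<xi> True) (\<xi> False)"
  unfolding limit_maps_def
proof (intro conjI ballI)
  have inj: "inj_on (\<xi> \<epsilon>) bdry" for \<epsilon>
  proof (rule inj_onI, rule ccontr)
    fix x y assume xy: "x \<in> bdry" "y \<in> bdry" "\<xi> \<epsilon> x = \<xi> \<epsilon> y" "x \<noteq> y"
    obtain p where p: "p \<in> X" "ep \<epsilon> p = x" using point_exists[OF xy(1)] .
    obtain g where g: "det g = 1" "(*v) g ` V \<epsilon> = E \<epsilon> p" using frame_exists1[OF p(1)] .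
    have "g \<in> \<xi> \<epsilon> x" unfolding \<xi>_def using g Eb[OF p(1), of \<epsilon>] p(2) by simp
    moreover from this have "g \<in> \<xi> \<epsilon> y" using xy(3) by simp
    ultimately show False unfolding \<xi>_def using Eb_inj[OF xy(1,2,4), of \<epsilon>] by simp
  qed
  show "inj_on (\<xi> True) bdry" "inj_on (\<xi> False) bdry" by (rule inj)+
  fix \<gamma> x assume g: "\<gamma> \<in> carrier \<Gamma>" "x \<in> bdry"
  have eq: "\<xi> \<epsilon> (\<beta> \<gamma> x) = \<rho> \<gamma> <#\<^bsub>SL_group\<^esub> \<xi> \<epsilon> x" for \<epsilon>
  proof
    show "\<rho> \<gamma> <#\<^bsub>SL_group\<^esub> \<xi> \<epsilon> x \<subseteq> \<xi> \<epsilon> (\<beta> \<gamma> x)"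
    proof
      fix k assume "k \<in> \<rho> \<gamma> <#\<^bsub>SL_group\<^esub> \<xi> \<epsilon> x"
      then obtain h where "h \<in> \<xi> \<epsilon> x" "k = \<rho> \<gamma> ** h" unfolding l_coset_def by auto
      then show "k \<in> \<xi> \<epsilon> (\<beta> \<gamma> x)" unfolding \<xi>_def using Eb_act[OF g] det_\<rho>[OF g(1)]
        by (simp add: det_mul matrix_image_comp)
    qed
    show "\<xi> \<epsilon> (\<beta> \<gamma> x) \<subseteq> \<rho> \<gamma> <#\<^bsub>SL_group\<^esub> \<xi> \<epsilon> x"
    proof
      fix k assume k: "k \<in> \<xi> \<epsilon> (\<beta> \<gamma> x)"
      have "(*v) (\<rho> (inv \<gamma>)) ` ((*v) (\<rho> \<gamma>) ` Eb \<epsilon> x) = Eb \<epsilon> x"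
        unfolding matrix_image_comp[symmetric] inv_\<rho>(2)[OF g(1)] by simp
      then have "\<rho> (inv \<gamma>) ** k \<in> \<xi> \<epsilon> x" using k det_\<rho>[of "inv \<gamma>"] g(1)
        unfolding \<xi>_def Eb_act[OF g] by (simp add: det_mul matrix_image_comp)
      moreover have "k = \<rho> \<gamma> ** (\<rho> (inv \<gamma>) ** k)" by (simp add: matrix_mul_assoc inv_\<rho>[OF g(1)])
      ultimately show "k \<in> \<rho> \<gamma> <#\<^bsub>SL_group\<^esub> \<xi> \<epsilon> x" unfolding l_coset_def by auto
    qed
  qed
  show "\<xi> True (\<beta> \<gamma> x) = \<rho> \<gamma> <#\<^bsub>SL_group\<^esub> \<xi> True x" "\<xi> False (\<beta> \<gamma> x) = \<rho> \<gamma> <#\<^bsub>SL_group\<^esub> \<xi> False x"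
    by (rule eq)+
next
  fix p assume p: "p \<in> X"
  obtain g where g: "det g = 1" "(*v) g ` V True = E True p" "(*v) g ` V False = E False p" using frame_exists[OF p] .
  show "\<xi> True (end_plus p) \<inter> \<xi> False (end_minus p) \<in> lcosets\<^bsub>SL_group\<^esub> (SL_stabilizer (V True) \<inter> SL_stabilizer (V False))"
    unfolding \<xi>_inter[OF p] LCOSETS_def using l_coset_SL_pair[OF g] g(1) by force
qed (rule \<xi>_continuous)+

end

section \<open>Contraction on the tangent spaces, through the adjoint action\<close>

context lyapunov_SL
begin

definition RM :: "'g \<Rightarrow> 'n mat2 \<Rightarrow> 'n mat2" where
  "RM \<gamma> Y = \<rho> \<gamma> ** Y ** \<rho> (inv \<gamma>)"

lemma \<rho>_mult: "\<gamma> \<in> carrier \<Gamma> \<Longrightarrow> \<eta> \<in> carrier \<Gamma> \<Longrightarrow> \<rho> (\<gamma> \<otimes> \<eta>) = \<rho> \<gamma> ** \<rho> \<eta>"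
  using hom unfolding hom_def by auto

lemma \<rho>_one: "\<rho> \<one> = mat 1"
  using R_one by (simp add: matrix_eq)

text \<open>The averaging construction is reused for the conjugation action on matrices; it yields
  equivariant norms on the Lie algebra.\<close>

sublocale MM: flow_rep \<Gamma> S act D RM
proof (intro flow_rep.intro flow_rep_axioms.intro flow_system_axioms)
  fix \<gamma> \<eta> Y assume g: "\<gamma> \<in> carrier \<Gamma>"
  show "linear (RM \<gamma>)" unfolding RM_def[abs_def] by (rule linear_matrix_conj)
  assume h: "\<eta> \<in> carrier \<Gamma>"
  show "RM (\<gamma> \<otimes> \<eta>) Y = RM \<gamma> (RM \<eta> Y)"
    using g h by (simp add: RM_def \<rho>_mult inv_mult_group matrix_mul_assoc)
next
  show "RM \<one> Y = Y" for Y by (simp add: RM_def \<rho>_one)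
qed

text \<open>The off-diagonal part represents a tangent vector of the space of splittings: its kernel
  on the Lie algebra is the stabilizer of the splitting.\<close>

definition od :: "'g fpoint \<Rightarrow> 'n mat2 \<Rightarrow> 'n mat2" where
  "od p Y = prj True p ** Y ** prj False p + prj False p ** Y ** prj True p"

lemma linear_od: "linear (od p)"
  unfolding od_def[abs_def] by (intro linear_compose_add linear_matrix_conj)

lemma od_vector: "od p Y *v v = prj True p *v (Y *v (prj False p *v v)) + prj False p *v (Y *v (prj True p *v v))"
  unfolding od_def by (simp add: matrix_vector_mult_add_rdistrib matrix_vector_mul_assoc matrix_mul_assoc)

lemma od_act:
  assumes g: "\<gamma> \<in> carrier \<Gamma>" and p: "p \<in> X"
  shows "od (act \<gamma> p) (RM \<gamma> Y) = RM \<gamma> (od p Y)"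
proof -
  have c: "A ** (\<rho> (inv \<gamma>) ** (\<rho> \<gamma> ** Z)) = A ** Z" for A Z :: "'n mat2"
    using inv_\<rho>(2)[OF g] by (metis matrix_mul_assoc matrix_mul_lid)
  show ?thesis
    unfolding od_def RM_def prj_act[OF g p] by (simp add: matrix_mul_assoc[symmetric] c matrix_add_ldistrib
      bilinear_radd[OF bilinear_matrix_mult] bilinear_ladd[OF bilinear_matrix_mult])
qed

lemma od_flow: "p \<in> X \<Longrightarrow> od (flow t p) Y = od p Y"
  unfolding od_def by (simp add: prj_flow)

lemma od_tendsto:
  assumes "\<And>j. P j \<in> X" "conv P p" "Y \<longlonglongrightarrow> Z"
  shows "(\<lambda>j. od (P j) (Y j)) \<longlonglongrightarrow> od p Z"
  unfolding od_def by (intro tendsto_intros prj_tendsto assms)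

lemma od_zero_iff:
  assumes p: "p \<in> X"
  shows "od p Y = 0 \<longleftrightarrow> (\<forall>v\<in>E True p. Y *v v \<in> E True p) \<and> (\<forall>v\<in>E False p. Y *v v \<in> E False p)"
proof
  assume od: "od p Y = 0"
  have "Y *v v \<in> E \<epsilon> p" if v: "v \<in> E \<epsilon> p" for v \<epsilon>
  proof -
    have "od p Y *v v = prj (\<not> \<epsilon>) p *v (Y *v v)"
      using prj_id[OF p v] prj_zero[OF p, of v "\<not> \<epsilon>"] v unfolding od_vector by (cases \<epsilon>) auto
    then have "prj (\<not> \<epsilon>) p *v (Y *v v) = 0" using od by simp
    then show ?thesis using prj_mem(2)[OF p, of "Y *v v" "\<not> \<epsilon>"] by simp
  qed
  then show "(\<forall>v\<in>E True p. Y *v v \<in> E True p) \<and> (\<forall>v\<in>E False p. Y *v v \<in> E False p)" by blast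
next
  assume *: "(\<forall>v\<in>E True p. Y *v v \<in> E True p) \<and> (\<forall>v\<in>E False p. Y *v v \<in> E False p)"
  have 1: "prj True p *v (Y *v (prj False p *v v)) = 0" for v
    using prj_zero[OF p, of "Y *v (prj False p *v v)" True] prj_mem(1)[OF p, of False v] * by simp
  have 2: "prj False p *v (Y *v (prj True p *v v)) = 0" for v
    using prj_zero[OF p, of "Y *v (prj True p *v v)" False] prj_mem(1)[OF p, of True v] * by simp
  show "od p Y = 0" unfolding matrix_eq od_vector 1 2 by simp
qed

lemma prj_bound: "\<exists>C>0. \<forall>p\<in>K. \<forall>v. norm (prj \<epsilon> p *v v) \<le> C * norm v"
proof -
  have "\<exists>c>0. \<forall>p\<in>K. \<forall>v :: real. norm v = 1 \<longrightarrow> norm (prj \<epsilon> p) \<le> c"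
    by (rule compact_upper_bound[OF K(1)], rule tendsto_norm, rule prj_tendsto) (simp_all add: K_X)
  then obtain c where c: "c > 0" "\<And>p. p \<in> K \<Longrightarrow> norm (prj \<epsilon> p) \<le> c" by (metis norm_one)
  have "norm (prj \<epsilon> p *v v) \<le> c * norm v" if "p \<in> K" for p v
    using norm_matrix_vector_le[of "prj \<epsilon> p" v] mult_right_mono[OF c(2)[OF that], of "norm v"] by simp
  then show ?thesis using c(1) by blast
qed

definition NM :: "'g fpoint \<Rightarrow> 'n mat2 \<Rightarrow> real" where
  "NM p Y = sqrt (MM.ip p (od p Y) (od p Y))"

text \<open>The off-diagonal part of \<open>Y\<close> maps \<open>E \<epsilon>\<close>, which expands in the backward \<open>\<epsilon>\<close>-direction, to the
  complementary bundle, which contracts in that direction.\<close>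

lemma NM_contracts:
  "\<exists>C>0. \<exists>c>0. \<forall>p\<in>X. \<forall>t\<ge>0. \<forall>\<epsilon>. \<forall>Y. (\<forall>v\<in>E (\<not> \<epsilon>) p. Y *v v \<in> E (\<not> \<epsilon>) p) \<longrightarrow>
     NM (flow (sg (\<not> \<epsilon>) * t) p) Y \<le> C * exp (- c * t) * NM p Y"
proof -
  obtain C c where C: "C > 0" "c > 0"
    "\<And>p \<epsilon> v s. p \<in> X \<Longrightarrow> v \<in> E \<epsilon> p \<Longrightarrow> s \<ge> 0 \<Longrightarrow>
        ip (flow (sg \<epsilon> * s) p) v v \<le> C * exp (- c * s) * ip p v v" using E_decay by metis
  obtain c0 d0 where cd: "c0 > 0" "d0 > 0"
    "\<And>p v. p \<in> K \<Longrightarrow> c0 * (norm v)\<^sup>2 \<le> ip p v v \<and> ip p v v \<le> d0 * (norm v)\<^sup>2"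
    using ip_bounds[OF K(1)] by blast
  obtain c1 d1 where cM: "c1 > 0" "d1 > 0"
    "\<And>p v. p \<in> K \<Longrightarrow> c1 * (norm v)\<^sup>2 \<le> MM.ip p v v \<and> MM.ip p v v \<le> d1 * (norm v)\<^sup>2"
    using MM.ip_bounds[OF K(1)] by blast
  obtain CT where CT: "CT > 0" "\<And>p v. p \<in> K \<Longrightarrow> norm (prj True p *v v) \<le> CT * norm v" using prj_bound[of True] by blast
  obtain CF where CF: "CF > 0" "\<And>p v. p \<in> K \<Longrightarrow> norm (prj False p *v v) \<le> CF * norm v" using prj_bound[of False] by blast
  define CP where "CP = max CT CF"
  have CP: "norm (prj \<epsilon> p *v v) \<le> CP * norm v" if "p \<in> K" for \<epsilon> p v
  proof -
    have "CT * norm v \<le> CP * norm v" "CF * norm v \<le> CP * norm v" unfolding CP_def by (auto intro: mult_right_mono)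
    then show ?thesis using CT(2)[OF that, of v] CF(2)[OF that, of v] by (cases \<epsilon>) auto
  qed
  have CP0: "CP > 0" unfolding CP_def using CT(1) by simp
  define C2 where "C2 = 1 / c0 * (C * (d0 * (1 / c0 * (C * (d0 * CP\<^sup>2)))))"
  have C2: "C2 > 0" unfolding C2_def using C cd CP0 by simp
  define C3 where "C3 = d1 * (real CARD('n + 'n) * C2) / c1"
  have C3: "C3 > 0" unfolding C3_def using cM C2 by simp
  have main: "NM (flow (sg (\<not> \<epsilon>) * t) p) Y \<le> sqrt C3 * exp (- c * t) * NM p Y"
    if p: "p \<in> X" and t: "t \<ge> 0" and Y: "\<forall>v\<in>E (\<not> \<epsilon>) p. Y *v v \<in> E (\<not> \<epsilon>) p" for p t \<epsilon> Y
  proof -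
    define p' where "p' = flow (sg (\<not> \<epsilon>) * t) p"
    have p': "p' \<in> X" unfolding p'_def using p by simp
    have p_eq: "p = flow (sg \<epsilon> * t) p'" unfolding p'_def by (simp add: sg_def)
    define Z where "Z = od p Y"
    have Z: "Z *v v = prj (\<not> \<epsilon>) p *v (Y *v (prj \<epsilon> p *v v))" for v
    proof -
      have "prj \<epsilon> p *v (Y *v (prj (\<not> \<epsilon>) p *v v)) = 0"
        by (rule prj_zero[OF p]) (use Y prj_mem(1)[OF p] in blast)
      then show ?thesis unfolding Z_def od_vector by (cases \<epsilon>) auto
    qed
    have Z_mem: "Z *v v \<in> E (\<not> \<epsilon>) p" for v unfolding Z by (rule prj_mem(1)[OF p])
    have Z_prj: "Z *v (prj \<epsilon> p *v v) = Z *v v" for v unfolding Z using prj_id[OF p prj_mem(1)[OF p]] by simp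
    obtain \<gamma> where g: "\<gamma> \<in> carrier \<Gamma>" "act \<gamma> p \<in> K" using K_cover[OF p] .
    obtain \<eta> where h: "\<eta> \<in> carrier \<Gamma>" "act \<eta> p' \<in> K" using K_cover[OF p'] .
    \<comment> \<open>With \<open>a\<close> in \<open>E \<epsilon>\<close>, passing from
      \<open>p'\<close> to \<open>p\<close> contracts \<open>a\<close>, and passing from
      \<open>p\<close> back to \<open>p'\<close> contracts \<open>Z *v a\<close>. In squared norms
      each passage contributes a factor \<open>exp (- c * t)\<close>.\<close>
    have vec: "(norm (RM \<eta> Z *v w))\<^sup>2 \<le> C2 * exp (- (2 * c) * t) * (norm (RM \<gamma> Z))\<^sup>2" if w: "norm w = 1" for w
    proof -
      define a where "a = prj \<epsilon> p *v (\<rho> (inv \<eta>) *v w)"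
      have a: "a \<in> E \<epsilon> p" unfolding a_def by (rule prj_mem(1)[OF p])
      have \<eta>a: "\<rho> \<eta> *v a = prj \<epsilon> (act \<eta> p') *v w"
        unfolding a_def p_eq prj_flow[OF p'] prj_act[OF h(1) p'] by (simp add: matrix_vector_mul_assoc matrix_mul_assoc)
      have "RM \<eta> Z *v w = \<rho> \<eta> *v (Z *v a)"
        unfolding RM_def a_def Z_prj by (simp add: matrix_vector_mul_assoc matrix_mul_assoc)
      then have "(norm (RM \<eta> Z *v w))\<^sup>2 \<le> 1 / c0 * ip (act \<eta> p') (\<rho> \<eta> *v (Z *v a)) (\<rho> \<eta> *v (Z *v a))"
        using conjunct1[OF cd(3)[OF h(2), of "\<rho> \<eta> *v (Z *v a)"]] cd(1) by (simp add: field_simps)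
      also have "\<dots> = 1 / c0 * ip p' (Z *v a) (Z *v a)" using ip_equivariant[OF h(1) p'] by simp
      also have "\<dots> \<le> 1 / c0 * (C * exp (- c * t) * ip p (Z *v a) (Z *v a))"
        unfolding p'_def using C(3)[OF p Z_mem t] cd(1) by (intro mult_left_mono) auto
      also have "ip p (Z *v a) (Z *v a) = ip (act \<gamma> p) (\<rho> \<gamma> *v (Z *v a)) (\<rho> \<gamma> *v (Z *v a))"
        using ip_equivariant[OF g(1) p] by simp
      also have "1 / c0 * (C * exp (- c * t) * \<dots>) \<le> 1 / c0 * (C * exp (- c * t) * (d0 * (norm (RM \<gamma> Z) * norm (\<rho> \<gamma> *v a))\<^sup>2))"
      proof (intro mult_left_mono)
        have "\<rho> \<gamma> *v (Z *v a) = RM \<gamma> Z *v (\<rho> \<gamma> *v a)"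
          unfolding RM_def using inv_\<rho>(2)[OF g(1)] by (metis matrix_vector_mul_assoc matrix_vector_mul_lid)
        then have "norm (\<rho> \<gamma> *v (Z *v a)) \<le> norm (RM \<gamma> Z) * norm (\<rho> \<gamma> *v a)" using norm_matrix_vector_le by simp
        then have "d0 * (norm (\<rho> \<gamma> *v (Z *v a)))\<^sup>2 \<le> d0 * (norm (RM \<gamma> Z) * norm (\<rho> \<gamma> *v a))\<^sup>2"
          using cd(2) by (intro mult_left_mono power_mono) auto
        then show "ip (act \<gamma> p) (\<rho> \<gamma> *v (Z *v a)) (\<rho> \<gamma> *v (Z *v a)) \<le> d0 * (norm (RM \<gamma> Z) * norm (\<rho> \<gamma> *v a))\<^sup>2"
          using conjunct2[OF cd(3)[OF g(2), of "\<rho> \<gamma> *v (Z *v a)"]] by linarith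
      qed (use cd C in auto)
      also have "\<dots> \<le> 1 / c0 * (C * exp (- c * t) * (d0 * ((norm (RM \<gamma> Z))\<^sup>2 * (1 / c0 * (C * exp (- c * t) * (d0 * CP\<^sup>2))))))"
        unfolding power_mult_distrib
      proof (intro mult_left_mono)
        have "(norm (\<rho> \<gamma> *v a))\<^sup>2 \<le> 1 / c0 * ip (act \<gamma> p) (\<rho> \<gamma> *v a) (\<rho> \<gamma> *v a)"
          using conjunct1[OF cd(3)[OF g(2), of "\<rho> \<gamma> *v a"]] cd(1) by (simp add: field_simps)
        also have "\<dots> = 1 / c0 * ip p a a" using ip_equivariant[OF g(1) p] by simp
        also have "\<dots> \<le> 1 / c0 * (C * exp (- c * t) * ip p' a a)"
          using C(3)[OF p' _ t, of a \<epsilon>] a cd(1) p_eq E_flow[OF p'] by (intro mult_left_mono) auto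
        also have "ip p' a a = ip (act \<eta> p') (\<rho> \<eta> *v a) (\<rho> \<eta> *v a)" using ip_equivariant[OF h(1) p'] by simp
        also have "1 / c0 * (C * exp (- c * t) * \<dots>) \<le> 1 / c0 * (C * exp (- c * t) * (d0 * CP\<^sup>2))"
        proof (intro mult_left_mono)
          have "norm (\<rho> \<eta> *v a) \<le> CP" unfolding \<eta>a using CP[OF h(2), of \<epsilon> w] w by simp
          then have "d0 * (norm (\<rho> \<eta> *v a))\<^sup>2 \<le> d0 * CP\<^sup>2" using cd(2) by (intro mult_left_mono power_mono) auto
          then show "ip (act \<eta> p') (\<rho> \<eta> *v a) (\<rho> \<eta> *v a) \<le> d0 * CP\<^sup>2"
            using conjunct2[OF cd(3)[OF h(2), of "\<rho> \<eta> *v a"]] by linarith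
        qed (use cd C in auto)
        finally show "(norm (\<rho> \<gamma> *v a))\<^sup>2 \<le> 1 / c0 * (C * exp (- c * t) * (d0 * CP\<^sup>2))" .
      qed (use cd C in auto)
      also have "\<dots> = C2 * (exp (- c * t) * exp (- c * t)) * (norm (RM \<gamma> Z))\<^sup>2" unfolding C2_def by simp
      also have "exp (- c * t) * exp (- c * t) = exp (- (2 * c) * t)"
        unfolding exp_add[symmetric] by (simp add: algebra_simps)
      finally show ?thesis .
    qed
    have "(norm (RM \<eta> Z))\<^sup>2 \<le> (\<Sum>j\<in>(UNIV :: ('n + 'n) set). C2 * exp (- (2 * c) * t) * (norm (RM \<gamma> Z))\<^sup>2)"
      unfolding norm_matrix_columns[of "RM \<eta> Z"] by (intro sum_mono vec) simp
    then have mat: "(norm (RM \<eta> Z))\<^sup>2 \<le> real CARD('n + 'n) * C2 * exp (- (2 * c) * t) * (norm (RM \<gamma> Z))\<^sup>2" by simp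
    have "MM.ip p' Z Z = MM.ip (act \<eta> p') (RM \<eta> Z) (RM \<eta> Z)" using MM.ip_equivariant[OF h(1) p'] by simp
    also have "\<dots> \<le> d1 * (norm (RM \<eta> Z))\<^sup>2" using cM(3)[OF h(2)] by blast
    also have "\<dots> \<le> d1 * (real CARD('n + 'n) * C2 * exp (- (2 * c) * t) * (norm (RM \<gamma> Z))\<^sup>2)"
      using mat cM(2) by (intro mult_left_mono) auto
    also have "\<dots> = C3 * exp (- (2 * c) * t) * (c1 * (norm (RM \<gamma> Z))\<^sup>2)" unfolding C3_def using cM(1) by simp
    also have "\<dots> \<le> C3 * exp (- (2 * c) * t) * MM.ip (act \<gamma> p) (RM \<gamma> Z) (RM \<gamma> Z)"
      using cM(3)[OF g(2)] C3 by (intro mult_left_mono) auto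
    also have "\<dots> = C3 * exp (- (2 * c) * t) * MM.ip p Z Z" using MM.ip_equivariant[OF g(1) p] by simp
    finally have "sqrt (MM.ip p' Z Z) \<le> sqrt (C3 * exp (- (2 * c) * t) * MM.ip p Z Z)" by simp
    also have "\<dots> = sqrt C3 * sqrt (exp (- (2 * c) * t)) * sqrt (MM.ip p Z Z)" by (simp add: real_sqrt_mult)
    also have "sqrt (exp (- (2 * c) * t)) = exp (- c * t)"
      by (rule real_sqrt_unique) (simp_all add: power2_eq_square exp_add[symmetric] algebra_simps)
    finally show ?thesis unfolding NM_def p'_def[symmetric] using od_flow[OF p] unfolding Z_def p'_def by simp
  qed
  show ?thesis using main C3 C(2) by (intro exI[of _ "sqrt C3"] exI[of _ c] conjI) auto
qed

end

context half_pair
begin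

lemma stabilizer_iff:
  assumes p: "p \<in> X" and Y: "Y \<in> lie_algebra SL_group (carrier SL_group)"
  shows "Y \<in> lie_algebra SL_group (coset_stabilizer SL_group (\<xi> True (end_plus p) \<inter> \<xi> False (end_minus p))) \<longleftrightarrow>
    od p Y = 0"
proof -
  obtain g where g: "det g = 1" "(*v) g ` V True = E True p" "(*v) g ` V False = E False p" using frame_exists[OF p] .
  show ?thesis unfolding od_zero_iff[OF p]
  proof (rule lie_stabilizer_SL[OF E_subspace E_subspace _ _ _ \<xi>_inter[OF p] _ Y])
    show "E True p \<inter> E False p = {0}" using E_int[OF p, of True] by simp
    show "prj True p *v v \<in> E True p" "v - prj True p *v v \<in> E False p" for v
      using prj_mem(1)[OF p, of True v] prj_mem(2)[OF p, of v True] by simp_all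
    show "\<xi> True (end_plus p) \<inter> \<xi> False (end_minus p) \<noteq> {}" unfolding \<xi>_inter[OF p] using g by blast
  qed
qed

lemma stabilizer_end:
  assumes p: "p \<in> X" and Y: "Y \<in> lie_algebra SL_group (coset_stabilizer SL_group (\<xi> \<epsilon> (ep \<epsilon> p)))" and v: "v \<in> E \<epsilon> p"
  shows "Y *v v \<in> E \<epsilon> p"
proof -
  obtain c where c: "\<And>t. c t \<in> coset_stabilizer SL_group (\<xi> \<epsilon> (ep \<epsilon> p))" "(c has_vector_derivative Y) (at 0)"
    using Y unfolding lie_algebra_def by blast
  obtain g where g: "det g = 1" "(*v) g ` V \<epsilon> = E \<epsilon> p" using frame_exists1[OF p] .
  then have gx: "g \<in> \<xi> \<epsilon> (ep \<epsilon> p)" unfolding \<xi>_def Eb[OF p] by simp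
  have "c t *v v \<in> E \<epsilon> p" for t
  proof -
    have "c t <#\<^bsub>SL_group\<^esub> \<xi> \<epsilon> (ep \<epsilon> p) = \<xi> \<epsilon> (ep \<epsilon> p)" using c(1) unfolding coset_stabilizer_def by blast
    then have "c t ** g \<in> \<xi> \<epsilon> (ep \<epsilon> p)" using gx unfolding l_coset_def by auto
    then have "(*v) (c t) ` E \<epsilon> p = E \<epsilon> p" unfolding \<xi>_def Eb[OF p] by (simp add: matrix_image_comp g(2))
    then show ?thesis using v by blast
  qed
  then show ?thesis
    by (rule has_vector_derivative_in_subspace[OF has_vector_derivative_matrix_vector[OF c(2)] E_subspace])
qed

lemma \<xi>_contracting: "contracting \<Gamma> S act SL_group \<rho> (\<xi> True) (\<xi> False)"
proof -
  obtain C c where C: "C > 0" "c > 0" "\<And>p t \<epsilon> Y. p \<in> X \<Longrightarrow> t \<ge> 0 \<Longrightarrow> \<forall>v\<in>E (\<not> \<epsilon>) p. Y *v v \<in> E (\<not> \<epsilon>) p \<Longrightarrow>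
     NM (flow (sg (\<not> \<epsilon>) * t) p) Y \<le> C * exp (- c * t) * NM p Y"
    using NM_contracts by blast
  have "(\<forall>p\<in>X. euclidean_norm_mod (lie_algebra SL_group (carrier SL_group))
          (lie_algebra SL_group (coset_stabilizer SL_group (\<xi> True (end_plus p) \<inter> \<xi> False (end_minus p)))) (NM p))"
    unfolding euclidean_norm_mod_def
  proof
    fix p assume p: "p \<in> X"
    show "\<exists>B. bilinear B \<and> (\<forall>X Y. B X Y = B Y X) \<and>
     (\<forall>X\<in>lie_algebra SL_group (carrier SL_group). 0 \<le> B X X \<and>
       (B X X = 0 \<longleftrightarrow> X \<in> lie_algebra SL_group (coset_stabilizer SL_group (\<xi> True (end_plus p) \<inter> \<xi> False (end_minus p)))) \<and>
       NM p X = sqrt (B X X))"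
    proof (intro exI[of _ "\<lambda>X Y. MM.ip p (od p X) (od p Y)"] conjI allI ballI)
      show "bilinear (\<lambda>X Y. MM.ip p (od p X) (od p Y))"
        using MM.bilinear_ip[of p] linear_compose[OF linear_od[of p]] unfolding bilinear_def o_def by blast
      fix Y :: "'n mat2" assume Y: "Y \<in> lie_algebra SL_group (carrier SL_group)"
      have "MM.ip p (od p Y) (od p Y) = 0 \<longleftrightarrow> od p Y = 0"
        using MM.ip_pos[OF p, of "od p Y"] by (cases "od p Y = 0") auto
      then show "(MM.ip p (od p Y) (od p Y) = 0) \<longleftrightarrow>
        Y \<in> lie_algebra SL_group (coset_stabilizer SL_group (\<xi> True (end_plus p) \<inter> \<xi> False (end_minus p)))"
        unfolding stabilizer_iff[OF p Y] .
    qed (simp_all add: NM_def avg_commute)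
  qed
  moreover have "continuous_map (prod_topology T (top_of_set (lie_algebra SL_group (carrier SL_group))))
         euclideanreal (\<lambda>(p, Y). NM p Y)"
  proof (rule continuous_map_sequential)
    show "metrizable_space (prod_topology T (top_of_set (lie_algebra SL_group (carrier SL_group))))"
      by (simp add: metrizable_space_prod_topology metrizable_T metrizable_space_subtopology metrizable_space_euclidean)
    fix \<sigma> :: "nat \<Rightarrow> 'g fpoint \<times> 'n mat2" and l assume \<sigma>: "range \<sigma> \<subseteq> topspace (prod_topology T (top_of_set (lie_algebra SL_group (carrier SL_group))))"
      and l: "limitin (prod_topology T (top_of_set (lie_algebra SL_group (carrier SL_group)))) \<sigma> l sequentially"
    have P: "conv (\<lambda>j. fst (\<sigma> j)) (fst l)" and Y: "(\<lambda>j. snd (\<sigma> j)) \<longlonglongrightarrow> snd l"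
      using l unfolding limitin_pairwise limitin_subtopology by (simp_all add: o_def)
    have "fst (\<sigma> j) \<in> X" for j
    proof -
      have "\<sigma> j \<in> X \<times> lie_algebra SL_group (carrier SL_group)" using \<sigma> by auto
      then show ?thesis by (simp add: mem_Times_iff)
    qed
    then have "(\<lambda>j. NM (fst (\<sigma> j)) (snd (\<sigma> j))) \<longlonglongrightarrow> NM (fst l) (snd l)"
      unfolding NM_def by (intro tendsto_real_sqrt MM.ip_tendsto od_tendsto P Y)
    then show "(\<lambda>j. case \<sigma> j of (p, Y) \<Rightarrow> NM p Y) \<longlonglongrightarrow> (case l of (p, Y) \<Rightarrow> NM p Y)"
      by (simp add: case_prod_beta)
  qed
  moreover have "NM (act \<gamma> p) (Ad SL_group (\<rho> \<gamma>) Y) = NM p Y" if "\<gamma> \<in> carrier \<Gamma>" "p \<in> X" for \<gamma> p Y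
  proof -
    have "Ad SL_group (\<rho> \<gamma>) Y = RM \<gamma> Y" unfolding Ad_SL[OF det_\<rho>[OF that(1)]] SL_inv_\<rho>[OF that(1)] RM_def ..
    then show ?thesis unfolding NM_def using od_act[OF that] MM.ip_equivariant[OF that] by simp
  qed
  moreover have "NM (flow (- t) p) Y \<le> C * exp (- c * t) * NM p Y"
    if "p \<in> X" "t \<ge> 0" "Y \<in> lie_algebra SL_group (coset_stabilizer SL_group (\<xi> False (end_minus p)))" for p t Y
    using C(3)[OF that(1,2), of True Y] stabilizer_end[OF that(1), of Y False] that(3) by (simp add: sg_def ep_def)
  moreover have "NM (flow t p) Y \<le> C * exp (- c * t) * NM p Y"
    if "p \<in> X" "t \<ge> 0" "Y \<in> lie_algebra SL_group (coset_stabilizer SL_group (\<xi> True (end_plus p)))" for p t Y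
    using C(3)[OF that(1,2), of False Y] stabilizer_end[OF that(1), of Y True] that(3) by (simp add: sg_def ep_def)
  ultimately show ?thesis
    unfolding contracting_def using C(1,2)
    by (intro exI[of _ C] exI[of _ c] exI[of _ NM] conjI ballI allI impI) auto
qed

lemma anosov_pair: "anosov \<Gamma> S act SL_group (SL_stabilizer (V True)) (SL_stabilizer (V False)) \<rho>"
  unfolding anosov_def using hom \<xi>_limit_maps \<xi>_contracting by blast

end

context lyapunov_SL
begin

theorem anosov_half: "anosov_SL_half \<Gamma> S act \<rho>"
  unfolding anosov_SL_half_def
proof (intro allI impI)
  fix Vp Vm :: "'n vec2 set"
  assume V: "subspace Vp \<and> subspace Vm \<and> dim Vp = CARD('n) \<and> dim Vm = CARD('n) \<and> Vp \<inter> Vm = {0}"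
  interpret half_pair \<Gamma> S act D \<rho> step qf Cq dq "\<lambda>\<epsilon>. if \<epsilon> then Vp else Vm"
    by unfold_locales (use V in auto)
  show "anosov \<Gamma> S act SL_group (SL_stabilizer Vp) (SL_stabilizer Vm) \<rho>" using anosov_pair by simp
qed

end

section \<open>The affine group\<close>

lemma matrix_Inn_vector: "(Inn *v v) $ i = (case i of Inl _ \<Rightarrow> 1 | Inr _ \<Rightarrow> -1) * v $ i"
  unfolding Inn_def matrix_vector_mult_def by (simp add: if_distrib[of "\<lambda>x. x * _"] cong: if_cong)

lemma form_explicit:
  "form v w = (\<Sum>j\<in>UNIV. v $ Inl j * w $ Inl j) - (\<Sum>j\<in>UNIV. v $ Inr j * w $ Inr j)"
  unfolding form_def inner_vec_def sum_UNIV_Plus matrix_Inn_vector by (simp add: sum_negf)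

lemma bilinear_form: "bilinear form"
  unfolding bilinear_def form_def
  by (intro conjI allI linearI) (simp_all add: inner_simps matrix_vector_right_distrib matrix_vector_mult_scaleR)

lemmas form_simps = bilinear_ladd[OF bilinear_form] bilinear_radd[OF bilinear_form] bilinear_lsub[OF bilinear_form]
  bilinear_rsub[OF bilinear_form] bilinear_lmul[OF bilinear_form] bilinear_rmul[OF bilinear_form]
  bilinear_lzero[OF bilinear_form] bilinear_rzero[OF bilinear_form]
  bilinear_lneg[OF bilinear_form] bilinear_rneg[OF bilinear_form]

lemmas tendsto_form [tendsto_intros] =
  bounded_bilinear.tendsto[OF bilinear_form[unfolded bilinear_conv_bounded_bilinear]]

lemma form_commute: "form v w = form w v"
  unfolding form_explicit by (simp add: mult.commute)

lemma form_Inr: "form v (axis (Inr k) 1) = - v $ Inr k" "form (axis (Inr k) 1) v = - v $ Inr k"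
  unfolding form_explicit by (simp_all add: axis_def if_distrib[of "\<lambda>x. _ * x"] if_distrib[of "\<lambda>x. x * _"] cong: if_cong)

lemma form_Inl: "form v (axis (Inl k) 1) = v $ Inl k" "form (axis (Inl k) 1) v = v $ Inl k"
  unfolding form_explicit by (simp_all add: axis_def if_distrib[of "\<lambda>x. _ * x"] if_distrib[of "\<lambda>x. x * _"] cong: if_cong)

lemma SOnn_form: "g \<in> SOnn \<Longrightarrow> form (g *v v) (g *v w) = form v w"
proof -
  assume "g \<in> SOnn"
  then have "transpose g ** Inn ** g = Inn" unfolding SOnn_def by simp
  then have "v \<bullet> ((transpose g ** Inn ** g) *v w) = form v w" unfolding form_def by simp
  then show ?thesis unfolding form_def
    by (simp add: matrix_vector_mul_assoc[symmetric] dot_lmul_matrix[symmetric] flip: transpose_matrix_vector)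
qed

lemma Inn_Inn: "Inn ** Inn = (mat 1 :: 'n::finite mat2)"
  unfolding matrix_eq
proof
  fix v :: "'n vec2"
  show "(Inn ** Inn) *v v = mat 1 *v v"
    unfolding vec_eq_iff matrix_vector_mul_assoc[symmetric]
  proof
    fix i :: "'n + 'n"
    show "(Inn *v (Inn *v v)) $ i = (mat 1 *v v) $ i" by (cases i) (simp_all add: matrix_Inn_vector)
  qed
qed

text \<open>The inverse on \<open>SOnn\<close>, written as the adjoint for the form. Being linear in
  \<open>g\<close>, it is visibly continuous on all matrices.\<close>

definition ginv :: "'n::finite mat2 \<Rightarrow> 'n mat2" where "ginv g = Inn ** transpose g ** Inn"

lemma ginv: assumes "g \<in> SOnn" shows "ginv g ** g = mat 1" "g ** ginv g = mat 1"
proof -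
  have "transpose g ** Inn ** g = Inn" using assms unfolding SOnn_def by simp
  then have "Inn ** (transpose g ** Inn ** g) = Inn ** Inn" by simp
  then show 1: "ginv g ** g = mat 1" unfolding ginv_def by (simp add: Inn_Inn matrix_mul_assoc)
  then show "g ** ginv g = mat 1" by (simp add: matrix_left_right_inverse)
qed

lemma ginv_vector: assumes "g \<in> SOnn" shows "ginv g *v (g *v v) = v" "g *v (ginv g *v v) = v"
  using ginv[OF assms] by (simp_all add: matrix_vector_mul_assoc)

lemma SOnn_one: "mat 1 \<in> SOnn" unfolding SOnn_def by (simp add: matrix_mul_lid transpose_mat)

lemma SOnn_mult: "g \<in> SOnn \<Longrightarrow> h \<in> SOnn \<Longrightarrow> g ** h \<in> SOnn"
proof -
  assume g: "g \<in> SOnn" and h: "h \<in> SOnn"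
  have "transpose (g ** h) ** Inn ** (g ** h) = transpose h ** (transpose g ** Inn ** g) ** h"
    by (simp add: matrix_transpose_mul matrix_mul_assoc)
  also have "\<dots> = Inn" using g h unfolding SOnn_def by simp
  finally show ?thesis using g h unfolding SOnn_def by (simp add: det_mul)
qed

lemma SOnn_ginv: assumes g: "g \<in> SOnn" shows "ginv g \<in> SOnn"
proof -
  have d: "det g = 1" "transpose g ** Inn ** g = Inn" using g unfolding SOnn_def by simp_all
  have "det (ginv g ** g) = 1" unfolding ginv(1)[OF g] by simp
  then have "det (ginv g) = 1" using d by (simp add: det_mul)
  moreover have "transpose (ginv g) ** Inn ** ginv g = transpose (ginv g) ** (transpose g ** Inn ** g) ** ginv g"
    using d by simp
  moreover have "\<dots> = transpose (g ** ginv g) ** Inn ** (g ** ginv g)"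
    by (simp add: matrix_transpose_mul matrix_mul_assoc)
  ultimately show ?thesis unfolding SOnn_def ginv(2)[OF g] by (simp add: transpose_mat)
qed

lemma G_group_simps [simp]:
  "g \<in> carrier G_group \<longleftrightarrow> g \<in> connected_component_set SOnn (mat 1)"
  "g \<otimes>\<^bsub>G_group\<^esub> h = g ** h" "\<one>\<^bsub>G_group\<^esub> = mat 1"
  unfolding G_group_def mat_group_def by simp_all

lemma G_SOnn: "g \<in> connected_component_set SOnn (mat 1) \<Longrightarrow> g \<in> SOnn"
  using connected_component_subset by blast

lemma G_one: "mat 1 \<in> connected_component_set SOnn (mat 1)"
  using SOnn_one by simp

text \<open>The image of the identity component is connected and meets the component again at
  \<open>f a\<close>, so it cannot leave it. Closure under products and inverses follows without any
  path.\<close>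

lemma G_image:
  assumes "\<And>g. g \<in> SOnn \<Longrightarrow> f g \<in> SOnn" "continuous_on UNIV f"
    and a: "a \<in> connected_component_set SOnn (mat 1)" "f a \<in> connected_component_set SOnn (mat 1)"
    and g: "g \<in> connected_component_set SOnn (mat 1)"
  shows "f g \<in> connected_component_set SOnn (mat 1)"
proof -
  let ?C = "connected_component_set SOnn (mat 1)"
  have "connected (f ` ?C)"
    using assms(2) by (intro connected_continuous_image connected_connected_component) (rule continuous_on_subset, auto)
  moreover have "f ` ?C \<subseteq> SOnn" using assms(1) G_SOnn by blast
  ultimately have "f ` ?C \<subseteq> connected_component_set SOnn (f a)"
    by (rule connected_component_maximal[rotated]) (use a in blast)
  also have "connected_component_set SOnn (f a) = ?C" using connected_component_eq[OF a(2)] .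
  finally show ?thesis using g by blast
qed

lemma continuous_ginv: "continuous_on UNIV (ginv :: 'n::finite mat2 \<Rightarrow> _)"
proof -
  have "linear (\<lambda>g :: 'n mat2. transpose g)" by (intro linearI) (simp_all add: transpose_def vec_eq_iff)
  then have "linear ((\<lambda>X :: 'n mat2. Inn ** X ** Inn) \<circ> transpose)" using linear_matrix_conj by (intro linear_compose)
  then have "linear (ginv :: 'n mat2 \<Rightarrow> _)" by (simp add: ginv_def[abs_def] o_def)
  then show ?thesis by (rule linear_continuous_on_compose[OF continuous_on_id])
qed

lemma G_mult:
  assumes "g \<in> connected_component_set SOnn (mat 1)" "h \<in> connected_component_set SOnn (mat 1)"
  shows "g ** h \<in> connected_component_set SOnn (mat 1)"
proof (rule G_image[of "\<lambda>h. g ** h", OF _ _ G_one _ assms(2)])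
  have "linear (\<lambda>X. g ** X ** mat 1)" by (rule linear_matrix_conj)
  then show "continuous_on UNIV (\<lambda>h. g ** h)" using linear_continuous_on_compose[OF continuous_on_id] by auto
qed (use assms G_SOnn SOnn_mult in auto)

lemma G_ginv:
  assumes "g \<in> connected_component_set SOnn (mat 1)"
  shows "ginv g \<in> connected_component_set SOnn (mat 1)"
proof (rule G_image[OF SOnn_ginv continuous_ginv G_one _ assms])
  have "ginv (mat 1) = (mat 1 :: 'a mat2)" unfolding ginv_def by (simp add: transpose_mat Inn_Inn)
  then show "ginv (mat 1) \<in> connected_component_set SOnn (mat 1 :: 'a mat2)" using G_one by simp
qed

lemma G0_SOnn: "g \<in> G0 k \<Longrightarrow> g \<in> SOnn"
  unfolding G0_def using G_SOnn by auto

lemma G0_mult: "g \<in> G0 k \<Longrightarrow> h \<in> G0 k \<Longrightarrow> g ** h \<in> G0 k"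
  unfolding G0_def using G_mult by (auto simp flip: matrix_vector_mul_assoc)

lemma G0_one: "mat 1 \<in> G0 k"
  unfolding G0_def using G_one by simp

lemma G0_ginv: "g \<in> G0 k \<Longrightarrow> ginv g \<in> G0 k"
  using G_ginv[of g] ginv_vector(1)[OF G_SOnn, of g "axis (Inr k) 1"] unfolding G0_def by auto

lemma G0_axis: "g \<in> G0 k \<Longrightarrow> g *v axis (Inr k) 1 = axis (Inr k) 1"
  unfolding G0_def by simp

lemma G0_component: assumes "g \<in> G0 k" shows "(g *v v) $ Inr k = v $ Inr k"
  using SOnn_form[OF G0_SOnn[OF assms], of v "axis (Inr k) 1"] unfolding G0_axis[OF assms] form_Inr by simp

section \<open>The affine group and its linearisation\<close>

lemma hyp_simps [simp]: "v \<in> hyp k \<longleftrightarrow> v $ Inr k = 0" unfolding hyp_def by simp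

lemma Ga_simps [simp]:
  "a \<in> carrier (Ga_group k) \<longleftrightarrow> fst a \<in> G0 k \<and> snd a $ Inr k = 0"
  "a \<otimes>\<^bsub>Ga_group k\<^esub> b = (fst a ** fst b, snd a + fst a *v snd b)" "\<one>\<^bsub>Ga_group k\<^esub> = (mat 1, 0)"
  unfolding Ga_group_def by (auto simp: case_prod_beta mem_Times_iff)

lemma group_Ga: "group (Ga_group k)"
proof (rule groupI)
  fix a assume a: "a \<in> carrier (Ga_group k)"
  let ?b = "(ginv (fst a), - (ginv (fst a) *v snd a))"
  show "\<exists>b\<in>carrier (Ga_group k). b \<otimes>\<^bsub>Ga_group k\<^esub> a = \<one>\<^bsub>Ga_group k\<^esub>"
    using a by (intro bexI[of _ ?b]) (auto simp: G0_ginv G0_component ginv(1) G0_SOnn)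
qed (auto simp: G0_mult G0_one G0_component matrix_mul_assoc matrix_vector_right_distrib matrix_vector_mul_assoc)

lemma Ga_inv:
  assumes "a \<in> carrier (Ga_group k)"
  shows "inv\<^bsub>Ga_group k\<^esub> a = (ginv (fst a), - (ginv (fst a) *v snd a))"
  using assms by (intro group.inv_equality[OF group_Ga]) (auto simp: G0_ginv G0_component ginv(1) G0_SOnn)

text \<open>The linearisation of the affine action: on the hyperplane of vectors with last
  coordinate 1, identified with \<open>hyp k\<close> by subtracting
  \<open>e\<^sub>2\<^sub>n\<close>, it is the affine map, and on \<open>hyp k\<close> it is the
  linear part.\<close>

definition hat :: "'n::finite \<Rightarrow> 'n mat2 \<times> 'n vec2 \<Rightarrow> 'n vec2 \<Rightarrow> 'n vec2" where
  "hat k a v = fst a *v v + v $ Inr k *\<^sub>R snd a"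

lemma linear_hat: "linear (hat k a)"
  unfolding hat_def[abs_def] by (intro linearI) (simp_all add: algebra_simps matrix_vector_mult_scaleR)

lemma hat_hyp: "v \<in> hyp k \<Longrightarrow> hat k a v = fst a *v v"
  unfolding hat_def by simp

lemma hat_component: "a \<in> carrier (Ga_group k) \<Longrightarrow> hat k a v $ Inr k = v $ Inr k"
  unfolding hat_def by (simp add: G0_component)

lemma hat_one: "hat k \<one>\<^bsub>Ga_group k\<^esub> v = v"
  unfolding hat_def by simp

lemma hat_mult:
  assumes "a \<in> carrier (Ga_group k)" "b \<in> carrier (Ga_group k)"
  shows "hat k (a \<otimes>\<^bsub>Ga_group k\<^esub> b) v = hat k a (hat k b v)"
  using assms unfolding hat_def
  by (simp add: G0_component algebra_simps matrix_vector_mult_scaleR matrix_vector_mul_assoc[symmetric])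

lemma hat_inv:
  assumes "a \<in> carrier (Ga_group k)"
  shows "hat k (inv\<^bsub>Ga_group k\<^esub> a) (hat k a v) = v" "hat k a (hat k (inv\<^bsub>Ga_group k\<^esub> a) v) = v"
  using assms group.inv_closed[OF group_Ga assms] group.l_inv[OF group_Ga assms] group.r_inv[OF group_Ga assms]
  by (metis hat_mult hat_one)+

lemma tendsto_hat:
  assumes "(a \<longlongrightarrow> b) F" "(v \<longlongrightarrow> w) F"
  shows "((\<lambda>i. hat k (a i) (v i)) \<longlongrightarrow> hat k b w) F"
  unfolding hat_def by (intro tendsto_intros assms)

lemma tendsto_Ga_inv:
  fixes k :: "'n::finite"
  assumes "(a \<longlongrightarrow> b) F" "\<And>i. a i \<in> carrier (Ga_group k)" "b \<in> carrier (Ga_group k)"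
  shows "((\<lambda>i. inv\<^bsub>Ga_group k\<^esub> (a i)) \<longlongrightarrow> inv\<^bsub>Ga_group k\<^esub> b) F"
proof -
  have "isCont ginv x" for x :: "'n mat2" using continuous_ginv by (auto simp: continuous_on_eq_continuous_at)
  then have "((\<lambda>i. ginv (fst (a i))) \<longlongrightarrow> ginv (fst b)) F"
    using tendsto_fst[OF assms(1)] by (rule isCont_tendsto_compose)
  then show ?thesis unfolding Ga_inv[OF assms(2)] Ga_inv[OF assms(3)] by (intro tendsto_intros assms)
qed

section \<open>The two standard flags and their stabilizers\<close>

definition W0 :: "'n::finite \<Rightarrow> bool \<Rightarrow> 'n vec2 set" where "W0 k \<epsilon> = (if \<epsilon> then Wp k else Wm k)"

text \<open>The orthogonal is taken in the full space and contains the last basis vector; it is the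
  linear cone over the standard affine null subspace.\<close>

definition O0 :: "'n::finite \<Rightarrow> bool \<Rightarrow> 'n vec2 set" where "O0 k \<epsilon> = form_orth (W0 k \<epsilon>)"

definition Pa :: "'n::finite \<Rightarrow> bool \<Rightarrow> ('n mat2 \<times> 'n vec2) set" where
  "Pa k \<epsilon> = (if \<epsilon> then Pa_plus k else Pa_minus k)"

lemma sg_simps [simp]: "sg True = 1" "sg False = -1" "sg \<epsilon> * sg \<epsilon> = 1" "sg (\<not> \<epsilon>) = - sg \<epsilon>" "sg \<epsilon> * (sg \<epsilon> * t) = t"
  unfolding sg_def by auto

lemma subspace_W0: "subspace (W0 k \<epsilon>)"
  unfolding W0_def Wp_def Wm_def by simp

lemma W0_span: "W0 k \<epsilon> = span {axis (Inl j) 1 + sg \<epsilon> *\<^sub>R axis (Inr j) 1 | j. j \<noteq> k}"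
  unfolding W0_def Wp_def Wm_def sg_def by simp

lemma W0_iff: "w \<in> W0 k \<epsilon> \<longleftrightarrow> w $ Inl k = 0 \<and> (\<forall>j. w $ Inr j = sg \<epsilon> * w $ Inl j)"
proof
  have "subspace {w. w $ Inl k = 0 \<and> (\<forall>j. w $ Inr j = sg \<epsilon> * w $ Inl j)}"
    by (intro subspaceI) (auto simp: algebra_simps)
  then have "W0 k \<epsilon> \<subseteq> {w. w $ Inl k = 0 \<and> (\<forall>j. w $ Inr j = sg \<epsilon> * w $ Inl j)}"
    unfolding W0_span by (intro span_minimal) (auto simp: axis_def)
  then show "w \<in> W0 k \<epsilon> \<Longrightarrow> w $ Inl k = 0 \<and> (\<forall>j. w $ Inr j = sg \<epsilon> * w $ Inl j)" by blast
next
  assume w: "w $ Inl k = 0 \<and> (\<forall>j. w $ Inr j = sg \<epsilon> * w $ Inl j)"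
  have "w = (\<Sum>j\<in>-{k}. w $ Inl j *\<^sub>R (axis (Inl j) 1 + sg \<epsilon> *\<^sub>R axis (Inr j) 1))"
    unfolding vec_eq_iff
  proof
    fix i
    show "w $ i = (\<Sum>j\<in>-{k}. w $ Inl j *\<^sub>R (axis (Inl j) 1 + sg \<epsilon> *\<^sub>R axis (Inr j) 1)) $ i"
    proof (cases i)
      case (Inl l)
      have "(\<Sum>j\<in>-{k}. w $ Inl j *\<^sub>R (axis (Inl j) 1 + sg \<epsilon> *\<^sub>R axis (Inr j) 1)) $ i =
          (\<Sum>j\<in>-{k}. if j = l then w $ Inl l else 0)"
        unfolding sum_component Inl by (intro sum.cong) (auto simp: axis_def)
      also have "\<dots> = w $ i" using w Inl by (auto simp: sum.delta')
      finally show ?thesis ..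
    next
      case (Inr l)
      have "(\<Sum>j\<in>-{k}. w $ Inl j *\<^sub>R (axis (Inl j) 1 + sg \<epsilon> *\<^sub>R axis (Inr j) 1)) $ i =
          (\<Sum>j\<in>-{k}. if j = l then sg \<epsilon> * w $ Inl l else 0)"
        unfolding sum_component Inr by (intro sum.cong) (auto simp: axis_def)
      also have "\<dots> = w $ i" using w Inr by (auto simp: sum.delta')
      finally show ?thesis ..
    qed
  qed
  also have "\<dots> \<in> W0 k \<epsilon>" unfolding W0_span
    by (intro span_sum span_scale span_base) auto
  finally show "w \<in> W0 k \<epsilon>" .
qed

lemma W0_vector: "j \<noteq> k \<Longrightarrow> axis (Inl j) 1 + sg \<epsilon> *\<^sub>R axis (Inr j) 1 \<in> W0 k \<epsilon>"
  unfolding W0_span by (rule span_base) blast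

lemma W0_hyp: "w \<in> W0 k \<epsilon> \<Longrightarrow> w \<in> hyp k"
  unfolding W0_iff by simp

lemma O0_iff: "v \<in> O0 k \<epsilon> \<longleftrightarrow> (\<forall>j. j \<noteq> k \<longrightarrow> v $ Inr j = sg \<epsilon> * v $ Inl j)"
proof
  assume v: "v \<in> O0 k \<epsilon>"
  show "\<forall>j. j \<noteq> k \<longrightarrow> v $ Inr j = sg \<epsilon> * v $ Inl j"
  proof (intro allI impI)
    fix j assume "j \<noteq> k"
    then have "form v (axis (Inl j) 1 + sg \<epsilon> *\<^sub>R axis (Inr j) 1) = 0"
      using v W0_vector[of j k \<epsilon>] unfolding O0_def form_orth_def by blast
    then have "v $ Inl j - sg \<epsilon> * v $ Inr j = 0" by (simp add: form_simps form_Inr form_Inl)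
    then show "v $ Inr j = sg \<epsilon> * v $ Inl j" by (cases \<epsilon>) auto
  qed
next
  assume v: "\<forall>j. j \<noteq> k \<longrightarrow> v $ Inr j = sg \<epsilon> * v $ Inl j"
  have "form v w = 0" if "w \<in> W0 k \<epsilon>" for w
  proof -
    have "v $ Inl j * w $ Inl j = v $ Inr j * w $ Inr j" for j
      using that v unfolding W0_iff by (cases "j = k") (auto simp: algebra_simps)
    then show ?thesis unfolding form_explicit by simp
  qed
  then show "v \<in> O0 k \<epsilon>" unfolding O0_def form_orth_def by blast
qed

lemma subspace_O0: "subspace (O0 k \<epsilon>)"
  by (intro subspaceI) (auto simp: O0_iff algebra_simps)

lemma W0_O0: "W0 k \<epsilon> \<subseteq> O0 k \<epsilon>"
  unfolding O0_iff W0_iff subset_iff by simp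

lemma O0_axis: "axis (Inl k) 1 \<in> O0 k \<epsilon>" "axis (Inr k) 1 \<in> O0 k \<epsilon>"
  unfolding O0_iff by (auto simp: axis_def)

definition pr0 :: "'n::finite \<Rightarrow> bool \<Rightarrow> 'n vec2 \<Rightarrow> 'n vec2" where
  "pr0 k \<epsilon> v = (\<chi> i. case i of Inl j \<Rightarrow> if j = k then 0 else (v $ Inl j + sg \<epsilon> * v $ Inr j) / 2
     | Inr j \<Rightarrow> if j = k then 0 else sg \<epsilon> * (v $ Inl j + sg \<epsilon> * v $ Inr j) / 2)"

lemma pr0: "pr0 k \<epsilon> v \<in> W0 k \<epsilon>" "v - pr0 k \<epsilon> v \<in> O0 k (\<not> \<epsilon>)"
  unfolding W0_iff O0_iff pr0_def by (cases \<epsilon>; auto simp: field_simps)+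

lemma pr0_sum: "v = pr0 k True v + pr0 k False v + v $ Inl k *\<^sub>R axis (Inl k) 1 + v $ Inr k *\<^sub>R axis (Inr k) 1"
  unfolding vec_eq_iff
proof
  fix i show "v $ i = (pr0 k True v + pr0 k False v + v $ Inl k *\<^sub>R axis (Inl k) 1 + v $ Inr k *\<^sub>R axis (Inr k) 1) $ i"
    by (cases i) (auto simp: pr0_def axis_def field_simps)
qed

lemma linear_pr0: "linear (pr0 k \<epsilon>)"
  by (intro linearI; simp add: vec_eq_iff; intro allI; simp add: pr0_def split: sum.split)
    (auto simp: field_simps)

lemma W0_O0_inter: "W0 k \<epsilon> \<inter> O0 k (\<not> \<epsilon>) = {0}"
proof -
  have "w = 0" if w: "w \<in> W0 k \<epsilon>" "w \<in> O0 k (\<not> \<epsilon>)" for w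
    unfolding vec_eq_iff
  proof
    fix i
    have "w $ Inl j = 0" for j
    proof (cases "j = k")
      case False
      then have "w $ Inr j = sg \<epsilon> * w $ Inl j" "w $ Inr j = - sg \<epsilon> * w $ Inl j"
        using w unfolding W0_iff O0_iff by simp_all
      then show ?thesis by (cases \<epsilon>) auto
    qed (use w in \<open>simp add: W0_iff\<close>)
    then show "w $ i = 0 $ i" using w unfolding W0_iff by (cases i) auto
  qed
  then show ?thesis using subspace_0[OF subspace_W0] subspace_0[OF subspace_O0] by blast
qed

lemma O0_inter: "v \<in> O0 k True \<Longrightarrow> v \<in> O0 k False \<Longrightarrow> v = v $ Inl k *\<^sub>R axis (Inl k) 1 + v $ Inr k *\<^sub>R axis (Inr k) 1"
  unfolding vec_eq_iff
proof
  fix i assume v: "v \<in> O0 k True" "v \<in> O0 k False"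
  have "v $ Inl j = 0 \<and> v $ Inr j = 0" if "j \<noteq> k" for j
    using v[unfolded O0_iff, rule_format, OF that] by simp
  then show "v $ i = (v $ Inl k *\<^sub>R axis (Inl k) 1 + v $ Inr k *\<^sub>R axis (Inr k) 1) $ i"
    by (cases i) (auto simp: axis_def)
qed

text \<open>Within \<open>hyp k\<close> the isotropic space is recovered as the orthogonal of the
  null subspace. An isometry that preserves the latter therefore preserves the former.\<close>

lemma W0_orth: "w \<in> hyp k \<Longrightarrow> (\<And>z. z \<in> O0 k \<epsilon> \<inter> hyp k \<Longrightarrow> form w z = 0) \<Longrightarrow> w \<in> W0 k \<epsilon>"
proof -
  assume w: "w \<in> hyp k" "\<And>z. z \<in> O0 k \<epsilon> \<inter> hyp k \<Longrightarrow> form w z = 0"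
  have "w $ Inl k = 0"
    using w(2)[of "axis (Inl k) 1"] O0_axis[of k \<epsilon>] by (simp add: form_Inl) (simp add: axis_def)
  moreover have "w $ Inr j = sg \<epsilon> * w $ Inl j" for j
  proof (cases "j = k")
    case False
    have "form w (axis (Inl j) 1 + sg \<epsilon> *\<^sub>R axis (Inr j) 1) = 0"
      using w(2) W0_vector[OF False] W0_O0 W0_hyp by blast
    then have "w $ Inl j - sg \<epsilon> * w $ Inr j = 0" by (simp add: form_simps form_Inr form_Inl)
    then show ?thesis by (cases \<epsilon>) auto
  qed (use w calculation in simp)
  ultimately show ?thesis unfolding W0_iff by blast
qed

lemma W0_isotropic: "v \<in> W0 k \<epsilon> \<Longrightarrow> z \<in> O0 k \<epsilon> \<Longrightarrow> form v z = 0"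
  unfolding O0_def form_orth_def using form_commute[of v z] by simp

lemma Pa_iff:
  "a \<in> Pa k \<epsilon> \<longleftrightarrow> a \<in> carrier (Ga_group k) \<and> affine_act a ` (O0 k \<epsilon> \<inter> hyp k) = O0 k \<epsilon> \<inter> hyp k"
  unfolding Pa_def Pa_plus_def Pa_minus_def O0_def W0_def by (cases \<epsilon>) auto

lemma inj_image_eq:
  fixes f :: "'a::euclidean_space \<Rightarrow> 'a"
  assumes "linear f" "inj f" "subspace V" "f ` V \<subseteq> V"
  shows "f ` V = V"
proof (rule subspace_dim_equal[OF linear_subspace_image[OF assms(1,3)] assms(3,4)])
  show "dim V \<le> dim (f ` V)" using dim_image_eq[OF assms(1), of V] assms(2) by (simp add: inj_on_subset)
qed

lemma inj_hat: "a \<in> carrier (Ga_group k) \<Longrightarrow> inj (hat k a)"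
  using hat_inv(1) by (metis injI)

text \<open>The image of 0 shows that the translation part lies in the null subspace; subtracting
  it, the linear part preserves that subspace, and so \<open>hat\<close> preserves the cone.
  Injectivity upgrades inclusions to equalities.\<close>

lemma Pa_linear:
  assumes "b \<in> Pa k \<epsilon>"
  shows "snd b \<in> O0 k \<epsilon> \<inter> hyp k" "(*v) (fst b) ` (O0 k \<epsilon> \<inter> hyp k) = O0 k \<epsilon> \<inter> hyp k"
    "hat k b ` O0 k \<epsilon> = O0 k \<epsilon>" "hat k b ` W0 k \<epsilon> = W0 k \<epsilon>"
proof -
  let ?Z = "O0 k \<epsilon> \<inter> hyp k"
  have b: "b \<in> carrier (Ga_group k)" and im: "affine_act b ` ?Z = ?Z" using assms unfolding Pa_iff by simp_all
  have sZ: "subspace ?Z" by (intro subspace_inter subspace_O0) (auto intro!: subspaceI)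
  have "affine_act b 0 \<in> ?Z" using im subspace_0[OF sZ] by blast
  then show u: "snd b \<in> ?Z" unfolding affine_act_def by simp
  have h: "fst b *v z \<in> ?Z" if "z \<in> ?Z" for z
  proof -
    have "affine_act b z - snd b \<in> ?Z" using im that u by (intro subspace_diff sZ) blast+
    then show ?thesis unfolding affine_act_def by simp
  qed
  have G: "fst b \<in> SOnn" using b by (auto intro: G0_SOnn)
  have inj: "inj ((*v) (fst b))" using ginv_vector(1)[OF G] by (metis injI)
  show hZ: "(*v) (fst b) ` ?Z = ?Z" using h by (intro inj_image_eq matrix_vector_mul_linear inj sZ) blast
  have "hat k b v \<in> O0 k \<epsilon>" if "v \<in> O0 k \<epsilon>" for v
  proof -
    let ?z = "v - v $ Inr k *\<^sub>R axis (Inr k) 1"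
    have z: "?z \<in> ?Z" using that O0_axis subspace_O0
      by (auto intro!: subspace_diff subspace_scale simp: axis_def)
    have "hat k b v = fst b *v ?z + v $ Inr k *\<^sub>R (axis (Inr k) 1 + snd b)"
      using b unfolding hat_def by (simp add: matrix_vector_mult_diff_distrib matrix_vector_mult_scaleR G0_axis scaleR_add_right)
    then show ?thesis using h[OF z] u O0_axis subspace_O0
      by (auto intro!: subspace_add subspace_scale)
  qed
  then show "hat k b ` O0 k \<epsilon> = O0 k \<epsilon>" by (intro inj_image_eq linear_hat inj_hat b subspace_O0) blast
  have "hat k b w \<in> W0 k \<epsilon>" if w: "w \<in> W0 k \<epsilon>" for w
    unfolding hat_hyp[OF W0_hyp[OF w]]
  proof (rule W0_orth)
    show "fst b *v w \<in> hyp k" using b W0_hyp[OF w] by (simp add: G0_component)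
    fix z assume "z \<in> ?Z"
    then obtain z' where z': "z' \<in> ?Z" "z = fst b *v z'" using hZ by blast
    then show "form (fst b *v w) z = 0" using W0_isotropic[OF w, of z'] by (simp add: SOnn_form[OF G])
  qed
  then show "hat k b ` W0 k \<epsilon> = W0 k \<epsilon>" by (intro inj_image_eq linear_hat inj_hat b subspace_W0) blast
qed

lemma matrix_form_eqI:
  assumes "\<And>v w. form (A *v v) (B *v w) = form v w" shows "transpose A ** Inn ** B = Inn"
  unfolding matrix_eq
proof
  fix w
  have "v \<bullet> ((transpose A ** Inn ** B) *v w) = v \<bullet> (Inn *v w)" for v
    using assms[of v w] unfolding form_def
    by (simp add: matrix_vector_mul_assoc[symmetric] dot_lmul_matrix[symmetric] flip: transpose_matrix_vector)
  then show "(transpose A ** Inn ** B) *v w = Inn *v w" by (metis vector_eq_ldot)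
qed

text \<open>An element of \<open>L\<^sub>0\<close> maps \<open>e\<^sub>n\<close> to \<open>\<plusminus>e\<^sub>n\<close>; the sign is the determinant, since the form pairs
  \<open>W\<^sub>+\<close> and \<open>W\<^sub>-\<close>, so that the determinants of the restrictions to these are inverse to each other.\<close>

lemma Pa_fix:
  assumes "b \<in> Pa k True" "b \<in> Pa k False"
  shows "fst b *v axis (Inl k) 1 = axis (Inl k) 1"
proof -
  let ?e = "axis (Inl k) 1" and ?f = "axis (Inr k) 1" and ?h = "fst b"
  have b: "b \<in> carrier (Ga_group k)" using assms(1) unfolding Pa_iff by simp
  have G: "?h \<in> SOnn" "?h \<in> G0 k" using b by (auto intro: G0_SOnn)
  have e: "?e \<in> O0 k \<epsilon> \<inter> hyp k" for \<epsilon> using O0_axis(1) by (simp add: axis_def)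
  have "?h *v ?e \<in> O0 k \<epsilon> \<inter> hyp k" for \<epsilon>
    using e[of \<epsilon>] Pa_linear(2)[OF assms(1)] Pa_linear(2)[OF assms(2)] by (cases \<epsilon>) auto
  then have he: "?h *v ?e \<in> O0 k True" "?h *v ?e \<in> O0 k False" "(?h *v ?e) $ Inr k = 0" by auto
  define m where "m = (?h *v ?e) $ Inl k"
  have le: "?h *v ?e = m *\<^sub>R ?e" using O0_inter[OF he(1,2)] he(3) unfolding m_def by simp
  \<comment> \<open>The restriction of \<open>?h\<close> to one isotropic space, extended by the
    identity on the complement \<open>O0 k (\<not> \<epsilon>)\<close>.\<close>
  define A where "A \<epsilon> = matrix (\<lambda>v. ?h *v pr0 k \<epsilon> v + (v - pr0 k \<epsilon> v))" for \<epsilon>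
  have A: "A \<epsilon> *v v = ?h *v pr0 k \<epsilon> v + (v - pr0 k \<epsilon> v)" for \<epsilon> v
  proof -
    have "linear (\<lambda>v. ?h *v pr0 k \<epsilon> v + (v - pr0 k \<epsilon> v))"
      using linear_pr0[of k \<epsilon>] by (intro linear_compose_add linear_compose_sub linear_ident linear_pr0
        linear_compose[of "pr0 k \<epsilon>" "(*v) ?h", unfolded o_def] matrix_vector_mul_linear)
    then show ?thesis unfolding A_def by (simp add: matrix_works)
  qed
  have hW: "?h *v w \<in> W0 k \<epsilon>" if "w \<in> W0 k \<epsilon>" for w \<epsilon>
  proof -
    have "hat k b ` W0 k \<epsilon> = W0 k \<epsilon>"
      using Pa_linear(4)[OF assms(1)] Pa_linear(4)[OF assms(2)] by (cases \<epsilon>) auto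
    then show ?thesis using that hat_hyp[OF W0_hyp[OF that], of b] by (metis imageI)
  qed
  have f0: "form v z = 0" if "v \<in> W0 k \<epsilon>" "z \<in> O0 k \<epsilon>" for v z \<epsilon> using W0_isotropic that .
  \<comment> \<open>Mixed terms vanish by orthogonality and the pairing of the two isotropic parts
    is preserved by \<open>?h\<close>. Taking determinants shows that the two blocks have inverse
    determinants.\<close>
  have "form (A True *v v) (A False *v w) = form v w" for v w
  proof -
    let ?v1 = "pr0 k True v" and ?v2 = "v - pr0 k True v" and ?w1 = "pr0 k False w" and ?w2 = "w - pr0 k False w"
    have w2: "?w2 \<in> O0 k True" and v2: "?v2 \<in> O0 k False" using pr0(2)[of w k False] pr0(2)[of v k True] by simp_all
    note z = f0[OF hW[OF pr0(1)[of k True v]] w2] f0[OF hW[OF pr0(1)[of k False w]] v2]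
      f0[OF pr0(1)[of k True v] w2] f0[OF pr0(1)[of k False w] v2]
    have "form (A True *v v) (A False *v w) = form ?v1 ?w1 + form ?v2 ?w2"
      unfolding A using z by (simp only: form_simps SOnn_form[OF G(1)]) (simp add: form_commute)
    also have "\<dots> = form (?v1 + ?v2) (?w1 + ?w2)"
      using z by (simp only: form_simps) (simp add: form_commute)
    finally show ?thesis by simp
  qed
  then have "transpose (A True) ** Inn ** A False = Inn" by (rule matrix_form_eqI)
  from arg_cong[OF this, of det] have "det (A True) * det (Inn :: 'a mat2) * det (A False) = det (Inn :: 'a mat2)"
    unfolding det_mul det_transpose .
  moreover have "det (Inn :: 'a mat2) * det (Inn :: 'a mat2) = 1" by (simp add: Inn_Inn flip: det_mul)
  then have "det (Inn :: 'a mat2) \<noteq> 0" by auto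
  ultimately have d: "det (A True) * det (A False) = 1" by (simp add: field_simps)
  define R :: "'a mat2" where "R = (\<chi> i j. if i = j then (if i = Inl k then m else 1) else 0)"
  have R: "R *v v = v + ((m - 1) * v $ Inl k) *\<^sub>R ?e" for v
  proof -
    have "(R *v v) $ i = (if i = Inl k then m else 1) * v $ i" for i
    proof -
      have "(R *v v) $ i = (\<Sum>j\<in>UNIV. if j = i then (if i = Inl k then m else 1) * v $ i else 0)"
        unfolding R_def matrix_vector_mult_def vec_lambda_beta by (intro sum.cong) auto
      then show ?thesis by simp
    qed
    then show ?thesis by (simp add: vec_eq_iff axis_def algebra_simps)
  qed
  have "det R = (\<Prod>i\<in>UNIV. R $ i $ i)" by (rule det_diagonal) (simp add: R_def)
  also have "\<dots> = m" unfolding R_def by (simp add: prod.delta)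
  finally have dR: "det R = m" .
  \<comment> \<open>The three factors act on different summands and fix the others, with
    \<open>R\<close> multiplying the vector \<open>?e\<close> by \<open>m\<close>. Hence the
    determinant of \<open>?h\<close> is \<open>m\<close>, and it is 1.\<close>
  have "?h = A True ** A False ** R"
    unfolding matrix_eq
  proof
    fix v
    have p1: "pr0 k \<epsilon> w = w" if "w \<in> W0 k \<epsilon>" for w \<epsilon>
    proof -
      have "w - pr0 k \<epsilon> w \<in> W0 k \<epsilon> \<inter> O0 k (\<not> \<epsilon>)" by (intro IntI subspace_diff[OF subspace_W0 that pr0(1)] pr0(2))
      then show ?thesis unfolding W0_O0_inter by simp
    qed
    have p0: "pr0 k \<epsilon> z = 0" if "z \<in> O0 k (\<not> \<epsilon>)" for z \<epsilon>
    proof -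
      have "z - (z - pr0 k \<epsilon> z) \<in> O0 k (\<not> \<epsilon>)" by (intro subspace_diff[OF subspace_O0 that pr0(2)])
      then have "pr0 k \<epsilon> z \<in> W0 k \<epsilon> \<inter> O0 k (\<not> \<epsilon>)" using pr0(1) by simp
      then show ?thesis unfolding W0_O0_inter by simp
    qed
    have A1: "A \<epsilon> *v w = ?h *v w" if "w \<in> W0 k \<epsilon>" for w \<epsilon> unfolding A p1[OF that] by simp
    have A0: "A \<epsilon> *v z = z" if "z \<in> O0 k (\<not> \<epsilon>)" for z \<epsilon> unfolding A p0[OF that] by simp
    let ?p = "pr0 k True v" and ?m = "pr0 k False v"
    have p: "?p \<in> W0 k True" "?m \<in> W0 k False" by (rule pr0)+
    have v: "v = ?p + ?m + v $ Inl k *\<^sub>R ?e + v $ Inr k *\<^sub>R ?f" by (rule pr0_sum)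
    have Rv: "R *v v = ?p + ?m + (m * v $ Inl k) *\<^sub>R ?e + v $ Inr k *\<^sub>R ?f"
      unfolding R by (subst (1) v) (simp add: algebra_simps)
    have "A False *v (R *v v) = ?p + ?h *v ?m + (m * v $ Inl k) *\<^sub>R ?e + v $ Inr k *\<^sub>R ?f"
      unfolding Rv matrix_vector_right_distrib matrix_vector_mult_scaleR
      using A0[of _ False] A1[OF p(2)] O0_axis[of k True] W0_O0[of k True] p(1) by auto
    also have "A True *v \<dots> = ?h *v ?p + ?h *v ?m + (m * v $ Inl k) *\<^sub>R ?e + v $ Inr k *\<^sub>R ?f"
      unfolding matrix_vector_right_distrib matrix_vector_mult_scaleR
      using A0[of _ True] A1[OF p(1)] O0_axis[of k False] W0_O0[of k False] hW[OF p(2)] by auto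
    also have "\<dots> = ?h *v (?p + ?m + v $ Inl k *\<^sub>R ?e + v $ Inr k *\<^sub>R ?f)"
      unfolding matrix_vector_right_distrib matrix_vector_mult_scaleR le G0_axis[OF G(2)] by (simp add: mult.commute)
    also have "\<dots> = ?h *v v" using v by simp
    finally show "?h *v v = (A True ** A False ** R) *v v" by (simp add: matrix_vector_mul_assoc[symmetric])
  qed
  then have "det ?h = m" using d dR by (simp add: det_mul)
  then have "m = 1" using G(1) unfolding SOnn_def by simp
  then show ?thesis using le by simp
qed

text \<open>The quotient map is open: the cosets that meet a ball around \<open>a\<close> form an
  open set. So converging cosets come arbitrarily close to each point \<open>a\<close> of the limit
  coset, and almost nearest points are chosen in them.\<close>

lemma coset_limit_lift:
  fixes G :: "'a::metric_space monoid"
  assumes G: "group G" and P: "P \<subseteq> carrier G"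
    and cont: "\<And>p. p \<in> P \<Longrightarrow> continuous_on (carrier G) (\<lambda>g. g \<otimes>\<^bsub>G\<^esub> p)"
    and lim: "limitin (coset_topology G P) c c0 sequentially" and c: "\<And>n. c n \<in> lcosets\<^bsub>G\<^esub> P" "P \<noteq> {}"
    and a: "a \<in> c0"
  obtains b where "\<And>n. b n \<in> c n" "b \<longlonglongrightarrow> a"
proof -
  have near: "\<forall>\<^sub>F n in sequentially. \<exists>b\<in>c n. dist b a < e" if "e > 0" for e
  proof -
    let ?V = "{x \<in> lcosets\<^bsub>G\<^esub> P. \<exists>b\<in>x. dist b a < e}"
    have "{g \<in> carrier G. g <#\<^bsub>G\<^esub> P \<in> ?V} = (\<Union>p\<in>P. carrier G \<inter> (\<lambda>g. g \<otimes>\<^bsub>G\<^esub> p) -` ball a e)"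
      unfolding LCOSETS_def l_coset_def by (auto simp: dist_commute)
    moreover have "openin (top_of_set (carrier G)) (\<Union>p\<in>P. carrier G \<inter> (\<lambda>g. g \<otimes>\<^bsub>G\<^esub> p) -` ball a e)"
      by (intro openin_clauses(3)) (auto intro!: continuous_openin_preimage_gen cont)
    ultimately have "openin (coset_topology G P) ?V" unfolding openin_coset_topology by auto
    moreover have "c0 \<in> ?V" using limitin_topspace[OF lim] a that by (auto intro!: bexI[of _ a])
    ultimately have "\<forall>\<^sub>F n in sequentially. c n \<in> ?V" using lim unfolding limitin_def by blast
    then show ?thesis by eventually_elim blast
  qed
  have ne: "c n \<noteq> {}" for n using c unfolding LCOSETS_def l_coset_def by auto
  \<comment> \<open>The distance to the coset need not be attained in it, hence the slack tending to
    0.\<close>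
  have "\<exists>b\<in>c n. dist a b < infdist a (c n) + 1 / real (Suc n)" for n
  proof -
    have "Inf (dist a ` c n) < infdist a (c n) + 1 / real (Suc n)"
      unfolding infdist_notempty[OF ne] by (simp add: image_def)
    then show ?thesis using cInf_lessD[of "dist a ` c n"] ne by blast
  qed
  then obtain b where b: "\<And>n. b n \<in> c n" "\<And>n. dist a (b n) < infdist a (c n) + 1 / real (Suc n)" by metis
  have "b \<longlonglongrightarrow> a"
  proof (rule tendstoI)
    fix e :: real assume e: "e > 0"
    have "\<forall>\<^sub>F n in sequentially. 1 / real (Suc n) < e / 2"
      using e by real_asymp
    then show "\<forall>\<^sub>F n in sequentially. dist (b n) a < e"
      using near[OF half_gt_zero[OF e]]
    proof eventually_elim
      case (elim n)
      then obtain b' where b': "b' \<in> c n" "dist b' a < e / 2" by auto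
      have "infdist a (c n) < e / 2" using infdist_le[OF b'(1), of a] b'(2) by (simp add: dist_commute)
      then show ?case using b(2)[of n] elim(1) by (simp add: dist_commute)
    qed
  qed
  then show ?thesis using b(1) that by blast
qed

section \<open>Bundles of an affine Anosov representation\<close>

lemma Pa_one: "(mat 1, 0) \<in> Pa k \<epsilon>"
  unfolding Pa_iff affine_act_def by (simp add: G0_one)

text \<open>Slicing the cone at last coordinate 1 gives back the affine null subspace, so preserving
  the cone is also sufficient for membership in the stabilizer.\<close>

lemma Pa_hat:
  assumes p: "p \<in> carrier (Ga_group k)" and im: "hat k p ` O0 k \<epsilon> = O0 k \<epsilon>"
  shows "p \<in> Pa k \<epsilon>"
proof -
  let ?e = "axis (Inr k) 1 :: 'a vec2"
  have act: "affine_act p z = hat k p (z + ?e) - ?e" if "z \<in> hyp k" for z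
    using that p unfolding affine_act_def hat_def
    by (simp add: matrix_vector_right_distrib G0_axis axis_nth)
  have "affine_act p ` (O0 k \<epsilon> \<inter> hyp k) = O0 k \<epsilon> \<inter> hyp k"
  proof (intro equalityI subsetI)
    fix x assume "x \<in> affine_act p ` (O0 k \<epsilon> \<inter> hyp k)"
    then obtain z where z: "z \<in> O0 k \<epsilon>" "z \<in> hyp k" "x = hat k p (z + ?e) - ?e" using act by auto
    have "hat k p (z + ?e) \<in> O0 k \<epsilon>" using im z(1) O0_axis(2) subspace_add[OF subspace_O0] by blast
    then have "x \<in> O0 k \<epsilon>" unfolding z(3) by (intro subspace_diff subspace_O0 O0_axis)
    moreover have "x $ Inr k = 0" using z by (simp add: hat_component[OF p] axis_nth)
    ultimately show "x \<in> O0 k \<epsilon> \<inter> hyp k" by simp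
  next
    fix z assume z: "z \<in> O0 k \<epsilon> \<inter> hyp k"
    then have "z + ?e \<in> O0 k \<epsilon>" using O0_axis(2) subspace_add[OF subspace_O0] by blast
    then obtain y where y: "y \<in> O0 k \<epsilon>" "z + ?e = hat k p y" using im by blast
    have "(z + ?e) $ Inr k = 1" using z by (simp add: axis_def)
    then have yk: "y $ Inr k = 1" unfolding y(2) hat_component[OF p] .
    have "y - ?e \<in> O0 k \<epsilon> \<inter> hyp k" using subspace_diff[OF subspace_O0 y(1) O0_axis(2)] yk by (simp add: axis_nth)
    moreover have "affine_act p (y - ?e) = z" using act[of "y - ?e"] yk by (simp add: axis_nth flip: y(2))
    ultimately show "z \<in> affine_act p ` (O0 k \<epsilon> \<inter> hyp k)" by force
  qed
  then show ?thesis using p unfolding Pa_iff by blast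
qed

lemma hat_image:
  assumes "a \<in> carrier (Ga_group k)" "b \<in> carrier (Ga_group k)"
  shows "hat k (a \<otimes>\<^bsub>Ga_group k\<^esub> b) ` V = hat k a ` hat k b ` V"
  unfolding image_image by (intro image_cong refl hat_mult assms)

text \<open>A point of the flag space is now a linear subspace, the cone over an affine null
  subspace. All later work on the limit maps is linear algebra with these cones.\<close>

lemma coset_Ga:
  assumes "g \<in> carrier (Ga_group k)"
  shows "g <#\<^bsub>Ga_group k\<^esub> Pa k \<epsilon> = {b \<in> carrier (Ga_group k). hat k b ` O0 k \<epsilon> = hat k g ` O0 k \<epsilon>}"
proof -
  interpret Ga: group "Ga_group k" by (rule group_Ga)
  note hm = hat_image
  show ?thesis
  proof (intro equalityI subsetI)
    fix b assume "b \<in> g <#\<^bsub>Ga_group k\<^esub> Pa k \<epsilon>"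
    then obtain p where p: "p \<in> Pa k \<epsilon>" "b = g \<otimes>\<^bsub>Ga_group k\<^esub> p" unfolding l_coset_def by blast
    have pc: "p \<in> carrier (Ga_group k)" using p(1) unfolding Pa_iff by blast
    show "b \<in> {b \<in> carrier (Ga_group k). hat k b ` O0 k \<epsilon> = hat k g ` O0 k \<epsilon>}"
      unfolding p(2) mem_Collect_eq hm[OF assms pc] Pa_linear(3)[OF p(1)] using Ga.m_closed[OF assms pc] by blast
  next
    fix b assume "b \<in> {b \<in> carrier (Ga_group k). hat k b ` O0 k \<epsilon> = hat k g ` O0 k \<epsilon>}"
    then have b: "b \<in> carrier (Ga_group k)" "hat k b ` O0 k \<epsilon> = hat k g ` O0 k \<epsilon>" by blast+
    let ?p = "inv\<^bsub>Ga_group k\<^esub> g \<otimes>\<^bsub>Ga_group k\<^esub> b"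
    have ig: "inv\<^bsub>Ga_group k\<^esub> g \<in> carrier (Ga_group k)" by (rule Ga.inv_closed[OF assms])
    have "hat k ?p ` O0 k \<epsilon> = O0 k \<epsilon>"
      unfolding hm[OF ig b(1)] b(2) image_image hat_inv[OF assms] by simp
    then have "?p \<in> Pa k \<epsilon>" by (intro Pa_hat Ga.m_closed ig b)
    moreover have "b = g \<otimes>\<^bsub>Ga_group k\<^esub> ?p"
      using Ga.m_assoc[OF assms ig b(1)] Ga.r_inv[OF assms] Ga.l_one[OF b(1)] by metis
    ultimately show "b \<in> g <#\<^bsub>Ga_group k\<^esub> Pa k \<epsilon>" unfolding l_coset_def by blast
  qed
qed

lemma coset_Ga_W0:
  assumes g: "g \<in> carrier (Ga_group k)" and b: "b \<in> g <#\<^bsub>Ga_group k\<^esub> Pa k \<epsilon>"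
  shows "hat k b ` W0 k \<epsilon> = hat k g ` W0 k \<epsilon>"
proof -
  obtain p where p: "p \<in> Pa k \<epsilon>" "b = g \<otimes>\<^bsub>Ga_group k\<^esub> p" using b unfolding l_coset_def by blast
  have pc: "p \<in> carrier (Ga_group k)" using p(1) unfolding Pa_iff by blast
  have "hat k b ` W0 k \<epsilon> = hat k g ` hat k p ` W0 k \<epsilon>" unfolding p(2) by (rule hat_image[OF g pc])
  then show ?thesis unfolding Pa_linear(4)[OF p(1)] .
qed

text \<open>Pure translations are the tangent vectors at which the contraction hypothesis will be
  evaluated; they turn norms on the Lie algebra into seminorms on \<open>hyp k\<close>.\<close>

lemma lie_translation:
  assumes "w \<in> hyp k" shows "(0, w) \<in> lie_algebra (Ga_group k) (carrier (Ga_group k))"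
proof -
  have "((\<lambda>t. (mat 1, t *\<^sub>R w)) has_vector_derivative (0, w)) (at 0)"
    by (auto intro!: derivative_eq_intros)
  then show ?thesis unfolding lie_algebra_def using assms
    by (auto intro!: exI[of _ "\<lambda>t. (mat 1, t *\<^sub>R w)"] simp: G0_one)
qed

lemma Ad_translation:
  "Ad (Ga_group k) a (0, w) = (0, fst a *v w)"
proof -
  let ?G = "Ga_group k" and ?i = "inv\<^bsub>Ga_group k\<^esub> a"
  let ?f = "\<lambda>x. (fst a ** fst x ** fst ?i, fst a *v snd x + (fst a ** fst x ** mat 1) *v snd ?i)"
  have "linear ?f"
    by (intro linearI) (simp_all add: bilinear_ladd[OF bilinear_matrix_mult] bilinear_radd[OF bilinear_matrix_mult]
      bilinear_lmul[OF bilinear_matrix_mult] bilinear_rmul[OF bilinear_matrix_mult] scaleR_matrix_vector_assoc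
      matrix_vector_mult_scaleR matrix_vector_mult_add_rdistrib matrix_vector_right_distrib algebra_simps)
  then have "((\<lambda>x. (0, snd a) + ?f x) has_derivative ?f) (at \<one>\<^bsub>?G\<^esub>)"
    using has_derivative_add[OF has_derivative_const bounded_linear_imp_has_derivative[OF linear_conv_bounded_linear[THEN iffD1]], of ?f "(0, snd a)"]
    by simp
  moreover have "(\<lambda>x. a \<otimes>\<^bsub>?G\<^esub> x \<otimes>\<^bsub>?G\<^esub> ?i) = (\<lambda>x. (0, snd a) + ?f x)"
    by (simp add: fun_eq_iff add.assoc)
  ultimately have "((\<lambda>x. a \<otimes>\<^bsub>?G\<^esub> x \<otimes>\<^bsub>?G\<^esub> ?i) has_derivative ?f) (at \<one>\<^bsub>?G\<^esub>)" by simp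
  from fun_cong[OF frechet_derivative_at[OF this], of "(0, w)", symmetric] show ?thesis
    unfolding Ad_def by simp
qed

locale affine_data = flow_system \<Gamma> S act D
  for \<Gamma> :: "'g monoid" (structure) and S :: "'g set"
    and act :: "'g \<Rightarrow> 'g fpoint \<Rightarrow> 'g fpoint" and D :: "'g fpoint \<Rightarrow> 'g fpoint \<Rightarrow> real" +
  fixes k :: "'n::finite" and a0 :: "'g \<Rightarrow> 'n mat2 \<times> 'n vec2"
    and \<xi> :: "bool \<Rightarrow> 'g bpoint \<Rightarrow> ('n mat2 \<times> 'n vec2) set"
    and N :: "'g fpoint \<Rightarrow> 'n mat2 \<times> 'n vec2 \<Rightarrow> real" and C c :: real and s :: "'g fpoint \<Rightarrow> 'n vec2"
  assumes a0_hom: "a0 \<in> hom \<Gamma> (Ga_group k)"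
    and \<xi>_cont: "continuous_map B (coset_topology (Ga_group k) (Pa k \<epsilon>)) (\<xi> \<epsilon>)"
    and \<xi>_inj: "inj_on (\<xi> \<epsilon>) bdry"
    and \<xi>_equiv: "\<gamma> \<in> carrier \<Gamma> \<Longrightarrow> x \<in> bdry \<Longrightarrow> \<xi> \<epsilon> (\<beta> \<gamma> x) = a0 \<gamma> <#\<^bsub>Ga_group k\<^esub> \<xi> \<epsilon> x"
    and \<xi>_pair: "p \<in> X \<Longrightarrow> \<xi> True (ep True p) \<inter> \<xi> False (ep False p) \<in> lcosets\<^bsub>Ga_group k\<^esub> (Pa k True \<inter> Pa k False)"
    and C_pos: "C > 0" and c_pos: "c > 0"
    and N_mod: "p \<in> X \<Longrightarrow> euclidean_norm_mod (lie_algebra (Ga_group k) (carrier (Ga_group k)))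
      (lie_algebra (Ga_group k) (coset_stabilizer (Ga_group k) (\<xi> True (ep True p) \<inter> \<xi> False (ep False p)))) (N p)"
    and N_cont: "continuous_map (prod_topology T (top_of_set (lie_algebra (Ga_group k) (carrier (Ga_group k)))))
      euclideanreal (\<lambda>(p, x). N p x)"
    and N_equiv: "\<gamma> \<in> carrier \<Gamma> \<Longrightarrow> p \<in> X \<Longrightarrow> Y \<in> lie_algebra (Ga_group k) (carrier (Ga_group k)) \<Longrightarrow>
      N (act \<gamma> p) (Ad (Ga_group k) (a0 \<gamma>) Y) = N p Y"
    and N_contract: "p \<in> X \<Longrightarrow> t \<ge> 0 \<Longrightarrow>
      Y \<in> lie_algebra (Ga_group k) (coset_stabilizer (Ga_group k) (\<xi> \<epsilon> (ep \<epsilon> p))) \<Longrightarrow>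
      N (flow (sg \<epsilon> * t) p) Y \<le> C * exp (- c * t) * N p Y"
    and s_hyp: "p \<in> X \<Longrightarrow> s p \<in> hyp k"
    and s_equiv: "\<gamma> \<in> carrier \<Gamma> \<Longrightarrow> p \<in> X \<Longrightarrow> s (act \<gamma> p) = affine_act (a0 \<gamma>) (s p)"
    and s_hoelder: "hoelder_on_flow \<Gamma> S D s"
    and s_diff: "p \<in> X \<Longrightarrow> (\<lambda>\<tau>. s (flow \<tau> p)) differentiable at t"
    and s_transverse: "p \<in> X \<Longrightarrow> form (vector_derivative (\<lambda>t. s (flow t p)) (at 0))
      (nu k (fst ` (\<xi> True (ep True p) \<inter> \<xi> False (ep False p)))) \<noteq> 0"
begin

abbreviation "Ga \<equiv> Ga_group k"
abbreviation "R \<gamma> \<equiv> hat k (a0 \<gamma>)"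
abbreviation "en \<equiv> axis (Inl k) 1 :: 'n vec2"
abbreviation "e2n \<equiv> axis (Inr k) 1 :: 'n vec2"

sublocale Ga: group "Ga_group k" by (rule group_Ga)

lemma a0_carrier: "\<gamma> \<in> carrier \<Gamma> \<Longrightarrow> a0 \<gamma> \<in> carrier Ga"
  using a0_hom unfolding hom_def by blast

lemma \<xi>_coset: assumes "x \<in> bdry" obtains g where "g \<in> carrier Ga" "\<xi> \<epsilon> x = g <#\<^bsub>Ga\<^esub> Pa k \<epsilon>"
proof -
  have "\<xi> \<epsilon> x \<in> lcosets\<^bsub>Ga\<^esub> (Pa k \<epsilon>)"
    using continuous_map_image_subset_topspace[OF \<xi>_cont[of \<epsilon>]] assms by auto
  then show ?thesis using that unfolding LCOSETS_def by auto
qed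

text \<open>The cone over the affine limit subspace at \<open>x\<close>. The union runs over all
  representatives of the coset, which all give the same subspace; this avoids a choice. The same
  holds for its isotropic part \<open>W\<close>.\<close>

definition A :: "bool \<Rightarrow> 'g bpoint \<Rightarrow> 'n vec2 set" where
  "A \<epsilon> x = (\<Union>a\<in>\<xi> \<epsilon> x. hat k a ` O0 k \<epsilon>)"

definition W :: "bool \<Rightarrow> 'g bpoint \<Rightarrow> 'n vec2 set" where
  "W \<epsilon> x = (\<Union>a\<in>\<xi> \<epsilon> x. hat k a ` W0 k \<epsilon>)"

lemma \<xi>_eq:
  assumes "x \<in> bdry" "a \<in> \<xi> \<epsilon> x"
  shows "a \<in> carrier Ga" "A \<epsilon> x = hat k a ` O0 k \<epsilon>" "W \<epsilon> x = hat k a ` W0 k \<epsilon>"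
    "\<xi> \<epsilon> x = {b \<in> carrier Ga. hat k b ` O0 k \<epsilon> = A \<epsilon> x}"
proof -
  obtain g where g: "g \<in> carrier Ga" "\<xi> \<epsilon> x = g <#\<^bsub>Ga\<^esub> Pa k \<epsilon>" using \<xi>_coset[OF assms(1)] .
  note x = g(2)[unfolded coset_Ga[OF g(1)]]
  show a: "a \<in> carrier Ga" using assms(2) unfolding x by blast
  show A: "A \<epsilon> x = hat k a ` O0 k \<epsilon>" unfolding A_def using assms(2) unfolding x by blast
  show "W \<epsilon> x = hat k a ` W0 k \<epsilon>"
  proof -
    have "hat k b ` W0 k \<epsilon> = hat k a ` W0 k \<epsilon>" if "b \<in> \<xi> \<epsilon> x" for b
      using coset_Ga_W0[OF g(1), of b \<epsilon>] coset_Ga_W0[OF g(1), of a \<epsilon>] assms(2) that unfolding g(2) by simp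
    then show ?thesis unfolding W_def using assms(2) by blast
  qed
  show "\<xi> \<epsilon> x = {b \<in> carrier Ga. hat k b ` O0 k \<epsilon> = A \<epsilon> x}" unfolding A using assms(2) unfolding x by blast
qed

lemma \<xi>_ex: assumes "x \<in> bdry" obtains a where "a \<in> \<xi> \<epsilon> x"
proof -
  obtain g where "g \<in> carrier Ga" "\<xi> \<epsilon> x = g <#\<^bsub>Ga\<^esub> Pa k \<epsilon>" using \<xi>_coset[OF assms(1)] .
  then show ?thesis using that[of g] by (simp add: coset_Ga)
qed

lemma A_inj:
  assumes "x \<in> bdry" "y \<in> bdry" "A \<epsilon> x = A \<epsilon> y" shows "x = y"
proof -
  obtain a where a: "a \<in> \<xi> \<epsilon> x" using \<xi>_ex[OF assms(1)] .
  obtain b where b: "b \<in> \<xi> \<epsilon> y" using \<xi>_ex[OF assms(2)] .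
  have "\<xi> \<epsilon> x = \<xi> \<epsilon> y" unfolding \<xi>_eq(4)[OF assms(1) a] \<xi>_eq(4)[OF assms(2) b] assms(3) ..
  then show ?thesis by (rule inj_onD[OF \<xi>_inj _ assms(1,2)])
qed

lemma subspace_A: "subspace (A \<epsilon> x)"
  and subspace_W: "subspace (W \<epsilon> x)"
  and dim_A: "dim (A \<epsilon> x) = dim (O0 k \<epsilon>)" if "x \<in> bdry"
proof -
  obtain a where a: "a \<in> \<xi> \<epsilon> x" using \<xi>_ex[OF \<open>x \<in> bdry\<close>] .
  note eq = \<xi>_eq[OF \<open>x \<in> bdry\<close> a]
  show "subspace (A \<epsilon> x)" "subspace (W \<epsilon> x)"
    unfolding eq(2,3) by (intro linear_subspace_image linear_hat subspace_O0 subspace_W0)+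
  show "dim (A \<epsilon> x) = dim (O0 k \<epsilon>)"
    unfolding eq(2) using dim_image_eq[OF linear_hat inj_on_subset[OF inj_hat[OF eq(1)] subset_UNIV]] .
qed

lemma A_subset_eq:
  assumes "x \<in> bdry" "y \<in> bdry" "A \<epsilon> x \<subseteq> A \<epsilon> y" shows "x = y"
  using A_inj[OF assms(1,2)] subspace_dim_equal[OF subspace_A[OF assms(1)] subspace_A[OF assms(2)] assms(3)]
    dim_A[OF assms(1)] dim_A[OF assms(2)] by simp

lemma W_A: "x \<in> bdry \<Longrightarrow> W \<epsilon> x \<subseteq> A \<epsilon> x"
  unfolding W_def A_def using W0_O0 by blast

lemma W_hyp: assumes "x \<in> bdry" "w \<in> W \<epsilon> x" shows "w \<in> hyp k"
proof -
  obtain a where a: "a \<in> \<xi> \<epsilon> x" using \<xi>_ex[OF assms(1)] .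
  then obtain z where "z \<in> W0 k \<epsilon>" "w = hat k a z" using assms(2) \<xi>_eq(3)[OF assms(1) a] by blast
  then show ?thesis using W0_hyp[of z k \<epsilon>] hat_component[OF \<xi>_eq(1)[OF assms(1) a]] by simp
qed

lemma \<xi>_act:
  assumes "\<gamma> \<in> carrier \<Gamma>" "x \<in> bdry" "a \<in> \<xi> \<epsilon> x" shows "a0 \<gamma> \<otimes>\<^bsub>Ga\<^esub> a \<in> \<xi> \<epsilon> (\<beta> \<gamma> x)"
  unfolding \<xi>_equiv[OF assms(1,2)] l_coset_def using assms(3) by blast

lemma A_act: assumes "\<gamma> \<in> carrier \<Gamma>" "x \<in> bdry" shows "A \<epsilon> (\<beta> \<gamma> x) = R \<gamma> ` A \<epsilon> x"
  and W_act: "W \<epsilon> (\<beta> \<gamma> x) = R \<gamma> ` W \<epsilon> x"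
proof -
  obtain a where a: "a \<in> \<xi> \<epsilon> x" using \<xi>_ex[OF assms(2)] .
  note g = a0_carrier[OF assms(1)] and ac = \<xi>_eq(1)[OF assms(2) a]
  note b = bdry_act[OF assms] \<xi>_act[OF assms a]
  show "A \<epsilon> (\<beta> \<gamma> x) = R \<gamma> ` A \<epsilon> x" "W \<epsilon> (\<beta> \<gamma> x) = R \<gamma> ` W \<epsilon> x"
    unfolding \<xi>_eq(2,3)[OF b] \<xi>_eq(2,3)[OF assms(2) a] image_image hat_mult[OF g ac] by (rule refl)+
qed

lemma R_inv: "\<gamma> \<in> carrier \<Gamma> \<Longrightarrow> hat k (inv\<^bsub>Ga\<^esub> (a0 \<gamma>)) (R \<gamma> v) = v"
  using hat_inv(1)[OF a0_carrier] .

lemma R_mem_iff: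
  assumes "\<gamma> \<in> carrier \<Gamma>" "x \<in> bdry"
  shows "R \<gamma> v \<in> A \<epsilon> (\<beta> \<gamma> x) \<longleftrightarrow> v \<in> A \<epsilon> x" "R \<gamma> v \<in> W \<epsilon> (\<beta> \<gamma> x) \<longleftrightarrow> v \<in> W \<epsilon> x"
  unfolding A_act[OF assms] W_act[OF assms] using inj_hat[OF a0_carrier[OF assms(1)]]
  by (simp_all add: inj_image_mem_iff)

lemma \<xi>_limit:
  assumes "limitin B x y sequentially" "\<And>j. x j \<in> bdry" "a \<in> \<xi> \<epsilon> y"
  obtains b where "\<And>j. b j \<in> \<xi> \<epsilon> (x j)" "b \<longlonglongrightarrow> a"
proof -
  have "limitin (coset_topology Ga (Pa k \<epsilon>)) (\<xi> \<epsilon> \<circ> x) (\<xi> \<epsilon> y) sequentially"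
    by (rule continuous_map_limit[OF \<xi>_cont assms(1)])
  then have lim: "limitin (coset_topology Ga (Pa k \<epsilon>)) (\<lambda>j. \<xi> \<epsilon> (x j)) (\<xi> \<epsilon> y) sequentially" by (simp add: o_def)
  show ?thesis
  proof (rule coset_limit_lift[OF group_Ga _ _ lim _ _ assms(3)])
    show "Pa k \<epsilon> \<subseteq> carrier Ga" using Pa_iff by blast
    show "continuous_on (carrier Ga) (\<lambda>g. g \<otimes>\<^bsub>Ga\<^esub> p)" for p
      unfolding Ga_simps continuous_on_def by (auto intro!: tendsto_intros)
    show "\<xi> \<epsilon> (x j) \<in> lcosets\<^bsub>Ga\<^esub> Pa k \<epsilon>" for j
      using continuous_map_image_subset_topspace[OF \<xi>_cont[of \<epsilon>]] assms(2)[of j] by auto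
    show "Pa k \<epsilon> \<noteq> {}" using Pa_one by blast
  qed (use that in blast)
qed

text \<open>Representatives are lifted to a convergent sequence in the group, and the vectors are
  pulled back by it into one fixed closed subspace.\<close>

lemma closed_limit:
  assumes x: "limitin B x y sequentially" "\<And>j. x j \<in> bdry" and v: "v \<longlonglongrightarrow> w"
  shows "(\<And>j. v j \<in> A \<epsilon> (x j)) \<Longrightarrow> w \<in> A \<epsilon> y" "(\<And>j. v j \<in> W \<epsilon> (x j)) \<Longrightarrow> w \<in> W \<epsilon> y"
proof -
  have y: "y \<in> bdry" using limitin_topspace[OF x(1)] by simp
  obtain a where a: "a \<in> \<xi> \<epsilon> y" using \<xi>_ex[OF y] .
  obtain b where b: "\<And>j. b j \<in> \<xi> \<epsilon> (x j)" "b \<longlonglongrightarrow> a" using \<xi>_limit[OF x a] by blast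
  note bc = \<xi>_eq(1)[OF x(2) b(1)] and ac = \<xi>_eq(1)[OF y a]
  have lim: "(\<lambda>j. hat k (inv\<^bsub>Ga\<^esub> (b j)) (v j)) \<longlonglongrightarrow> hat k (inv\<^bsub>Ga\<^esub> a) w"
    by (rule tendsto_hat[OF tendsto_Ga_inv[OF b(2) bc ac] v])
  have *: "w \<in> hat k a ` V" if V: "subspace V" "\<And>j. v j \<in> hat k (b j) ` V" for V
  proof -
    have "hat k (inv\<^bsub>Ga\<^esub> (b j)) (v j) \<in> V" for j using V(2)[of j] hat_inv(1)[OF bc] by auto
    then have "hat k (inv\<^bsub>Ga\<^esub> a) w \<in> V" using closed_sequentially[OF closed_subspace[OF V(1)] _ lim] by blast
    then show ?thesis using hat_inv(2)[OF ac, of w] by (metis imageI)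
  qed
  show "(\<And>j. v j \<in> A \<epsilon> (x j)) \<Longrightarrow> w \<in> A \<epsilon> y"
    using *[OF subspace_O0[of k \<epsilon>]] unfolding \<xi>_eq(2)[OF x(2) b(1)] \<xi>_eq(2)[OF y a] by blast
  show "(\<And>j. v j \<in> W \<epsilon> (x j)) \<Longrightarrow> w \<in> W \<epsilon> y"
    using *[OF subspace_W0[of k \<epsilon>]] unfolding \<xi>_eq(3)[OF x(2) b(1)] \<xi>_eq(3)[OF y a] by blast
qed

lemma A_approx:
  assumes x: "limitin B x y sequentially" "\<And>j. x j \<in> bdry" and w: "w \<in> A \<epsilon> y"
  obtains v where "\<And>j. v j \<in> A \<epsilon> (x j)" "v \<longlonglongrightarrow> w"
proof -
  have y: "y \<in> bdry" using limitin_topspace[OF x(1)] by simp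
  obtain a where a: "a \<in> \<xi> \<epsilon> y" using \<xi>_ex[OF y] .
  obtain b where b: "\<And>j. b j \<in> \<xi> \<epsilon> (x j)" "b \<longlonglongrightarrow> a" using \<xi>_limit[OF x a] by blast
  obtain z where z: "z \<in> O0 k \<epsilon>" "w = hat k a z" using w unfolding \<xi>_eq(2)[OF y a] by blast
  show ?thesis
  proof (rule that[of "\<lambda>j. hat k (b j) z"])
    show "hat k (b j) z \<in> A \<epsilon> (x j)" for j unfolding \<xi>_eq(2)[OF x(2) b(1)] using z(1) by blast
    show "(\<lambda>j. hat k (b j) z) \<longlonglongrightarrow> w" unfolding z(2) by (rule tendsto_hat[OF b(2) tendsto_const])
  qed
qed

section \<open>Adapted frames, the neutral direction and equivariant projections\<close>

definition frame :: "'g fpoint \<Rightarrow> 'n mat2 \<times> 'n vec2" where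
  "frame p = (SOME a. a \<in> \<xi> True (ep True p) \<inter> \<xi> False (ep False p))"

definition \<nu> :: "'g fpoint \<Rightarrow> 'n vec2" where
  "\<nu> p = nu k (fst ` (\<xi> True (ep True p) \<inter> \<xi> False (ep False p)))"

text \<open>\<open>nu\<close> is given by \<open>the_elem\<close>, which has its intended meaning
  only because \<open>Pa_fix\<close> makes the image of the basis vector \<open>en\<close> the same
  for all representatives.\<close>

lemma frame: assumes "p \<in> X" shows "frame p \<in> \<xi> \<epsilon> (ep \<epsilon> p)" "frame p \<in> carrier Ga"
  and \<nu>_eq: "(\<And>\<epsilon>. a \<in> \<xi> \<epsilon> (ep \<epsilon> p)) \<Longrightarrow> \<nu> p = hat k a en"
proof -
  let ?I = "\<xi> True (ep True p) \<inter> \<xi> False (ep False p)"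
  obtain g where g: "g \<in> carrier Ga" "?I = g <#\<^bsub>Ga\<^esub> (Pa k True \<inter> Pa k False)"
    using \<xi>_pair[OF assms] unfolding LCOSETS_def by auto
  have "g \<otimes>\<^bsub>Ga\<^esub> (mat 1, 0) \<in> ?I" unfolding g(2) l_coset_def using Pa_one by blast
  then have f: "frame p \<in> ?I" unfolding frame_def by (rule someI)
  then show 1: "frame p \<in> \<xi> \<epsilon> (ep \<epsilon> p)" for \<epsilon> by (cases \<epsilon>) auto
  show "frame p \<in> carrier Ga" by (rule \<xi>_eq(1)[OF ep_bdry[OF assms] 1[of True]])
  have en: "en $ Inr k = 0" by (simp add: axis_def)
  have *: "fst b *v en = fst g *v en" if b: "b \<in> ?I" for b
  proof -
    obtain l where l: "l \<in> Pa k True" "l \<in> Pa k False" "b = g \<otimes>\<^bsub>Ga\<^esub> l" using b unfolding g(2) l_coset_def by blast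
    show ?thesis unfolding l(3) by (simp add: matrix_vector_mul_assoc[symmetric] Pa_fix[OF l(1,2)])
  qed
  moreover have "fst g *v en \<in> (\<lambda>h. h *v en) ` fst ` ?I" using imageI[OF imageI[OF f], of "\<lambda>h. h *v en" fst] *[OF f] by simp
  ultimately have "(\<lambda>h. h *v en) ` fst ` ?I = {fst g *v en}" by blast
  then have \<nu>: "\<nu> p = fst g *v en" unfolding \<nu>_def nu_def by simp
  show "\<nu> p = hat k a en" if "\<And>\<epsilon>. a \<in> \<xi> \<epsilon> (ep \<epsilon> p)" for a
    using that[of True] that[of False] * en unfolding \<nu> by (simp add: hat_def)
qed

lemma frame_flow [simp]: "frame (flow t p) = frame p"
  unfolding frame_def by simp

lemma \<nu>_flow [simp]: "\<nu> (flow t p) = \<nu> p"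
  unfolding \<nu>_def by simp

lemma \<nu>_frame: "p \<in> X \<Longrightarrow> \<nu> p = hat k (frame p) en"
  by (rule \<nu>_eq) (assumption, rule frame(1))

lemma W_A_inter: assumes "p \<in> X" shows "W \<epsilon> (ep \<epsilon> p) \<inter> A (\<not> \<epsilon>) (ep (\<not> \<epsilon>) p) = {0}"
proof -
  note f = frame(1)[OF assms]
  have "W \<epsilon> (ep \<epsilon> p) \<inter> A (\<not> \<epsilon>) (ep (\<not> \<epsilon>) p) = hat k (frame p) ` (W0 k \<epsilon> \<inter> O0 k (\<not> \<epsilon>))"
    unfolding \<xi>_eq(3)[OF ep_bdry[OF assms] f] \<xi>_eq(2)[OF ep_bdry[OF assms] f]
    using image_Int[OF inj_hat[OF frame(2)[OF assms]]] by simp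
  then show ?thesis unfolding W0_O0_inter by (simp add: linear_0[OF linear_hat])
qed

definition pr :: "bool \<Rightarrow> 'g fpoint \<Rightarrow> 'n vec2 \<Rightarrow> 'n vec2" where
  "pr \<epsilon> p v = hat k (frame p) (pr0 k \<epsilon> (hat k (inv\<^bsub>Ga\<^esub> (frame p)) v))"

lemma pr_flow [simp]: "pr \<epsilon> (flow t p) = pr \<epsilon> p"
  unfolding pr_def by simp

lemma linear_pr: "linear (pr \<epsilon> p)"
  unfolding pr_def[abs_def]
  by (rule linear_compose[OF linear_compose[OF linear_hat linear_pr0] linear_hat, unfolded o_def])

lemma pr: assumes "p \<in> X" shows "pr \<epsilon> p v \<in> W \<epsilon> (ep \<epsilon> p)" "v - pr \<epsilon> p v \<in> A (\<not> \<epsilon>) (ep (\<not> \<epsilon>) p)"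
proof -
  note f = frame(1)[OF assms] and fc = frame(2)[OF assms]
  let ?v = "hat k (inv\<^bsub>Ga\<^esub> (frame p)) v"
  show "pr \<epsilon> p v \<in> W \<epsilon> (ep \<epsilon> p)" unfolding \<xi>_eq(3)[OF ep_bdry[OF assms] f] pr_def by (intro imageI pr0)
  have "v - pr \<epsilon> p v = hat k (frame p) (?v - pr0 k \<epsilon> ?v)"
    unfolding pr_def linear_diff[OF linear_hat] hat_inv(2)[OF fc] ..
  then show "v - pr \<epsilon> p v \<in> A (\<not> \<epsilon>) (ep (\<not> \<epsilon>) p)"
    unfolding \<xi>_eq(2)[OF ep_bdry[OF assms] f] using pr0(2) by blast
qed

lemma pr_unique:
  assumes "p \<in> X" "w \<in> W \<epsilon> (ep \<epsilon> p)" "v - w \<in> A (\<not> \<epsilon>) (ep (\<not> \<epsilon>) p)"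
  shows "pr \<epsilon> p v = w"
proof -
  have "w - pr \<epsilon> p v \<in> W \<epsilon> (ep \<epsilon> p)" by (rule subspace_diff[OF subspace_W[OF ep_bdry[OF assms(1)]] assms(2) pr(1)[OF assms(1)]])
  moreover have "(v - pr \<epsilon> p v) - (v - w) \<in> A (\<not> \<epsilon>) (ep (\<not> \<epsilon>) p)"
    by (rule subspace_diff[OF subspace_A[OF ep_bdry[OF assms(1)]] pr(2)[OF assms(1)] assms(3)])
  ultimately have "w - pr \<epsilon> p v \<in> W \<epsilon> (ep \<epsilon> p) \<inter> A (\<not> \<epsilon>) (ep (\<not> \<epsilon>) p)" by simp
  then show ?thesis unfolding W_A_inter[OF assms(1)] by simp
qed

lemma pr_A: "p \<in> X \<Longrightarrow> z \<in> A (\<not> \<epsilon>) (ep (\<not> \<epsilon>) p) \<longleftrightarrow> pr \<epsilon> p z = 0"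
  using pr_unique[of p 0 \<epsilon> z] pr(2)[of p z \<epsilon>] by (auto simp: subspace_0 subspace_W ep_bdry)

lemma pr_act:
  assumes "\<gamma> \<in> carrier \<Gamma>" "p \<in> X" shows "pr \<epsilon> (act \<gamma> p) (R \<gamma> v) = R \<gamma> (pr \<epsilon> p v)"
proof (rule pr_unique)
  note e = ep_act[OF assms] and b = ep_bdry[OF assms(2)]
  show "R \<gamma> (pr \<epsilon> p v) \<in> W \<epsilon> (ep \<epsilon> (act \<gamma> p))" unfolding e R_mem_iff[OF assms(1) b] by (rule pr[OF assms(2)])
  show "R \<gamma> v - R \<gamma> (pr \<epsilon> p v) \<in> A (\<not> \<epsilon>) (ep (\<not> \<epsilon>) (act \<gamma> p))"
    unfolding e linear_diff[OF linear_hat, symmetric] R_mem_iff[OF assms(1) b] by (rule pr[OF assms(2)])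
qed (use assms in simp)

lemma pr_limit:
  assumes P: "conv P p" "\<And>j. P j \<in> X" and v: "v \<longlonglongrightarrow> w"
  shows "(\<lambda>j. pr \<epsilon> (P j) (v j)) \<longlonglongrightarrow> pr \<epsilon> p w"
proof -
  note p = conv_X[OF P(1)]
  have "\<exists>a0\<in>W \<epsilon> (ep \<epsilon> p). w - a0 \<in> A (\<not> \<epsilon>) (ep (\<not> \<epsilon>) p) \<and> (\<lambda>j. pr \<epsilon> (P j) (v j)) \<longlonglongrightarrow> a0"
  proof (rule decomposition_limit[where A = "\<lambda>j. W \<epsilon> (ep \<epsilon> (P j))" and B = "\<lambda>j. A (\<not> \<epsilon>) (ep (\<not> \<epsilon>) (P j))" and v = v])
    fix r :: "nat \<Rightarrow> nat" and v :: "nat \<Rightarrow> 'n vec2" and w assume r: "strict_mono r" and lim: "v \<longlonglongrightarrow> w"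
    have e: "limitin B (\<lambda>j. ep \<epsilon> (P (r j))) (ep \<epsilon> p) sequentially" for \<epsilon>
      using conv_ep[OF conv_subseq[OF P(1) r], of \<epsilon>] by (simp add: o_def)
    show "w \<in> W \<epsilon> (ep \<epsilon> p)" if "\<And>j. v j \<in> W \<epsilon> (ep \<epsilon> (P (r j)))"
      by (rule closed_limit(2)[OF e ep_bdry[OF P(2)] lim that])
    show "w \<in> A (\<not> \<epsilon>) (ep (\<not> \<epsilon>) p)" if "\<And>j. v j \<in> A (\<not> \<epsilon>) (ep (\<not> \<epsilon>) (P (r j)))"
      by (rule closed_limit(1)[OF e ep_bdry[OF P(2)] lim that])
  qed (simp_all add: subspace_W subspace_A ep_bdry P p pr v W_A_inter)
  then show ?thesis using pr_unique[OF p] by metis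
qed

lemma form_fst:
  assumes "a \<in> carrier Ga" "v \<in> hyp k" "w \<in> hyp k" shows "form (hat k a v) (hat k a w) = form v w"
  using assms SOnn_form[OF G0_SOnn[of "fst a" k]] by (simp add: hat_hyp)

lemma \<nu>: assumes "p \<in> X" shows "\<nu> p \<in> hyp k" "form (\<nu> p) (\<nu> p) = 1"
    "w \<in> W \<epsilon> (ep \<epsilon> p) \<Longrightarrow> form w (\<nu> p) = 0" "\<nu> p \<in> A \<epsilon> (ep \<epsilon> p)"
proof -
  note f = frame(1)[OF assms] and fc = frame(2)[OF assms]
  have en: "en \<in> hyp k" by (simp add: axis_def)
  show "\<nu> p \<in> hyp k" using hat_component[OF fc, of en] en unfolding \<nu>_frame[OF assms] by simp
  show "form (\<nu> p) (\<nu> p) = 1" unfolding \<nu>_frame[OF assms] form_fst[OF fc en en] form_Inl by (simp add: axis_def)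
  show "\<nu> p \<in> A \<epsilon> (ep \<epsilon> p)" unfolding \<nu>_frame[OF assms] \<xi>_eq(2)[OF ep_bdry[OF assms] f] using O0_axis(1) by blast
  assume "w \<in> W \<epsilon> (ep \<epsilon> p)"
  then obtain z where z: "z \<in> W0 k \<epsilon>" "w = hat k (frame p) z" unfolding \<xi>_eq(3)[OF ep_bdry[OF assms] f] by blast
  show "form w (\<nu> p) = 0" unfolding \<nu>_frame[OF assms] z(2) form_fst[OF fc W0_hyp[OF z(1)] en] form_Inl
    using z(1) unfolding W0_iff by simp
qed

lemma hyp_sum:
  assumes "p \<in> X" "v \<in> hyp k"
  shows "v = pr True p v + pr False p v + form v (\<nu> p) *\<^sub>R \<nu> p"
proof -
  note fc = frame(2)[OF assms(1)]
  let ?v = "hat k (inv\<^bsub>Ga\<^esub> (frame p)) v"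
  have "?v $ Inr k = 0" using hat_component[OF fc, of ?v] assms(2) by (simp add: hat_inv(2)[OF fc])
  then have "?v = pr0 k True ?v + pr0 k False ?v + ?v $ Inl k *\<^sub>R en" using pr0_sum[of ?v k] by simp
  then have "hat k (frame p) ?v = hat k (frame p) (pr0 k True ?v + pr0 k False ?v + ?v $ Inl k *\<^sub>R en)" by simp
  then have v: "v = pr True p v + pr False p v + ?v $ Inl k *\<^sub>R \<nu> p"
    unfolding hat_inv(2)[OF fc] linear_add[OF linear_hat] linear_scale[OF linear_hat] pr_def[symmetric] \<nu>_frame[OF assms(1)] .
  have "form v (\<nu> p) = ?v $ Inl k"
    by (subst v) (simp add: form_simps \<nu>[OF assms(1)] \<nu>(3)[OF assms(1) pr(1)[OF assms(1)]])
  then show ?thesis using v by simp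
qed

lemma pr_\<nu>: "p \<in> X \<Longrightarrow> pr \<epsilon> p (\<nu> p) = 0"
  using \<nu>(4)[of p "\<not> \<epsilon>"] pr_A[of p "\<nu> p" \<epsilon>] by simp

lemma \<nu>_act: assumes "\<gamma> \<in> carrier \<Gamma>" "p \<in> X" shows "\<nu> (act \<gamma> p) = R \<gamma> (\<nu> p)"
proof -
  have "a0 \<gamma> \<otimes>\<^bsub>Ga\<^esub> frame p \<in> \<xi> \<epsilon> (ep \<epsilon> (act \<gamma> p))" for \<epsilon>
    unfolding ep_act[OF assms] by (rule \<xi>_act[OF assms(1) ep_bdry[OF assms(2)] frame(1)[OF assms(2)]])
  then have "\<nu> (act \<gamma> p) = hat k (a0 \<gamma> \<otimes>\<^bsub>Ga\<^esub> frame p) en" using \<nu>_eq assms by simp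
  then show ?thesis unfolding hat_mult[OF a0_carrier[OF assms(1)] frame(2)[OF assms(2)]] \<nu>_frame[OF assms(2)] .
qed

end

section \<open>Contracted directions and the neutralised section\<close>

context affine_data
begin

definition n :: "'g fpoint \<Rightarrow> 'n vec2 \<Rightarrow> real" where "n p v = N p (0, v)"

lemma n_form:
  assumes "p \<in> X"
  shows "\<exists>b. bilinear b \<and> (\<forall>x y. b x y = b y x) \<and> (\<forall>v\<in>hyp k. 0 \<le> b v v \<and> n p v = sqrt (b v v) \<and>
    (b v v = 0 \<longrightarrow> (0, v) \<in> lie_algebra Ga
        (coset_stabilizer Ga (\<xi> True (ep True p) \<inter> \<xi> False (ep False p)))))"
proof -
  obtain b where b: "bilinear b" "\<And>x y. b x y = b y x"
      "\<And>x. x \<in> lie_algebra Ga (carrier Ga) \<Longrightarrow> 0 \<le> b x x"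
      "\<And>x. x \<in> lie_algebra Ga (carrier Ga) \<Longrightarrow> (b x x = 0 \<longleftrightarrow> x \<in> lie_algebra Ga
        (coset_stabilizer Ga (\<xi> True (ep True p) \<inter> \<xi> False (ep False p))))"
      "\<And>x. x \<in> lie_algebra Ga (carrier Ga) \<Longrightarrow> N p x = sqrt (b x x)"
    using N_mod[OF assms] unfolding euclidean_norm_mod_def by auto
  have add: "(0 :: 'n mat2, x + y) = (0, x) + (0, y)" "(0 :: 'n mat2, r *\<^sub>R x) = r *\<^sub>R (0, x)" for x y :: "'n vec2" and r
    by simp_all
  show ?thesis
  proof (intro exI[of _ "\<lambda>v w. b (0, v) (0, w)"] conjI allI ballI impI)
    show "bilinear (\<lambda>v w. b (0, v) (0, w))"
      unfolding bilinear_def by (intro conjI allI linearI; unfold add bilinear_ladd[OF b(1)] bilinear_radd[OF b(1)]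
        bilinear_lmul[OF b(1)] bilinear_rmul[OF b(1)]; rule refl)
    show "b (0, x) (0, y) = b (0, y) (0, x)" for x y by (rule b(2))
    fix v assume v: "v \<in> hyp k"
    note l = lie_translation[OF v]
    show "0 \<le> b (0, v) (0, v)" by (rule b(3)[OF l])
    show "n p v = sqrt (b (0, v) (0, v))" unfolding n_def by (rule b(5)[OF l])
    assume "b (0, v) (0, v) = 0"
    then show "(0, v) \<in> lie_algebra Ga (coset_stabilizer Ga (\<xi> True (ep True p) \<inter> \<xi> False (ep False p)))"
      using b(4)[OF l] by (rule iffD1[rotated])
  qed
qed

lemma hyp_closed: "v \<in> hyp k \<Longrightarrow> w \<in> hyp k \<Longrightarrow> v + w \<in> hyp k" "v \<in> hyp k \<Longrightarrow> t *\<^sub>R v \<in> hyp k"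
  "v \<in> hyp k \<Longrightarrow> w \<in> hyp k \<Longrightarrow> v - w \<in> hyp k"
  by simp_all

lemma n_nonneg: assumes "p \<in> X" "v \<in> hyp k" shows "0 \<le> n p v"
proof -
  obtain b where "\<forall>v\<in>hyp k. 0 \<le> b v v \<and> n p v = sqrt (b v v)"
    using n_form[OF assms(1)] by blast
  then show ?thesis using assms(2) by simp
qed

text \<open>Polarisation expresses the mixed term by squared norms, so expansions and limits can be
  handled without referring to the underlying bilinear form.\<close>

lemma n_expand:
  assumes "p \<in> X" "v \<in> hyp k" "w \<in> hyp k"
  shows "(n p (v + t *\<^sub>R w))\<^sup>2 = (n p v)\<^sup>2 + t * ((n p (v + w))\<^sup>2 - (n p v)\<^sup>2 - (n p w)\<^sup>2) + t\<^sup>2 * (n p w)\<^sup>2"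
proof -
  obtain b where b: "bilinear b" "\<forall>x y. b x y = b y x" "\<forall>v\<in>hyp k. 0 \<le> b v v \<and> n p v = sqrt (b v v)"
    using n_form[OF assms(1)] by blast
  have n2: "(n p v)\<^sup>2 = b v v" if "v \<in> hyp k" for v using b(3) that by simp
  have "v + t *\<^sub>R w \<in> hyp k" "v + w \<in> hyp k" using assms by (auto intro: hyp_closed)
  note n2[OF this(1)] n2[OF this(2)] n2[OF assms(2)] n2[OF assms(3)]
  then show ?thesis
    by (simp add: bilinear_ladd[OF b(1)] bilinear_radd[OF b(1)] bilinear_lmul[OF b(1)] bilinear_rmul[OF b(1)]
      b(2)[rule_format, of w v] algebra_simps power2_eq_square)
qed

lemma n_zero: "p \<in> X \<Longrightarrow> n p 0 = 0"
  using n_expand[of p 0 0 2] by simp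

lemma n_scale: assumes "p \<in> X" "v \<in> hyp k" shows "n p (t *\<^sub>R v) = \<bar>t\<bar> * n p v"
proof -
  have "(n p (t *\<^sub>R v))\<^sup>2 = (\<bar>t\<bar> * n p v)\<^sup>2"
    using n_expand[OF assms(1) _ assms(2), of 0 t] n_zero[OF assms(1)] by (simp add: power_mult_distrib)
  then show ?thesis using n_nonneg[OF assms] n_nonneg[OF assms(1), of "t *\<^sub>R v"] assms(2)
    by (simp add: power2_eq_iff_nonneg)
qed

text \<open>A null translation \<open>w\<close> is the velocity of a curve stabilizing the pair of
  flags. Applied to a vector of last coordinate 1 in both cones, the curve stays in both cones, so
  its velocity \<open>w\<close> lies in their intersection, which meets \<open>W \<epsilon>\<close>
  trivially.\<close>

lemma n_pos:
  assumes p: "p \<in> X" and w: "w \<in> W \<epsilon> (ep \<epsilon> p)" "w \<noteq> 0" shows "0 < n p w"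
proof (rule ccontr)
  let ?I = "\<xi> True (ep True p) \<inter> \<xi> False (ep False p)"
  note wh = W_hyp[OF ep_bdry[OF p] w(1)]
  assume "\<not> 0 < n p w"
  then have "n p w = 0" using n_nonneg[OF p wh] by simp
  obtain b where "\<forall>v\<in>hyp k. n p v = sqrt (b v v) \<and>
      (b v v = 0 \<longrightarrow> (0, v) \<in> lie_algebra Ga (coset_stabilizer Ga ?I))"
    using n_form[OF p] by blast
  then have "(0, w) \<in> lie_algebra Ga (coset_stabilizer Ga ?I)" using wh \<open>n p w = 0\<close> by simp
  then obtain f where f: "\<And>t. f t \<in> coset_stabilizer Ga ?I" "(f has_vector_derivative (0, w)) (at 0)"
    unfolding lie_algebra_def by blast
  let ?V = "A True (ep True p) \<inter> A False (ep False p)"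
  have sub: "subspace ?V" by (intro subspace_inter subspace_A ep_bdry p)
  have fr: "frame p \<in> ?I" using frame(1)[OF p] by blast
  note fc = frame(2)[OF p]
  define y where "y = hat k (frame p) e2n"
  have yk: "y $ Inr k = 1" unfolding y_def hat_component[OF fc] by (simp add: axis_nth)
  have fy: "hat k (f t) y \<in> ?V" for t
  proof -
    have t: "f t \<in> carrier Ga" "f t <#\<^bsub>Ga\<^esub> ?I = ?I" using f(1)[of t] unfolding coset_stabilizer_def by blast+
    then have m: "f t \<otimes>\<^bsub>Ga\<^esub> frame p \<in> ?I" unfolding l_coset_def using fr by blast
    have "hat k (f t) y = hat k (f t \<otimes>\<^bsub>Ga\<^esub> frame p) e2n" unfolding y_def hat_mult[OF t(1) fc] ..
    then show ?thesis using O0_axis(2) m unfolding A_def by blast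
  qed
  have "((\<lambda>t. fst (f t) *v y + snd (f t)) has_vector_derivative (0 *v y + w)) (at 0)"
    using has_vector_derivative_matrix_vector[OF bounded_linear.has_vector_derivative[OF bounded_linear_fst f(2)], of y]
      bounded_linear.has_vector_derivative[OF bounded_linear_snd f(2)]
    by (intro has_vector_derivative_add) simp_all
  then have "((\<lambda>t. hat k (f t) y) has_vector_derivative w) (at 0)" unfolding hat_def yk by simp
  then have "w \<in> ?V" by (rule has_vector_derivative_in_subspace[OF _ sub fy])
  then have "w \<in> W \<epsilon> (ep \<epsilon> p) \<inter> A (\<not> \<epsilon>) (ep (\<not> \<epsilon>) p)" using w(1) by (cases \<epsilon>) auto
  then show False using w(2) unfolding W_A_inter[OF p] by simp
qed

lemma n_act:
  assumes "\<gamma> \<in> carrier \<Gamma>" "p \<in> X" "v \<in> hyp k" shows "n (act \<gamma> p) (R \<gamma> v) = n p v"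
  using N_equiv[OF assms(1,2) lie_translation[OF assms(3)]] unfolding n_def Ad_translation hat_hyp[OF assms(3)] .

lemma n_limit:
  assumes P: "conv P p" and v: "\<And>j. v j \<in> hyp k" "v \<longlonglongrightarrow> w"
  shows "(\<lambda>j. n (P j) (v j)) \<longlonglongrightarrow> n p w"
proof -
  let ?L = "lie_algebra Ga (carrier Ga)"
  have "subspace (hyp k)" by (intro subspaceI) auto
  then have w: "w \<in> hyp k" using closed_sequentially[OF closed_subspace v] by blast
  have "(\<lambda>j. (0 :: 'n mat2, v j)) \<longlonglongrightarrow> (0, w)" by (intro tendsto_intros v)
  then have "limitin (top_of_set ?L) (\<lambda>j. (0, v j)) (0, w) sequentially"
    unfolding limitin_subtopology limitin_canonical_iff using lie_translation v(1) w by auto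
  then have "limitin (prod_topology T (top_of_set ?L)) (\<lambda>j. (P j, (0, v j))) (p, (0, w)) sequentially"
    unfolding limitin_pairwise using P by (simp add: o_def)
  from continuous_map_limit[OF N_cont this] show ?thesis unfolding n_def by (simp add: o_def)
qed

text \<open>A translation along the isotropic directions of an affine null subspace preserves the
  subspace. This places \<open>W \<epsilon>\<close> among the directions to which the contraction
  hypothesis applies.\<close>

lemma \<xi>_translate:
  assumes x: "x \<in> bdry" and w: "w \<in> W \<epsilon> x" shows "(0, w) \<in> lie_algebra Ga (coset_stabilizer Ga (\<xi> \<epsilon> x))"
proof -
  obtain a where a: "a \<in> \<xi> \<epsilon> x" using \<xi>_ex[OF x] .
  have st: "(mat 1, w) <#\<^bsub>Ga\<^esub> \<xi> \<epsilon> x \<subseteq> \<xi> \<epsilon> x" "(mat 1, w) \<in> carrier Ga" if w: "w \<in> W \<epsilon> x" for w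
  proof -
    show wc: "(mat 1, w) \<in> carrier Ga" using W_hyp[OF x w] by (simp add: G0_one)
    show "(mat 1, w) <#\<^bsub>Ga\<^esub> \<xi> \<epsilon> x \<subseteq> \<xi> \<epsilon> x"
    proof
      fix y assume "y \<in> (mat 1, w) <#\<^bsub>Ga\<^esub> \<xi> \<epsilon> x"
      then obtain b where b: "b \<in> \<xi> \<epsilon> x" "y = (mat 1, w) \<otimes>\<^bsub>Ga\<^esub> b" unfolding l_coset_def by blast
      note bc = \<xi>_eq(1)[OF x b(1)]
      have yc: "y \<in> carrier Ga" unfolding b(2) by (rule Ga.m_closed[OF wc bc])
      have "hat k y z \<in> A \<epsilon> x" if z: "z \<in> O0 k \<epsilon>" for z
      proof -
        have 1: "hat k b z \<in> A \<epsilon> x" unfolding \<xi>_eq(2)[OF x b(1)] using z by blast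
        have "hat k y z = hat k b z + (hat k b z $ Inr k) *\<^sub>R w" unfolding b(2) hat_mult[OF wc bc] by (simp add: hat_def)
        also have "\<dots> \<in> A \<epsilon> x"
          using 1 w W_A[OF x, of \<epsilon>] by (intro subspace_add subspace_scale subspace_A x) auto
        finally show ?thesis .
      qed
      then have "hat k y ` O0 k \<epsilon> \<subseteq> A \<epsilon> x" by blast
      then have "hat k y ` O0 k \<epsilon> = A \<epsilon> x"
        using dim_A[OF x, of \<epsilon>] dim_image_eq[OF linear_hat inj_on_subset[OF inj_hat[OF yc] subset_UNIV], of "O0 k \<epsilon>"]
        by (intro subspace_dim_equal linear_subspace_image linear_hat subspace_O0 subspace_A x) simp_all
      then show "y \<in> \<xi> \<epsilon> x" unfolding \<xi>_eq(4)[OF x a] using yc by blast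
    qed
  qed
  have "(mat 1, t *\<^sub>R w) \<in> coset_stabilizer Ga (\<xi> \<epsilon> x)" for t
  proof -
    have tw: "t *\<^sub>R w \<in> W \<epsilon> x" "(-t) *\<^sub>R w \<in> W \<epsilon> x" using subspace_scale[OF subspace_W[OF x] w] by blast+
    have "\<xi> \<epsilon> x \<subseteq> (mat 1, t *\<^sub>R w) <#\<^bsub>Ga\<^esub> \<xi> \<epsilon> x"
    proof
      fix b assume b: "b \<in> \<xi> \<epsilon> x"
      then have "(mat 1, (-t) *\<^sub>R w) \<otimes>\<^bsub>Ga\<^esub> b \<in> \<xi> \<epsilon> x" using st(1)[OF tw(2)] unfolding l_coset_def by blast
      moreover have "b = (mat 1, t *\<^sub>R w) \<otimes>\<^bsub>Ga\<^esub> ((mat 1, (-t) *\<^sub>R w) \<otimes>\<^bsub>Ga\<^esub> b)" by (simp add: prod_eq_iff)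
      ultimately show "b \<in> (mat 1, t *\<^sub>R w) <#\<^bsub>Ga\<^esub> \<xi> \<epsilon> x" unfolding l_coset_def by blast
    qed
    then show ?thesis using st[OF tw(1)] unfolding coset_stabilizer_def by blast
  qed
  moreover have "((\<lambda>t. (mat 1 :: 'n mat2, t *\<^sub>R w)) has_vector_derivative (0, w)) (at 0)"
    by (auto intro!: derivative_eq_intros)
  ultimately show ?thesis unfolding lie_algebra_def
    by (intro CollectI exI[of _ "\<lambda>t. (mat 1, t *\<^sub>R w)"]) auto
qed

lemma n_flow:
  assumes "p \<in> X" "w \<in> W \<epsilon> (ep \<epsilon> p)" "0 \<le> t"
  shows "n (flow (sg \<epsilon> * t) p) w \<le> C * exp (- c * t) * n p w"
  unfolding n_def using N_contract[OF assms(1,3) \<xi>_translate[OF ep_bdry[OF assms(1)] assms(2)]] .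

lemma n_flow_back:
  assumes "p \<in> X" "w \<in> W (\<not> \<epsilon>) (ep (\<not> \<epsilon>) p)" "0 \<le> t"
  shows "n p w \<le> C * exp (- c * t) * n (flow (sg \<epsilon> * t) p) w"
  using n_flow[of "flow (sg \<epsilon> * t) p" w "\<not> \<epsilon>" t] assms by simp

lemma n_lower:
  assumes "compactin T Y" shows "\<exists>r>0. \<forall>p\<in>Y. \<forall>w\<in>W \<epsilon> (ep \<epsilon> p). r * norm w \<le> n p w"
proof -
  have YX: "p \<in> X" if "p \<in> Y" for p using compactin_subset_topspace[OF assms] that by blast
  have "\<exists>r>0. \<forall>p\<in>Y. \<forall>v. norm v = 1 \<longrightarrow> v \<in> W \<epsilon> (ep \<epsilon> p) \<longrightarrow> r \<le> n p v"
  proof (rule compact_pos_bound[OF assms])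
    fix P p v w assume P: "\<And>j. P j \<in> Y" "\<And>j. v j \<in> W \<epsilon> (ep \<epsilon> (P j))" "conv P p" "v \<longlonglongrightarrow> w"
    have "w \<in> W \<epsilon> (ep \<epsilon> p)" by (rule closed_limit(2)[OF conv_ep[OF P(3)] ep_bdry[OF YX[OF P(1)]] P(4,2)])
    then show "(\<lambda>j. n (P j) (v j)) \<longlonglongrightarrow> n p w \<and> w \<in> W \<epsilon> (ep \<epsilon> p)"
      using n_limit[OF P(3) W_hyp[OF ep_bdry[OF YX[OF P(1)]] P(2)] P(4)] by blast
  next
    fix p and v :: "'n vec2" assume "p \<in> Y" "norm v = 1" "v \<in> W \<epsilon> (ep \<epsilon> p)"
    then show "0 < n p v" by (intro n_pos[OF YX]) auto
  qed
  then obtain r where r: "r > 0" "\<And>p v. p \<in> Y \<Longrightarrow> norm v = 1 \<Longrightarrow> v \<in> W \<epsilon> (ep \<epsilon> p) \<Longrightarrow> r \<le> n p v" by blast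
  have "r * norm w \<le> n p w" if p: "p \<in> Y" and w: "w \<in> W \<epsilon> (ep \<epsilon> p)" for p w
  proof (cases "w = 0")
    case False
    let ?u = "(1 / norm w) *\<^sub>R w"
    have "r \<le> n p ?u"
      by (rule r(2)[OF p]) (use False w in \<open>auto intro!: subspace_scale subspace_W ep_bdry YX p\<close>)
    also have "n p ?u = n p w / norm w" using n_scale[OF YX[OF p] W_hyp[OF ep_bdry[OF YX[OF p]] w], of "1 / norm w"] by simp
    finally show ?thesis using False by (simp add: field_simps)
  qed (use n_zero[OF YX[OF p]] in simp)
  then show ?thesis using r(1) by blast
qed

lemma n_small:
  assumes P: "conv P p" "\<And>j. P j \<in> X" and w: "\<And>j. w j \<in> W \<epsilon> (ep \<epsilon> (P j))" "(\<lambda>j. n (P j) (w j)) \<longlonglongrightarrow> 0"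
  shows "w \<longlonglongrightarrow> 0"
proof -
  obtain r where r: "r > 0" "\<And>q v. q \<in> insert p (range P) \<Longrightarrow> v \<in> W \<epsilon> (ep \<epsilon> q) \<Longrightarrow> r * norm v \<le> n q v"
    using n_lower[OF compact_convergent[OF P(2,1)], of \<epsilon>] by metis
  have "norm (w j) \<le> n (P j) (w j) / r" for j
    using r(2)[of "P j" "w j", OF _ w(1)] r(1) by (simp add: field_simps)
  moreover have "(\<lambda>j. n (P j) (w j) / r) \<longlonglongrightarrow> 0" using tendsto_divide[OF w(2) tendsto_const, of r] r(1) by simp
  ultimately show ?thesis by (intro Lim_null_comparison[OF _ \<open>(\<lambda>j. n (P j) (w j) / r) \<longlonglongrightarrow> 0\<close>]) auto
qed

lemma s_limit: assumes P: "conv P p" shows "(\<lambda>j. s (P j)) \<longlonglongrightarrow> s p"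
proof -
  have p: "p \<in> X" by (rule conv_X[OF P])
  obtain r H \<alpha> where r: "r > 0" "0 < \<alpha>"
    "\<And>q q'. q \<in> X \<Longrightarrow> q' \<in> X \<Longrightarrow> D p q < r \<Longrightarrow> D p q' < r \<Longrightarrow> dist (s q) (s q') \<le> H * D q q' powr \<alpha>"
    using s_hoelder p unfolding hoelder_on_flow_def by metis
  have ev: "\<forall>\<^sub>F j in sequentially. P j \<in> X \<and> D (P j) p < e" if "e > 0" for e
    using P that unfolding conv_metric by blast
  have "(\<lambda>j. D (P j) p) \<longlonglongrightarrow> 0"
  proof (rule tendstoI)
    fix e :: real assume "e > 0"
    show "\<forall>\<^sub>F j in sequentially. dist (D (P j) p) 0 < e"
      using ev[OF \<open>e > 0\<close>] by eventually_elim simp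
  qed
  then have "(\<lambda>j. H * D (P j) p powr \<alpha>) \<longlonglongrightarrow> H * 0 powr \<alpha>"
    using r(2) by (intro tendsto_intros tendsto_powr') auto
  then have lim: "(\<lambda>j. H * D (P j) p powr \<alpha>) \<longlonglongrightarrow> 0" by simp
  have "\<forall>\<^sub>F j in sequentially. norm (s (P j) - s p) \<le> H * D (P j) p powr \<alpha>"
    using ev[OF r(1)]
  proof eventually_elim
    case (elim j)
    then show ?case using r(3)[of "P j" p] r(1) p by (simp add: dist_norm M.commute)
  qed
  then have "(\<lambda>j. s (P j) - s p) \<longlonglongrightarrow> 0" by (rule Lim_null_comparison[OF _ lim])
  then show ?thesis by (simp add: LIM_zero_iff)
qed

section \<open>Monotonicity of the section along flow lines\<close>

definition f0 :: "'g fpoint \<Rightarrow> real \<Rightarrow> real" where "f0 p t = form (s (flow t p)) (\<nu> p)"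

lemma f0_derivative:
  assumes "p \<in> X" shows "\<exists>d. d \<noteq> 0 \<and> (f0 p has_real_derivative d) (at t)"
proof -
  let ?d = "vector_derivative (\<lambda>\<tau>. s (flow \<tau> p)) (at t)"
  have lin: "bounded_linear (\<lambda>v. form v (\<nu> p))"
    using bilinear_form unfolding bilinear_def linear_conv_bounded_linear by blast
  have 1: "((\<lambda>\<tau>. s (flow \<tau> p)) has_vector_derivative ?d) (at t)"
    using s_diff[OF assms] vector_derivative_works by blast
  have "((\<lambda>\<tau>. form (s (flow \<tau> p)) (\<nu> p)) has_vector_derivative form ?d (\<nu> p)) (at t)"
    by (rule bounded_linear.has_vector_derivative[OF lin 1])
  then have "(f0 p has_real_derivative form ?d (\<nu> p)) (at t)"
    unfolding f0_def[abs_def] has_real_derivative_iff_has_vector_derivative .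
  moreover have "((\<lambda>\<tau>. s (flow \<tau> (flow t p))) has_vector_derivative ?d) (at 0)"
  proof -
    have "((\<lambda>\<tau>. s (flow \<tau> p)) \<circ> (\<lambda>\<tau>. \<tau> + t) has_vector_derivative 1 *\<^sub>R ?d) (at 0)"
      by (rule vector_diff_chain_at) (auto intro!: derivative_eq_intros simp: 1)
    then show ?thesis by (simp add: o_def)
  qed
  then have "vector_derivative (\<lambda>\<tau>. s (flow \<tau> (flow t p))) (at 0) = ?d" by (rule vector_derivative_at)
  then have "form ?d (\<nu> p) \<noteq> 0"
    using s_transverse[of "flow t p"] assms \<nu>_flow[of t p] unfolding \<nu>_def by simp
  ultimately show ?thesis by blast
qed

lemma f0_continuous: "p \<in> X \<Longrightarrow> continuous_on UNIV (f0 p)"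
  unfolding continuous_on_eq_continuous_at[OF open_UNIV] using f0_derivative DERIV_isCont by blast

lemma f0_distinct: assumes "p \<in> X" "x < y" shows "f0 p x \<noteq> f0 p y"
proof
  assume eq: "f0 p x = f0 p y"
  have "\<exists>z>x. z < y \<and> (f0 p has_real_derivative 0) (at z)"
  proof (rule Rolle[OF assms(2) eq])
    show "continuous_on {x..y} (f0 p)" using f0_continuous[OF assms(1)] continuous_on_subset by blast
    show "f0 p differentiable at z" for z
      using f0_derivative[OF assms(1)] unfolding real_differentiable_def by blast
  qed
  then obtain z where z: "(f0 p has_real_derivative 0) (at z)" by blast
  obtain d where "d \<noteq> 0" "(f0 p has_real_derivative d) (at z)" using f0_derivative[OF assms(1)] by blast
  then show False using DERIV_unique[OF z] by simp
qed

text \<open>Rolle makes \<open>f0 p\<close> injective in time, but its derivative is not known to be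
  continuous. Deforming the ordered pair \<open>(x, y)\<close> linearly to \<open>(x', y')\<close>
  through ordered pairs, the difference of values never vanishes and keeps its sign.\<close>

lemma f0_monotone:
  assumes p: "p \<in> X" and "x < y" "f0 p x < f0 p y" "x' < y'" shows "f0 p x' < f0 p y'"
proof (rule ccontr)
  assume "\<not> f0 p x' < f0 p y'"
  define g where "g r = f0 p ((1 - r) * y + r * y') - f0 p ((1 - r) * x + r * x')" for r
  have "continuous_on {0..1} g" unfolding g_def
    by (intro continuous_intros continuous_on_compose2[OF f0_continuous[OF p]]) auto
  moreover have "g 1 \<le> 0" "0 \<le> g 0" using assms(3) \<open>\<not> f0 p x' < f0 p y'\<close> unfolding g_def by simp_all
  ultimately obtain r where r: "0 \<le> r" "r \<le> 1" "g r = 0" using IVT2'[of g 1 0 0] by auto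
  have "0 < (1 - r) * (y - x) + r * (y' - x')"
    using r assms(2,4) by (cases "r = 0") (auto intro!: add_nonneg_pos mult_nonneg_nonneg mult_pos_pos)
  then have "(1 - r) * x + r * x' < (1 - r) * y + r * y'" by (simp add: algebra_simps)
  from f0_distinct[OF p this] show False using r(3) unfolding g_def by simp
qed

text \<open>Transversality leaves the sign open. It is detected from the values at times 0 and 1
  instead of from the derivative, for which no continuity in the base point is given; values of
  \<open>s\<close> do pass to limits.\<close>

definition \<sigma> :: "'g fpoint \<Rightarrow> real" where "\<sigma> p = (if f0 p 0 < f0 p 1 then 1 else -1)"

definition \<nu>' :: "'g fpoint \<Rightarrow> 'n vec2" where "\<nu>' p = \<sigma> p *\<^sub>R \<nu> p"

definition h :: "'g fpoint \<Rightarrow> real" where "h p = form (s p) (\<nu>' p)"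

lemma \<sigma>_sq: "\<sigma> p * \<sigma> p = 1" unfolding \<sigma>_def by simp

lemma f0_flow: "f0 (flow t p) x = f0 p (x + t)"
  unfolding f0_def by simp

lemma \<sigma>_flow: "p \<in> X \<Longrightarrow> \<sigma> (flow t p) = \<sigma> p"
  using f0_monotone[of p t "1 + t" 0 1] f0_monotone[of p 0 1 t "1 + t"]
  unfolding \<sigma>_def f0_flow by auto

lemma \<nu>'_flow: "p \<in> X \<Longrightarrow> \<nu>' (flow t p) = \<nu>' p"
  unfolding \<nu>'_def by (simp add: \<sigma>_flow)

lemma h_flow: "p \<in> X \<Longrightarrow> h (flow t p) = \<sigma> p * f0 p t"
  unfolding h_def f0_def \<nu>'_flow by (simp add: \<nu>'_def form_simps)

lemma h_increasing: assumes "p \<in> X" "x < y" shows "h (flow x p) < h (flow y p)"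
proof (cases "f0 p 0 < f0 p 1")
  case True
  then show ?thesis unfolding h_flow[OF assms(1)] \<sigma>_def using f0_monotone[OF assms(1) _ True assms(2)] by simp
next
  case False
  have "\<not> f0 p x < f0 p y" using f0_monotone[OF assms(1,2), of 0 1] False by auto
  then have "f0 p y < f0 p x" using f0_distinct[OF assms] by simp
  then show ?thesis unfolding h_flow[OF assms(1)] \<sigma>_def using False by simp
qed

lemma \<nu>': assumes "p \<in> X" shows "\<nu>' p \<in> hyp k" "form (\<nu>' p) (\<nu>' p) = 1"
    "w \<in> W \<epsilon> (ep \<epsilon> p) \<Longrightarrow> form w (\<nu>' p) = 0" "\<nu>' p \<in> A \<epsilon> (ep \<epsilon> p)" "pr \<epsilon> p (\<nu>' p) = 0"
  using \<nu>[OF assms] \<sigma>_sq subspace_scale[OF subspace_A[OF ep_bdry[OF assms]]] pr_\<nu>[OF assms]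
  unfolding \<nu>'_def by (auto simp: form_simps linear_scale[OF linear_pr])

lemma hyp_sum':
  assumes "p \<in> X" "v \<in> hyp k"
  shows "v = pr True p v + pr False p v + form v (\<nu>' p) *\<^sub>R \<nu>' p"
  using hyp_sum[OF assms] unfolding \<nu>'_def by (simp add: \<sigma>_def form_simps)

lemma R_hyp: "\<gamma> \<in> carrier \<Gamma> \<Longrightarrow> v \<in> hyp k \<Longrightarrow> R \<gamma> v \<in> hyp k"
  using hat_component[OF a0_carrier, of \<gamma> v] by simp

lemma s_act_diff:
  assumes "\<gamma> \<in> carrier \<Gamma>" "p \<in> X" "q \<in> X" shows "s (act \<gamma> p) - s (act \<gamma> q) = R \<gamma> (s p - s q)"
  using assms s_hyp unfolding s_equiv[OF assms(1,2)] s_equiv[OF assms(1,3)] affine_act_def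
  by (simp add: hat_hyp hyp_closed matrix_vector_mult_diff_distrib)

lemma f0_act:
  assumes "\<gamma> \<in> carrier \<Gamma>" "p \<in> X" shows "f0 (act \<gamma> p) y - f0 (act \<gamma> p) x = f0 p y - f0 p x"
proof -
  have "f0 (act \<gamma> p) y - f0 (act \<gamma> p) x = form (s (act \<gamma> (flow y p)) - s (act \<gamma> (flow x p))) (R \<gamma> (\<nu> p))"
    unfolding f0_def by (simp add: form_simps act_flow assms \<nu>_act)
  also have "\<dots> = form (s (flow y p) - s (flow x p)) (\<nu> p)"
    using assms \<nu>(1) s_hyp unfolding s_act_diff[OF assms(1), of "flow y p" "flow x p", unfolded flow_closed, OF assms(2,2)]
    by (intro form_fst a0_carrier) (auto intro: hyp_closed)
  finally show ?thesis unfolding f0_def by (simp add: form_simps)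
qed

lemma \<nu>'_act: assumes "\<gamma> \<in> carrier \<Gamma>" "p \<in> X" shows "\<nu>' (act \<gamma> p) = R \<gamma> (\<nu>' p)"
proof -
  have "\<sigma> (act \<gamma> p) = \<sigma> p" using f0_act[OF assms, of 1 0] unfolding \<sigma>_def by simp
  then show ?thesis unfolding \<nu>'_def \<nu>_act[OF assms] linear_scale[OF linear_hat] by simp
qed

text \<open>Projections determine the neutral line continuously, and the normalisation of the form
  fixes the vector up to sign. The sign is the delicate point.\<close>

lemma \<nu>'_limit:
  assumes P: "conv P p" "\<And>j. P j \<in> X" shows "(\<lambda>j. \<nu>' (P j)) \<longlonglongrightarrow> \<nu>' p"
proof -
  have p: "p \<in> X" by (rule conv_X[OF P(1)])
  define r where "r j = form (\<nu>' p) (\<nu>' (P j))" for j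
  have "(\<lambda>j. \<nu>' p - pr True (P j) (\<nu>' p) - pr False (P j) (\<nu>' p)) \<longlonglongrightarrow> \<nu>' p - pr True p (\<nu>' p) - pr False p (\<nu>' p)"
    by (intro tendsto_intros pr_limit P)
  moreover have "\<nu>' p - pr True (P j) (\<nu>' p) - pr False (P j) (\<nu>' p) = r j *\<^sub>R \<nu>' (P j)" for j
    using hyp_sum'[OF P(2)[of j] \<nu>'(1)[OF p]] unfolding r_def by (simp add: algebra_simps)
  ultimately have rn: "(\<lambda>j. r j *\<^sub>R \<nu>' (P j)) \<longlonglongrightarrow> \<nu>' p" using \<nu>'(5)[OF p] by simp
  have r2: "form (r j *\<^sub>R \<nu>' (P j)) (r j *\<^sub>R \<nu>' (P j)) = (r j)\<^sup>2" for j
    using \<nu>'(2)[OF P(2)] by (simp add: form_simps power2_eq_square)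
  have "(\<lambda>j. (r j)\<^sup>2) \<longlonglongrightarrow> 1" using tendsto_form[OF rn rn] unfolding r2 \<nu>'(2)[OF p] .
  then have "(\<lambda>j. sqrt ((r j)\<^sup>2)) \<longlonglongrightarrow> sqrt 1" by (rule tendsto_real_sqrt)
  then have r1: "(\<lambda>j. \<bar>r j\<bar>) \<longlonglongrightarrow> 1" by simp
  \<comment> \<open>The displacement of \<open>s\<close> over unit time pairs positively with every
    \<open>\<nu>'\<close>; this strict inequality passes to nearby points and excludes a sign
    change.\<close>
  have d: "form (s (flow 1 q) - s q) (\<nu>' q) > 0" if "q \<in> X" for q
    using h_increasing[OF that, of 0 1] that by (simp add: h_def \<nu>'_flow form_simps)
  have "(\<lambda>j. form (s (flow 1 (P j)) - s (P j)) (r j *\<^sub>R \<nu>' (P j))) \<longlonglongrightarrow> form (s (flow 1 p) - s p) (\<nu>' p)"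
    by (intro tendsto_intros rn s_limit conv_flow P)
  from order_tendstoD(1)[OF this d[OF p]]
  have "\<forall>\<^sub>F j in sequentially. 0 < r j"
  proof eventually_elim
    case (elim j)
    then show ?case using d[OF P(2)[of j]] by (simp add: form_simps zero_less_mult_iff)
  qed
  then have ev: "\<forall>\<^sub>F j in sequentially. (1 / \<bar>r j\<bar>) *\<^sub>R (r j *\<^sub>R \<nu>' (P j)) = \<nu>' (P j)"
    by eventually_elim simp
  have "(\<lambda>j. (1 / \<bar>r j\<bar>) *\<^sub>R (r j *\<^sub>R \<nu>' (P j))) \<longlonglongrightarrow> (1 / 1) *\<^sub>R \<nu>' p"
    by (intro tendsto_intros rn r1) simp
  then show ?thesis using Lim_transform_eventually[OF _ ev] by simp
qed

lemma h_limit: "conv P p \<Longrightarrow> (\<And>j. P j \<in> X) \<Longrightarrow> (\<lambda>j. h (P j)) \<longlonglongrightarrow> h p"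
  unfolding h_def by (intro tendsto_form s_limit \<nu>'_limit)

lemma h_act:
  assumes "\<gamma> \<in> carrier \<Gamma>" "p \<in> X" shows "h (act \<gamma> p) = h p + form (snd (a0 \<gamma>)) (\<nu>' (act \<gamma> p))"
proof -
  have "s (act \<gamma> p) = R \<gamma> (s p) + snd (a0 \<gamma>)"
    unfolding s_equiv[OF assms] affine_act_def hat_hyp[OF s_hyp[OF assms(2)]] ..
  then have "h (act \<gamma> p) = form (R \<gamma> (s p)) (R \<gamma> (\<nu>' p)) + form (snd (a0 \<gamma>)) (\<nu>' (act \<gamma> p))"
    unfolding h_def \<nu>'_act[OF assms] by (simp add: form_simps)
  then show ?thesis
    unfolding form_fst[OF a0_carrier[OF assms(1)] s_hyp[OF assms(2)] \<nu>'(1)[OF assms(2)]] h_def .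
qed

end

section \<open>Growth along rays\<close>

context affine_data
begin

text \<open>In the linearised picture \<open>e2n + s p\<close> is the affine point
  \<open>s p\<close>. Removing its components along both isotropic spaces moves it into the
  intersection of the two affine limit subspaces: the neutralised section.\<close>

definition neutral :: "'g fpoint \<Rightarrow> 'n vec2" where
  "neutral p = (e2n + s p) - pr True p (e2n + s p) - pr False p (e2n + s p)"

lemma neutral: assumes "p \<in> X" shows "neutral p \<in> A \<epsilon> (ep \<epsilon> p)" "neutral p $ Inr k = 1"
proof -
  have 1: "neutral p = ((e2n + s p) - pr (\<not> \<epsilon>) p (e2n + s p)) - pr \<epsilon> p (e2n + s p)" for \<epsilon>
    unfolding neutral_def by (cases \<epsilon>) simp_all
  show "neutral p \<in> A \<epsilon> (ep \<epsilon> p)" unfolding 1[of \<epsilon>]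
    by (rule subspace_diff[OF subspace_A[OF ep_bdry[OF assms]]])
      (use pr(2)[OF assms, of "e2n + s p" "\<not> \<epsilon>"] pr(1)[OF assms, of \<epsilon> "e2n + s p"] W_A[OF ep_bdry[OF assms], of \<epsilon> \<epsilon>]
       in auto)
  have "pr \<epsilon> p v $ Inr k = 0" for \<epsilon> v using W_hyp[OF ep_bdry pr(1)] assms by simp
  then show "neutral p $ Inr k = 1" unfolding neutral_def using s_hyp[OF assms] by (simp add: axis_nth)
qed

text \<open>The coefficient of \<open>\<nu>'\<close> in the decomposition that follows. The vector
  \<open>e2n + s p\<close> may be used in place of \<open>neutral p\<close> because they differ by
  isotropic components orthogonal to \<open>\<nu>'\<close>.\<close>

definition nu_coeff :: "'g fpoint \<Rightarrow> 'n vec2 \<Rightarrow> real" where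
  "nu_coeff p v = form (v - v $ Inr k *\<^sub>R (e2n + s p)) (\<nu>' p)"

lemma vec_sum:
  assumes "p \<in> X"
  shows "v = pr True p v + pr False p v + nu_coeff p v *\<^sub>R \<nu>' p + v $ Inr k *\<^sub>R neutral p"
proof -
  define y where "y = e2n + s p"
  let ?b = "v $ Inr k"
  have "v - ?b *\<^sub>R y \<in> hyp k" using s_hyp[OF assms] unfolding y_def by (simp add: axis_nth)
  from hyp_sum'[OF assms this]
  have 1: "v - ?b *\<^sub>R y = pr True p v + pr False p v - ?b *\<^sub>R (pr True p y + pr False p y) + nu_coeff p v *\<^sub>R \<nu>' p"
    unfolding nu_coeff_def y_def[symmetric] linear_diff[OF linear_pr] linear_scale[OF linear_pr] by (simp add: algebra_simps)
  have "?b *\<^sub>R neutral p = ?b *\<^sub>R y - ?b *\<^sub>R (pr True p y + pr False p y)"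
    unfolding neutral_def y_def[symmetric] by (simp add: algebra_simps)
  then have "v = (v - ?b *\<^sub>R y) + (?b *\<^sub>R neutral p + ?b *\<^sub>R (pr True p y + pr False p y))" by simp
  then show ?thesis unfolding 1 by (simp add: add.assoc)
qed

lemma vec_sum_sign:
  assumes "p \<in> X"
  shows "v = pr \<epsilon> p v + pr (\<not> \<epsilon>) p v + nu_coeff p v *\<^sub>R \<nu>' p + v $ Inr k *\<^sub>R neutral p"
  using vec_sum[OF assms, of v] by (cases \<epsilon>) (simp_all add: add.commute add.left_commute)

lemma neutral_act: assumes "\<gamma> \<in> carrier \<Gamma>" "p \<in> X" shows "neutral (act \<gamma> p) = R \<gamma> (neutral p)"
proof -
  have "R \<gamma> (e2n + s p) = e2n + s (act \<gamma> p)"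
    using a0_carrier[OF assms(1)] s_hyp[OF assms(2)] unfolding s_equiv[OF assms] affine_act_def hat_def
    by (simp add: axis_nth G0_axis matrix_vector_right_distrib)
  then show ?thesis unfolding neutral_def linear_diff[OF linear_hat] pr_act[OF assms, symmetric] by simp
qed

text \<open>Up to isotropic components, \<open>s\<close> moves in the direction
  \<open>\<nu>'\<close>, which is constant on a flow line; the amount is the increment of
  \<open>h\<close>.\<close>

lemma neutral_flow: assumes "p \<in> X" shows "neutral (flow t p) = neutral p + (h (flow t p) - h p) *\<^sub>R \<nu>' p"
proof -
  let ?x = "s (flow t p) - s p"
  have x: "?x \<in> hyp k" using s_hyp assms by (intro hyp_closed) simp_all
  have "e2n + s (flow t p) = (e2n + s p) + ?x" by simp
  then have "neutral (flow t p) = neutral p + (?x - pr True p ?x - pr False p ?x)"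
    unfolding neutral_def pr_flow by (simp add: linear_add[OF linear_pr] linear_diff[OF linear_pr] algebra_simps)
  also have "?x - pr True p ?x - pr False p ?x = form ?x (\<nu>' p) *\<^sub>R \<nu>' p"
    using hyp_sum'[OF assms x] by (simp add: algebra_simps)
  also have "form ?x (\<nu>' p) = h (flow t p) - h p"
    unfolding h_def \<nu>'_flow[OF assms] by (simp add: form_simps)
  finally show ?thesis .
qed

lemma neutral_limit: "conv P p \<Longrightarrow> (\<And>j. P j \<in> X) \<Longrightarrow> (\<lambda>j. neutral (P j)) \<longlonglongrightarrow> neutral p"
  unfolding neutral_def by (intro tendsto_intros pr_limit s_limit)

lemma h_flow_act:
  assumes "\<gamma> \<in> carrier \<Gamma>" "p \<in> X" shows "h (flow t (act \<gamma> p)) - h (act \<gamma> p) = h (flow t p) - h p"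
proof -
  have "\<nu>' (act \<gamma> (flow t p)) = \<nu>' (act \<gamma> p)" using assms by (simp add: act_flow \<nu>'_flow)
  then show ?thesis
    using h_act[OF assms] h_act[OF assms(1), of "flow t p"] assms by (simp add: act_flow)
qed

lemma h_step: "\<exists>M\<ge>0. \<forall>p\<in>X. h (flow 1 p) - h p \<le> M"
proof -
  have "\<exists>M>0. \<forall>p\<in>K. \<forall>v::real. norm v = 1 \<longrightarrow> h (flow 1 p) - h p \<le> M"
    by (rule compact_upper_bound[OF K(1)]) (intro tendsto_intros h_limit conv_flow; simp add: K_X)
  then obtain M where M: "M > 0" "\<And>p. p \<in> K \<Longrightarrow> h (flow 1 p) - h p \<le> M" using norm_one by blast
  have "h (flow 1 p) - h p \<le> M" if "p \<in> X" for p
  proof -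
    obtain \<gamma> where "\<gamma> \<in> carrier \<Gamma>" "act \<gamma> p \<in> K" using K_cover[OF \<open>p \<in> X\<close>] .
    then show ?thesis using M(2)[of "act \<gamma> p"] h_flow_act[of \<gamma> p 1] \<open>p \<in> X\<close> by simp
  qed
  then show ?thesis using M(1) by (intro exI[of _ M]) auto
qed

text \<open>Increments of \<open>h\<close> along the flow are invariant under the group, hence
  bounded over unit time by compactness, and they add up to linear growth. The exponential rate
  \<open>c\<close> will dominate it.\<close>

lemma h_growth: "\<exists>M\<ge>0. \<forall>p\<in>X. \<forall>\<epsilon>. \<forall>t\<ge>0. \<bar>h (flow (sg \<epsilon> * t) p) - h p\<bar> \<le> M * (t + 1)"
proof -
  obtain M where M: "M \<ge> 0" "\<And>p. p \<in> X \<Longrightarrow> h (flow 1 p) - h p \<le> M" using h_step by blast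
  have nat: "h (flow (real m) p) - h p \<le> M * real m" if "p \<in> X" for p m
  proof (induction m)
    case (Suc m)
    have "h (flow (real (Suc m)) p) - h (flow (real m) p) \<le> M"
      using M(2)[of "flow (real m) p"] that by (simp add: add.commute)
    then show ?case using Suc by (simp add: algebra_simps)
  qed simp
  have mono: "h (flow x p) \<le> h (flow y p)" if "p \<in> X" "x \<le> y" for p x y
    using h_increasing[OF that(1), of x y] that(2) by (cases "x = y") auto
  have pos: "h p \<le> h (flow t p)" "h (flow t p) - h p \<le> M * (t + 1)" if "p \<in> X" "t \<ge> 0" for p t
  proof -
    show "h p \<le> h (flow t p)" using mono[OF that] by simp
    have "h (flow t p) \<le> h (flow (real (nat \<lceil>t\<rceil>)) p)" using that by (intro mono) (auto simp: real_nat_ceiling_ge)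
    also have "\<dots> \<le> h p + M * real (nat \<lceil>t\<rceil>)" using nat[OF that(1), of "nat \<lceil>t\<rceil>"] by simp
    also have "\<dots> \<le> h p + M * (t + 1)" using M(1) that(2) by (intro add_left_mono mult_left_mono) linarith+
    finally show "h (flow t p) - h p \<le> M * (t + 1)" by simp
  qed
  have "\<bar>h (flow (sg \<epsilon> * t) p) - h p\<bar> \<le> M * (t + 1)" if "p \<in> X" "t \<ge> 0" for p \<epsilon> t
  proof (cases \<epsilon>)
    case True
    then show ?thesis using pos[OF that] by simp
  next
    case False
    then show ?thesis using pos[of "flow (- t) p" t] that by simp
  qed
  then show ?thesis using M(1) by blast
qed

lemma exp_decay: "((\<lambda>x. exp (- c * x) * (x + 1)) \<longlongrightarrow> 0) at_top"
  using c_pos by real_asymp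

end

text \<open>The elements \<open>g j\<close> follow a ray from \<open>p\<close> in the direction
  \<epsilon>: they bring its points at times tending to infinity to a convergent sequence.\<close>

locale affine_ray = affine_data \<Gamma> S act D k a0 \<xi> N C c s
  for \<Gamma> :: "'g monoid" (structure) and S :: "'g set"
    and act :: "'g \<Rightarrow> 'g fpoint \<Rightarrow> 'g fpoint" and D :: "'g fpoint \<Rightarrow> 'g fpoint \<Rightarrow> real"
    and k :: "'n::finite" and a0 :: "'g \<Rightarrow> 'n mat2 \<times> 'n vec2"
    and \<xi> :: "bool \<Rightarrow> 'g bpoint \<Rightarrow> ('n mat2 \<times> 'n vec2) set"
    and N :: "'g fpoint \<Rightarrow> 'n mat2 \<times> 'n vec2 \<Rightarrow> real" and C c :: real and s :: "'g fpoint \<Rightarrow> 'n vec2" +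
  fixes \<epsilon> :: bool and p p' :: "'g fpoint" and g :: "nat \<Rightarrow> 'g" and t :: "nat \<Rightarrow> real"
  assumes p: "p \<in> X" and g: "g j \<in> carrier \<Gamma>" and t: "filterlim t at_top sequentially"
    and lim: "conv (\<lambda>j. act (g j) (flow (sg \<epsilon> * t j) p)) p'"
begin

definition P :: "nat \<Rightarrow> 'g fpoint" where "P j = act (g j) (flow (sg \<epsilon> * t j) p)"

lemma P_X: "P j \<in> X" unfolding P_def using p g by simp

lemma lim_P: "conv P p'" using lim unfolding P_def[abs_def] .

lemma ep_P: "ep \<epsilon>' (P j) = \<beta> (g j) (ep \<epsilon>' p)"
  unfolding P_def using p g by (simp add: ep_act)

lemma t_nonneg: "\<forall>\<^sub>F j in sequentially. 0 \<le> t j"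
  using t unfolding filterlim_at_top by blast

text \<open>The scale that separates the two kinds of growth under \<open>R (g j)\<close>: at most
  linear in \<open>t j\<close> on the flag \<open>A \<epsilon>\<close>, and at least of order
  \<open>1 / u j\<close> on the complement.\<close>

definition u :: "nat \<Rightarrow> real" where "u j = exp (- c * t j)"

lemma u_decay: "(\<lambda>j. u j * (t j + 1)) \<longlonglongrightarrow> 0" "u \<longlonglongrightarrow> 0"
proof -
  show "(\<lambda>j. u j * (t j + 1)) \<longlonglongrightarrow> 0" unfolding u_def using filterlim_compose[OF exp_decay t] .
  have "((\<lambda>x. exp (- c * x)) \<longlongrightarrow> 0) at_top" using c_pos by real_asymp
  from filterlim_compose[OF this t] show "u \<longlonglongrightarrow> 0" unfolding u_def[abs_def] .
qed

lemma n_P: "v \<in> hyp k \<Longrightarrow> n (P j) (R (g j) v) = n (flow (sg \<epsilon> * t j) p) v"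
  unfolding P_def using n_act[OF g] p by simp

lemma pr_P: "pr \<epsilon>' (P j) (R (g j) v) = R (g j) (pr \<epsilon>' p v)"
  unfolding P_def using pr_act[OF g] p by simp

lemma \<nu>'_P: "R (g j) (\<nu>' p) = \<nu>' (P j)"
  unfolding P_def using \<nu>'_act[OF g] p by (simp add: \<nu>'_flow)

definition \<delta> :: "nat \<Rightarrow> real" where "\<delta> j = h (flow (sg \<epsilon> * t j) p) - h p"

lemma neutral_P: "R (g j) (neutral p) = neutral (P j) - \<delta> j *\<^sub>R \<nu>' (P j)"
proof -
  have "neutral (P j) = R (g j) (neutral p + \<delta> j *\<^sub>R \<nu>' p)"
    unfolding P_def \<delta>_def using neutral_act[OF g] neutral_flow p by simp
  then show ?thesis by (simp add: linear_add[OF linear_hat] linear_scale[OF linear_hat] \<nu>'_P)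
qed

lemma \<delta>_decay: "(\<lambda>j. u j * \<delta> j) \<longlonglongrightarrow> 0"
proof -
  obtain M where M: "M \<ge> 0" "\<And>t. t \<ge> 0 \<Longrightarrow> \<bar>h (flow (sg \<epsilon> * t) p) - h p\<bar> \<le> M * (t + 1)"
    using h_growth p by blast
  have "\<forall>\<^sub>F j in sequentially. norm (u j * \<delta> j) \<le> M * (u j * (t j + 1))"
    using t_nonneg
  proof eventually_elim
    case (elim j)
    then have "u j * \<bar>\<delta> j\<bar> \<le> u j * (M * (t j + 1))" unfolding \<delta>_def using M(2) by (intro mult_left_mono) (simp_all add: u_def)
    then show ?case by (simp add: abs_mult u_def mult.commute mult.left_commute)
  qed
  moreover have "(\<lambda>j. M * (u j * (t j + 1))) \<longlonglongrightarrow> 0" using tendsto_mult_left[OF u_decay(1), of M] by simp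
  ultimately show ?thesis by (rule Lim_null_comparison)
qed

lemma contract:
  assumes w: "\<And>j. w j \<in> W \<epsilon> (ep \<epsilon> p)" "(\<lambda>j. u j * n p (w j)) \<longlonglongrightarrow> 0"
  shows "(\<lambda>j. R (g j) (w j)) \<longlonglongrightarrow> 0"
proof (rule n_small[OF lim_P P_X])
  note wh = W_hyp[OF ep_bdry[OF p] w(1)]
  show "R (g j) (w j) \<in> W \<epsilon> (ep \<epsilon> (P j))" for j
    unfolding ep_P R_mem_iff[OF g ep_bdry[OF p]] by (rule w)
  have "\<forall>\<^sub>F j in sequentially. norm (n (P j) (R (g j) (w j))) \<le> C * (u j * n p (w j))"
    using t_nonneg
  proof eventually_elim
    case (elim j)
    have "n (flow (sg \<epsilon> * t j) p) (w j) \<le> C * u j * n p (w j)" unfolding u_def by (rule n_flow[OF p w(1) elim])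
    moreover have "0 \<le> n (flow (sg \<epsilon> * t j) p) (w j)" using n_nonneg[OF _ wh] p by simp
    ultimately show ?case unfolding n_P[OF wh] by (simp add: mult.assoc)
  qed
  moreover have "(\<lambda>j. C * (u j * n p (w j))) \<longlonglongrightarrow> 0" using tendsto_mult_left[OF w(2), of C] by simp
  ultimately show "(\<lambda>j. n (P j) (R (g j) (w j))) \<longlonglongrightarrow> 0" by (rule Lim_null_comparison)
qed

text \<open>In the flag, the isotropic component is contracted, the component along
  \<open>\<nu>'\<close> stays bounded, and the neutral component drifts along \<open>\<nu>'\<close>
  by an increment of \<open>h\<close>. Together with \<open>fast_growth\<close> this describes the
  flag by growth alone, without mention of the base point.\<close>

lemma slow_growth:
  assumes v: "v \<in> A \<epsilon> (ep \<epsilon> p)" shows "(\<lambda>j. u j *\<^sub>R R (g j) v) \<longlonglongrightarrow> 0"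
proof -
  have "pr (\<not> \<epsilon>) p v = 0" using pr_A[OF p, of v "\<not> \<epsilon>"] v by simp
  then have dec: "v = pr \<epsilon> p v + nu_coeff p v *\<^sub>R \<nu>' p + v $ Inr k *\<^sub>R neutral p" using vec_sum_sign[OF p, of v \<epsilon>] by simp
  have R: "R (g j) v = R (g j) (pr \<epsilon> p v) + nu_coeff p v *\<^sub>R \<nu>' (P j) + v $ Inr k *\<^sub>R (neutral (P j) - \<delta> j *\<^sub>R \<nu>' (P j))" for j
    by (subst dec) (simp only: linear_add[OF linear_hat] linear_scale[OF linear_hat] \<nu>'_P neutral_P)
  have "(\<lambda>j. u j * n p (pr \<epsilon> p v)) \<longlonglongrightarrow> 0" using tendsto_mult_right[OF u_decay(2)] by simp
  then have "(\<lambda>j. R (g j) (pr \<epsilon> p v)) \<longlonglongrightarrow> 0" by (intro contract pr p)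
  then have "(\<lambda>j. u j *\<^sub>R R (g j) (pr \<epsilon> p v) + nu_coeff p v *\<^sub>R u j *\<^sub>R \<nu>' (P j) +
      v $ Inr k *\<^sub>R (u j *\<^sub>R neutral (P j) - (u j * \<delta> j) *\<^sub>R \<nu>' (P j))) \<longlonglongrightarrow>
      0 *\<^sub>R 0 + nu_coeff p v *\<^sub>R 0 *\<^sub>R \<nu>' p' + v $ Inr k *\<^sub>R (0 *\<^sub>R neutral p' - 0 *\<^sub>R \<nu>' p')"
    by (intro tendsto_intros u_decay \<delta>_decay \<nu>'_limit neutral_limit lim_P P_X)
  then show ?thesis unfolding R by (simp add: algebra_simps)
qed

text \<open>The component in the opposite isotropic space expands at least like
  \<open>1 / u j\<close>, so it has to vanish if the rescaled images tend to 0.\<close>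

lemma fast_growth:
  assumes v: "(\<lambda>j. u j *\<^sub>R R (g j) v) \<longlonglongrightarrow> 0" shows "v \<in> A \<epsilon> (ep \<epsilon> p)"
proof -
  let ?w = "pr (\<not> \<epsilon>) p v"
  have w: "?w \<in> W (\<not> \<epsilon>) (ep (\<not> \<epsilon>) p)" by (rule pr[OF p])
  have wh: "?w \<in> hyp k" by (rule W_hyp[OF ep_bdry[OF p] w])
  have "(\<lambda>j. pr (\<not> \<epsilon>) (P j) (u j *\<^sub>R R (g j) v)) \<longlonglongrightarrow> pr (\<not> \<epsilon>) p' 0" by (rule pr_limit[OF lim_P P_X v])
  then have "(\<lambda>j. u j *\<^sub>R R (g j) ?w) \<longlonglongrightarrow> 0"
    by (simp add: linear_scale[OF linear_pr] linear_0[OF linear_pr] pr_P)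
  then have "(\<lambda>j. n (P j) (u j *\<^sub>R R (g j) ?w)) \<longlonglongrightarrow> n p' 0"
    by (intro n_limit[OF lim_P] hyp_closed R_hyp g wh)
  then have "(\<lambda>j. C * n (P j) (u j *\<^sub>R R (g j) ?w)) \<longlonglongrightarrow> C * 0"
    unfolding n_zero[OF conv_X[OF lim_P]] by (rule tendsto_mult_left)
  moreover have "\<forall>\<^sub>F j in sequentially. n p ?w \<le> C * n (P j) (u j *\<^sub>R R (g j) ?w)"
    using t_nonneg
  proof eventually_elim
    case (elim j)
    have "n (P j) (u j *\<^sub>R R (g j) ?w) = u j * n (flow (sg \<epsilon> * t j) p) ?w"
      unfolding n_scale[OF P_X R_hyp[OF g wh]] n_P[OF wh] by (simp add: u_def)
    then show ?case using n_flow_back[OF p w elim] by (simp add: u_def)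
  qed
  ultimately have "n p ?w \<le> C * 0" by (rule tendsto_lowerbound) simp
  then have "?w = 0" using n_pos[OF p w] by force
  then show ?thesis using pr_A[OF p, of v "\<not> \<epsilon>"] by simp
qed

text \<open>Pulling back by \<open>g j\<close> contracts the isotropic component of
  \<open>z j\<close>; its last coordinate converges; the coefficient of \<open>\<nu>'\<close> is a
  convergent term plus a multiple of \<open>\<delta> j\<close>, which is at most linear in the
  time.\<close>

lemma bounded_preimage:
  assumes z: "\<And>j. z j \<in> A (\<not> \<epsilon>) (ep (\<not> \<epsilon>) p)" and v: "(\<lambda>j. R (g j) (z j)) \<longlonglongrightarrow> v"
  shows "(\<lambda>j. u j *\<^sub>R z j) \<longlonglongrightarrow> 0"
proof -
  define w where "w j = pr (\<not> \<epsilon>) p (z j)" for j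
  define a b where "a j = nu_coeff p (z j)" and "b j = z j $ Inr k" for j
  have w: "w j \<in> W (\<not> \<epsilon>) (ep (\<not> \<epsilon>) p)" for j unfolding w_def by (rule pr[OF p])
  note wh = W_hyp[OF ep_bdry[OF p] w]
  have "pr \<epsilon> p (z j) = 0" for j using pr_A[OF p, of "z j" \<epsilon>] z by simp
  then have dec: "z j = w j + a j *\<^sub>R \<nu>' p + b j *\<^sub>R neutral p" for j
    using vec_sum_sign[OF p, of "z j" \<epsilon>] unfolding w_def a_def b_def by simp
  have "b = (\<lambda>j. R (g j) (z j) $ Inr k)" unfolding b_def hat_component[OF a0_carrier[OF g]] ..
  then have b: "b \<longlonglongrightarrow> v $ Inr k" using tendsto_vec_nth[OF v, of "Inr k"] by simp
  have Rw: "(\<lambda>j. R (g j) (w j)) \<longlonglongrightarrow> pr (\<not> \<epsilon>) p' v"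
    using pr_limit[OF lim_P P_X v] unfolding pr_P w_def .
  have "(\<lambda>j. n (P j) (R (g j) (w j))) \<longlonglongrightarrow> n p' (pr (\<not> \<epsilon>) p' v)"
    by (rule n_limit[OF lim_P R_hyp[OF g wh] Rw])
  then have lim0: "(\<lambda>j. C * (u j * n (P j) (R (g j) (w j)))) \<longlonglongrightarrow> C * (0 * n p' (pr (\<not> \<epsilon>) p' v))"
    by (intro tendsto_intros u_decay)
  have w0: "w \<longlonglongrightarrow> 0"
  proof (rule n_small[of "\<lambda>_. p" p])
    show "conv (\<lambda>_. p) p" using p by (simp add: limitin_const)
    have "\<forall>\<^sub>F j in sequentially. norm (n p (w j)) \<le> C * (u j * n (P j) (R (g j) (w j)))"
      using t_nonneg
    proof eventually_elim
      case (elim j)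
      then show ?case using n_flow_back[OF p w elim] n_nonneg[OF p wh] unfolding n_P[OF wh] u_def by (simp add: mult.assoc)
    qed
    then show "(\<lambda>j. n p (w j)) \<longlonglongrightarrow> 0" by (rule Lim_null_comparison) (use lim0 in simp)
  qed (use p w in auto)
  define m where "m j = form (R (g j) (z j) - R (g j) (w j) - b j *\<^sub>R neutral (P j)) (\<nu>' (P j))" for j
  have mlim: "m \<longlonglongrightarrow> form (v - pr (\<not> \<epsilon>) p' v - v $ Inr k *\<^sub>R neutral p') (\<nu>' p')"
    unfolding m_def[abs_def] by (intro tendsto_intros v Rw b neutral_limit \<nu>'_limit lim_P P_X)
  have am: "a j = m j + b j * \<delta> j" for j
  proof -
    have "R (g j) (z j) = R (g j) (w j) + a j *\<^sub>R \<nu>' (P j) + b j *\<^sub>R (neutral (P j) - \<delta> j *\<^sub>R \<nu>' (P j))"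
      by (subst dec) (simp only: linear_add[OF linear_hat] linear_scale[OF linear_hat] \<nu>'_P neutral_P)
    then have "R (g j) (z j) - R (g j) (w j) - b j *\<^sub>R neutral (P j) = (a j - b j * \<delta> j) *\<^sub>R \<nu>' (P j)"
      by (simp add: algebra_simps)
    then show ?thesis unfolding m_def by (simp add: form_simps \<nu>'(2)[OF P_X])
  qed
  have "(\<lambda>j. u j *\<^sub>R w j + (u j * m j + b j * (u j * \<delta> j)) *\<^sub>R \<nu>' p + (u j * b j) *\<^sub>R neutral p) \<longlonglongrightarrow>
     0 *\<^sub>R 0 + (0 * form (v - pr (\<not> \<epsilon>) p' v - v $ Inr k *\<^sub>R neutral p') (\<nu>' p') + v $ Inr k * 0) *\<^sub>R \<nu>' p +
     (0 * v $ Inr k) *\<^sub>R neutral p"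
    by (intro tendsto_intros u_decay w0 mlim b \<delta>_decay)
  moreover have "u j *\<^sub>R z j = u j *\<^sub>R w j + (u j * m j + b j * (u j * \<delta> j)) *\<^sub>R \<nu>' p + (u j * b j) *\<^sub>R neutral p" for j
    by (subst dec) (simp add: am algebra_simps)
  ultimately show ?thesis by simp
qed

end

section \<open>Asymptotic and opposite rays, deduced from growth\<close>

context affine_data
begin

lemma affine_rayI:
  assumes "p \<in> X" "\<And>j. g j \<in> carrier \<Gamma>" "filterlim t at_top sequentially"
    and "conv (\<lambda>j. act (g j) (flow (sg \<epsilon> * t j) p)) p'"
  shows "affine_ray \<Gamma> S act D k a0 \<xi> N C c s \<epsilon> p p' g t"
  by (rule affine_ray.intro[OF affine_data_axioms affine_ray_axioms.intro[OF assms]])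

text \<open>When the same elements follow two rays, the ray with the larger times has the smaller
  scale. Slow vectors for the first are then slow for the second, which gives an inclusion of flags,
  hence equality of flags and of ends.\<close>

lemma A_opposite:
  assumes p: "p \<in> X" "q \<in> X" and g: "\<And>j. g j \<in> carrier \<Gamma>"
    and t: "filterlim t at_top sequentially" "filterlim t' at_top sequentially" "\<And>j. t j \<le> t' j"
    and lim: "conv (\<lambda>j. act (g j) (flow (sg \<epsilon> * t j) p)) P" "conv (\<lambda>j. act (g j) (flow (sg \<epsilon> * t' j) q)) Q"
  shows "ep \<epsilon> p = ep \<epsilon> q"
proof (rule A_subset_eq[of _ _ \<epsilon>])
  interpret a: affine_ray \<Gamma> S act D k a0 \<xi> N C c s \<epsilon> p P g t by (rule affine_rayI[OF p(1) g t(1) lim(1)])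
  interpret b: affine_ray \<Gamma> S act D k a0 \<xi> N C c s \<epsilon> q Q g t' by (rule affine_rayI[OF p(2) g t(2) lim(2)])
  show "A \<epsilon> (ep \<epsilon> p) \<subseteq> A \<epsilon> (ep \<epsilon> q)"
  proof
    fix v assume "v \<in> A \<epsilon> (ep \<epsilon> p)"
    then have 1: "(\<lambda>j. norm (a.u j *\<^sub>R R (g j) v)) \<longlonglongrightarrow> 0" using a.slow_growth tendsto_norm_zero by blast
    have "\<forall>\<^sub>F j in sequentially. norm (b.u j *\<^sub>R R (g j) v) \<le> norm (a.u j *\<^sub>R R (g j) v)"
      using t(3) c_pos by (intro always_eventually allI) (simp add: a.u_def b.u_def mult_right_mono)
    then have "(\<lambda>j. b.u j *\<^sub>R R (g j) v) \<longlonglongrightarrow> 0" by (rule Lim_null_comparison[OF _ 1])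
    then show "v \<in> A \<epsilon> (ep \<epsilon> q)" by (rule b.fast_growth)
  qed
qed (use p ep_bdry in auto)

text \<open>On a subsequence one of the two time sequences dominates the other, and
  \<open>A_opposite\<close> identifies the two ends in whichever order applies.\<close>

lemma opposite: "opposite_rays_diverge \<epsilon>"
  unfolding opposite_rays_diverge_def
proof (intro allI impI)
  fix x y \<gamma> P Q and t t' :: "nat \<Rightarrow> real"
  assume x: "x \<in> bdry" "y \<in> bdry" "x \<noteq> y" and "\<forall>j. \<gamma> j \<in> carrier \<Gamma>"
    and t: "filterlim t at_top sequentially" "filterlim t' at_top sequentially"
    and lim: "conv (\<lambda>j. act (\<gamma> j) (mk \<epsilon> x y (sg \<epsilon> * t j))) P" "conv (\<lambda>j. act (\<gamma> j) (mk \<epsilon> y x (sg \<epsilon> * t' j))) Q"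
  then have g: "\<And>j. \<gamma> j \<in> carrier \<Gamma>" by blast
  let ?p = "mk \<epsilon> x y 0" and ?q = "mk \<epsilon> y x 0"
  have pq: "?p \<in> X" "?q \<in> X" using x by (simp_all add: mk_in_X)
  have sub: "x = y" if "strict_mono r" "(\<forall>j. t (r j) \<le> t' (r j)) \<or> (\<forall>j. t' (r j) \<le> t (r j))" for r :: "nat \<Rightarrow> nat"
  proof -
    have f: "filterlim (\<lambda>j. t (r j)) at_top sequentially" "filterlim (\<lambda>j. t' (r j)) at_top sequentially"
      using filterlim_compose[OF t(1) filterlim_subseq[OF that(1)]] filterlim_compose[OF t(2) filterlim_subseq[OF that(1)]] .
    have l: "conv (\<lambda>j. act (\<gamma> (r j)) (flow (sg \<epsilon> * t (r j)) ?p)) P" "conv (\<lambda>j. act (\<gamma> (r j)) (flow (sg \<epsilon> * t' (r j)) ?q)) Q"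
      using conv_subseq[OF lim(1) that(1)] conv_subseq[OF lim(2) that(1)] by (simp_all add: o_def)
    from that(2) show ?thesis
    proof
      assume "\<forall>j. t (r j) \<le> t' (r j)"
      then have *: "\<And>j. t (r j) \<le> t' (r j)" by blast
      show ?thesis using A_opposite[OF pq g f * l] by simp
    next
      assume "\<forall>j. t' (r j) \<le> t (r j)"
      then have *: "\<And>j. t' (r j) \<le> t (r j)" by blast
      show ?thesis using A_opposite[OF pq(2,1) g f(2,1) * l(2,1)] by simp
    qed
  qed
  show False
  proof (cases "\<forall>\<^sub>F j in sequentially. t j \<le> t' j")
    case True
    then obtain m where "\<And>j. j \<ge> m \<Longrightarrow> t j \<le> t' j" unfolding eventually_sequentially by blast
    then have "x = y" by (intro sub[of "\<lambda>j. j + m"]) (auto simp: strict_mono_def)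
    then show False using x(3) by simp
  next
    case False
    from not_eventually_sequentiallyD[OF this] obtain r :: "nat \<Rightarrow> nat"
      where "strict_mono r" "\<And>j. \<not> t (r j) \<le> t' (r j)" by blast
    then have "x = y" by (intro sub[of r] disjI2 allI) (auto simp: not_le intro: less_imp_le)
    then show False using x(3) by simp
  qed
qed

lemma W_nonzero:
  assumes "CARD('n) \<ge> 2" "x \<in> bdry" obtains w where "w \<in> W \<epsilon> x" "w \<noteq> 0"
proof -
  have "\<exists>j. j \<noteq> k"
  proof (rule ccontr)
    assume "\<not> ?thesis"
    then have "(UNIV :: 'n set) = {k}" by auto
    then have "CARD('n) = card {k}" by simp
    then show False using assms(1) by simp
  qed
  then obtain j where "j \<noteq> k" by blast
  then have w: "axis (Inl j) 1 + sg \<epsilon> *\<^sub>R axis (Inr j) 1 \<in> W0 k \<epsilon>" by (rule W0_vector)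
  have nz: "axis (Inl j) 1 + sg \<epsilon> *\<^sub>R axis (Inr j) 1 \<noteq> (0 :: 'n vec2)"
  proof
    assume "axis (Inl j) 1 + sg \<epsilon> *\<^sub>R axis (Inr j) 1 = (0 :: 'n vec2)"
    from arg_cong[OF this, of "\<lambda>v. v $ Inl j"] show False by (simp add: axis_def)
  qed
  obtain a where a: "a \<in> \<xi> \<epsilon> x" using \<xi>_ex[OF assms(2)] .
  show ?thesis
  proof (rule that)
    show "hat k a (axis (Inl j) 1 + sg \<epsilon> *\<^sub>R axis (Inr j) 1) \<in> W \<epsilon> x"
      unfolding \<xi>_eq(3)[OF assms(2) a] using w by blast
    show "hat k a (axis (Inl j) 1 + sg \<epsilon> *\<^sub>R axis (Inr j) 1) \<noteq> 0"
      using nz inj_hat[OF \<xi>_eq(1)[OF assms(2) a]] linear_0[OF linear_hat[of k a]] by (metis injD)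
  qed
qed

text \<open>The elements that bring the ray of \<open>q\<close> back to \<open>K\<close> are applied
  to the line of \<open>p\<close>. Its end \<epsilon> is common to both lines, so the issue is that
  the other end must not collapse onto the limit of the common one, and that the convergent points
  occur at nonnegative times.\<close>

lemma asymptotic:
  assumes card: "CARD('n) \<ge> 2" shows "asymptotic_rays \<epsilon>"
  unfolding asymptotic_rays_def
proof (intro ballI allI impI)
  fix p q and t :: "nat \<Rightarrow> real"
  assume p: "p \<in> X" and q: "q \<in> X" and e: "ep \<epsilon> p = ep \<epsilon> q" and t: "filterlim t at_top sequentially"
  let ?x = "ep \<epsilon> p" and ?y = "ep (\<not> \<epsilon>) p"
  have "\<exists>\<gamma>. \<gamma> \<in> carrier \<Gamma> \<and> act \<gamma> (flow (sg \<epsilon> * t j) q) \<in> K" for j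
    using K_cover[of "flow (sg \<epsilon> * t j) q"] q by (metis flow_closed)
  then obtain \<gamma> where \<gamma>: "\<And>j. \<gamma> j \<in> carrier \<Gamma>" "\<And>j. act (\<gamma> j) (flow (sg \<epsilon> * t j) q) \<in> K" by metis
  obtain r1 P where r1: "strict_mono r1" "P \<in> K" "conv ((\<lambda>j. act (\<gamma> j) (flow (sg \<epsilon> * t j) q)) \<circ> r1) P"
    using compact_seq[OF K(1), of "\<lambda>j. act (\<gamma> j) (flow (sg \<epsilon> * t j) q)", OF \<gamma>(2)] .
  \<comment> \<open>Compactness of the boundary gives some limit for the other end; a priori it
    could be the limit of the common end.\<close>
  obtain r2 b where r2: "strict_mono r2" "limitin B ((\<lambda>j. \<beta> (\<gamma> (r1 j)) ?y) \<circ> r2) b sequentially"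
    using boundary_seq_compact[of "\<lambda>j. \<beta> (\<gamma> (r1 j)) ?y", OF bdry_act[OF \<gamma>(1) ep_bdry[OF p]]] .
  define r where "r = r1 \<circ> r2"
  have r: "strict_mono r" unfolding r_def by (rule strict_mono_o[OF r1(1) r2(1)])
  define g where "g j = \<gamma> (r j)" for j
  have g: "g j \<in> carrier \<Gamma>" for j unfolding g_def by (rule \<gamma>)
  have limq: "conv (\<lambda>j. act (g j) (flow (sg \<epsilon> * t (r j)) q)) P"
    using conv_subseq[OF r1(3) r2(1)] unfolding g_def r_def o_def .
  have limb: "limitin B (\<lambda>j. \<beta> (g j) ?y) b sequentially" using r2(2) unfolding g_def r_def o_def .
  have tr: "filterlim (\<lambda>j. t (r j)) at_top sequentially" by (rule filterlim_compose[OF t filterlim_subseq[OF r]])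
  interpret a: affine_ray \<Gamma> S act D k a0 \<xi> N C c s \<epsilon> q P g "\<lambda>j. t (r j)"
    by (rule affine_rayI[OF q g tr limq])
  have PX: "P \<in> X" by (rule conv_X[OF limq])
  have bb: "b \<in> bdry" using limitin_topspace[OF limb] by simp
  \<comment> \<open>Collapse is excluded by identifying \<open>b\<close> with the other end of
    \<open>P\<close>, through an inclusion of flags.\<close>
  have "A (\<not> \<epsilon>) (ep (\<not> \<epsilon>) P) \<subseteq> A (\<not> \<epsilon>) b"
  proof
    fix v assume v: "v \<in> A (\<not> \<epsilon>) (ep (\<not> \<epsilon>) P)"
    obtain w where w: "\<And>j. w j \<in> A (\<not> \<epsilon>) (ep (\<not> \<epsilon>) (a.P j))" "w \<longlonglongrightarrow> v"
      using A_approx[OF conv_ep[OF a.lim_P] ep_bdry[OF a.P_X] v] by blast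
    have "\<exists>z. z \<in> A (\<not> \<epsilon>) (ep (\<not> \<epsilon>) q) \<and> w j = R (g j) z" for j
      using w(1)[of j] unfolding a.ep_P A_act[OF g ep_bdry[OF q]] by blast
    then obtain z where z: "\<And>j. z j \<in> A (\<not> \<epsilon>) (ep (\<not> \<epsilon>) q)" "\<And>j. w j = R (g j) (z j)" by metis
    have u0: "(\<lambda>j. a.u j *\<^sub>R z j) \<longlonglongrightarrow> 0" by (rule a.bounded_preimage[OF z(1)]) (use w(2) in \<open>simp only: z(2)[symmetric]\<close>)
    \<comment> \<open>Subtracting this component moves \<open>z j\<close> from the flag at the far
      end of \<open>q\<close> to that of \<open>p\<close>. The correction lies in the isotropic
      space of the common end and is contracted by \<open>g j\<close>, because \<open>u j\<close>
      times it tends to 0.\<close>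
    let ?z = "\<lambda>j. pr \<epsilon> p (z j)"
    have zW: "?z j \<in> W \<epsilon> (ep \<epsilon> q)" for j using pr(1)[OF p, of \<epsilon>] unfolding e .
    note zh = W_hyp[OF ep_bdry[OF q] zW]
    have cp: "conv (\<lambda>_. p) p" "conv (\<lambda>_. q) q" using p q by (simp_all add: limitin_const)
    have "(\<lambda>j. pr \<epsilon> p (a.u j *\<^sub>R z j)) \<longlonglongrightarrow> pr \<epsilon> p 0" by (rule pr_limit[OF cp(1) p u0])
    then have "(\<lambda>j. a.u j *\<^sub>R ?z j) \<longlonglongrightarrow> 0" by (simp add: linear_scale[OF linear_pr] linear_0[OF linear_pr])
    then have "(\<lambda>j. n q (a.u j *\<^sub>R ?z j)) \<longlonglongrightarrow> n q 0" by (intro n_limit[OF cp(2)] hyp_closed zh)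
    then have "(\<lambda>j. a.u j * n q (?z j)) \<longlonglongrightarrow> 0"
      unfolding n_scale[OF q zh] n_zero[OF q] by (simp add: a.u_def)
    from a.contract[OF zW this] have "(\<lambda>j. R (g j) (z j) - R (g j) (?z j)) \<longlonglongrightarrow> v - 0"
      using w(2) unfolding z(2) by (intro tendsto_diff)
    then have lim: "(\<lambda>j. R (g j) (z j - ?z j)) \<longlonglongrightarrow> v" by (simp add: linear_diff[OF linear_hat])
    show "v \<in> A (\<not> \<epsilon>) b"
    proof (rule closed_limit(1)[OF limb bdry_act[OF g ep_bdry[OF p]] lim])
      show "R (g j) (z j - ?z j) \<in> A (\<not> \<epsilon>) (\<beta> (g j) ?y)" for j
        unfolding R_mem_iff[OF g ep_bdry[OF p]] by (rule pr[OF p])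
    qed
  qed
  then have b: "ep (\<not> \<epsilon>) P = b" by (rule A_subset_eq[OF ep_bdry[OF PX] bb])
  have "\<exists>\<tau>. \<forall>x. act (g j) (flow x p) = mk \<epsilon> (\<beta> (g j) ?x) (\<beta> (g j) ?y) (\<tau> + x)" for j
  proof -
    have "mk \<epsilon> ?x ?y (snd p) \<in> X" using p by (simp add: mk_ep)
    then obtain \<tau> where \<tau>: "\<And>x. act (g j) (mk \<epsilon> ?x ?y (snd p + x)) = mk \<epsilon> (\<beta> (g j) ?x) (\<beta> (g j) ?y) (\<tau> + x)"
      using act_mk[OF g, of \<epsilon> ?x ?y "snd p" j] by blast
    moreover have "mk \<epsilon> ?x ?y (snd p + x) = flow x p" for x
      using flow_mk[of x \<epsilon> ?x ?y "snd p"] by (simp add: mk_ep)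
    ultimately show ?thesis by auto
  qed
  then obtain \<tau> where \<tau>: "\<And>j x. act (g j) (flow x p) = mk \<epsilon> (\<beta> (g j) ?x) (\<beta> (g j) ?y) (\<tau> j + x)" by metis
  define t' where "t' j = - sg \<epsilon> * \<tau> j" for j
  let ?Q = "mk \<epsilon> (ep \<epsilon> P) (ep (\<not> \<epsilon>) P) 0"
  have Q: "act (g j) (flow (sg \<epsilon> * t' j) p) = mk \<epsilon> (\<beta> (g j) ?x) (\<beta> (g j) ?y) 0" for j
    unfolding \<tau> t'_def by simp
  have QX: "act (g j) (flow (sg \<epsilon> * t' j) p) \<in> X" for j using p g by simp
  have limQ: "conv (\<lambda>j. act (g j) (flow (sg \<epsilon> * t' j) p)) ?Q"
  proof (rule convI[OF QX])
    show "?Q \<in> X" using ep_bdry[OF PX] ep_distinct[OF PX] by (simp add: mk_in_X)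
    have "limitin B (\<lambda>j. \<beta> (g j) ?x) (ep \<epsilon> P) sequentially"
      using conv_ep[OF limq, of \<epsilon>] q g by (simp add: ep_act e)
    then show "limitin B (\<lambda>j. ep \<epsilon>' (act (g j) (flow (sg \<epsilon> * t' j) p))) (ep \<epsilon>' ?Q) sequentially" for \<epsilon>'
      using limb unfolding Q b by (cases "\<epsilon>' = \<epsilon>") (simp_all add: ep_mk(2)[of \<epsilon>, folded not_False_eq_True])
    show "(\<lambda>j. snd (act (g j) (flow (sg \<epsilon> * t' j) p))) \<longlonglongrightarrow> snd ?Q" unfolding Q by simp
  qed
  have "\<forall>\<^sub>F j in sequentially. 0 \<le> t' j"
  proof (rule ccontr)
    assume "\<not> ?thesis"
    from not_eventually_sequentiallyD[OF this] obtain l :: "nat \<Rightarrow> nat"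
      where l: "strict_mono l" "\<And>j. t' (l j) < 0" by (auto simp: not_le)
    \<comment> \<open>A nonzero vector contracted by the \<open>g j\<close>. At negative times its
      norm would stay above \<open>n p w / C\<close>, whereas its images tend to 0.\<close>
    obtain w where w: "w \<in> W \<epsilon> ?x" "w \<noteq> 0" using W_nonzero[OF card ep_bdry[OF p]] .
    note wh = W_hyp[OF ep_bdry[OF p] w(1)]
    have "(\<lambda>j. a.u j * n q w) \<longlonglongrightarrow> 0" using tendsto_mult_right[OF a.u_decay(2)] by simp
    then have "(\<lambda>j. R (g j) w) \<longlonglongrightarrow> 0" using w(1) unfolding e by (intro a.contract)
    from n_limit[OF limQ R_hyp[OF g wh] this]
    have "(\<lambda>j. n (flow (sg \<epsilon> * t' j) p) w) \<longlonglongrightarrow> 0"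
      using n_zero[OF conv_X[OF limQ]] p by (simp add: n_act[OF g _ wh])
    from LIMSEQ_subseq_LIMSEQ[OF this l(1)]
    have "(\<lambda>j. C * n (flow (sg \<epsilon> * t' (l j)) p) w) \<longlonglongrightarrow> C * 0" by (intro tendsto_mult_left) (simp add: o_def)
    then have lim0: "(\<lambda>j. C * n (flow (sg \<epsilon> * t' (l j)) p) w) \<longlonglongrightarrow> 0" by simp
    have "n p w \<le> C * n (flow (sg \<epsilon> * t' (l j)) p) w" for j
    proof -
      let ?q = "flow (sg \<epsilon> * t' (l j)) p"
      have qX: "?q \<in> X" using p by simp
      have "n (flow (sg \<epsilon> * - t' (l j)) ?q) w \<le> C * exp (- c * - t' (l j)) * n ?q w"
        by (rule n_flow[OF qX]) (use w(1) l(2)[of j] in simp_all)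
      also have "\<dots> \<le> C * 1 * n ?q w"
        using C_pos c_pos l(2)[of j] n_nonneg[OF qX wh]
        by (intro mult_right_mono mult_left_mono) (simp_all add: mult_nonneg_nonpos)
      finally show ?thesis by simp
    qed
    then have "n p w \<le> 0" by (intro LIMSEQ_le_const[OF lim0]) blast
    then show False using n_pos[OF p w] by simp
  qed
  then obtain m where m: "\<And>j. j \<ge> m \<Longrightarrow> 0 \<le> t' j" unfolding eventually_sequentially by blast
  have sm: "strict_mono (\<lambda>j. j + m)" by (simp add: strict_mono_def)
  show "\<exists>r \<gamma> t'' P Q. strict_mono (r :: nat \<Rightarrow> nat) \<and> (\<forall>j. \<gamma> j \<in> carrier \<Gamma>) \<and> (\<forall>j. 0 \<le> t'' j) \<and>
      conv (\<lambda>j. act (\<gamma> j) (flow (sg \<epsilon> * t (r j)) q)) P \<and> conv (\<lambda>j. act (\<gamma> j) (flow (sg \<epsilon> * t'' j) p)) Q"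
    using strict_mono_o[OF r sm] g m conv_subseq[OF limq sm] conv_subseq[OF limQ sm]
    by (intro exI[of _ "r \<circ> (\<lambda>j. j + m)"] exI[of _ "\<lambda>j. g (j + m)"] exI[of _ "\<lambda>j. t' (j + m)"] exI[of _ P] exI[of _ ?Q])
      (simp add: o_def)
qed

end

section \<open>Deformations\<close>

lemma finite_common_bound:
  fixes Q :: "'a \<Rightarrow> real \<Rightarrow> bool"
  assumes "finite F" "\<And>f. f \<in> F \<Longrightarrow> \<exists>e>0. Q f e" "\<And>f e e'. Q f e \<Longrightarrow> 0 < e' \<Longrightarrow> e' \<le> e \<Longrightarrow> Q f e'"
  shows "\<exists>e>0. \<forall>f\<in>F. Q f e"
  using assms(1,2)
proof (induction F rule: finite_induct)
  case (insert f F)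
  obtain e where e: "e > 0" "\<forall>f\<in>F. Q f e" using insert by auto
  obtain e' where e': "e' > 0" "Q f e'" using insert by auto
  have "Q g (min e e')" if "g \<in> insert f F" for g
    using that e e' assms(3)[of g e "min e e'"] assms(3)[of f e' "min e e'"] by auto
  then show ?case using e(1) e'(1) by (intro exI[of _ "min e e'"]) auto
qed (auto intro: exI[of _ 1])

locale deformation = affine_data \<Gamma> S act D k a0 \<xi> N C c s
  for \<Gamma> :: "'g monoid" (structure) and S :: "'g set"
    and act :: "'g \<Rightarrow> 'g fpoint \<Rightarrow> 'g fpoint" and D :: "'g fpoint \<Rightarrow> 'g fpoint \<Rightarrow> real"
    and k :: "'n::finite" and a0 :: "'g \<Rightarrow> 'n mat2 \<times> 'n vec2"
    and \<xi> :: "bool \<Rightarrow> 'g bpoint \<Rightarrow> ('n mat2 \<times> 'n vec2) set"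
    and N :: "'g fpoint \<Rightarrow> 'n mat2 \<times> 'n vec2 \<Rightarrow> real" and C c :: real and s :: "'g fpoint \<Rightarrow> 'n vec2" +
  fixes \<rho> :: "real \<Rightarrow> 'g \<Rightarrow> 'n mat2" and U :: "'g \<Rightarrow> 'n mat2"
  assumes \<rho>_hom: "\<bar>t\<bar> < 1 \<Longrightarrow> \<rho> t \<in> hom \<Gamma> G_group"
    and \<rho>_0: "\<gamma> \<in> carrier \<Gamma> \<Longrightarrow> \<rho> 0 \<gamma> = fst (a0 \<gamma>)"
    and U: "\<gamma> \<in> carrier \<Gamma> \<Longrightarrow> ((\<lambda>t. \<rho> t \<gamma> ** ginv (\<rho> 0 \<gamma>)) has_vector_derivative U \<gamma>) (at 0)"
    and U_e2n: "\<gamma> \<in> carrier \<Gamma> \<Longrightarrow> U \<gamma> *v axis (Inr k) 1 = snd (a0 \<gamma>)"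
begin

lemma \<rho>_SOnn: "\<gamma> \<in> carrier \<Gamma> \<Longrightarrow> \<bar>t\<bar> < 1 \<Longrightarrow> \<rho> t \<gamma> \<in> SOnn"
  using \<rho>_hom[of t] hom_in_carrier[of "\<rho> t" \<Gamma> G_group \<gamma>] G_SOnn by auto

lemma \<rho>_G0: "\<gamma> \<in> carrier \<Gamma> \<Longrightarrow> \<rho> 0 \<gamma> \<in> G0 k"
  using a0_carrier[of \<gamma>] \<rho>_0 by simp

definition Mt :: "real \<Rightarrow> 'g \<Rightarrow> 'n mat2" where "Mt t \<gamma> = \<rho> t \<gamma> ** ginv (\<rho> 0 \<gamma>)"

lemma Mt_0: "\<gamma> \<in> carrier \<Gamma> \<Longrightarrow> Mt 0 \<gamma> = mat 1"
  unfolding Mt_def using ginv(2)[OF \<rho>_SOnn] by simp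

lemma Mt_\<rho>: "\<gamma> \<in> carrier \<Gamma> \<Longrightarrow> Mt t \<gamma> *v (\<rho> 0 \<gamma> *v v) = \<rho> t \<gamma> *v v"
  unfolding Mt_def using ginv_vector(1)[OF \<rho>_SOnn] by (simp flip: matrix_vector_mul_assoc)

text \<open>The derivative at the identity of the invariance of the form under
  \<open>Mt t \<gamma>\<close>, which belongs to \<open>SOnn\<close> near
  \<open>t = 0\<close>.\<close>

lemma U_skew:
  assumes \<gamma>: "\<gamma> \<in> carrier \<Gamma>" shows "form (U \<gamma> *v v) w + form v (U \<gamma> *v w) = 0"
proof -
  have M: "((\<lambda>t. Mt t \<gamma> *v v) has_vector_derivative U \<gamma> *v v) (at 0)" for v
    unfolding Mt_def by (rule has_vector_derivative_matrix_vector[OF U[OF \<gamma>]])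
  have "((\<lambda>t. form (Mt t \<gamma> *v v) (Mt t \<gamma> *v w)) has_vector_derivative
      form (Mt 0 \<gamma> *v v) (U \<gamma> *v w) + form (U \<gamma> *v v) (Mt 0 \<gamma> *v w)) (at 0)"
    by (rule bounded_bilinear.has_vector_derivative[OF bilinear_form[unfolded bilinear_conv_bounded_bilinear] M M])
  moreover have "((\<lambda>t. form (Mt t \<gamma> *v v) (Mt t \<gamma> *v w)) has_vector_derivative 0) (at 0)"
  proof (rule has_vector_derivative_transform_within_open[of "\<lambda>_. form v w" _ _ "{-1<..<1}"])
    fix t :: real assume "t \<in> {-1<..<1}"
    then have "Mt t \<gamma> \<in> SOnn" unfolding Mt_def using \<gamma> by (intro SOnn_mult SOnn_ginv \<rho>_SOnn) auto
    then show "form v w = form (Mt t \<gamma> *v v) (Mt t \<gamma> *v w)" by (simp add: SOnn_form)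
  qed auto
  ultimately have "form (Mt 0 \<gamma> *v v) (U \<gamma> *v w) + form (U \<gamma> *v v) (Mt 0 \<gamma> *v w) = 0"
    by (rule vector_derivative_unique_at)
  then show ?thesis using \<gamma> by (simp add: Mt_0)
qed

section \<open>The Lyapunov form and its exact increment\<close>

definition hyp_part :: "'n vec2 \<Rightarrow> 'n vec2" where "hyp_part v = v - v $ Inr k *\<^sub>R e2n"

lemma hyp_part_hyp: "hyp_part v \<in> hyp k" unfolding hyp_part_def by (simp add: axis_nth)

lemma linear_hyp_part: "linear hyp_part" unfolding hyp_part_def[abs_def] by (intro linearI) (simp_all add: algebra_simps)

lemma hyp_part_\<rho>: assumes "\<gamma> \<in> carrier \<Gamma>" shows "hyp_part (\<rho> 0 \<gamma> *v v) = R \<gamma> (hyp_part v)"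
  using hat_hyp[OF hyp_part_hyp, of "a0 \<gamma>" v] G0_component[OF \<rho>_G0[OF assms]] G0_axis[OF \<rho>_G0[OF assms]] assms
  unfolding hyp_part_def by (simp add: \<rho>_0[symmetric] matrix_vector_mult_diff_distrib matrix_vector_mult_scaleR)

text \<open>\<open>\<rho> 0\<close> fixes the last basis vector, whereas \<open>R\<close> moves it
  by the cocycle. Dropping the last coordinate first makes the isotropic projections equivariant for
  \<open>\<rho> 0\<close>.\<close>

definition hyp_pr :: "bool \<Rightarrow> 'g fpoint \<Rightarrow> 'n vec2 \<Rightarrow> 'n vec2" where "hyp_pr \<epsilon> p v = pr \<epsilon> p (hyp_part v)"

lemma linear_hyp_pr: "linear (hyp_pr \<epsilon> p)"
  unfolding hyp_pr_def[abs_def] by (rule linear_compose[OF linear_hyp_part linear_pr, unfolded o_def])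

lemma hyp_pr_W: "p \<in> X \<Longrightarrow> hyp_pr \<epsilon> p v \<in> W \<epsilon> (ep \<epsilon> p)"
  unfolding hyp_pr_def by (rule pr)

lemma hyp_pr_hyp: "p \<in> X \<Longrightarrow> hyp_pr \<epsilon> p v \<in> hyp k"
  using W_hyp[OF ep_bdry hyp_pr_W] .

lemma hyp_pr_limit: "conv P p \<Longrightarrow> (\<And>j. P j \<in> X) \<Longrightarrow> v \<longlonglongrightarrow> w \<Longrightarrow> (\<lambda>j. hyp_pr \<epsilon> (P j) (v j)) \<longlonglongrightarrow> hyp_pr \<epsilon> p w"
  unfolding hyp_pr_def hyp_part_def by (intro pr_limit tendsto_intros)

lemma n_hyp_pr_limit:
  "conv P p \<Longrightarrow> (\<And>j. P j \<in> X) \<Longrightarrow> v \<longlonglongrightarrow> w \<Longrightarrow> (\<lambda>j. n (P j) (hyp_pr \<epsilon> (P j) (v j))) \<longlonglongrightarrow> n p (hyp_pr \<epsilon> p w)"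
  by (rule n_limit[OF _ hyp_pr_hyp hyp_pr_limit])

lemma hyp_pr_sum:
  assumes "p \<in> X"
  shows "v = hyp_pr True p v + hyp_pr False p v + form v (\<nu>' p) *\<^sub>R \<nu>' p + v $ Inr k *\<^sub>R e2n"
proof -
  have "form (hyp_part v) (\<nu>' p) = form v (\<nu>' p)"
    using \<nu>'(1)[OF assms] unfolding hyp_part_def by (simp add: form_simps form_Inr)
  then show ?thesis using hyp_sum'[OF assms hyp_part_hyp, of v] unfolding hyp_pr_def by (simp add: hyp_part_def algebra_simps)
qed

text \<open>The Lyapunov function. The three terms have weight \<open>1\<close>, \<open>1\<close> and \<open>\<bar>t\<bar>\<close>: the first two increase
  along the undeformed flow resp. are invariant; the first order effect of the deformation on
  the second one is a coboundary up to the increments of \<open>h\<close>, and the third one corrects it.\<close>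

definition lyap :: "real \<Rightarrow> 'g fpoint \<Rightarrow> 'n vec2 \<Rightarrow> real" where
  "lyap t p v = (n p (hyp_pr False p v))\<^sup>2 - (n p (hyp_pr True p v))\<^sup>2 - sgn t * (form v (\<nu>' p) * v $ Inr k) +
     \<bar>t\<bar> * (h p * ((form v (\<nu>' p))\<^sup>2 + (v $ Inr k)\<^sup>2))"

lemma lyap_limit:
  "conv P p \<Longrightarrow> (\<And>j. P j \<in> X) \<Longrightarrow> v \<longlonglongrightarrow> w \<Longrightarrow> (\<lambda>j. lyap t (P j) (v j)) \<longlonglongrightarrow> lyap t p w"
  unfolding lyap_def by (intro tendsto_intros n_hyp_pr_limit \<nu>'_limit h_limit)

lemma lyap_scale: assumes "p \<in> X" shows "lyap t p (r *\<^sub>R v) = r\<^sup>2 * lyap t p v"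
  unfolding lyap_def linear_scale[OF linear_hyp_pr] n_scale[OF assms hyp_pr_hyp[OF assms]]
  by (simp add: form_simps power_mult_distrib algebra_simps power2_eq_square)

lemma lyap_continuous: assumes "p \<in> X" shows "continuous_on UNIV (lyap t p)"
  unfolding continuous_on_sequentially
  using lyap_limit[of "\<lambda>_. p" p] assms by (simp add: limitin_const o_def)

lemma K_homogeneous_bound:
  fixes f :: "'g fpoint \<Rightarrow> 'n vec2 \<Rightarrow> real"
  assumes "\<And>P p v w. (\<And>j. P j \<in> X) \<Longrightarrow> conv P p \<Longrightarrow> v \<longlonglongrightarrow> w \<Longrightarrow> (\<lambda>j. f (P j) (v j)) \<longlonglongrightarrow> f p w"
    and "\<And>p v r. p \<in> X \<Longrightarrow> f p (r *\<^sub>R v) = r\<^sup>2 * f p v"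
  shows "\<exists>B. \<forall>p\<in>K. \<forall>v. \<bar>f p v\<bar> \<le> B * (norm v)\<^sup>2"
proof -
  have "\<exists>c>0. \<forall>p\<in>K. \<forall>v. norm v = 1 \<longrightarrow> \<bar>f p v\<bar> \<le> c"
    by (rule compact_upper_bound[OF K(1)]) (intro tendsto_intros assms(1); simp add: K_X)
  then obtain b where b: "\<And>p v. p \<in> K \<Longrightarrow> norm v = 1 \<Longrightarrow> \<bar>f p v\<bar> \<le> b" by blast
  have "\<bar>f p v\<bar> \<le> b * (norm v)\<^sup>2" if p: "p \<in> K" for p v
  proof (cases "v = 0")
    case True
    then show ?thesis using assms(2)[OF K_X[OF p], of 0 v] by simp
  next
    case False
    let ?u = "(1 / norm v) *\<^sub>R v"
    have v: "v = norm v *\<^sub>R ?u" using False by simp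
    have "f p v = (norm v)\<^sup>2 * f p ?u" by (subst (1) v) (rule assms(2)[OF K_X[OF p]])
    moreover have "\<bar>f p ?u\<bar> \<le> b" using False by (intro b p) simp
    then have "(norm v)\<^sup>2 * \<bar>f p ?u\<bar> \<le> (norm v)\<^sup>2 * b" by (rule mult_left_mono) simp
    ultimately show ?thesis by (simp add: abs_mult mult.commute)
  qed
  then show ?thesis by blast
qed

text \<open>For \<open>t \<noteq> 0\<close> this is the difference quotient of the squared isotropic
  norm from \<open>w\<close> to \<open>w + t *\<^sub>R y\<close>; in this polarised form it also
  makes sense, and is continuous, at \<open>t = 0\<close>.\<close>

definition At :: "bool \<Rightarrow> real \<Rightarrow> 'g fpoint \<Rightarrow> 'n vec2 \<Rightarrow> 'n vec2 \<Rightarrow> real" where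
  "At \<epsilon> t p w y = (n p (hyp_pr \<epsilon> p (w + y)))\<^sup>2 - (n p (hyp_pr \<epsilon> p w))\<^sup>2 - (n p (hyp_pr \<epsilon> p y))\<^sup>2 + t * (n p (hyp_pr \<epsilon> p y))\<^sup>2"

definition Bt :: "real \<Rightarrow> 'g fpoint \<Rightarrow> 'n vec2 \<Rightarrow> real" where
  "Bt \<tau> p v = (n (flow \<tau> p) (hyp_pr False p v))\<^sup>2 - (n p (hyp_pr False p v))\<^sup>2 +
     ((n p (hyp_pr True p v))\<^sup>2 - (n (flow \<tau> p) (hyp_pr True p v))\<^sup>2)"

definition Gt :: "real \<Rightarrow> real \<Rightarrow> 'g \<Rightarrow> 'g fpoint \<Rightarrow> 'n vec2 \<Rightarrow> 'n vec2 \<Rightarrow> real" where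
  "Gt \<tau> t f p v y = (let p' = act f (flow \<tau> p); w = \<rho> 0 f *v v; a = form w (\<nu>' p'); b = w $ Inr k;
      a' = form y (\<nu>' p'); b' = y $ Inr k in
     sgn t * (At False t p' w y - At True t p' w y) - (a * b' + b * a' + t * (a' * b')) +
     (h p' * ((a + t * a')\<^sup>2 + (b + t * b')\<^sup>2) - h p * (a\<^sup>2 + b\<^sup>2)))"

lemma n_hyp_pr_expand:
  assumes "p \<in> X" shows "(n p (hyp_pr \<epsilon> p (w + t *\<^sub>R y)))\<^sup>2 = (n p (hyp_pr \<epsilon> p w))\<^sup>2 + t * At \<epsilon> t p w y"
  unfolding At_def linear_add[OF linear_hyp_pr] linear_scale[OF linear_hyp_pr] n_expand[OF assms hyp_pr_hyp[OF assms] hyp_pr_hyp[OF assms]]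
  by (simp add: algebra_simps power2_eq_square)

text \<open>An exact identity, with \<open>y\<close> the difference quotient of the deformation:
  \<open>Bt\<close> is the gain of the undeformed flow and \<open>Gt\<close> the whole effect of
  order \<bar>t\<bar>. Apart from the factor \<open>sgn t\<close>, every ingredient of
  \<open>Gt\<close> has a limit as \<open>t\<close> tends to 0, so no error terms have to be
  estimated.\<close>

lemma increment:
  assumes f: "f \<in> carrier \<Gamma>" and p: "p \<in> X" and t: "t \<noteq> 0"
    and y: "\<rho> t f *v v = \<rho> 0 f *v v + t *\<^sub>R y"
  shows "lyap t (act f (flow \<tau> p)) (\<rho> t f *v v) - lyap t p v = \<bar>t\<bar> * Gt \<tau> t f p v y + Bt \<tau> p v"
proof -
  define p' where "p' = act f (flow \<tau> p)"
  define w where "w = \<rho> 0 f *v v"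
  have p': "p' \<in> X" unfolding p'_def using f p by simp
  have hyp_pr: "hyp_pr \<epsilon> p' w = R f (hyp_pr \<epsilon> p v)" for \<epsilon>
    unfolding hyp_pr_def w_def hyp_part_\<rho>[OF f] p'_def using pr_act[OF f] p by simp
  have npx: "n p' (hyp_pr \<epsilon> p' w) = n (flow \<tau> p) (hyp_pr \<epsilon> p v)" for \<epsilon>
    unfolding hyp_pr unfolding p'_def using n_act[OF f _ hyp_pr_hyp[OF p]] p by simp
  have "\<nu>' p' = \<rho> 0 f *v \<nu>' p"
    unfolding p'_def using \<nu>'_act[OF f] \<nu>'_flow[OF p] hat_hyp[OF \<nu>'(1)[OF p]] \<rho>_0[OF f] p by simp
  then have a: "form w (\<nu>' p') = form v (\<nu>' p)" unfolding w_def using SOnn_form[OF \<rho>_SOnn[OF f]] by simp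
  have b: "w $ Inr k = v $ Inr k" unfolding w_def by (rule G0_component[OF \<rho>_G0[OF f]])
  have st: "t = \<bar>t\<bar> * sgn t" "\<bar>t\<bar> = sgn t * t" by (simp_all add: abs_mult_sgn mult.commute sgn_mult_abs) (simp add: sgn_if)
  have q: "lyap t p' (w + t *\<^sub>R y) = (n (flow \<tau> p) (hyp_pr False p v))\<^sup>2 + t * At False t p' w y
     - ((n (flow \<tau> p) (hyp_pr True p v))\<^sup>2 + t * At True t p' w y)
     - sgn t * ((form v (\<nu>' p) + t * form y (\<nu>' p')) * (v $ Inr k + t * y $ Inr k)) +
     \<bar>t\<bar> * (h p' * ((form v (\<nu>' p) + t * form y (\<nu>' p'))\<^sup>2 + (v $ Inr k + t * y $ Inr k)\<^sup>2))"
    unfolding lyap_def n_hyp_pr_expand[OF p'] npx by (simp add: form_simps a b)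
  have alg: "(x0 + t * A0 - (x1 + t * A1) - g * ((a + t * a') * (b + t * b')) + m * H) -
      (y0 - y1 - g * (a * b) + m * h') =
      m * (g * (A0 - A1) - (a * b' + b * a' + t * (a' * b')) + (H - h')) + (x0 - y0 + (y1 - x1))"
    if "t = m * g" "m = g * t" for x0 x1 y0 y1 A0 A1 a a' b b' g m H h' :: real
  proof -
    have "g * ((a + t * a') * (b + t * b')) = g * (a * b) + (g * t) * (a * b' + b * a' + t * (a' * b'))"
      by (simp add: algebra_simps)
    moreover have "t * A0 - t * A1 = m * (g * (A0 - A1))" unfolding that(1) by (simp add: algebra_simps)
    ultimately show ?thesis unfolding that(2)[symmetric] by (simp add: algebra_simps)
  qed
  have "lyap t p' (w + t *\<^sub>R y) - lyap t p v = \<bar>t\<bar> * Gt \<tau> t f p v y + Bt \<tau> p v"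
    unfolding q lyap_def[of t p v] Gt_def Let_def p'_def[symmetric] w_def[symmetric] a b Bt_def
    by (rule alg[OF st])
  then show ?thesis unfolding y p'_def w_def .
qed

text \<open>The time is long enough for a contraction factor of at most \<open>1 / 2\<close>.
  Squared norms then change by a factor of at least 4, so the contracted part loses at least three
  quarters and the expanded part gains at least three times itself.\<close>

lemma Bt_lower:
  assumes p: "p \<in> X" and \<tau>: "\<tau> \<ge> 0" "C * exp (- c * \<tau>) \<le> 1 / 2"
  shows "3 / 4 * ((n p (hyp_pr True p v))\<^sup>2 + (n p (hyp_pr False p v))\<^sup>2) \<le> Bt \<tau> p v"
proof -
  let ?q = "flow \<tau> p"
  have q: "?q \<in> X" using p by simp
  have "n (flow (sg True * \<tau>) p) (hyp_pr True p v) \<le> C * exp (- c * \<tau>) * n p (hyp_pr True p v)"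
    by (rule n_flow[OF p hyp_pr_W[OF p] \<tau>(1)])
  also have "\<dots> \<le> 1 / 2 * n p (hyp_pr True p v)" by (rule mult_right_mono[OF \<tau>(2) n_nonneg[OF p hyp_pr_hyp[OF p]]])
  finally have "n ?q (hyp_pr True p v) \<le> n p (hyp_pr True p v) / 2" by simp
  then have 1: "(n ?q (hyp_pr True p v))\<^sup>2 \<le> (n p (hyp_pr True p v) / 2)\<^sup>2"
    by (rule power_mono[OF _ n_nonneg[OF q hyp_pr_hyp[OF p]]])
  have "n p (hyp_pr False p v) \<le> C * exp (- c * \<tau>) * n (flow (sg True * \<tau>) p) (hyp_pr False p v)"
    by (rule n_flow_back[OF p _ \<tau>(1)]) (use hyp_pr_W[OF p, of False v] in simp)
  then have "n p (hyp_pr False p v) \<le> C * exp (- c * \<tau>) * n ?q (hyp_pr False p v)" by simp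
  also have "\<dots> \<le> 1 / 2 * n ?q (hyp_pr False p v)" by (rule mult_right_mono[OF \<tau>(2) n_nonneg[OF q hyp_pr_hyp[OF p]]])
  finally have "n p (hyp_pr False p v) * 2 \<le> n ?q (hyp_pr False p v)" by simp
  then have "(n p (hyp_pr False p v) * 2)\<^sup>2 \<le> (n ?q (hyp_pr False p v))\<^sup>2"
    by (rule power_mono) (use n_nonneg[OF p hyp_pr_hyp[OF p]] in simp)
  then have "(n p (hyp_pr False p v))\<^sup>2 * 4 \<le> (n ?q (hyp_pr False p v))\<^sup>2" by (simp add: power_mult_distrib)
  moreover have "(n ?q (hyp_pr True p v))\<^sup>2 * 4 \<le> (n p (hyp_pr True p v))\<^sup>2" using 1 by (simp add: power_divide)
  ultimately show ?thesis using zero_le_power2[of "n p (hyp_pr False p v)"] unfolding Bt_def by argo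
qed

section \<open>The strict increase, to zeroth and first order in the deformation parameter\<close>

lemma U_limit:
  assumes f: "f \<in> carrier \<Gamma>" and t: "t \<longlonglongrightarrow> 0" "\<And>j. t j \<noteq> 0" and w: "w \<longlonglongrightarrow> w0"
  shows "(\<lambda>j. (Mt (t j) f *v w j - w j) /\<^sub>R t j) \<longlonglongrightarrow> U f *v w0"
proof -
  let ?g = "\<lambda>x. norm (Mt (0 + x) f - Mt 0 f - x *\<^sub>R U f) / norm x"
  have "(?g \<longlongrightarrow> 0) (at 0)"
    using U[OF f] unfolding Mt_def[symmetric] has_vector_derivative_def has_derivative_at by blast
  moreover have "filterlim t (at 0) sequentially" using t by (simp add: filterlim_at)
  ultimately have lim: "(\<lambda>j. ?g (t j)) \<longlonglongrightarrow> 0" by (rule filterlim_compose)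
  have "norm ((Mt (t j) f - Mt 0 f) /\<^sub>R t j - U f) \<le> ?g (t j)" for j
  proof -
    have "(Mt (t j) f - Mt 0 f) /\<^sub>R t j - U f = (Mt (0 + t j) f - Mt 0 f - t j *\<^sub>R U f) /\<^sub>R t j"
      using t(2)[of j] by (simp add: scaleR_diff_right)
    then show ?thesis by (simp add: divide_inverse mult.commute)
  qed
  then have "(\<lambda>j. (Mt (t j) f - Mt 0 f) /\<^sub>R t j - U f) \<longlonglongrightarrow> 0"
    by (intro Lim_null_comparison[OF _ lim] always_eventually allI)
  then have "(\<lambda>j. (Mt (t j) f - Mt 0 f) /\<^sub>R t j) \<longlonglongrightarrow> U f" by (simp add: LIM_zero_iff)
  then have "(\<lambda>j. ((Mt (t j) f - Mt 0 f) /\<^sub>R t j) *v w j) \<longlonglongrightarrow> U f *v w0" by (intro tendsto_intros w)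
  then show ?thesis
    unfolding Mt_0[OF f] by (simp add: scaleR_matrix_vector_assoc[symmetric] matrix_vector_mult_diff_rdistrib)
qed

text \<open>The two orders are separated by taking limits: at order zero the undeformed gain forces
  the limit vector into the neutral plane, and there the first-order terms collapse to the increment
  of \<open>h\<close>, which is positive.\<close>

lemma step_contradiction:
  fixes P :: "nat \<Rightarrow> 'g fpoint" and t :: "nat \<Rightarrow> real" and v :: "nat \<Rightarrow> 'n vec2"
  assumes f: "f \<in> carrier \<Gamma>" and P: "\<And>j. P j \<in> X" "conv P p"
    and t: "t \<longlonglongrightarrow> 0" "\<And>j. t j \<noteq> 0" and v: "v \<longlonglongrightarrow> v0" "norm v0 = 1"
    and \<tau>: "\<tau> > 0" "C * exp (- c * \<tau>) \<le> 1 / 2"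
    and e: "e \<longlonglongrightarrow> 0" "\<And>j. lyap (t j) (act f (flow \<tau> (P j))) (\<rho> (t j) f *v v j) - lyap (t j) (P j) (v j) < e j * \<bar>t j\<bar>"
  shows False
proof -
  define y where "y j = (\<rho> (t j) f *v v j - \<rho> 0 f *v v j) /\<^sub>R t j" for j
  define w0 where "w0 = \<rho> 0 f *v v0"
  define p' where "p' = act f (flow \<tau> p)"
  have p: "p \<in> X" by (rule conv_X[OF P(2)])
  have p'X: "p' \<in> X" unfolding p'_def using f p by simp
  have w: "(\<lambda>j. \<rho> 0 f *v v j) \<longlonglongrightarrow> w0" unfolding w0_def by (intro tendsto_intros v)
  have y: "y \<longlonglongrightarrow> U f *v w0"
    using U_limit[OF f t w] unfolding Mt_\<rho>[OF f] y_def[abs_def] .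
  have step: "\<bar>t j\<bar> * Gt \<tau> (t j) f (P j) (v j) (y j) + Bt \<tau> (P j) (v j) < e j * \<bar>t j\<bar>" for j
  proof -
    have "\<rho> (t j) f *v v j = \<rho> 0 f *v v j + t j *\<^sub>R y j" unfolding y_def using t(2)[of j] by simp
    then show ?thesis using increment[OF f P(1) t(2), of j "v j" "y j" \<tau>] e(2)[of j] by simp
  qed
  have P': "conv (\<lambda>j. act f (flow \<tau> (P j))) p'" "\<And>j. act f (flow \<tau> (P j)) \<in> X"
    unfolding p'_def using conv_act[OF f conv_flow[OF P(1,2) tendsto_const]] P(1) f by auto
  have At: "(\<lambda>j. At \<epsilon> (t j) (act f (flow \<tau> (P j))) (\<rho> 0 f *v v j) (y j)) \<longlonglongrightarrow> At \<epsilon> 0 p' w0 (U f *v w0)" for \<epsilon>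
    unfolding At_def by (intro tendsto_intros n_hyp_pr_limit P' w y t)
  define S where "S q v = 3 / 4 * ((n q (hyp_pr True q v))\<^sup>2 + (n q (hyp_pr False q v))\<^sup>2)" for q v
  have S: "(\<lambda>j. S (P j) (v j)) \<longlonglongrightarrow> S p v0" unfolding S_def by (intro tendsto_intros n_hyp_pr_limit P v)
  have SB: "S (P j) (v j) \<le> Bt \<tau> (P j) (v j)" for j unfolding S_def by (rule Bt_lower[OF P(1)]) (use \<tau> in simp_all)
  let ?a = "form w0 (\<nu>' p')" and ?b = "w0 $ Inr k" and ?a' = "form (U f *v w0) (\<nu>' p')" and ?b' = "(U f *v w0) $ Inr k"
  define A where "A j = At False (t j) (act f (flow \<tau> (P j))) (\<rho> 0 f *v v j) (y j) -
     At True (t j) (act f (flow \<tau> (P j))) (\<rho> 0 f *v v j) (y j)" for j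
  define H where "H j = - (form (\<rho> 0 f *v v j) (\<nu>' (act f (flow \<tau> (P j)))) * y j $ Inr k +
       (\<rho> 0 f *v v j) $ Inr k * form (y j) (\<nu>' (act f (flow \<tau> (P j)))) +
       t j * (form (y j) (\<nu>' (act f (flow \<tau> (P j)))) * y j $ Inr k)) +
     (h (act f (flow \<tau> (P j))) * ((form (\<rho> 0 f *v v j) (\<nu>' (act f (flow \<tau> (P j)))) +
         t j * form (y j) (\<nu>' (act f (flow \<tau> (P j)))))\<^sup>2 + ((\<rho> 0 f *v v j) $ Inr k + t j * y j $ Inr k)\<^sup>2) -
      h (P j) * ((form (\<rho> 0 f *v v j) (\<nu>' (act f (flow \<tau> (P j)))))\<^sup>2 + ((\<rho> 0 f *v v j) $ Inr k)\<^sup>2))" for j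
  have GA: "Gt \<tau> (t j) f (P j) (v j) (y j) = H j + sgn (t j) * A j" for j
    unfolding Gt_def Let_def H_def A_def by simp
  have A: "A \<longlonglongrightarrow> At False 0 p' w0 (U f *v w0) - At True 0 p' w0 (U f *v w0)"
    unfolding A_def[abs_def] by (intro tendsto_intros At)
  have H: "H \<longlonglongrightarrow> - (?a * ?b' + ?b * ?a' + 0 * (?a' * ?b')) +
     (h p' * ((?a + 0 * ?a')\<^sup>2 + (?b + 0 * ?b')\<^sup>2) - h p * (?a\<^sup>2 + ?b\<^sup>2))"
    unfolding H_def by (intro tendsto_intros w y t(1) \<nu>'_limit h_limit P P')
  have lim0: "(\<lambda>j. \<bar>t j\<bar> * (e j - H j + \<bar>A j\<bar>)) \<longlonglongrightarrow> 0"
  proof -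
    have "(\<lambda>j. \<bar>t j\<bar>) \<longlonglongrightarrow> 0" using tendsto_rabs[OF t(1)] by simp
    from tendsto_mult[OF this tendsto_add[OF tendsto_diff[OF e(1) H] tendsto_rabs[OF A]]] show ?thesis by simp
  qed
  have G: "\<bar>t j\<bar> * (H j + sgn (t j) * A j) + Bt \<tau> (P j) (v j) < e j * \<bar>t j\<bar>" for j
    using step[of j] unfolding GA .
  have sA: "\<bar>sgn (t j) * A j\<bar> = \<bar>A j\<bar>" for j using t(2)[of j] by (simp add: abs_mult sgn_if)
  have "S (P j) (v j) \<le> \<bar>t j\<bar> * (e j - H j + \<bar>A j\<bar>)" for j
  proof -
    have "\<bar>t j\<bar> * (e j - H j - sgn (t j) * A j) \<le> \<bar>t j\<bar> * (e j - H j + \<bar>A j\<bar>)"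
      using sA[of j] by (intro mult_left_mono) linarith+
    then show ?thesis using G[of j] SB[of j] by (simp add: algebra_simps)
  qed
  \<comment> \<open>Order zero: all terms carrying \<bar>t\<bar> have disappeared, so the isotropic
    components of the limit vector are null.\<close>
  then have "S p v0 \<le> 0" by (intro LIMSEQ_le[OF S lim0]) blast
  then have "(n p (hyp_pr True p v0))\<^sup>2 + (n p (hyp_pr False p v0))\<^sup>2 \<le> 0" unfolding S_def by simp
  then have nz: "n p (hyp_pr \<epsilon> p v0) = 0" for \<epsilon>
    by (cases \<epsilon>) (simp_all add: sum_power2_le_zero_iff)
  have px0: "hyp_pr \<epsilon> p v0 = 0" for \<epsilon> using n_pos[OF p hyp_pr_W[OF p], of \<epsilon> v0] nz[of \<epsilon>] by fastforce
  have v0: "v0 = form v0 (\<nu>' p) *\<^sub>R \<nu>' p + v0 $ Inr k *\<^sub>R e2n" using hyp_pr_sum[OF p, of v0] by (simp add: px0)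
  have \<nu>p': "\<nu>' p' = \<rho> 0 f *v \<nu>' p"
    unfolding p'_def using \<nu>'_act[OF f] \<nu>'_flow[OF p] hat_hyp[OF \<nu>'(1)[OF p]] \<rho>_0[OF f] p by simp
  have a: "?a = form v0 (\<nu>' p)" unfolding w0_def \<nu>p' using SOnn_form[OF \<rho>_SOnn[OF f]] by simp
  have b: "?b = v0 $ Inr k" unfolding w0_def by (rule G0_component[OF \<rho>_G0[OF f]])
  have w0: "w0 = ?a *\<^sub>R \<nu>' p' + ?b *\<^sub>R e2n"
    unfolding a b unfolding w0_def \<nu>p' by (subst v0)
      (simp only: matrix_vector_right_distrib matrix_vector_mult_scaleR G0_axis[OF \<rho>_G0[OF f]])
  have pxw: "hyp_pr \<epsilon> p' w0 = 0" for \<epsilon>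
  proof -
    have "hyp_pr \<epsilon> p' w0 = R f (hyp_pr \<epsilon> p v0)"
      unfolding hyp_pr_def w0_def hyp_part_\<rho>[OF f] p'_def using pr_act[OF f] p by simp
    then show ?thesis by (simp add: px0 linear_0[OF linear_hat])
  qed
  have "At \<epsilon> 0 p' w0 (U f *v w0) = 0" for \<epsilon>
    unfolding At_def linear_add[OF linear_hyp_pr] pxw n_zero[OF p'X] by simp
  then have A0: "A \<longlonglongrightarrow> 0" using A by simp
  \<comment> \<open>The sign of \<open>t j\<close> may oscillate, so it matters that
    \<open>A\<close> tends to 0 and not merely to some limit.\<close>
  have "(\<lambda>j. sgn (t j) * A j) \<longlonglongrightarrow> 0"
    by (rule Lim_null_comparison[OF _ tendsto_rabs_zero[OF A0]]) (simp add: sA)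
  from tendsto_add[OF H this] have GH: "(\<lambda>j. H j + sgn (t j) * A j) \<longlonglongrightarrow> - (?a * ?b' + ?b * ?a') + (h p' - h p) * (?a\<^sup>2 + ?b\<^sup>2)"
    by (simp add: algebra_simps)
  \<comment> \<open>Order one: the gain \<open>Bt\<close> is nonnegative and is dropped, after which
    the inequality is divided by \<bar>t j\<bar>.\<close>
  have "H j + sgn (t j) * A j \<le> e j" for j
  proof -
    have "0 \<le> S (P j) (v j)" unfolding S_def by simp
    then have "\<bar>t j\<bar> * (H j + sgn (t j) * A j) < \<bar>t j\<bar> * e j" using G[of j] SB[of j] by (simp add: mult.commute)
    then show ?thesis using mult_less_cancel_left_pos[of "\<bar>t j\<bar>"] t(2)[of j] by simp
  qed
  then have le: "- (?a * ?b' + ?b * ?a') + (h p' - h p) * (?a\<^sup>2 + ?b\<^sup>2) \<le> 0"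
    by (intro LIMSEQ_le[OF GH e(1)]) blast
  define \<kappa> where "\<kappa> = form (snd (a0 f)) (\<nu>' p')"
  have sk: "form (U f *v \<nu>' p') (\<nu>' p') = 0" using U_skew[OF f, of "\<nu>' p'" "\<nu>' p'"] form_commute[of "\<nu>' p'" "U f *v \<nu>' p'"] by simp
  have "U f *v w0 = ?a *\<^sub>R (U f *v \<nu>' p') + ?b *\<^sub>R snd (a0 f)"
    by (subst w0) (simp only: matrix_vector_right_distrib matrix_vector_mult_scaleR U_e2n[OF f])
  then have a': "?a' = ?b * \<kappa>" unfolding \<kappa>_def by (simp add: form_simps sk)
  have "form (U f *v w0) e2n = - form w0 (snd (a0 f))" using U_skew[OF f, of w0 e2n] U_e2n[OF f] by simp
  also have "form w0 (snd (a0 f)) = ?a * \<kappa>"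
    using a0_carrier[OF f] unfolding \<kappa>_def by (subst w0) (simp add: form_simps form_Inr form_commute[of "\<nu>' p'"])
  finally have b': "?b' = ?a * \<kappa>" by (simp add: form_Inr)
  \<comment> \<open>With \<open>?a' = ?b * \<kappa>\<close> and \<open>?b' = ?a * \<kappa>\<close>
    the middle term contributes \<kappa> times \<open>?a\<^sup>2 + ?b\<^sup>2\<close> with a minus
    sign, which the cocycle part of \<open>h p'\<close> cancels exactly.\<close>
  have "h p' = h (flow \<tau> p) + \<kappa>" unfolding \<kappa>_def p'_def using h_act[OF f] p by simp
  then have "(h (flow \<tau> p) - h p) * (?a\<^sup>2 + ?b\<^sup>2) \<le> 0" using le unfolding a' b' by (simp add: algebra_simps power2_eq_square)
  moreover have "0 < h (flow \<tau> p) - h p" using h_increasing[OF p, of 0 \<tau>] \<tau>(1) by simp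
  ultimately have "?a\<^sup>2 + ?b\<^sup>2 \<le> 0" by (simp add: mult_le_0_iff)
  then have "?a = 0 \<and> ?b = 0" by (simp add: sum_power2_le_zero_iff)
  then have "v0 = 0" using v0 a b by simp
  then show False using v(2) by simp
qed

text \<open>An isotropic space enlarged by the line through \<open>en + r *\<^sub>R e2n\<close> of
  the neutral plane.\<close>

definition V0 :: "bool \<Rightarrow> real \<Rightarrow> 'n vec2 set" where
  "V0 \<epsilon> r = {v. \<forall>j. v $ Inr j = (if j = k then r else sg \<epsilon>) * v $ Inl j}"

lemma V0: "subspace (V0 \<epsilon> r)" "dim (V0 \<epsilon> r) = CARD('n)"
proof -
  define \<phi> :: "real ^ 'n \<Rightarrow> 'n vec2" where
    "\<phi> x = (\<chi> i. case i of Inl j \<Rightarrow> x $ j | Inr j \<Rightarrow> (if j = k then r else sg \<epsilon>) * x $ j)" for x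
  have lin: "linear \<phi>" unfolding \<phi>_def[abs_def]
    by (intro linearI; simp add: vec_eq_iff; intro allI; simp split: sum.split add: algebra_simps)
  have "inj \<phi>"
  proof (rule injI)
    fix x y assume "\<phi> x = \<phi> y"
    then have "\<phi> x $ Inl j = \<phi> y $ Inl j" for j by simp
    then show "x = y" unfolding \<phi>_def by (simp add: vec_eq_iff)
  qed
  have V: "V0 \<epsilon> r = range \<phi>"
  proof (intro equalityI subsetI)
    fix v assume v: "v \<in> V0 \<epsilon> r"
    have "\<phi> (\<chi> j. v $ Inl j) $ i = v $ i" for i using v unfolding \<phi>_def V0_def by (cases i) simp_all
    then have "v = \<phi> (\<chi> j. v $ Inl j)" by (simp add: vec_eq_iff)
    then show "v \<in> range \<phi>" by blast
  qed (auto simp: \<phi>_def V0_def)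
  show "subspace (V0 \<epsilon> r)" unfolding V by (rule linear_subspace_image[OF lin subspace_UNIV])
  show "dim (V0 \<epsilon> r) = CARD('n)"
    unfolding V using dim_image_eq[OF lin, of UNIV] \<open>inj \<phi>\<close> by simp
qed

text \<open>On the eigenlines of the boost \<open>ab\<close> is definite, of value
  \<open>m\<^sup>2\<close> up to sign with \<open>m\<close> the coordinate along the line. There
  \<open>a\<^sup>2 + b\<^sup>2 = 2m\<^sup>2\<close>, so the bound \<open>1 / 2\<close> is what keeps
  the correction term from exceeding the main one.\<close>

lemma lyap_subspace:
  assumes p: "p \<in> X" and t: "t \<noteq> 0" "\<bar>t\<bar> * \<bar>h p\<bar> \<le> 1 / 2"
  shows "\<exists>V. subspace V \<and> dim V = CARD('n) \<and> (\<forall>v\<in>V. if \<epsilon> then lyap t p v \<le> 0 else lyap t p v \<ge> 0)"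
proof -
  let ?g = "fst (frame p)"
  \<comment> \<open>The sign that makes \<open>sgn t * ab\<close> positive for \<open>True\<close>
    and negative for \<open>False\<close>; the factor \<open>\<sigma> p\<close> accounts for the
    orientation of \<open>\<nu>'\<close> relative to \<open>\<nu>\<close>.\<close>
  define r where "r = (if \<epsilon> then 1 else -1) * sgn t * \<sigma> p"
  note fc = frame(2)[OF p]
  have G: "?g \<in> G0 k" using fc by simp
  have inj: "inj ((*v) ?g)" using ginv_vector(1)[OF G0_SOnn[OF G]] by (metis injI)
  have "subspace ((*v) ?g ` V0 \<epsilon> r)" by (intro linear_subspace_image matrix_vector_mul_linear V0)
  moreover have "dim ((*v) ?g ` V0 \<epsilon> r) = CARD('n)"
    using dim_image_eq[OF matrix_vector_mul_linear inj_on_subset[OF inj subset_UNIV]] V0(2) by simp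
  moreover have "if \<epsilon> then lyap t p v \<le> 0 else lyap t p v \<ge> 0" if v: "v \<in> (*v) ?g ` V0 \<epsilon> r" for v
  proof -
    obtain z where z: "z \<in> V0 \<epsilon> r" "v = ?g *v z" using v by blast
    let ?m = "z $ Inl k"
    define w where "w = z - ?m *\<^sub>R (en + r *\<^sub>R e2n)"
    have w: "w \<in> W0 k \<epsilon>" unfolding W0_iff
    proof (intro conjI allI)
      show "w $ Inl k = 0" unfolding w_def by (simp add: axis_def)
      fix j show "w $ Inr j = sg \<epsilon> * w $ Inl j"
        using z(1) unfolding w_def V0_def by (cases "j = k") (simp_all add: axis_def)
    qed
    note wh = W0_hyp[OF w]
    let ?w = "?g *v w"
    have wW: "?w \<in> W \<epsilon> (ep \<epsilon> p)"
      unfolding \<xi>_eq(3)[OF ep_bdry[OF p] frame(1)[OF p]] hat_hyp[OF wh, of "frame p", symmetric] using w by blast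
    have en: "en \<in> hyp k" by (simp add: axis_def)
    have \<nu>: "\<nu> p = \<sigma> p *\<^sub>R \<nu>' p" unfolding \<nu>'_def by (simp add: \<sigma>_sq)
    have "z = w + ?m *\<^sub>R en + (?m * r) *\<^sub>R e2n" unfolding w_def by (simp add: scaleR_add_right)
    then have "v = ?g *v (w + ?m *\<^sub>R en + (?m * r) *\<^sub>R e2n)" using z(2) by simp
    then have dec: "v = ?w + (?m * \<sigma> p) *\<^sub>R \<nu>' p + (?m * r) *\<^sub>R e2n"
      using \<nu>_frame[OF p] unfolding hat_hyp[OF en] \<nu>
      by (simp add: matrix_vector_right_distrib matrix_vector_mult_scaleR G0_axis[OF G] flip: scaleR_scaleR)
    have vk: "v $ Inr k = ?m * r"
      unfolding dec using W_hyp[OF ep_bdry[OF p] wW] \<nu>'(1)[OF p] by (simp add: axis_nth)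
    have va: "form v (\<nu>' p) = ?m * \<sigma> p"
      by (subst dec) (use \<nu>'[OF p] \<nu>'(3)[OF p wW] in \<open>simp add: form_simps form_Inr\<close>)
    have hpv: "hyp_part v = ?w + (?m * \<sigma> p) *\<^sub>R \<nu>' p" unfolding hyp_part_def vk by (subst dec) simp
    have hyp_pr: "hyp_pr \<epsilon>' p v = pr \<epsilon>' p ?w" for \<epsilon>'
      unfolding hyp_pr_def hpv linear_add[OF linear_pr] linear_scale[OF linear_pr] \<nu>'(5)[OF p] by simp
    have px0: "hyp_pr (\<not> \<epsilon>) p v = 0"
      unfolding hyp_pr using pr_A[OF p, of ?w "\<not> \<epsilon>"] wW W_A[OF ep_bdry[OF p], of \<epsilon> \<epsilon>] by auto
    have r2: "r\<^sup>2 = 1" "(\<sigma> p)\<^sup>2 = 1" "sgn t * (\<sigma> p * r) = (if \<epsilon> then 1 else -1)"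
      using t(1) unfolding r_def \<sigma>_def by (auto simp: sgn_if)
    have mid: "sgn t * (form v (\<nu>' p) * v $ Inr k) = (if \<epsilon> then 1 else -1) * ?m\<^sup>2"
    proof -
      have "sgn t * (form v (\<nu>' p) * v $ Inr k) = (sgn t * (\<sigma> p * r)) * ?m\<^sup>2"
        unfolding va vk by (simp add: power2_eq_square)
      then show ?thesis unfolding r2(3) .
    qed
    have last: "\<bar>\<bar>t\<bar> * (h p * ((form v (\<nu>' p))\<^sup>2 + (v $ Inr k)\<^sup>2))\<bar> \<le> ?m\<^sup>2"
    proof -
      have "\<bar>\<bar>t\<bar> * (h p * ((form v (\<nu>' p))\<^sup>2 + (v $ Inr k)\<^sup>2))\<bar> = (\<bar>t\<bar> * \<bar>h p\<bar>) * (2 * ?m\<^sup>2)"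
        unfolding va vk by (simp add: power_mult_distrib r2 abs_mult)
      also have "\<dots> \<le> 1 / 2 * (2 * ?m\<^sup>2)" by (rule mult_right_mono[OF t(2)]) simp
      finally show ?thesis by simp
    qed
    show ?thesis
    proof (cases \<epsilon>)
      case True
      have "hyp_pr False p v = 0" using px0 True by simp
      then show ?thesis unfolding lyap_def mid using True
        by (simp add: n_zero[OF p]) (use zero_le_power2[of "n p (hyp_pr True p v)"] abs_le_D1[OF last] abs_le_D2[OF last] in linarith)
    next
      case False
      have "hyp_pr True p v = 0" using px0 False by simp
      then show ?thesis unfolding lyap_def mid using False
        by (simp add: n_zero[OF p]) (use zero_le_power2[of "n p (hyp_pr False p v)"] abs_le_D1[OF last] abs_le_D2[OF last] in linarith)
    qed
  qed
  ultimately show ?thesis by blast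
qed

text \<open>Failure for every \<open>e\<close> yields sequences in the compact set \<open>K\<close>
  and in the unit sphere, and their limits are excluded by \<open>step_contradiction\<close>. The
  same number bounds \<bar>t\<bar> and measures the gain, so a single sequence
  \<open>1 / (j + 1)\<close> drives both to 0.\<close>

lemma step_uniform:
  assumes \<tau>: "\<tau> > 0" "C * exp (- c * \<tau>) \<le> 1 / 2" and f: "f \<in> carrier \<Gamma>"
  shows "\<exists>e>0. \<forall>t p v. 0 < \<bar>t\<bar> \<and> \<bar>t\<bar> < e \<and> p \<in> K \<and> norm v = 1 \<longrightarrow>
    e * \<bar>t\<bar> \<le> lyap t (act f (flow \<tau> p)) (\<rho> t f *v v) - lyap t p v"
proof (rule ccontr)
  assume neg: "\<not> ?thesis"
  define e where "e j = 1 / real (Suc j)" for j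
  have "\<exists>t p v. 0 < \<bar>t\<bar> \<and> \<bar>t\<bar> < e j \<and> p \<in> K \<and> norm v = 1 \<and>
    lyap t (act f (flow \<tau> p)) (\<rho> t f *v v) - lyap t p v < e j * \<bar>t\<bar>" for j
  proof -
    have "e j > 0" unfolding e_def by simp
    then show ?thesis using neg by (meson not_le)
  qed
  then obtain t P v where tPv: "\<And>j. 0 < \<bar>t j\<bar>" "\<And>j. \<bar>t j\<bar> < e j" "\<And>j. P j \<in> K" "\<And>j. norm (v j) = 1"
    "\<And>j. lyap (t j) (act f (flow \<tau> (P j))) (\<rho> (t j) f *v v j) - lyap (t j) (P j) (v j) < e j * \<bar>t j\<bar>" by metis
  have e0: "e \<longlonglongrightarrow> 0" unfolding e_def[abs_def] using lim_inverse_n' by real_asymp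
  have t0: "t \<longlonglongrightarrow> 0" by (rule Lim_null_comparison[OF _ e0]) (use tPv(2) in \<open>auto intro!: always_eventually less_imp_le\<close>)
  obtain r1 p where r1: "strict_mono r1" "p \<in> K" "conv (P \<circ> r1) p" using compact_seq[OF K(1), of P, OF tPv(3)] .
  have "\<forall>j. (v \<circ> r1) j \<in> sphere 0 1" using tPv(4) by simp
  then obtain v0 r2 where r2: "v0 \<in> sphere 0 1" "strict_mono r2" "(v \<circ> r1 \<circ> r2) \<longlonglongrightarrow> v0"
    using compact_sphere[of "0 :: 'n vec2" 1, unfolded compact_def] by blast
  let ?r = "r1 \<circ> r2"
  have r: "strict_mono ?r" by (rule strict_mono_o[OF r1(1) r2(2)])
  show False
  proof (rule step_contradiction[OF f, of "P \<circ> ?r" p "t \<circ> ?r" "v \<circ> ?r" v0 \<tau> "e \<circ> ?r"])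
    show "conv (P \<circ> ?r) p" using conv_subseq[OF r1(3) r2(2)] by (simp add: o_assoc)
    show "(t \<circ> ?r) \<longlonglongrightarrow> 0" "(e \<circ> ?r) \<longlonglongrightarrow> 0" using LIMSEQ_subseq_LIMSEQ[OF _ r] t0 e0 by blast+
    show "(v \<circ> ?r) \<longlonglongrightarrow> v0" using r2(3) by (simp add: o_assoc)
    show "(t \<circ> ?r) j \<noteq> 0" for j using tPv(1)[of "?r j"] by simp
  qed (use tPv \<tau> r2(1) K_X in auto)
qed

lemma step_size: "\<exists>\<tau>>0. C * exp (- c * \<tau>) \<le> 1 / 2"
proof -
  have "((\<lambda>x. C * exp (- c * x)) \<longlongrightarrow> 0) at_top" using c_pos by real_asymp
  then have "\<forall>\<^sub>F x in at_top. C * exp (- c * x) < 1 / 2" by (rule order_tendstoD) simp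
  then have "\<forall>\<^sub>F x in at_top. 0 < x \<and> C * exp (- c * x) \<le> 1 / 2"
    using eventually_gt_at_top[of 0] by eventually_elim simp
  then show ?thesis using eventually_happens'[OF trivial_limit_at_top_linorder] by blast
qed

text \<open>All conditions of the Lyapunov criterion live over \<open>K\<close>. For fixed
  \<open>t\<close> the gain is a positive constant proportional to \<bar>t\<bar>; it degenerates as
  \<open>t\<close> tends to 0, which is harmless since each \<rho>(t) is treated separately.\<close>

lemma deformed_anosov:
  assumes card: "CARD('n) \<ge> 2"
  shows "\<exists>\<epsilon>>0. \<forall>t. 0 < \<bar>t\<bar> \<and> \<bar>t\<bar> < \<epsilon> \<longrightarrow> anosov_SL_half \<Gamma> S act (\<rho> t)"
proof -
  obtain \<tau> where \<tau>: "\<tau> > 0" "C * exp (- c * \<tau>) \<le> 1 / 2" using step_size by blast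
  \<comment> \<open>\<open>step_uniform\<close> provides a constant for one return element at a
    time; properness leaves only finitely many elements, so a common constant exists.\<close>
  define F where "F = {\<gamma> \<in> carrier \<Gamma>. \<exists>p\<in>K. act \<gamma> (flow \<tau> p) \<in> K}"
  let ?Y = "{flow t p | t p. \<bar>t\<bar> \<le> \<tau> \<and> p \<in> K}"
  have KY: "p \<in> ?Y" "flow \<tau> p \<in> ?Y" if "p \<in> K" for p
  proof -
    show "p \<in> ?Y" using that \<tau>(1) by (intro CollectI exI[of _ 0] exI[of _ p]) simp
    show "flow \<tau> p \<in> ?Y" using that \<tau>(1) by (intro CollectI exI[of _ \<tau>] exI[of _ p]) simp
  qed
  have "F \<subseteq> {\<gamma> \<in> carrier \<Gamma>. act \<gamma> ` ?Y \<inter> ?Y \<noteq> {}}"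
  proof
    fix \<gamma> assume "\<gamma> \<in> F"
    then obtain p where p: "\<gamma> \<in> carrier \<Gamma>" "p \<in> K" "act \<gamma> (flow \<tau> p) \<in> K" unfolding F_def by blast
    have "act \<gamma> (flow \<tau> p) \<in> act \<gamma> ` ?Y \<inter> ?Y" using KY(2)[OF p(2)] KY(1)[OF p(3)] by blast
    then show "\<gamma> \<in> {\<gamma> \<in> carrier \<Gamma>. act \<gamma> ` ?Y \<inter> ?Y \<noteq> {}}" using p(1) by blast
  qed
  then have "finite F" using act_proper[OF compact_flow_K[of \<tau>]] finite_subset by blast
  let ?Q = "\<lambda>f e. \<forall>t p v. 0 < \<bar>t\<bar> \<and> \<bar>t\<bar> < e \<and> p \<in> K \<and> norm v = 1 \<longrightarrow>
    e * \<bar>t\<bar> \<le> lyap t (act f (flow \<tau> p)) (\<rho> t f *v v) - lyap t p v"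
  have "\<exists>e>0. \<forall>f\<in>F. ?Q f e"
  proof (rule finite_common_bound[OF \<open>finite F\<close>])
    show "\<exists>e>0. ?Q f e" if "f \<in> F" for f using step_uniform[OF \<tau>] that unfolding F_def by blast
    fix f and e e' :: real assume Q: "?Q f e" and e': "0 < e'" "e' \<le> e"
    show "?Q f e'"
    proof (intro allI impI)
      fix t p and v :: "'n vec2" assume *: "0 < \<bar>t\<bar> \<and> \<bar>t\<bar> < e' \<and> p \<in> K \<and> norm v = 1"
      then have "e' * \<bar>t\<bar> \<le> e * \<bar>t\<bar>" using e' by (intro mult_right_mono) auto
      also have "\<dots> \<le> lyap t (act f (flow \<tau> p)) (\<rho> t f *v v) - lyap t p v" using Q * e' by auto
      finally show "e' * \<bar>t\<bar> \<le> lyap t (act f (flow \<tau> p)) (\<rho> t f *v v) - lyap t p v" .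
    qed
  qed
  then obtain e where e: "e > 0" "\<And>f t p v. f \<in> F \<Longrightarrow> 0 < \<bar>t\<bar> \<Longrightarrow> \<bar>t\<bar> < e \<Longrightarrow> p \<in> K \<Longrightarrow> norm v = 1 \<Longrightarrow>
    e * \<bar>t\<bar> \<le> lyap t (act f (flow \<tau> p)) (\<rho> t f *v v) - lyap t p v" by blast
  have "\<exists>c>0. \<forall>p\<in>K. \<forall>v::real. norm v = 1 \<longrightarrow> \<bar>h p\<bar> \<le> c"
    by (rule compact_upper_bound[OF K(1)]) (intro tendsto_intros h_limit; simp add: K_X)
  then obtain H where H: "H > 0" "\<And>p. p \<in> K \<Longrightarrow> \<bar>h p\<bar> \<le> H" using norm_one by blast
  \<comment> \<open>The three bounds give the uniform step, the domain of the family, and the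
    condition \<bar>t\<bar>\<bar>h\<bar> \<le> 1/2 for the half-dimensional subspaces.\<close>
  define \<epsilon> where "\<epsilon> = min (min e 1) (1 / (2 * H))"
  have "anosov_SL_half \<Gamma> S act (\<rho> t)" if t: "0 < \<bar>t\<bar>" "\<bar>t\<bar> < \<epsilon>" for t
  proof -
    have t1: "\<bar>t\<bar> < 1" "\<bar>t\<bar> < e" "\<bar>t\<bar> < 1 / (2 * H)" "t \<noteq> 0" using t unfolding \<epsilon>_def by auto
    have tH: "\<bar>t\<bar> * \<bar>h p\<bar> \<le> 1 / 2" if "p \<in> K" for p
    proof -
      have "\<bar>t\<bar> * \<bar>h p\<bar> \<le> 1 / (2 * H) * H" using t1(3) H(1) H(2)[OF that] by (intro mult_mono) auto
      then show ?thesis using H(1) by simp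
    qed
    have "\<exists>B. \<forall>p\<in>K. \<forall>v. \<bar>lyap t p v\<bar> \<le> B * (norm v)\<^sup>2"
      by (rule K_homogeneous_bound[OF lyap_limit lyap_scale])
    then obtain B where B: "\<And>p v. p \<in> K \<Longrightarrow> \<bar>lyap t p v\<bar> \<le> B * (norm v)\<^sup>2" by blast
    have mult: "\<rho> t (\<gamma> \<otimes> \<eta>) = \<rho> t \<gamma> ** \<rho> t \<eta>" if "\<gamma> \<in> carrier \<Gamma>" "\<eta> \<in> carrier \<Gamma>" for \<gamma> \<eta>
      using hom_mult[OF \<rho>_hom[OF t1(1)] that] by simp
    \<comment> \<open>\<open>hom\<close> records multiplicativity only; the image of the unit is an
      invertible idempotent and so the identity.\<close>
    have "\<rho> t \<one> ** \<rho> t \<one> = \<rho> t \<one>" using mult[of \<one> \<one>] by simp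
    then have "ginv (\<rho> t \<one>) ** (\<rho> t \<one> ** \<rho> t \<one>) = ginv (\<rho> t \<one>) ** \<rho> t \<one>" by simp
    then have one: "\<rho> t \<one> = mat 1" unfolding matrix_mul_assoc ginv(1)[OF \<rho>_SOnn[OF one_closed t1(1)]] by simp
    interpret lyapunov_SL \<Gamma> S act D "\<rho> t" \<tau> "lyap t" B "e * \<bar>t\<bar>"
    proof unfold_locales
      fix \<gamma> p v assume g: "\<gamma> \<in> carrier \<Gamma>" "p \<in> K" "act \<gamma> (flow \<tau> p) \<in> K"
      show "lyap t (act \<gamma> (flow \<tau> p)) (\<rho> t \<gamma> *v v) \<ge> lyap t p v + e * \<bar>t\<bar> * (norm v)\<^sup>2"
      proof (cases "v = 0")
        case True
        have "act \<gamma> (flow \<tau> p) \<in> X" "p \<in> X" using g K_X by auto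
        then show ?thesis using True lyap_scale[of _ t 0 0] by simp
      next
        case False
        let ?u = "(1 / norm v) *\<^sub>R v"
        have v: "v = norm v *\<^sub>R ?u" using False by simp
        have "e * \<bar>t\<bar> \<le> lyap t (act \<gamma> (flow \<tau> p)) (\<rho> t \<gamma> *v ?u) - lyap t p ?u"
          using g t(1) t1(2) False by (intro e(2)) (auto simp: F_def)
        then have "(norm v)\<^sup>2 * (e * \<bar>t\<bar>) \<le> (norm v)\<^sup>2 * (lyap t (act \<gamma> (flow \<tau> p)) (\<rho> t \<gamma> *v ?u) - lyap t p ?u)"
          by (rule mult_left_mono) simp
        also have "\<dots> = lyap t (act \<gamma> (flow \<tau> p)) (norm v *\<^sub>R (\<rho> t \<gamma> *v ?u)) - lyap t p (norm v *\<^sub>R ?u)"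
          unfolding lyap_scale[OF K_X[OF g(3)]] lyap_scale[OF K_X[OF g(2)]] by (simp add: algebra_simps)
        finally show ?thesis using v by (simp add: matrix_vector_mult_scaleR mult.commute flip: matrix_vector_mult_scaleR)
      qed
    next
      fix p assume "p \<in> K"
      note X = K_X[OF this]
      show "continuous_on UNIV (lyap t p)" by (rule lyap_continuous[OF X])
      show "\<exists>V. subspace V \<and> dim V = CARD('n) \<and> (\<forall>v\<in>V. lyap t p v \<le> 0)"
        using lyap_subspace[OF X t1(4) tH[OF \<open>p \<in> K\<close>], of True] by simp
      show "\<exists>V. subspace V \<and> dim V = CARD('n) \<and> (\<forall>v\<in>V. lyap t p v \<ge> 0)"
        using lyap_subspace[OF X t1(4) tH[OF \<open>p \<in> K\<close>], of False] by simp
    next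
      have "det (\<rho> t \<gamma>) = 1" if "\<gamma> \<in> carrier \<Gamma>" for \<gamma> using \<rho>_SOnn[OF that t1(1)] unfolding SOnn_def by simp
      then show "\<rho> t \<in> hom \<Gamma> SL_group" using mult by (auto intro!: homI)
    next
      show "asymptotic_rays \<epsilon>" "opposite_rays_diverge \<epsilon>" for \<epsilon> by (rule asymptotic[OF card] opposite)+
    qed (use \<tau>(1) e(1) t(1) B mult one in \<open>simp_all add: matrix_vector_mul_assoc[symmetric] matrix_vector_right_distrib matrix_vector_mult_scaleR\<close>)
    show ?thesis by (rule anosov_half)
  qed
  moreover have "\<epsilon> > 0" unfolding \<epsilon>_def using e(1) H(1) by simp
  ultimately show ?thesis by blast
qed

end

text \<open>Scalar power series are differentiated termwise at their centre; the vector-valued case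
  is reduced to them by taking coordinates.\<close>

lemma analytic_differentiable:
  fixes f :: "real \<Rightarrow> 'v::euclidean_space"
  assumes "real_analytic_on f I" "0 \<in> I"
  shows "f differentiable (at 0)"
proof -
  obtain r a where r: "r > 0" "\<And>t. \<bar>t - 0\<bar> < r \<Longrightarrow> (\<lambda>i. (t - 0) ^ i *\<^sub>R a i) sums f t"
    using assms unfolding real_analytic_on_def by blast
  have "(\<lambda>t. f t \<bullet> b) differentiable (at 0)" for b
  proof -
    have sums: "(\<lambda>i. (a i \<bullet> b) * t ^ i) sums (f t \<bullet> b)" if "\<bar>t\<bar> < r" for t
      using bounded_linear.sums[OF bounded_linear_inner_left r(2), of t b] that by (simp add: mult.commute)
    have "summable (\<lambda>i. (a i \<bullet> b) * (r / 2) ^ i)" using sums[of "r / 2"] r(1) by (simp add: sums_iff)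
    from termdiffs_strong[OF this, of 0] obtain d
      where d: "((\<lambda>t. \<Sum>i. (a i \<bullet> b) * t ^ i) has_field_derivative d) (at 0)" using r(1) by auto
    have "((\<lambda>t. f t \<bullet> b) has_field_derivative d) (at 0)"
    proof (rule has_field_derivative_transform_within_open[OF d, of "ball 0 r"])
      show "(\<Sum>i. (a i \<bullet> b) * t ^ i) = f t \<bullet> b" if "t \<in> ball 0 r" for t
        using sums[of t] that by (simp add: sums_iff)
    qed (use r(1) in auto)
    then show ?thesis using real_differentiable_def by blast
  qed
  then show ?thesis using differentiable_componentwise_within[of f 0 UNIV] by simp
qed

theorem theorem1p2:
  fixes k :: "'n::finite"
    and \<Gamma> :: "'g monoid" and S :: "'g set"
    and act :: "'g \<Rightarrow> 'g fpoint \<Rightarrow> 'g fpoint" and D :: "'g fpoint \<Rightarrow> 'g fpoint \<Rightarrow> real"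
    and \<rho> :: "real \<Rightarrow> 'g \<Rightarrow> 'n mat2"
    and u :: "'g \<Rightarrow> 'n vec2"
  assumes "CARD('n) \<ge> 2"
    and "group \<Gamma>" and "finite_generating_set \<Gamma> S" and "word_hyperbolic \<Gamma> S"
    and "gromov_flow \<Gamma> S act D"
    and "\<And>t. t \<in> {-1<..<1} \<Longrightarrow> \<rho> t \<in> hom \<Gamma> G_group"
    and "\<And>\<gamma>. \<gamma> \<in> carrier \<Gamma> \<Longrightarrow> real_analytic_on (\<lambda>t. \<rho> t \<gamma>) {-1<..<1}"
    and "\<rho> 0 ` carrier \<Gamma> \<subseteq> G0 k"
    and "\<And>\<gamma>. \<gamma> \<in> carrier \<Gamma> \<Longrightarrow> u \<gamma> = tangent_vector \<rho> \<gamma> *v axis (Inr k) 1"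
    and "affine_anosov k \<Gamma> S act D (\<lambda>\<gamma>. (\<rho> 0 \<gamma>, u \<gamma>))"
  shows "\<exists>\<epsilon>>0. \<forall>t. 0 < \<bar>t\<bar> \<and> \<bar>t\<bar> < \<epsilon> \<longrightarrow> anosov_SL_half \<Gamma> S act (\<rho> t)"
proof -
  let ?a = "\<lambda>\<gamma>. (\<rho> 0 \<gamma>, u \<gamma>)" and ?G = "Ga_group k"
  interpret flow_system \<Gamma> S act D
    by (intro flow_system.intro hyperbolic_group.intro flow_system_axioms.intro hyperbolic_group_axioms.intro assms)
  obtain \<xi>p \<xi>m s where hom: "?a \<in> hom \<Gamma> ?G"
    and lm: "limit_maps \<Gamma> S ?G (Pa_plus k) (Pa_minus k) ?a \<xi>p \<xi>m"
    and con: "contracting \<Gamma> S act ?G ?a \<xi>p \<xi>m"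
    and s: "\<forall>p\<in>X. s p \<in> hyp k" "\<forall>\<gamma>\<in>carrier \<Gamma>. \<forall>p\<in>X. s (act \<gamma> p) = affine_act (?a \<gamma>) (s p)"
      "hoelder_on_flow \<Gamma> S D s" "\<forall>p\<in>X. \<forall>t. (\<lambda>\<tau>. s (flow \<tau> p)) differentiable at t"
      "\<forall>p\<in>X. form (vector_derivative (\<lambda>t. s (flow t p)) (at 0)) (nu k (fst ` (\<xi>p (end_plus p) \<inter> \<xi>m (end_minus p)))) \<noteq> 0"
    using assms(10) unfolding affine_anosov_def by blast
  obtain C c N where Cc: "C > 0" "c > 0"
    and N: "\<forall>p\<in>X. euclidean_norm_mod (lie_algebra ?G (carrier ?G))
          (lie_algebra ?G (coset_stabilizer ?G (\<xi>p (end_plus p) \<inter> \<xi>m (end_minus p)))) (N p)"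
      "continuous_map (prod_topology T (top_of_set (lie_algebra ?G (carrier ?G)))) euclideanreal (\<lambda>(p, Y). N p Y)"
      "\<forall>\<gamma>\<in>carrier \<Gamma>. \<forall>p\<in>X. \<forall>Y\<in>lie_algebra ?G (carrier ?G). N (act \<gamma> p) (Ad ?G (?a \<gamma>) Y) = N p Y"
      "\<forall>p\<in>X. \<forall>t\<ge>0. (\<forall>Y\<in>lie_algebra ?G (coset_stabilizer ?G (\<xi>m (end_minus p))).
             N (flow (- t) p) Y \<le> C * exp (- c * t) * N p Y) \<and>
          (\<forall>Y\<in>lie_algebra ?G (coset_stabilizer ?G (\<xi>p (end_plus p))).
             N (flow t p) Y \<le> C * exp (- c * t) * N p Y)"
    using con unfolding contracting_def by blast
  define \<xi> where "\<xi> \<epsilon> = (if \<epsilon> then \<xi>p else \<xi>m)" for \<epsilon>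
  have ad: "affine_data \<Gamma> S act D k ?a \<xi> N C c s"
  proof (unfold_locales)
    show "?a \<in> hom \<Gamma> ?G" by (rule hom)
    show "continuous_map B (coset_topology ?G (Pa k \<epsilon>)) (\<xi> \<epsilon>)" "inj_on (\<xi> \<epsilon>) bdry" for \<epsilon>
      using lm unfolding limit_maps_def \<xi>_def Pa_def by (cases \<epsilon>; simp)+
    show "\<xi> \<epsilon> (\<beta> \<gamma> x) = ?a \<gamma> <#\<^bsub>?G\<^esub> \<xi> \<epsilon> x" if "\<gamma> \<in> carrier \<Gamma>" "x \<in> bdry" for \<epsilon> \<gamma> x
      using lm that unfolding limit_maps_def \<xi>_def by (cases \<epsilon>) simp_all
    have X: "\<xi> True (ep True p) = \<xi>p (end_plus p)" "\<xi> False (ep False p) = \<xi>m (end_minus p)" for p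
      unfolding \<xi>_def ep_def by simp_all
    show "\<xi> True (ep True p) \<inter> \<xi> False (ep False p) \<in> lcosets\<^bsub>?G\<^esub> (Pa k True \<inter> Pa k False)" if "p \<in> X" for p
      using lm that unfolding limit_maps_def X Pa_def by simp
    show "euclidean_norm_mod (lie_algebra ?G (carrier ?G))
      (lie_algebra ?G (coset_stabilizer ?G (\<xi> True (ep True p) \<inter> \<xi> False (ep False p)))) (N p)" if "p \<in> X" for p
      unfolding X using N(1) that by blast
    show "N (flow (sg \<epsilon> * t) p) Y \<le> C * exp (- c * t) * N p Y" if "p \<in> X" "t \<ge> 0"
      "Y \<in> lie_algebra ?G (coset_stabilizer ?G (\<xi> \<epsilon> (ep \<epsilon> p)))" for p t Y \<epsilon>
      using N(4) that X by (cases \<epsilon>) (simp_all add: \<xi>_def ep_def)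
    show "form (vector_derivative (\<lambda>t. s (flow t p)) (at 0)) (nu k (fst ` (\<xi> True (ep True p) \<inter> \<xi> False (ep False p)))) \<noteq> 0"
      if "p \<in> X" for p unfolding X using s(5) that by blast
  qed (use Cc N s in blast)+
  have def: "deformation \<Gamma> S act D k ?a \<xi> N C c s \<rho> (tangent_vector \<rho>)"
  proof (intro deformation.intro ad deformation_axioms.intro)
    fix \<gamma> assume g: "\<gamma> \<in> carrier \<Gamma>"
    have G: "\<rho> 0 \<gamma> \<in> SOnn" using assms(8) g G0_SOnn by blast
    \<comment> \<open>\<open>matrix_inv\<close> picks some two-sided inverse; uniqueness of inverses
      identifies it with the explicit \<open>ginv\<close>.\<close>
    have "\<exists>B. \<rho> 0 \<gamma> ** B = mat 1 \<and> B ** \<rho> 0 \<gamma> = mat 1" using ginv[OF G] by blast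
    from someI_ex[OF this] have "matrix_inv (\<rho> 0 \<gamma>) ** \<rho> 0 \<gamma> = mat 1" unfolding matrix_inv_def by blast
    from arg_cong[OF this, of "\<lambda>B. B ** ginv (\<rho> 0 \<gamma>)"]
    have "matrix_inv (\<rho> 0 \<gamma>) ** (\<rho> 0 \<gamma> ** ginv (\<rho> 0 \<gamma>)) = ginv (\<rho> 0 \<gamma>)" by (simp add: matrix_mul_assoc)
    then have inv: "matrix_inv (\<rho> 0 \<gamma>) = ginv (\<rho> 0 \<gamma>)" unfolding ginv(2)[OF G] by simp
    have "(\<lambda>t. \<rho> t \<gamma>) differentiable (at 0)" by (rule analytic_differentiable[OF assms(7)[OF g]]) simp
    then have "((\<lambda>t. \<rho> t \<gamma>) has_vector_derivative vector_derivative (\<lambda>t. \<rho> t \<gamma>) (at 0)) (at 0)"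
      by (simp add: vector_derivative_works)
    from has_vector_derivative_matrix_mult[OF this, of "mat 1" "ginv (\<rho> 0 \<gamma>)"]
    have 1: "((\<lambda>t. \<rho> t \<gamma> ** ginv (\<rho> 0 \<gamma>)) has_vector_derivative vector_derivative (\<lambda>t. \<rho> t \<gamma>) (at 0) ** ginv (\<rho> 0 \<gamma>)) (at 0)"
      by simp
    then show "((\<lambda>t. \<rho> t \<gamma> ** ginv (\<rho> 0 \<gamma>)) has_vector_derivative tangent_vector \<rho> \<gamma>) (at 0)"
      unfolding tangent_vector_def inv vector_derivative_at[OF 1] .
    show "tangent_vector \<rho> \<gamma> *v axis (Inr k) 1 = snd (\<rho> 0 \<gamma>, u \<gamma>)" using assms(9)[OF g] by simp
  qed (use assms(6) in \<open>simp_all add: abs_less_iff\<close>)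
  show ?thesis by (rule deformation.deformed_anosov[OF def assms(1)])
qed

end
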